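(* For every $p\in(0,1)$ and every $t>0$, \[ \lim_{n\to\infty}\operatorname{Corr}\big(T_n(\omega),T_n(\omega^t)\big)=0, \] where $T_n(\omega)$ is the geometric last-passage time from $(0,0)$ to $(n,n)$ in the weight configuration $\omega$ and $\omega^t$ is the bit-resampling perturbation of $\omega$ described in the context.
   Context: Let $\mathbb{N}=\{0,1,2,\dots\}$. For $u,v\in\mathbb{Z}^2$ write $u\le v$ if $u_1\le v_1$ and $u_2\le v_2$. A directed path from $u\le v$ to $v$ is a sequence $x_0=u,x_1,\dots,x_m=v$ with $x_i-x_{i-1}\in\{(1,0),(0,1)\}$. Given weights $\omega=(\omega_x)_{x\in\mathbb{Z}^2}$, set $T(u,v)=\max\{\sum_{x\in\gamma}\omega_x:\gamma\text{ a directed path from }u\text{ to }v\}$, and $T_n(\omega)=T((0,0),(n,n))$. Let $(X_{v,i})_{v\in\mathbb{Z}^2,i\in\mathbb{N}}$, $(X'_{v,i})$ be i.i.d. Bernoulli($p$) and $(U_{v,i})$ i.i.d. exponential of mean $1$, all independent. Set $\omega_v=\min\{i\ge0:X_{v,i}=1\}$ (so the $\omega_v$ are i.i.d. with $\mathbb{P}(\omega_v=k)=p(1-p)^k$, $k\in\mathbb{N}$). For $t\ge0$ let $X^t_{v,i}=X_{v,i}$ if $t<U_{v,i}$ and $X^t_{v,i}=X'_{v,i}$ if $t\ge U_{v,i}$, and $\omega^t_v=\min\{i\ge0:X^t_{v,i}=1\}$. *)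

theory Defs
  imports "HOL-Probability.Probability"
begin

type_synonym site = "int \<times> int"

definition directed_path :: "site \<Rightarrow> site \<Rightarrow> site list \<Rightarrow> bool" where
  "directed_path u v xs \<longleftrightarrow> xs \<noteq> [] \<and> hd xs = u \<and> last xs = v \<and>
     (\<forall>i. Suc i < length xs \<longrightarrow> xs ! Suc i - xs ! i \<in> {(1,0),(0,1)})"

definition lpp :: "(site \<Rightarrow> nat) \<Rightarrow> site \<Rightarrow> site \<Rightarrow> real" where
  "lpp w u v = Max {real (\<Sum>x\<leftarrow>xs. w x) | xs. directed_path u v xs}"

definition T_n :: "nat \<Rightarrow> (site \<Rightarrow> nat) \<Rightarrow> real" where
  "T_n n w = lpp w (0,0) (int n, int n)"

text \<open>One coordinate (X_{v,i}, X'_{v,i}, U_{v,i}); True encodes the value 1.\<close>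
definition coord_measure :: "real \<Rightarrow> (bool \<times> bool \<times> real) measure" where
  "coord_measure p = measure_pmf (bernoulli_pmf p) \<Otimes>\<^sub>M
     (measure_pmf (bernoulli_pmf p) \<Otimes>\<^sub>M density lborel (exponential_density 1))"

definition Omega :: "real \<Rightarrow> ((site \<times> nat) \<Rightarrow> bool \<times> bool \<times> real) measure" where
  "Omega p = PiM UNIV (\<lambda>_. coord_measure p)"

definition X :: "((site \<times> nat) \<Rightarrow> bool \<times> bool \<times> real) \<Rightarrow> site \<Rightarrow> nat \<Rightarrow> bool" where
  "X s v i = fst (s (v,i))"
definition X' :: "((site \<times> nat) \<Rightarrow> bool \<times> bool \<times> real) \<Rightarrow> site \<Rightarrow> nat \<Rightarrow> bool" where
  "X' s v i = fst (snd (s (v,i)))"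
definition U :: "((site \<times> nat) \<Rightarrow> bool \<times> bool \<times> real) \<Rightarrow> site \<Rightarrow> nat \<Rightarrow> real" where
  "U s v i = snd (snd (s (v,i)))"

definition Xt :: "real \<Rightarrow> ((site \<times> nat) \<Rightarrow> bool \<times> bool \<times> real) \<Rightarrow> site \<Rightarrow> nat \<Rightarrow> bool" where
  "Xt t s v i = (if t < U s v i then X s v i else X' s v i)"

definition omega :: "((site \<times> nat) \<Rightarrow> bool \<times> bool \<times> real) \<Rightarrow> site \<Rightarrow> nat" where
  "omega s v = (LEAST i. X s v i)"

definition omega_t :: "real \<Rightarrow> ((site \<times> nat) \<Rightarrow> bool \<times> bool \<times> real) \<Rightarrow> site \<Rightarrow> nat" where
  "omega_t t s v = (LEAST i. Xt t s v i)"

definition correlation :: "'a measure \<Rightarrow> ('a \<Rightarrow> real) \<Rightarrow> ('a \<Rightarrow> real) \<Rightarrow> real" where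
  "correlation M A B =
    (let EA = integral\<^sup>L M A; EB = integral\<^sup>L M B in
      integral\<^sup>L M (\<lambda>x. (A x - EA) * (B x - EB)) /
      sqrt (integral\<^sup>L M (\<lambda>x. (A x - EA)^2) * integral\<^sup>L M (\<lambda>x. (B x - EB)^2)))"

end

theory Submission
  imports Defs "HOL-Real_Asymp.Real_Asymp"
begin

text \<open>The covariance is shown to be of smaller order than the variance.

  Lower bound for the variance: the model with independent boundary weights is stationary (Burke's
  property), and reweighting its boundary computes an exponential moment that controls where
  maximal paths leave the boundary. Hence the increments of the passage time over a distance
  \<open>k\<close> of order at most \<open>\<surd>n\<close> are sandwiched between stationary increments, which are
  sums of \<open>k\<close> independent variables. Consequently the variance is at least of order
  \<open>n powr 0.6\<close>, while translating the box by at most \<open>\<surd>n\<close> changes the passage time by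
  \<open>O(n powr (1/4))\<close> in mean square.

  Upper bound for the covariance: by the Cauchy-Schwarz inequality for the reversible bit dynamics,
  the squared covariance at bit correlation \<open>\<rho>\<close> is at most the variance times the covariance at
  \<open>\<rho>\<^sup>2\<close>, so that \<open>\<rho> = exp (- t)\<close> may be replaced by an arbitrarily small power of it. For
  small \<open>\<rho>\<close> the bits are hypercontractive. As in Benjamini, Kalai and Schramm, the passage time is
  replaced by its average over \<open>\<surd>n \<times> \<surd>n\<close> translates, on which each site has influence
  \<open>O(1 / \<surd>n)\<close>; hypercontractivity applied to the martingale increments then bounds the covariance
  by \<open>O(n powr 0.56)\<close>.\<close>

subsection \<open>Passage times by recursion\<close>

text \<open>Two features of the weights shape the proof. Each weight reads infinitely many bits and
  is unbounded, so the noise estimates are proved for variables cut off after \<open>N\<close> bits,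
  with constants free of \<open>N\<close>, and \<open>N\<close> tends to infinity at fixed
  \<open>n\<close>. The exponents come from one window. With boundary tilt \<open>d\<close>, the
  probability that a maximal path leaves along the wrong axis is bounded by a multiple of exp (-C n
  d^3), which forces \<open>d\<close> above n^(-1/3). The two stationary increments that enclose a
  bulk increment differ in mean by order k d, and this is below their fluctuation, of order sqrt k,
  only for \<open>k\<close> below d^(-2). Hence \<open>k\<close> stays below n^(2/3); the choices d
  = n^(-0.32) and k = n^0.6 leave a little room. The variance bound so obtained suffices because
  both competing errors are smaller: the averaging error is of order n^(1/2) in mean square, and the
  influence bound approaches the same exponent 1/2 as the hypercontractive exponent tends to 1 and
  higher moments of the weights are used. Repeated squaring lowers the correlation of the bits as
  far as such an exponent requires.\<close>

fun lp :: "(nat \<times> nat \<Rightarrow> nat) \<Rightarrow> nat \<Rightarrow> nat \<Rightarrow> nat" where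
  "lp w 0 0 = w (0, 0)"
| "lp w (Suc i) 0 = w (Suc i, 0) + lp w i 0"
| "lp w 0 (Suc j) = w (0, Suc j) + lp w 0 j"
| "lp w (Suc i) (Suc j) = w (Suc i, Suc j) + max (lp w i (Suc j)) (lp w (Suc i) j)"

definition sh :: "nat \<Rightarrow> nat \<Rightarrow> (nat \<times> nat \<Rightarrow> 'a) \<Rightarrow> nat \<times> nat \<Rightarrow> 'a" where
  "sh a b w = (\<lambda>(i, j). w (i + a, j + b))"

text \<open>Rotation of the box by half a turn. Truncated subtraction repeats boundary values
  outside the box, where \<open>lp _ i j\<close> does not look.\<close>

definition rot :: "nat \<Rightarrow> nat \<Rightarrow> (nat \<times> nat \<Rightarrow> 'a) \<Rightarrow> nat \<times> nat \<Rightarrow> 'a" where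
  "rot i j w = (\<lambda>(a, b). w (i - a, j - b))"

lemma lp_cong:
  assumes "\<And>a b. a \<le> i \<Longrightarrow> b \<le> j \<Longrightarrow> w (a, b) = w' (a, b)"
  shows "lp w i j = lp w' i j"
  using assms by (induction w i j rule: lp.induct) auto

lemma lp_mono_weights:
  assumes "\<And>a b. a \<le> i \<Longrightarrow> b \<le> j \<Longrightarrow> w (a, b) \<le> w' (a, b)"
  shows "lp w i j \<le> lp w' i j"
  using assms by (induction w i j rule: lp.induct) (auto intro!: add_mono max.mono)

lemma lp_swap: "lp (w \<circ> prod.swap) i j = lp w j i"
  by (induction w j i rule: lp.induct) (auto simp: max.commute)

text \<open>\<open>P\<close> is the site set of one maximal path. Of being a path only two things
  are kept: at most one site per antidiagonal, which later bounds the number of essential sites, and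
  that \<open>P\<close> still competes when the weights change.\<close>

lemma lp_path:
  "\<exists>P. finite P \<and> P \<subseteq> {..i} \<times> {..j} \<and> inj_on (\<lambda>(a, b). a + b) P \<and>
     lp w i j = sum w P \<and> (\<forall>w'. sum w' P \<le> lp w' i j)"
proof (induction w i j rule: lp.induct)
  case (1 w)
  show ?case by (rule exI[of _ "{(0, 0)}"]) auto
next
  case (2 w i)
  then obtain P where P: "finite P" "P \<subseteq> {..i} \<times> {..0}" "inj_on (\<lambda>(a, b). a + b) P"
     "lp w i 0 = sum w P" "\<forall>w'. sum w' P \<le> lp w' i 0" by blast
  have "(Suc i, 0) \<notin> P" using P(2) by auto
  moreover have "inj_on (\<lambda>(a, b). a + b) (insert (Suc i, 0) P)"
    using P(2,3) by (auto simp: inj_on_insert)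
  ultimately show ?case using P
    by (intro exI[of _ "insert (Suc i, 0) P"]) auto
next
  case (3 w j)
  then obtain P where P: "finite P" "P \<subseteq> {..0} \<times> {..j}" "inj_on (\<lambda>(a, b). a + b) P"
     "lp w 0 j = sum w P" "\<forall>w'. sum w' P \<le> lp w' 0 j" by blast
  have "(0, Suc j) \<notin> P" using P(2) by auto
  moreover have "inj_on (\<lambda>(a, b). a + b) (insert (0, Suc j) P)"
    using P(2,3) by (auto simp: inj_on_insert)
  ultimately show ?case using P
    by (intro exI[of _ "insert (0, Suc j) P"]) auto
next
  case (4 w i j)
  have "\<exists>P. finite P \<and> P \<subseteq> {..Suc i} \<times> {..Suc j} - {(Suc i, Suc j)} \<and> inj_on (\<lambda>(a, b). a + b) P \<and>
     max (lp w i (Suc j)) (lp w (Suc i) j) = sum w P \<and>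
     (\<forall>w'. sum w' P \<le> max (lp w' i (Suc j)) (lp w' (Suc i) j))"
  proof (cases "lp w i (Suc j) \<le> lp w (Suc i) j")
    case True
    obtain P where P: "finite P" "P \<subseteq> {..Suc i} \<times> {..j}" "inj_on (\<lambda>(a, b). a + b) P"
     "lp w (Suc i) j = sum w P" "\<And>w'. sum w' P \<le> lp w' (Suc i) j" using 4(2) by blast
    have "P \<subseteq> {..Suc i} \<times> {..Suc j} - {(Suc i, Suc j)}" using P(2) by auto
    then show ?thesis using P True by (intro exI[of _ P]) (simp add: max_absorb2 le_max_iff_disj)
  next
    case False
    obtain P where P: "finite P" "P \<subseteq> {..i} \<times> {..Suc j}" "inj_on (\<lambda>(a, b). a + b) P"
     "lp w i (Suc j) = sum w P" "\<And>w'. sum w' P \<le> lp w' i (Suc j)" using 4(1) by blast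
    have "P \<subseteq> {..Suc i} \<times> {..Suc j} - {(Suc i, Suc j)}" using P(2) by auto
    then show ?thesis using P False by (intro exI[of _ P]) (simp add: max_absorb1 le_max_iff_disj)
  qed
  then obtain P where P: "finite P" "P \<subseteq> {..Suc i} \<times> {..Suc j} - {(Suc i, Suc j)}"
    "inj_on (\<lambda>(a, b). a + b) P" "max (lp w i (Suc j)) (lp w (Suc i) j) = sum w P"
    "\<forall>w'. sum w' P \<le> max (lp w' i (Suc j)) (lp w' (Suc i) j)" by blast
  have nin: "(Suc i, Suc j) \<notin> P" using P(2) by auto
  have "a + b \<noteq> Suc i + Suc j" if "(a, b) \<in> P" for a b
  proof -
    have "a \<le> Suc i" "b \<le> Suc j" "(a, b) \<noteq> (Suc i, Suc j)" using that P(2) by auto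
    then show ?thesis by auto
  qed
  then have "inj_on (\<lambda>(a, b). a + b) (insert (Suc i, Suc j) P)"
    using P(2,3) by (auto simp: inj_on_insert)
  then show ?case using P nin
    by (intro exI[of _ "insert (Suc i, Suc j) P"]) auto
qed

lemma lp_le_sum: "lp w i j \<le> sum w ({..i} \<times> {..j})"
proof -
  obtain P where "P \<subseteq> {..i} \<times> {..j}" "lp w i j = sum w P" using lp_path[of i j w] by blast
  then show ?thesis by (simp add: sum_mono2)
qed

text \<open>The recursion peels off the last site of a path; here the first site is peeled off
  instead. This is what makes \<open>lp\<close> invariant under rotation.\<close>

lemma lp_first:
  shows "lp w (Suc i) 0 = w (0, 0) + lp (sh 1 0 w) i 0"
    and "lp w 0 (Suc j) = w (0, 0) + lp (sh 0 1 w) 0 j"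
    and "lp w (Suc i) (Suc j) = w (0, 0) + max (lp (sh 1 0 w) i (Suc j)) (lp (sh 0 1 w) (Suc i) j)"
proof -
  have a: "lp w (Suc i) 0 = w (0, 0) + lp (sh 1 0 w) i 0" for i
    by (induction i) (auto simp: sh_def)
  have b: "lp w 0 (Suc j) = w (0, 0) + lp (sh 0 1 w) 0 j" for j
    by (induction j) (auto simp: sh_def)
  show "lp w (Suc i) 0 = w (0, 0) + lp (sh 1 0 w) i 0" "lp w 0 (Suc j) = w (0, 0) + lp (sh 0 1 w) 0 j"
    by (fact a b)+
  show "lp w (Suc i) (Suc j) = w (0, 0) + max (lp (sh 1 0 w) i (Suc j)) (lp (sh 0 1 w) (Suc i) j)"
  proof (induction "i + j" arbitrary: i j rule: less_induct)
    case less
    show ?case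
    proof (cases i; cases j)
      assume "i = 0" "j = 0" then show ?thesis by (auto simp: sh_def)
    next
      fix j' assume ij: "i = 0" "j = Suc j'"
      have "lp w (Suc 0) (Suc j') = w (0, 0) + max (lp (sh 1 0 w) 0 (Suc j')) (lp (sh 0 1 w) (Suc 0) j')"
        using less[of 0 j'] ij by simp
      then show ?thesis unfolding ij using b[of "Suc j'"] by (simp add: sh_def)
    next
      fix i' assume ij: "i = Suc i'" "j = 0"
      have "lp w (Suc i') (Suc 0) = w (0, 0) + max (lp (sh 1 0 w) i' (Suc 0)) (lp (sh 0 1 w) (Suc i') 0)"
        using less[of i' 0] ij by simp
      then show ?thesis unfolding ij using a[of "Suc i'"] by (simp add: sh_def)
    next
      fix i' j' assume ij: "i = Suc i'" "j = Suc j'"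
      have "lp w (Suc i') (Suc j) = w (0, 0) + max (lp (sh 1 0 w) i' (Suc j)) (lp (sh 0 1 w) (Suc i') j)"
           "lp w (Suc i) (Suc j') = w (0, 0) + max (lp (sh 1 0 w) i (Suc j')) (lp (sh 0 1 w) (Suc i) j')"
        using less[of i' j] less[of i j'] ij by auto
      moreover have "w' + max (w0 + max a1 a2) (w0 + max b1 b2) = w0 + max (w' + max a1 b1) (w' + max a2 b2)"
        for w' w0 a1 a2 b1 b2 :: nat by (simp add: max_def)
      moreover have "sh 1 0 w (Suc i', Suc j) = w (Suc i, Suc j)" "sh 0 1 w (Suc i, Suc j') = w (Suc i, Suc j)"
        using ij by (simp_all add: sh_def)
      ultimately show ?thesis unfolding ij lp.simps by (simp only:)
    qed
  qed
qed

lemma sh_rot: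
  "sh 1 0 (rot (Suc i) j w) = rot i j w" "sh 0 1 (rot i (Suc j) w) = rot i j w"
  by (auto simp: sh_def rot_def)

lemma lp_rot: "lp (rot i j w) i j = lp w i j"
proof (induction w i j rule: lp.induct)
  case (1 w)
  show ?case by (simp add: rot_def)
next
  case (2 w i)
  then show ?case unfolding lp_first(1)[of "rot (Suc i) 0 w"] sh_rot by (simp add: rot_def)
next
  case (3 w j)
  then show ?case unfolding lp_first(2)[of "rot 0 (Suc j) w"] sh_rot by (simp add: rot_def)
next
  case (4 w i j)
  have "lp (rot (Suc i) (Suc j) w) (Suc i) (Suc j) = 
    rot (Suc i) (Suc j) w (0, 0) + max (lp (rot i (Suc j) w) i (Suc j)) (lp (rot (Suc i) j w) (Suc i) j)"
    unfolding lp_first(3)[of "rot (Suc i) (Suc j) w"] sh_rot ..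
  then show ?case unfolding 4 by (simp add: rot_def)
qed

section \<open>Monotonicity of increments in the boundary weights\<close>

lemma cell_mono:
  fixes a x y a' x' y' w :: nat
  assumes "x + a' \<le> x' + a" "y' + a \<le> y + a'"
  shows "(w + max y x) + y' \<le> (w + max y' x') + y" "(w + max y' x') + x \<le> (w + max y x) + x'"
  using assms by (auto simp: max_def)

text \<open>In a unit cell with lower left value \<open>a\<close> and neighbours \<open>x\<close> to
  the right and \<open>y\<close> above, the top increment is w + max 0 (x - y): it grows with x - a
  and falls with y - a. The right increment behaves oppositely, so horizontal and vertical
  comparisons have to be carried through one induction.\<close>

lemma lp_increments_mono:
  assumes bot: "\<And>i. s (Suc i, 0) \<le> s' (Suc i, 0)" and left: "\<And>j. s' (0, Suc j) \<le> s (0, Suc j)"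
    and bulk: "\<And>i j. s (Suc i, Suc j) = s' (Suc i, Suc j)"
  shows "lp s (Suc i) j + lp s' i j \<le> lp s' (Suc i) j + lp s i j \<and>
         lp s' i (Suc j) + lp s i j \<le> lp s i (Suc j) + lp s' i j"
proof (induction "i + j" arbitrary: i j rule: less_induct)
  case less
  have "lp s (Suc i) j + lp s' i j \<le> lp s' (Suc i) j + lp s i j"
  proof (cases j)
    case 0
    then show ?thesis using bot[of i] by simp
  next
    case (Suc j')
    have IH: "lp s (Suc i) j' + lp s' i j' \<le> lp s' (Suc i) j' + lp s i j'"
         "lp s' i (Suc j') + lp s i j' \<le> lp s i (Suc j') + lp s' i j'"
      using less[of i j'] Suc by auto
    show ?thesis using cell_mono(1)[OF IH, of "s (Suc i, Suc j')"] unfolding Suc lp.simps bulk .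
  qed
  moreover have "lp s' i (Suc j) + lp s i j \<le> lp s i (Suc j) + lp s' i j"
  proof (cases i)
    case 0
    then show ?thesis using left[of j] by simp
  next
    case (Suc i')
    have IH: "lp s (Suc i') j + lp s' i' j \<le> lp s' (Suc i') j + lp s i' j"
         "lp s' i' (Suc j) + lp s i' j \<le> lp s i' (Suc j) + lp s' i' j"
      using less[of i' j] Suc by auto
    show ?thesis using cell_mono(2)[OF IH, of "s (Suc i', Suc j)"] unfolding Suc lp.simps bulk .
  qed
  ultimately show ?case by blast
qed

lemma lp_increment_mono:
  assumes "\<And>i. s (Suc i, 0) \<le> s' (Suc i, 0)" "\<And>j. s' (0, Suc j) \<le> s (0, Suc j)"
    and "\<And>i j. s (Suc i, Suc j) = s' (Suc i, Suc j)"
  shows "int (lp s (i + k) j) - lp s i j \<le> int (lp s' (i + k) j) - lp s' i j"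
proof (induction k)
  case (Suc k)
  then show ?case using lp_increments_mono[OF assms, of "i + k" j] by simp
qed simp

definition bulk :: "(nat \<times> nat \<Rightarrow> nat) \<Rightarrow> nat \<times> nat \<Rightarrow> nat" where
  "bulk s = (\<lambda>(i, j). s (Suc i, Suc j))"

definition zero_left :: "(nat \<times> nat \<Rightarrow> nat) \<Rightarrow> nat \<times> nat \<Rightarrow> nat" where
  "zero_left s = (\<lambda>(i, j). if i = 0 then 0 else s (i, j))"

definition zero_bot :: "(nat \<times> nat \<Rightarrow> nat) \<Rightarrow> nat \<times> nat \<Rightarrow> nat" where
  "zero_bot s = (\<lambda>(i, j). if j = 0 then 0 else s (i, j))"

lemma lp_zero_both: "lp (zero_left (zero_bot s)) 0 j = 0 \<and> lp (zero_left (zero_bot s)) i 0 = 0"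
proof -
  have "lp (zero_left (zero_bot s)) 0 j = 0" by (induction j) (auto simp: zero_left_def zero_bot_def)
  moreover have "lp (zero_left (zero_bot s)) i 0 = 0"
    by (induction i) (auto simp: zero_left_def zero_bot_def)
  ultimately show ?thesis by simp
qed

lemma lp_bulk: "lp (bulk s) i j = lp (zero_left (zero_bot s)) (Suc i) (Suc j)"
proof (induction "bulk s" i j rule: lp.induct)
qed (use lp_zero_both in \<open>auto simp: bulk_def zero_left_def zero_bot_def\<close>)

text \<open>Every path follows only one of the axes at the start, so erasing the weights of the
  other axis costs it nothing.\<close>

lemma lp_left_bot:
  assumes "s (0, 0) = 0"
  shows "lp s i j = max (lp (zero_left s) i j) (lp (zero_bot s) i j)"
proof -
  have a: "lp (zero_bot s) i 0 = 0" for i s by (induction i) (auto simp: zero_bot_def)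
  have b: "lp (zero_left s) 0 i = 0" for i s by (induction i) (auto simp: zero_left_def)
  show ?thesis using assms
  proof (induction s i j rule: lp.induct)
    case (1 w)
    then show ?case by (simp add: zero_left_def zero_bot_def)
  next
    case (2 w i)
    then show ?case unfolding a by (simp add: zero_left_def)
  next
    case (3 w j)
    then show ?case unfolding b by (simp add: zero_bot_def)
  next
    case (4 w i j)
    then show ?case by (simp add: zero_left_def zero_bot_def)
  qed
qed

text \<open>The advantage of starting along the bottom axis grows with the abscissa of the endpoint.
  So if the bottom axis wins at the left end of an interval, it wins on the whole interval, and
  likewise if the left axis wins at the right end.\<close>

lemma zero_left_increment:
  "int (lp (zero_bot s) (i + k) j) - lp (zero_bot s) i j \<le> int (lp (zero_left s) (i + k) j) - lp (zero_left s) i j"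
  by (rule lp_increment_mono) (auto simp: zero_left_def zero_bot_def)

text \<open>The second assumption says that a maximal path of the boundary model starts along the bottom axis.\<close>

lemma bulk_increment_le:
  assumes "s (0, 0) = 0" "lp (zero_bot s) (Suc i) (Suc j) \<le> lp (zero_left s) (Suc i) (Suc j)"
  shows "int (lp (bulk s) (i + k) j) - lp (bulk s) i j \<le> int (lp s (Suc (i + k)) (Suc j)) - lp s (Suc i) (Suc j)"
proof -
  have "int (lp (bulk s) (i + k) j) - lp (bulk s) i j \<le>
     int (lp (zero_left s) (Suc i + k) (Suc j)) - lp (zero_left s) (Suc i) (Suc j)"
    using lp_increment_mono[of "zero_left (zero_bot s)" "zero_left s" "Suc i" k "Suc j"]
    by (auto simp: lp_bulk zero_left_def zero_bot_def)
  also have "\<dots> = int (lp s (Suc i + k) (Suc j)) - lp s (Suc i) (Suc j)"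
    using zero_left_increment[of s "Suc i" k "Suc j"] assms(2)
    unfolding lp_left_bot[of s, OF assms(1)] by simp
  finally show ?thesis by simp
qed

text \<open>The opposite case, in which a maximal path starts along the left axis. The condition is
  imposed at the right endpoint, from which it passes to the left one.\<close>

lemma bulk_increment_ge:
  assumes "s (0, 0) = 0"
    "lp (zero_left s) (Suc (i + k)) (Suc j) \<le> lp (zero_bot s) (Suc (i + k)) (Suc j)"
  shows "int (lp s (Suc (i + k)) (Suc j)) - lp s (Suc i) (Suc j) \<le> int (lp (bulk s) (i + k) j) - lp (bulk s) i j"
proof -
  have "int (lp s (Suc i + k) (Suc j)) - lp s (Suc i) (Suc j) =
     int (lp (zero_bot s) (Suc i + k) (Suc j)) - lp (zero_bot s) (Suc i) (Suc j)"
    using zero_left_increment[of s "Suc i" k "Suc j"] assms(2)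
    unfolding lp_left_bot[of s, OF assms(1)] by simp
  also have "\<dots> \<le> int (lp (bulk s) (i + k) j) - lp (bulk s) i j"
    using lp_increment_mono[of "zero_bot s" "zero_left (zero_bot s)" "Suc i" k "Suc j"]
    by (auto simp: lp_bulk zero_left_def zero_bot_def)
  finally show ?thesis by simp
qed

lemma lp_mono_endpoint: "i \<le> i' \<Longrightarrow> lp w i j \<le> lp w i' j"
proof -
  have "lp w i j \<le> lp w (Suc i) j" for i by (cases j) auto
  then show "i \<le> i' \<Longrightarrow> lp w i j \<le> lp w i' j" by (rule lift_Suc_mono_le)
qed

section \<open>Reindexing product laws\<close>

lemma map_Pi_pmf_reindex:
  assumes "finite A" "finite B" "inj_on h B" "h ` B \<subseteq> A"
  shows "map_pmf (\<lambda>s b. if b \<in> B then s (h b) else d) (Pi_pmf A d P) = Pi_pmf B d (P \<circ> h)"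
proof -
  have *: "map_pmf (\<lambda>s b. if b \<in> B then s (h b) else d) (Pi_pmf (h ` B) d P) = Pi_pmf B d (P \<circ> h)"
    using assms(2,3)
  proof (induction B rule: finite_induct)
    case empty
    then show ?case by simp
  next
    case (insert b B)
    have nin: "h b \<notin> h ` B" using insert by auto
    have ne: "h x \<noteq> h b" if "x \<in> B" for x using nin that by (metis imageI)
    have "map_pmf (\<lambda>s b'. if b' \<in> insert b B then s (h b') else d) (Pi_pmf (h ` insert b B) d P) =
      map_pmf (\<lambda>(y, f) b'. if b' \<in> insert b B then (f(h b := y)) (h b') else d)
        (pair_pmf (P (h b)) (Pi_pmf (h ` B) d P))"
      using nin insert(1) by (simp add: Pi_pmf_insert pmf.map_comp o_def case_prod_unfold)
    also have "\<dots> = map_pmf (\<lambda>(y, f). (\<lambda>b'. if b' \<in> B then f (h b') else d)(b := y))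
        (pair_pmf (P (h b)) (Pi_pmf (h ` B) d P))"
      using ne insert(2) by (intro map_pmf_cong refl) (auto simp: fun_eq_iff)
    also have "\<dots> = map_pmf (\<lambda>(y, f). f(b := y)) (pair_pmf (P (h b))
        (map_pmf (\<lambda>f b'. if b' \<in> B then f (h b') else d) (Pi_pmf (h ` B) d P)))"
      by (simp add: pair_map_pmf2 pmf.map_comp o_def case_prod_unfold)
    also have "\<dots> = Pi_pmf (insert b B) d (P \<circ> h)"
      using insert by (simp add: Pi_pmf_insert) (simp add: o_def)
    finally show ?case .
  qed
  have "map_pmf (\<lambda>s b. if b \<in> B then s (h b) else d) (Pi_pmf (h ` B) d P) =
        map_pmf (\<lambda>s b. if b \<in> B then s (h b) else d) (Pi_pmf A d P)"
    unfolding Pi_pmf_subset[OF assms(1,4)] pmf.map_comp o_def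
    by (intro map_pmf_cong refl) (auto simp: fun_eq_iff)
  with * show ?thesis by simp
qed

lemma map_pmf_reindex:
  assumes "finite A" "finite B" "inj_on h B" "h ` B \<subseteq> A"
    and "\<And>w w'. (\<And>b. b \<in> B \<Longrightarrow> w b = w' b) \<Longrightarrow> F w = F w'"
  shows "map_pmf (\<lambda>s. F (s \<circ> h)) (Pi_pmf A d P) = map_pmf F (Pi_pmf B d (P \<circ> h))"
  unfolding map_Pi_pmf_reindex[OF assms(1-4), symmetric] pmf.map_comp
  by (intro map_pmf_cong refl) (auto intro!: assms(5))

lemma map_pmf_involution:
  assumes "\<And>s. f (f s) = s" "\<And>s. pmf M (f s) = pmf M s"
  shows "map_pmf f M = M"
proof (rule pmf_eqI)
  fix s
  have "f -` {s} = {f s}" using assms(1) by (auto simp: vimage_def)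
  then show "pmf (map_pmf f M) s = pmf M s"
    using assms(2) by (simp add: pmf_map measure_pmf_single)
qed

text \<open>Parametrised by the ratio \<open>r\<close> of consecutive masses: ratios multiply both
  under exponential tilting and under taking the minimum of independent variables.\<close>

definition geo :: "real \<Rightarrow> nat pmf" where "geo r = geometric_pmf (1 - r)"

lemma pmf_geo: "0 \<le> r \<Longrightarrow> r < 1 \<Longrightarrow> pmf (geo r) k = r ^ k * (1 - r)"
  unfolding geo_def by (subst pmf_geometric) auto

subsection \<open>The Burke property\<close>

text \<open>One corner flip of the growth process. Before it, \<open>a\<close> holds the bottom
  increment of a unit cell, \<open>b\<close> the left increment and \<open>e\<close> the weight;
  afterwards \<open>a\<close> and \<open>b\<close> hold the top and right increments. The value kept
  at \<open>e\<close> is the dual weight, which makes the map an involution.\<close>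

definition cell :: "'a \<Rightarrow> 'a \<Rightarrow> 'a \<Rightarrow> ('a \<Rightarrow> nat) \<Rightarrow> 'a \<Rightarrow> nat" where
  "cell a b e s = s(a := s e + (s a - s b), b := s e + (s b - s a), e := min (s a) (s b))"

text \<open>Because the map is an involution, invariance reduces to equality of point masses. The
  total powers of \<open>r a\<close> and \<open>r b\<close> are preserved once
  \<open>r e = r a * r b\<close> turns each unit at \<open>e\<close> into one unit at
  \<open>a\<close> and one at \<open>b\<close>.\<close>

lemma cell_pmf_invariant:
  assumes A: "finite A" "a \<in> A" "b \<in> A" "e \<in> A" and ne: "a \<noteq> b" "a \<noteq> e" "b \<noteq> e"
    and r: "\<And>x. x \<in> A \<Longrightarrow> 0 \<le> r x \<and> r x < 1" and re: "r e = r a * r b"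
  shows "map_pmf (cell a b e) (Pi_pmf A 0 (\<lambda>x. geo (r x))) = Pi_pmf A 0 (\<lambda>x. geo (r x))"
proof (rule map_pmf_involution)
  fix s :: "'a \<Rightarrow> nat"
  show "cell a b e (cell a b e s) = s"
    using ne by (auto simp: cell_def fun_eq_iff min_def)
  have split: "(\<Prod>x\<in>A. f x) = f a * f b * f e * (\<Prod>x\<in>A - {a, b, e}. f x)" for f :: "'a \<Rightarrow> real"
  proof -
    have "A = {a, b, e} \<union> (A - {a, b, e})" using A by auto
    then have "prod f A = prod f {a, b, e} * prod f (A - {a, b, e})"
      using A(1) by (metis Diff_disjoint finite.emptyI finite.insertI finite_Diff prod.union_disjoint)
    then show ?thesis using ne by (simp add: mult.assoc)
  qed
  have "r a ^ (s e + (s a - s b)) * r b ^ (s e + (s b - s a)) * r e ^ (min (s a) (s b)) =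
        r a ^ s a * r b ^ s b * r e ^ s e"
  proof (cases "s a \<le> s b")
    case True
    then obtain d where "s b = s a + d" by (metis le_iff_add)
    then show ?thesis by (simp add: re power_mult_distrib power_add)
  next
    case False
    then obtain d where "s a = s b + d" by (metis le_iff_add nle_le)
    then show ?thesis by (simp add: re power_mult_distrib power_add)
  qed
  moreover have "x1 * y1 * (x2 * y2) * (x3 * y3) = (x1 * x2 * x3) * (y1 * y2 * y3)" for x1 x2 x3 y1 y2 y3 :: real
    by (simp add: mult_ac)
  ultimately have *: "r a ^ (s e + (s a - s b)) * (1 - r a) * (r b ^ (s e + (s b - s a)) * (1 - r b)) * 
     (r e ^ (min (s a) (s b)) * (1 - r e)) = 
     r a ^ s a * (1 - r a) * (r b ^ s b * (1 - r b)) * (r e ^ s e * (1 - r e))"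
    by (simp only:)
  show "pmf (Pi_pmf A 0 (\<lambda>x. geo (r x))) (cell a b e s) = pmf (Pi_pmf A 0 (\<lambda>x. geo (r x))) s"
  proof (cases "\<forall>x. x \<notin> A \<longrightarrow> s x = 0")
    case True
    then have t: "\<forall>x. x \<notin> A \<longrightarrow> cell a b e s x = 0" using A by (auto simp: cell_def)
    have "(\<Prod>x\<in>A - {a, b, e}. pmf (geo (r x)) (cell a b e s x)) = (\<Prod>x\<in>A - {a, b, e}. pmf (geo (r x)) (s x))"
      by (intro prod.cong) (auto simp: cell_def)
    then show ?thesis using True t A(1) * A(2-4) r ne
      by (simp add: pmf_Pi split pmf_geo cell_def)
  next
    case False
    then have "\<not> (\<forall>x. x \<notin> A \<longrightarrow> cell a b e s x = 0)" using A by (auto simp: cell_def)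
    with False show ?thesis unfolding pmf_Pi[OF A(1)] by (simp only: if_False)
  qed
qed

text \<open>\<open>v\<close> tilts the bottom axis and \<open>u\<close> the left axis. Exactly for u
  = v the two boundary ratios multiply to the bulk ratio \<open>c\<^sup>2\<close>, the stationary
  case; separate parameters allow one axis to be changed alone.\<close>

definition rate :: "real \<Rightarrow> real \<Rightarrow> real \<Rightarrow> nat \<times> nat \<Rightarrow> real" where
  "rate c u v = (\<lambda>(i, j). if j = 0 then c * exp v else if i = 0 then c * exp (- u) else c\<^sup>2)"

text \<open>The origin is left out, so that it carries the default weight 0 of
  \<open>Pi_pmf\<close>.\<close>

definition bx :: "nat \<Rightarrow> nat \<Rightarrow> (nat \<times> nat) set" where
  "bx N m = {..N} \<times> {..m} - {(0, 0)}"

lemma rate_bounds: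
  assumes "0 < c" "c < 1" "c * exp v < 1" "c * exp (- u) < 1"
  shows "0 < rate c u v x" "rate c u v x < 1"
  using assms by (auto simp: rate_def power_less_one_iff split: prod.split)

definition blaw :: "real \<Rightarrow> real \<Rightarrow> real \<Rightarrow> nat \<Rightarrow> nat \<Rightarrow> (nat \<times> nat \<Rightarrow> nat) pmf" where
  "blaw c u v N m = Pi_pmf (bx N m) 0 (\<lambda>x. geo (rate c u v x))"

lemma finite_bx [simp, intro]: "finite (bx N m)"
  by (simp add: bx_def)

lemma blaw_swap: "map_pmf (\<lambda>s. s \<circ> prod.swap) (blaw c u v N m) = blaw c (- v) (- u) m N"
proof -
  have "map_pmf (\<lambda>s b. if b \<in> bx m N then s (prod.swap b) else 0)
        (Pi_pmf (bx N m) 0 (\<lambda>x. geo (rate c u v x))) = Pi_pmf (bx m N) 0 ((\<lambda>x. geo (rate c u v x)) \<circ> prod.swap)"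
    by (rule map_Pi_pmf_reindex) (auto simp: bx_def inj_on_def)
  also have "\<dots> = blaw c (- v) (- u) m N" unfolding blaw_def
    by (intro Pi_pmf_cong) (auto simp: rate_def bx_def split: if_splits)
  also have "map_pmf (\<lambda>s b. if b \<in> bx m N then s (prod.swap b) else 0)
        (Pi_pmf (bx N m) 0 (\<lambda>x. geo (rate c u v x))) = 
    map_pmf (\<lambda>s. s \<circ> prod.swap) (Pi_pmf (bx N m) 0 (\<lambda>x. geo (rate c u v x)))"
  proof (intro map_pmf_cong refl)
    fix s assume "s \<in> set_pmf (Pi_pmf (bx N m) 0 (\<lambda>x. geo (rate c u v x)))"
    then have "s \<in> {f. \<forall>x. x \<notin> bx N m \<longrightarrow> f x = 0}"
      by (rule subsetD[OF set_Pi_pmf_subset[OF finite_bx]])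
    then have "s x = 0" if "x \<notin> bx N m" for x using that by blast
    moreover have "prod.swap b \<notin> bx N m" if "b \<notin> bx m N" for b
      using that by (cases b) (auto simp: bx_def)
    ultimately have "s (prod.swap b) = 0" if "b \<notin> bx m N" for b using that by blast
    then show "(\<lambda>b. if b \<in> bx m N then s (prod.swap b) else 0) = s \<circ> prod.swap"
      by (intro ext) simp
  qed
  finally show ?thesis unfolding blaw_def .
qed

text \<open>Flips the cells between columns 0 and 1 from bottom to top. After \<open>j\<close>
  flips, position (1, 0) holds the horizontal increment at height \<open>j\<close>, the positions
  (0, k) with 1 \<le> k \<le> j hold the vertical increments of column 1, and the positions (1, k)
  hold the dual weights.\<close>

primrec colpass :: "nat \<Rightarrow> (nat \<times> nat \<Rightarrow> nat) \<Rightarrow> nat \<times> nat \<Rightarrow> nat" where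
  "colpass 0 s = s"
| "colpass (Suc j) s = cell (1, 0) (0, Suc j) (1, Suc j) (colpass j s)"

lemma colpass_frame:
  "k > j \<Longrightarrow> colpass j s (0, k) = s (0, k)" "k > j \<Longrightarrow> colpass j s (1, k) = s (1, k)"
  "i \<ge> 2 \<Longrightarrow> colpass j s (i, k) = s (i, k)" "colpass j s (0, 0) = s (0, 0)"
  by (induction j) (auto simp: cell_def)

lemma colpass_left: "0 < k \<Longrightarrow> k \<le> j \<Longrightarrow> colpass j s (0, k) = colpass k s (0, k)"
  by (induction j) (auto simp: cell_def le_Suc_eq)

lemma lp_col:
  "lp s 1 j = lp s 0 j + colpass j s (1, 0)"
  "lp s 1 (Suc j) = lp s 1 j + colpass (Suc j) s (0, Suc j)"
proof -
  show 1: "lp s 1 j = lp s 0 j + colpass j s (1, 0)" for j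
    by (induction j) (auto simp: cell_def colpass_frame simp flip: One_nat_def, auto simp: max_def)
  show "lp s 1 (Suc j) = lp s 1 j + colpass (Suc j) s (0, Suc j)"
    using 1[of j] by (auto simp: cell_def colpass_frame simp flip: One_nat_def) (auto simp: max_def)
qed

lemma colpass_law:
  assumes "0 < c" "c < 1" "c * exp u < 1" "c * exp (- u) < 1" "j \<le> m"
  shows "map_pmf (colpass j) (blaw c u u (Suc N) m) = blaw c u u (Suc N) m"
  using assms(5)
proof (induction j)
  case (Suc j)
  have cc: "c * exp u * (c * exp (- u)) = c\<^sup>2"
    by (simp add: power2_eq_square exp_minus)
  have "colpass (Suc j) = cell (1, 0) (0, Suc j) (1, Suc j) \<circ> colpass j" by (rule ext) simp
  then have "map_pmf (colpass (Suc j)) (blaw c u u (Suc N) m) =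
     map_pmf (cell (1, 0) (0, Suc j) (1, Suc j)) (map_pmf (colpass j) (blaw c u u (Suc N) m))"
    by (simp only: pmf.map_comp)
  also have "\<dots> = map_pmf (cell (1, 0) (0, Suc j) (1, Suc j)) (blaw c u u (Suc N) m)"
    using Suc by simp
  also have "\<dots> = blaw c u u (Suc N) m" unfolding blaw_def
  proof (rule cell_pmf_invariant)
    show "0 \<le> rate c u u x \<and> rate c u u x < 1" for x
      using rate_bounds[of c u u x] assms by (auto intro: less_imp_le)
    show "rate c u u (1, Suc j) = rate c u u (1, 0) * rate c u u (0, Suc j)"
      by (simp add: rate_def cc)
  qed (use Suc.prems in \<open>auto simp: bx_def\<close>)
  finally show ?case .
next
  case 0
  have "colpass 0 = id" by (rule ext) simp
  then show ?case by simp
qed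

text \<open>Forgets column 0: the new left axis carries the vertical increments along column 1, and
  columns 2, 3, ... move one step to the left.\<close>

definition colshift :: "nat \<Rightarrow> nat \<Rightarrow> (nat \<times> nat \<Rightarrow> nat) \<Rightarrow> nat \<times> nat \<Rightarrow> nat" where
  "colshift N m s = (\<lambda>b. if b \<in> bx N m then
     colpass m s (case b of (i, j) \<Rightarrow> if i = 0 then (0, j) else (Suc i, j)) else 0)"

lemma colshift_law:
  assumes "0 < c" "c < 1" "c * exp u < 1" "c * exp (- u) < 1"
  shows "map_pmf (colshift N m) (blaw c u u (Suc N) m) = blaw c u u N m"
proof -
  let ?h = "\<lambda>(i, j). if i = 0 then (0, j) else (Suc i, j) :: nat \<times> nat"
  have "map_pmf (colshift N m) (blaw c u u (Suc N) m) =
    map_pmf (\<lambda>s b. if b \<in> bx N m then s (?h b) else 0) (map_pmf (colpass m) (blaw c u u (Suc N) m))"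
    unfolding pmf.map_comp by (intro map_pmf_cong refl) (auto simp: colshift_def fun_eq_iff)
  also have "map_pmf (colpass m) (blaw c u u (Suc N) m) = blaw c u u (Suc N) m"
    by (rule colpass_law) (use assms in auto)
  also have "map_pmf (\<lambda>s b. if b \<in> bx N m then s (?h b) else 0) (blaw c u u (Suc N) m) = 
    Pi_pmf (bx N m) 0 ((\<lambda>x. geo (rate c u u x)) \<circ> ?h)" unfolding blaw_def
    by (rule map_Pi_pmf_reindex) (auto simp: bx_def inj_on_def split: if_splits)
  also have "\<dots> = blaw c u u N m" unfolding blaw_def
    by (intro Pi_pmf_cong) (auto simp: rate_def bx_def split: if_splits)
  finally show ?thesis .
qed

text \<open>Passage times to later columns see column 0 only through the increments along column 1,
  and these are what \<open>colshift\<close> stores.\<close>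

lemma lp_colshift:
  assumes "s (0, 0) = 0" "i \<le> N" "j \<le> m"
  shows "lp s (Suc i) j = lp s 1 0 + lp (colshift N m s) i j"
proof -
  have l: "lp s 1 j = lp s 1 0 + lp (colshift N m s) 0 j" if "j \<le> m" for j
    using that
  proof (induction j)
    case 0
    then show ?case by (simp add: colshift_def bx_def)
  next
    case (Suc j)
    then show ?case using lp_col(2)[of s j] colpass_left[of "Suc j" m s]
      by (simp add: colshift_def bx_def)
  qed
  have r: "lp s (Suc i) 0 = lp s 1 0 + lp (colshift N m s) i 0" if "i \<le> N" for i
    using that
  proof (induction i)
    case (Suc i)
    then show ?case by (simp add: colshift_def bx_def colpass_frame)
  qed (simp add: colshift_def bx_def)
  have "i \<le> N \<Longrightarrow> j \<le> m \<Longrightarrow> lp s (Suc i) j = lp s 1 0 + lp (colshift N m s) i j"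
  proof (induction "i + j" arbitrary: i j rule: less_induct)
    case less
    show ?case
    proof (cases "i = 0 \<or> j = 0")
      case True
      then show ?thesis using l[of j] r[of i] less by auto
    next
      case False
      then obtain i' j' where ij: "i = Suc i'" "j = Suc j'" by (metis not0_implies_Suc)
      have "lp s (Suc i') j = lp s 1 0 + lp (colshift N m s) i' j"
        "lp s (Suc i) j' = lp s 1 0 + lp (colshift N m s) i j'"
        using less.hyps[of i' j] less.hyps[of i j'] less.prems ij by (simp_all del: lp.simps)
      moreover have "colshift N m s (i, j) = s (Suc i, j)"
        using ij less.prems by (simp add: colshift_def bx_def colpass_frame)
      moreover have "lp s (Suc i) j = s (Suc i, j) + max (lp s (Suc i') j) (lp s (Suc i) j')"
        "lp (colshift N m s) i j = colshift N m s (i, j) + max (lp (colshift N m s) i' j) (lp (colshift N m s) i j')"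
        unfolding ij by (simp_all only: lp.simps)
      ultimately show ?thesis by (simp only: max_def) auto
    qed
  qed
  then show ?thesis using assms by simp
qed

text \<open>\<open>g s\<close> is the field seen from (x, y), with the increments of
  \<open>lp s\<close> along the two lines through that point as boundary weights. The last clause
  keeps the bulk, so that \<open>s\<close> and \<open>g s\<close> can be compared with the same bulk
  increments.\<close>

definition burke_map :: "nat \<Rightarrow> nat \<Rightarrow> nat \<Rightarrow> nat \<Rightarrow> ((nat \<times> nat \<Rightarrow> nat) \<Rightarrow> nat \<times> nat \<Rightarrow> nat) \<Rightarrow> bool" where
  "burke_map x y N m g \<longleftrightarrow> (\<forall>s. s (0, 0) = 0 \<longrightarrow> g s (0, 0) = 0 \<and>
     (\<forall>i\<le>N. \<forall>j\<le>m. lp s (x + i) (y + j) = lp s x y + lp (g s) i j) \<and>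
     (\<forall>i<N. \<forall>j<m. g s (Suc i, Suc j) = s (x + Suc i, y + Suc j)))"

lemma burke_right:
  assumes "0 < c" "c < 1" "c * exp u < 1" "c * exp (- u) < 1"
  shows "\<exists>g. map_pmf g (blaw c u u (x + N) m) = blaw c u u N m \<and> burke_map x 0 N m g"
proof (induction x)
  case 0
  then show ?case
    by (intro exI[of _ id]) (auto simp: burke_map_def)
next
  case (Suc x)
  then obtain g where g: "map_pmf g (blaw c u u (x + N) m) = blaw c u u N m" "burke_map x 0 N m g" by blast
  let ?g = "g \<circ> colshift (x + N) m"
  have "map_pmf ?g (blaw c u u (Suc x + N) m) = map_pmf g (map_pmf (colshift (x + N) m) (blaw c u u (Suc (x + N)) m))"
    by (simp add: pmf.map_comp)
  also have "\<dots> = blaw c u u N m" unfolding colshift_law[OF assms] g ..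
  finally have 1: "map_pmf ?g (blaw c u u (Suc x + N) m) = blaw c u u N m" .
  have "burke_map (Suc x) 0 N m ?g" unfolding burke_map_def
  proof (intro allI impI conjI)
    fix s :: "nat \<times> nat \<Rightarrow> nat" assume s: "s (0, 0) = 0"
    have cs: "colshift (x + N) m s (0, 0) = 0" by (simp add: colshift_def bx_def)
    then show "?g s (0, 0) = 0" using g(2) by (auto simp: burke_map_def)
    fix i j assume ij: "i \<le> N" "j \<le> m"
    have "lp (colshift (x + N) m s) (x + i) j = lp (colshift (x + N) m s) x 0 + lp (?g s) i j"
      using g(2) cs ij by (auto simp: burke_map_def)
    then show "lp s (Suc x + i) (0 + j) = lp s (Suc x) 0 + lp (?g s) i j"
      using lp_colshift[where s=s, OF s, of "x + i" "x + N" j m] lp_colshift[where s=s, OF s, of x "x + N" 0 m] ij by simp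
  next
    fix s :: "nat \<times> nat \<Rightarrow> nat" and i j assume s: "s (0, 0) = 0" and ij: "i < N" "j < m"
    have cs: "colshift (x + N) m s (0, 0) = 0" by (simp add: colshift_def bx_def)
    have "?g s (Suc i, Suc j) = colshift (x + N) m s (x + Suc i, Suc j)"
      using g(2) cs ij by (auto simp: burke_map_def)
    also have "\<dots> = s (Suc x + Suc i, 0 + Suc j)"
      using ij by (simp add: colshift_def bx_def colpass_frame)
    finally show "?g s (Suc i, Suc j) = s (Suc x + Suc i, 0 + Suc j)" .
  qed
  with 1 show ?case by blast
qed

text \<open>Reflection in the diagonal reduces the upward shift to \<open>burke_right\<close>, with
  -u in place of u.\<close>

lemma burke_up:
  assumes "0 < c" "c < 1" "c * exp u < 1" "c * exp (- u) < 1"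
  shows "\<exists>g. map_pmf g (blaw c u u N (y + m)) = blaw c u u N m \<and> burke_map 0 y N m g"
proof -
  obtain g where g: "map_pmf g (blaw c (- u) (- u) (y + m) N) = blaw c (- u) (- u) m N" "burke_map y 0 m N g"
    using burke_right[of c "- u" y m N] assms by auto
  let ?g = "\<lambda>s. g (s \<circ> prod.swap) \<circ> prod.swap"
  have "map_pmf ?g (blaw c u u N (y + m)) =
     map_pmf (\<lambda>s. s \<circ> prod.swap) (map_pmf g (map_pmf (\<lambda>s. s \<circ> prod.swap) (blaw c u u N (y + m))))"
    by (simp add: pmf.map_comp o_def)
  also have "\<dots> = blaw c u u N m" by (simp add: blaw_swap g)
  finally have 1: "map_pmf ?g (blaw c u u N (y + m)) = blaw c u u N m" .
  have "burke_map 0 y N m ?g" unfolding burke_map_def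
  proof (intro allI impI)
    fix s :: "nat \<times> nat \<Rightarrow> nat" assume s: "s (0, 0) = 0"
    have lps: "lp w j i = lp (w \<circ> prod.swap) i j" for w i j by (simp add: lp_swap)
    have "(s \<circ> prod.swap) (0, 0) = 0" using s by simp
    then have b: "g (s \<circ> prod.swap) (0, 0) = 0"
      "\<And>i j. i \<le> m \<Longrightarrow> j \<le> N \<Longrightarrow> lp (s \<circ> prod.swap) (y + i) j = lp (s \<circ> prod.swap) y 0 + lp (g (s \<circ> prod.swap)) i j"
      "\<And>i j. i < m \<Longrightarrow> j < N \<Longrightarrow> g (s \<circ> prod.swap) (Suc i, Suc j) = (s \<circ> prod.swap) (y + Suc i, Suc j)"
      using g(2)[unfolded burke_map_def] by auto
    show "?g s (0, 0) = 0 \<and> (\<forall>i\<le>N. \<forall>j\<le>m. lp s (0 + i) (y + j) = lp s 0 y + lp (?g s) i j) \<and>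
       (\<forall>i<N. \<forall>j<m. ?g s (Suc i, Suc j) = s (0 + Suc i, y + Suc j))"
      using b by (auto simp: lp_swap)
  qed
  with 1 show ?thesis by blast
qed

lemma burke:
  assumes "0 < c" "c < 1" "c * exp u < 1" "c * exp (- u) < 1"
  shows "\<exists>g. map_pmf g (blaw c u u (x + N) (y + m)) = blaw c u u N m \<and> burke_map x y N m g"
proof -
  obtain g where g: "map_pmf g (blaw c u u (x + N) (y + m)) = blaw c u u N (y + m)" "burke_map x 0 N (y + m) g"
    using burke_right[OF assms] by blast
  obtain h where h: "map_pmf h (blaw c u u N (y + m)) = blaw c u u N m" "burke_map 0 y N m h"
    using burke_up[OF assms] by blast
  have "map_pmf (h \<circ> g) (blaw c u u (x + N) (y + m)) = blaw c u u N m"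
    by (simp add: pmf.map_comp[symmetric] g h)
  moreover have "burke_map x y N m (h \<circ> g)" unfolding burke_map_def
  proof (intro allI impI)
    fix s :: "nat \<times> nat \<Rightarrow> nat" assume s: "s (0, 0) = 0"
    have G: "g s (0, 0) = 0" "\<And>i j. i \<le> N \<Longrightarrow> j \<le> y + m \<Longrightarrow> lp s (x + i) j = lp s x 0 + lp (g s) i j"
      "\<And>i j. i < N \<Longrightarrow> j < y + m \<Longrightarrow> g s (Suc i, Suc j) = s (x + Suc i, Suc j)"
      using g(2) s by (auto simp: burke_map_def)
    have H: "h (g s) (0, 0) = 0" "\<And>i j. i \<le> N \<Longrightarrow> j \<le> m \<Longrightarrow> lp (g s) i (y + j) = lp (g s) 0 y + lp (h (g s)) i j"
      "\<And>i j. i < N \<Longrightarrow> j < m \<Longrightarrow> h (g s) (Suc i, Suc j) = g s (Suc i, y + Suc j)"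
      using h(2) G(1) by (auto simp: burke_map_def)
    show "(h \<circ> g) s (0, 0) = 0 \<and> (\<forall>i\<le>N. \<forall>j\<le>m. lp s (x + i) (y + j) = lp s x y + lp ((h \<circ> g) s) i j) \<and>
       (\<forall>i<N. \<forall>j<m. (h \<circ> g) s (Suc i, Suc j) = s (x + Suc i, y + Suc j))"
    proof (intro conjI allI impI)
      show "(h \<circ> g) s (0, 0) = 0" using H by simp
      fix i j assume "i \<le> N" "j \<le> m"
      then show "lp s (x + i) (y + j) = lp s x y + lp ((h \<circ> g) s) i j"
        using G(2)[of i "y + j"] G(2)[of 0 y] H(2)[of i j] by simp
    next
      fix i j assume "i < N" "j < m"
      then show "(h \<circ> g) s (Suc i, Suc j) = s (x + Suc i, y + Suc j)"
        using G(3)[of i "y + j"] H(3)[of i j] by simp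
    qed
  qed
  ultimately show ?thesis by blast
qed

subsection \<open>Exit points\<close>

lemma burke_mapD:
  assumes "burke_map x y N m g" "s (0, 0) = 0"
  shows "g s (0, 0) = 0" "i \<le> N \<Longrightarrow> j \<le> m \<Longrightarrow> lp s (x + i) (y + j) = lp s x y + lp (g s) i j"
    "i < N \<Longrightarrow> j < m \<Longrightarrow> g s (Suc i, Suc j) = s (x + Suc i, y + Suc j)"
  using assms unfolding burke_map_def by blast+

lemma lp_bottom: "lp s N 0 = (\<Sum>i\<le>N. s (i, 0))"
  by (induction N) auto

lemma lp_left: "lp s 0 m = (\<Sum>j\<le>m. s (0, j))"
  by (induction m) auto

lemma set_blaw: "s \<in> set_pmf (blaw c u v N m) \<Longrightarrow> x \<notin> bx N m \<Longrightarrow> s x = 0"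
  unfolding blaw_def using set_Pi_pmf_subset[OF finite_bx, of N m 0] by blast

lemma set_blaw_origin: "s \<in> set_pmf (blaw c u v N m) \<Longrightarrow> s (0, 0) = 0"
  by (rule set_blaw) (auto simp: bx_def)

lemma nn_integral_exp_geo:
  assumes "0 \<le> b" "b < 1" "b * exp t < 1"
  shows "(\<integral>\<^sup>+k. ennreal (exp (t * real k)) \<partial>geo b) = ennreal ((1 - b) / (1 - b * exp t))"
proof -
  have "(\<integral>\<^sup>+k. ennreal (exp (t * real k)) \<partial>geo b) = (\<Sum>k. ennreal (pmf (geo b) k) * ennreal (exp (t * real k)))"
    unfolding nn_integral_measure_pmf by (rule nn_integral_count_space_nat)
  also have "\<dots> = (\<Sum>k. ennreal ((b * exp t) ^ k * (1 - b)))"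
    using assms by (intro suminf_cong) (simp add: pmf_geo power_mult_distrib exp_of_nat_mult[symmetric]
      ennreal_mult[symmetric] mult_ac)
  also have "\<dots> = ennreal (1 / (1 - b * exp t) * (1 - b))"
    using assms by (intro suminf_ennreal_eq sums_mult2 geometric_sums) auto
  finally show ?thesis by simp
qed

text \<open>Its derivative at \<open>t\<close> is the mean passage time to (N, m) in the stationary
  model with parameter \<open>t\<close>: N horizontal increments of ratio c exp t and m vertical
  ones of ratio c exp (-t).\<close>

definition Lam :: "real \<Rightarrow> nat \<Rightarrow> nat \<Rightarrow> real \<Rightarrow> real" where
  "Lam c N m t = real m * ln (1 - c * exp (- t)) - real N * ln (1 - c * exp t)"

text \<open>Only the bottom axis depends on \<open>v\<close>, so the density is a multiple of an
  exponential of the sum of its weights.\<close>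

lemma pmf_blaw_tilt:
  assumes "0 < c" "c < 1" "c * exp u < 1" "c * exp (- u) < 1" "c * exp v < 1"
  shows "pmf (blaw c u v N m) s = pmf (blaw c u u N m) s *
    (((1 - c * exp v) / (1 - c * exp u)) ^ N * exp ((v - u) * (\<Sum>i\<in>{1..N}. real (s (i, 0)))))"
proof (cases "\<forall>x. x \<notin> bx N m \<longrightarrow> s x = 0")
  case True
  define k where "k = (1 - c * exp v) / (1 - c * exp u)"
  define f where "f = (\<lambda>x. if snd x = 0 then k * exp ((v - u) * real (s x)) else 1)"
  have "pmf (geo (rate c u v x)) (s x) = pmf (geo (rate c u u x)) (s x) * f x" for x
  proof (cases "snd x = 0")
    case True
    have "(c * exp v) ^ s x = (c * exp u) ^ s x * exp ((v - u) * real (s x))"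
      by (simp add: power_mult_distrib exp_of_nat_mult[symmetric] exp_add[symmetric] algebra_simps)
    then show ?thesis using True assms
      by (cases x) (simp add: f_def k_def rate_def pmf_geo)
  next
    case False
    then show ?thesis by (cases x) (simp add: f_def rate_def)
  qed
  then have "pmf (blaw c u v N m) s = pmf (blaw c u u N m) s * (\<Prod>x\<in>bx N m. f x)"
    unfolding blaw_def using True by (simp add: pmf_Pi prod.distrib)
  also have "(\<Prod>x\<in>bx N m. f x) = (\<Prod>x\<in>(\<lambda>i. (i, 0)) ` {1..N}. f x)"
  proof (rule prod.mono_neutral_right)
    show "\<forall>i\<in>bx N m - (\<lambda>i. (i, 0)) ` {1..N}. f i = 1"
      by (auto simp: bx_def f_def image_iff)
  qed (auto simp: bx_def)
  also have "\<dots> = (\<Prod>i\<in>{1..N}. f (i, 0))"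
    by (subst prod.reindex) (auto simp: inj_on_def)
  also have "\<dots> = k ^ N * exp ((v - u) * (\<Sum>i\<in>{1..N}. real (s (i, 0))))"
    by (simp add: f_def prod.distrib exp_sum sum_distrib_left)
  finally show ?thesis unfolding k_def .
next
  case False
  then show ?thesis unfolding blaw_def pmf_Pi[OF finite_bx] by (simp only: if_False mult_zero_left)
qed

text \<open>Reweighting the bottom boundary turns the model with boundary parameters \<open>(u, v)\<close> into the
  stationary one with parameter \<open>u\<close>, and the weight of the bottom boundary cancels against its
  contribution to the passage time: only the right boundary, which is i.i.d. by the Burke property,
  remains.\<close>

lemma nn_integral_exp_lp:
  assumes c: "0 < c" "c < 1" "c * exp u < 1" "c * exp (- u) < 1" "c * exp v < 1" "c * exp (- v) < 1"
  shows "(\<integral>\<^sup>+s. ennreal (exp ((u - v) * real (lp s N m))) \<partial>blaw c u v N m) =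
     ennreal (exp (Lam c N m u - Lam c N m v))"
proof -
  define k where "k = ((1 - c * exp v) / (1 - c * exp u)) ^ N"
  have k0: "0 \<le> k" using c by (simp add: k_def)
  \<comment> \<open>Seen from (N, 0) the box has width 0, so all that remains of the field is its
    right boundary.\<close>
  obtain g where g: "map_pmf g (blaw c u u (N + 0) m) = blaw c u u 0 m" "burke_map N 0 0 m g"
    using burke_right[of c u N 0 m] c by blast
  have pt: "exp ((v - u) * (\<Sum>i\<in>{1..N}. real (s (i, 0)))) * exp ((u - v) * real (lp s N m)) =
     exp ((u - v) * real (lp (g s) 0 m))" if "s \<in> set_pmf (blaw c u u N m)" for s
  proof -
    have s0: "s (0, 0) = 0" by (rule set_blaw_origin[OF that])
    have "lp s N m = lp s N 0 + lp (g s) 0 m"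
      using burke_mapD(2)[where s = s, OF g(2) s0, of 0 m] by simp
    moreover have "lp s N 0 = (\<Sum>i\<in>{1..N}. s (i, 0))"
      unfolding lp_bottom using s0 by (simp add: atMost_atLeast0 sum.atLeast_Suc_atMost)
    ultimately have "real (lp s N m) = (\<Sum>i\<in>{1..N}. real (s (i, 0))) + real (lp (g s) 0 m)"
      by simp
    then have "(v - u) * (\<Sum>i\<in>{1..N}. real (s (i, 0))) + (u - v) * real (lp s N m) = (u - v) * real (lp (g s) 0 m)"
      by algebra
    then show ?thesis unfolding exp_add[symmetric] by (rule arg_cong)
  qed
  have "(\<integral>\<^sup>+s. ennreal (exp ((u - v) * real (lp s N m))) \<partial>blaw c u v N m) =
     (\<integral>\<^sup>+s. ennreal (pmf (blaw c u v N m) s) * ennreal (exp ((u - v) * real (lp s N m))) \<partial>count_space UNIV)"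
    by (rule nn_integral_measure_pmf)
  also have "\<dots> = (\<integral>\<^sup>+s. ennreal (pmf (blaw c u u N m) s) * 
     ennreal (k * exp ((v - u) * (\<Sum>i\<in>{1..N}. real (s (i, 0)))) * exp ((u - v) * real (lp s N m))) \<partial>count_space UNIV)"
  proof (rule nn_integral_cong)
    fix s
    have "pmf (blaw c u v N m) s * exp ((u - v) * real (lp s N m)) = pmf (blaw c u u N m) s *
     (k * exp ((v - u) * (\<Sum>i\<in>{1..N}. real (s (i, 0)))) * exp ((u - v) * real (lp s N m)))"
      using c by (simp add: pmf_blaw_tilt[of c u v] k_def)
    then show "ennreal (pmf (blaw c u v N m) s) * ennreal (exp ((u - v) * real (lp s N m))) =
      ennreal (pmf (blaw c u u N m) s) * 
      ennreal (k * exp ((v - u) * (\<Sum>i\<in>{1..N}. real (s (i, 0)))) * exp ((u - v) * real (lp s N m)))"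
      by (simp only: ennreal_mult'[symmetric] pmf_nonneg)
  qed
  also have "\<dots> = (\<integral>\<^sup>+s. ennreal (k * exp ((v - u) * (\<Sum>i\<in>{1..N}. real (s (i, 0)))) * exp ((u - v) * real (lp s N m))) \<partial>blaw c u u N m)"
    by (rule nn_integral_measure_pmf[symmetric])
  also have "\<dots> = (\<integral>\<^sup>+s. ennreal (k * exp ((u - v) * real (lp (g s) 0 m))) \<partial>blaw c u u N m)"
  proof (rule nn_integral_cong_AE, rule AE_pmfI)
    fix s assume "s \<in> set_pmf (blaw c u u N m)"
    from pt[OF this] show "ennreal (k * exp ((v - u) * (\<Sum>i\<in>{1..N}. real (s (i, 0)))) * exp ((u - v) * real (lp s N m))) =
      ennreal (k * exp ((u - v) * real (lp (g s) 0 m)))" by (simp add: mult.assoc)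
  qed
  also have "\<dots> = (\<integral>\<^sup>+s. ennreal (k * exp ((u - v) * real (lp s 0 m))) \<partial>map_pmf g (blaw c u u N m))"
    by simp
  also have "\<dots> = (\<integral>\<^sup>+s. ennreal k * (\<Prod>x\<in>bx 0 m. ennreal (exp ((u - v) * real (s x)))) \<partial>blaw c u u 0 m)"
  proof -
    have "lp s 0 m = (\<Sum>x\<in>bx 0 m. s x)" if "s (0, 0) = 0" for s
    proof -
      have "{..m} = insert 0 {1..m}" by auto
      then have "lp s 0 m = (\<Sum>j\<in>{1..m}. s (0, j))" using that by (simp add: lp_left)
      also have "\<dots> = (\<Sum>x\<in>(\<lambda>j. (0, j)) ` {1..m}. s x)" by (subst sum.reindex) (auto simp: inj_on_def)
      also have "(\<lambda>j. (0, j)) ` {1..m} = bx 0 m" by (auto simp: bx_def image_iff)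
      finally show ?thesis .
    qed
    then have "ennreal (k * exp ((u - v) * real (lp s 0 m))) = ennreal k * (\<Prod>x\<in>bx 0 m. ennreal (exp ((u - v) * real (s x))))"
      if "s (0, 0) = 0" for s
      using that k0 by (simp add: ennreal_mult' prod_ennreal exp_sum sum_distrib_left)
    then show ?thesis using g(1) by (auto intro!: nn_integral_cong_AE AE_pmfI set_blaw_origin)
  qed
  also have "\<dots> = ennreal k * (\<integral>\<^sup>+s. (\<Prod>x\<in>bx 0 m. ennreal (exp ((u - v) * real (s x)))) \<partial>blaw c u u 0 m)"
    by (rule nn_integral_cmult) simp
  also have "(\<integral>\<^sup>+s. (\<Prod>x\<in>bx 0 m. ennreal (exp ((u - v) * real (s x)))) \<partial>blaw c u u 0 m) =
    (\<Prod>x\<in>bx 0 m. \<integral>\<^sup>+k. ennreal (exp ((u - v) * real k)) \<partial>geo (rate c u u x))"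
    unfolding blaw_def by (rule nn_integral_prod_Pi_pmf[OF finite_bx])
  also have "\<dots> = (\<Prod>x\<in>bx 0 m. ennreal ((1 - c * exp (- u)) / (1 - c * exp (- v))))"
  proof (rule prod.cong[OF refl])
    fix x assume "x \<in> bx 0 m"
    then have r: "rate c u u x = c * exp (- u)" by (auto simp: bx_def rate_def split: if_splits)
    have e: "c * exp (- u) * exp (u - v) = c * exp (- v)" by (simp add: exp_add[symmetric])
    then show "(\<integral>\<^sup>+k. ennreal (exp ((u - v) * real k)) \<partial>geo (rate c u u x)) = ennreal ((1 - c * exp (- u)) / (1 - c * exp (- v)))"
      unfolding r using nn_integral_exp_geo[of "c * exp (- u)" "u - v", unfolded e] c by simp
  qed
  also have "\<dots> = ennreal (((1 - c * exp (- u)) / (1 - c * exp (- v))) ^ m)"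
  proof -
    have "bx 0 m = (\<lambda>j. (0, j)) ` {1..m}" by (auto simp: bx_def image_iff)
    then have "card (bx 0 m) = m" by (simp add: card_image inj_on_def)
    then show ?thesis using c by (simp add: ennreal_power)
  qed
  also have "ennreal k * \<dots> = ennreal (k * ((1 - c * exp (- u)) / (1 - c * exp (- v))) ^ m)"
    using k0 by (simp add: ennreal_mult')
  also have "k * ((1 - c * exp (- u)) / (1 - c * exp (- v))) ^ m = exp (Lam c N m u - Lam c N m v)"
  proof -
    have e: "exp (real n * ln x) = x ^ n" if "0 < x" for x n
      using that by (simp add: exp_of_nat_mult)
    have "Lam c N m u - Lam c N m v = real N * ln ((1 - c * exp v) / (1 - c * exp u)) + 
       real m * ln ((1 - c * exp (- u)) / (1 - c * exp (- v)))"
      using c by (simp add: Lam_def ln_div algebra_simps)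
    then show ?thesis using c by (simp add: k_def exp_add e)
  qed
  finally show ?thesis .
qed

text \<open>Chernoff's bound. With the factor u - v left in the event, one statement gives the upper
  tail for u > v and the lower tail for u < v.\<close>

lemma lp_tail:
  assumes c: "0 < c" "c < 1" "c * exp u < 1" "c * exp (- u) < 1" "c * exp v < 1" "c * exp (- v) < 1"
  shows "measure_pmf.prob (blaw c u v N m) {s. (u - v) * x \<le> (u - v) * real (lp s N m)} \<le>
     exp (Lam c N m u - Lam c N m v - (u - v) * x)"
proof -
  let ?M = "blaw c u v N m"
  let ?E = "{s. (u - v) * x \<le> (u - v) * real (lp s N m)}"
  have "emeasure ?M ?E = (\<integral>\<^sup>+s. indicator ?E s \<partial>?M)" by simp
  also have "\<dots> \<le> (\<integral>\<^sup>+s. ennreal (exp (- (u - v) * x)) * ennreal (exp ((u - v) * real (lp s N m))) \<partial>?M)"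
  proof (intro nn_integral_mono)
    fix s
    show "indicator ?E s \<le> ennreal (exp (- (u - v) * x)) * ennreal (exp ((u - v) * real (lp s N m)))"
    proof (cases "s \<in> ?E")
      case True
      then have "(1::ennreal) \<le> ennreal (exp (- (u - v) * x + (u - v) * real (lp s N m)))"
        by (simp add: algebra_simps)
      also have "\<dots> = ennreal (exp (- (u - v) * x)) * ennreal (exp ((u - v) * real (lp s N m)))"
        by (simp only: exp_add ennreal_mult' exp_ge_zero)
      finally show ?thesis using True by simp
    qed simp
  qed
  also have "\<dots> = ennreal (exp (- (u - v) * x)) * ennreal (exp (Lam c N m u - Lam c N m v))"
    by (subst nn_integral_cmult) (simp_all only: nn_integral_exp_lp[OF c], simp)
  also have "\<dots> = ennreal (exp (Lam c N m u - Lam c N m v - (u - v) * x))"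
    by (simp add: ennreal_mult'[symmetric] exp_add[symmetric] algebra_simps)
  finally show ?thesis
    by (simp add: measure_pmf.emeasure_eq_measure)
qed

text \<open>Erasing the bottom axis erases every trace of its parameter, so that parameter may
  afterwards be chosen freely.\<close>

lemma zero_bot_law: "map_pmf zero_bot (blaw c u v N m) = map_pmf zero_bot (blaw c u v' N m)"
proof -
  let ?A = "{x \<in> bx N m. snd x \<noteq> 0}"
  have *: "map_pmf zero_bot (blaw c u v N m) = Pi_pmf ?A 0 (\<lambda>x. geo (rate c u v x))" for v
  proof -
    have "Pi_pmf ?A 0 (\<lambda>x. geo (rate c u v x)) = map_pmf (\<lambda>f x. if x \<in> ?A then f x else 0) (blaw c u v N m)"
      unfolding blaw_def by (rule Pi_pmf_subset) auto
    also have "\<dots> = map_pmf zero_bot (blaw c u v N m)"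
      by (intro map_pmf_cong refl ext) (auto simp: zero_bot_def set_blaw split: prod.splits)
    finally show ?thesis ..
  qed
  show ?thesis unfolding * by (intro Pi_pmf_cong refl) (auto simp: rate_def)
qed

lemma zero_left_law: "map_pmf zero_left (blaw c u v N m) = map_pmf zero_left (blaw c u' v N m)"
proof -
  have z: "zero_left = (\<lambda>s. s \<circ> prod.swap) \<circ> zero_bot \<circ> (\<lambda>s. s \<circ> prod.swap)"
    by (auto simp: fun_eq_iff zero_left_def zero_bot_def)
  show ?thesis unfolding z pmf.map_comp[symmetric] blaw_swap
    using zero_bot_law[of c "- v" "- u" m N "- u'"] by simp
qed

text \<open>For d > 0 the bottom axis is favoured. If the left axis nevertheless wins, then either
  the best path along it reaches the level \<open>x\<close>, or the best path along the bottom axis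
  does not exceed \<open>x\<close>. In each case the parameter of the erased axis is changed to a
  value for which \<open>lp_tail\<close> becomes effective.\<close>

lemma exit_prob:
  assumes c: "0 < c" "c * exp d < 1" "0 < d"
  shows "measure_pmf.prob (blaw c d d N m) {s. lp (zero_left s) N m \<le> lp (zero_bot s) N m} \<le>
     exp (Lam c N m d - Lam c N m 0 - d * x) + exp (Lam c N m (d / 2) - Lam c N m 0 - d / 2 * x) +
     exp (Lam c N m (d / 2) - Lam c N m d + d / 2 * x)"
proof -
  have c1: "c < 1" using c by (metis exp_gt_one mult.right_neutral mult_less_cancel_left_pos order_less_trans)
  have lt: "c * exp t < 1" if "t \<le> d" for t
  proof -
    have "c * exp t \<le> c * exp d" using c that by simp
    also have "\<dots> < 1" by (rule c)
    finally show ?thesis .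
  qed
  \<comment> \<open>The event sees only the left axis and the bulk, so the bottom parameter is set
    to 0; adding the bottom weights back can only raise the passage time.\<close>
  have W: "measure_pmf.prob (blaw c u v N m) {s. x \<le> real (lp (zero_bot s) N m)} \<le>
     exp (Lam c N m u - Lam c N m 0 - u * x)" if "0 < u" "u \<le> d" for u v
  proof -
    have "measure_pmf.prob (blaw c u v N m) {s. x \<le> real (lp (zero_bot s) N m)} = 
      measure_pmf.prob (map_pmf zero_bot (blaw c u v N m)) {s. x \<le> real (lp s N m)}"
      by (simp add: vimage_def)
    also have "\<dots> = measure_pmf.prob (map_pmf zero_bot (blaw c u 0 N m)) {s. x \<le> real (lp s N m)}"
      by (simp only: zero_bot_law[of c u v N m 0])
    also have "\<dots> = measure_pmf.prob (blaw c u 0 N m) {s. x \<le> real (lp (zero_bot s) N m)}"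
      by (simp add: vimage_def)
    also have "\<dots> \<le> measure_pmf.prob (blaw c u 0 N m) {s. (u - 0) * x \<le> (u - 0) * real (lp s N m)}"
    proof (rule measure_pmf.finite_measure_mono)
      show "{s. x \<le> real (lp (zero_bot s) N m)} \<subseteq> {s. (u - 0) * x \<le> (u - 0) * real (lp s N m)}"
      proof safe
        fix s assume "x \<le> real (lp (zero_bot s) N m)"
        also have "lp (zero_bot s) N m \<le> lp s N m" by (rule lp_mono_weights) (simp add: zero_bot_def)
        finally show "(u - 0) * x \<le> (u - 0) * real (lp s N m)" using that by simp
      qed
    qed simp
    also have "\<dots> \<le> exp (Lam c N m u - Lam c N m 0 - (u - 0) * x)"
      by (rule lp_tail) (use c c1 lt that in auto)
    finally show ?thesis by simp
  qed
  \<comment> \<open>The left parameter is changed from d to d / 2, and \<open>lp_tail\<close> then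
    controls the lower tail. A small passage time along the bottom axis means a small total passage
    time, unless the left axis already reaches \<open>x\<close>.\<close>
  have S: "measure_pmf.prob (blaw c d d N m) {s. real (lp (zero_left s) N m) \<le> x} \<le>
     exp (Lam c N m (d / 2) - Lam c N m d + d / 2 * x) + exp (Lam c N m (d / 2) - Lam c N m 0 - d / 2 * x)"
  proof -
    have "measure_pmf.prob (blaw c d d N m) {s. real (lp (zero_left s) N m) \<le> x} = 
      measure_pmf.prob (map_pmf zero_left (blaw c d d N m)) {s. real (lp s N m) \<le> x}"
      by (simp add: vimage_def)
    also have "\<dots> = measure_pmf.prob (map_pmf zero_left (blaw c (d / 2) d N m)) {s. real (lp s N m) \<le> x}"
      by (simp only: zero_left_law[of c d d N m "d / 2"])
    also have "\<dots> = measure_pmf.prob (blaw c (d / 2) d N m) {s. real (lp (zero_left s) N m) \<le> x}"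
      by (simp add: vimage_def)
    also have "\<dots> \<le> measure_pmf.prob (blaw c (d / 2) d N m) 
      ({s. (d / 2 - d) * x \<le> (d / 2 - d) * real (lp s N m)} \<union> {s. x \<le> real (lp (zero_bot s) N m)})"
    proof (rule measure_pmf.finite_measure_mono_AE[OF AE_pmfI])
      fix s assume s: "s \<in> set_pmf (blaw c (d / 2) d N m)"
      have "lp s N m = max (lp (zero_left s) N m) (lp (zero_bot s) N m)"
        by (rule lp_left_bot[where s = s, OF set_blaw_origin[OF s]])
      then show "s \<in> {s. real (lp (zero_left s) N m) \<le> x} \<longrightarrow> s \<in> {s. (d / 2 - d) * x \<le> (d / 2 - d) * real (lp s N m)} \<union> {s. x \<le> real (lp (zero_bot s) N m)}"
        using c by (auto simp: max_def)
    qed simp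
    also have "\<dots> \<le> measure_pmf.prob (blaw c (d / 2) d N m) {s. (d / 2 - d) * x \<le> (d / 2 - d) * real (lp s N m)}
        + measure_pmf.prob (blaw c (d / 2) d N m) {s. x \<le> real (lp (zero_bot s) N m)}"
      by (rule measure_Un_le) auto
    also have "\<dots> \<le> exp (Lam c N m (d / 2) - Lam c N m d - (d / 2 - d) * x) +
        exp (Lam c N m (d / 2) - Lam c N m 0 - d / 2 * x)"
      by (intro add_mono lp_tail W) (use c c1 lt in auto)
    finally show ?thesis by (simp add: algebra_simps)
  qed
  have "measure_pmf.prob (blaw c d d N m) {s. lp (zero_left s) N m \<le> lp (zero_bot s) N m} \<le>
     measure_pmf.prob (blaw c d d N m) ({s. x \<le> real (lp (zero_bot s) N m)} \<union> {s. real (lp (zero_left s) N m) \<le> x})"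
    by (rule measure_pmf.finite_measure_mono) auto
  also have "\<dots> \<le> measure_pmf.prob (blaw c d d N m) {s. x \<le> real (lp (zero_bot s) N m)} +
     measure_pmf.prob (blaw c d d N m) {s. real (lp (zero_left s) N m) \<le> x}"
    by (rule measure_Un_le) auto
  also have "\<dots> \<le> exp (Lam c N m d - Lam c N m 0 - d * x) + 
    (exp (Lam c N m (d / 2) - Lam c N m d + d / 2 * x) + exp (Lam c N m (d / 2) - Lam c N m 0 - d / 2 * x))"
    by (intro add_mono W S) (use c in auto)
  finally show ?thesis by simp
qed

section \<open>Cubic expansion of the exponent\<close>

lemma ln_taylor:
  fixes c :: real
  assumes "0 < c" "c < 1"
  shows "\<exists>t0>0. \<exists>K>0. c * exp t0 < 1 \<and> (\<exists>a0 a1 a2 a3. 0 < a3 \<and> (\<forall>t. \<bar>t\<bar> \<le> t0 \<longrightarrow>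
    \<bar>- ln (1 - c * exp t) - (a0 + a1 * t + a2 * t\<^sup>2 + a3 * t ^ 3)\<bar> \<le> K * t ^ 4))"
proof -
  \<comment> \<open>Then c exp t0 is the square root of c, which stays below 1.\<close>
  define t0 where "t0 = - ln c / 2"
  have t0: "0 < t0" using assms by (simp add: t0_def)
  have "ln c + t0 < 0" using assms by (simp add: t0_def)
  then have "exp (ln c + t0) < 1" by simp
  then have ct0: "c * exp t0 < 1" using assms by (simp add: exp_add)
  have lt: "c * exp t < 1" if "t \<le> t0" for t
  proof -
    have "c * exp t \<le> c * exp t0" using assms that by simp
    also have "\<dots> < 1" by (rule ct0)
    finally show ?thesis .
  qed
  define A where "A = (\<lambda>t. c * exp t / (1 - c * exp t))"
  have dA: "DERIV A t :> A t + (A t)\<^sup>2" if "t \<le> t0" for t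
  proof -
    have "DERIV A t :> (c * exp t * (1 - c * exp t) + c * exp t * (c * exp t)) / (1 - c * exp t)\<^sup>2"
      unfolding A_def using lt[OF that]
      by (auto intro!: derivative_eq_intros simp: power2_eq_square)
    moreover have "y / z + (y / z)\<^sup>2 = (y * z + y * y) / z\<^sup>2" if "z \<noteq> 0" for y z :: real
      using that by (simp add: field_simps power2_eq_square)
    ultimately show ?thesis unfolding A_def using lt[OF that] by simp
  qed
  have Apos: "0 < A t" if "t \<le> t0" for t
    unfolding A_def using lt[OF that] assms by simp
  have Amono: "A t \<le> A t0" if "t \<le> t0" for t
    unfolding A_def using lt[OF that] ct0 that assms by (intro frac_le) auto
  define f where "f = (\<lambda>t. - ln (1 - c * exp t))"
  \<comment> \<open>The derivatives of -ln (1 - c exp t) are polynomials in \<open>A\<close>, since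
    A' = A + A^2. Their coefficients are positive, whence the positive cubic coefficient and the
    monotone bound on the fourth derivative.\<close>
  define D where "D = (\<lambda>m::nat. if m = 0 then f else if m = 1 then A else if m = 2 then (\<lambda>t. A t + (A t)\<^sup>2) else
     if m = 3 then (\<lambda>t. A t + 3 * (A t)\<^sup>2 + 2 * (A t) ^ 3) else (\<lambda>t. (1 + 6 * A t + 6 * (A t)\<^sup>2) * (A t + (A t)\<^sup>2)))"
  have der: "DERIV (D m) t :> D (Suc m) t" if "m < 4" "t \<le> t0" for m t
  proof -
    consider "m = 0" | "m = 1" | "m = 2" | "m = 3" using \<open>m < 4\<close> by linarith
    then show ?thesis
    proof cases
      case 1
      have "DERIV f t :> A t" unfolding f_def A_def using lt[OF that(2)]
        by (auto intro!: derivative_eq_intros simp: field_simps)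
      then show ?thesis using 1 by (simp add: D_def)
    next
      case 2
      then show ?thesis using dA[OF that(2)] by (simp add: D_def)
    next
      case 3
      have "DERIV (\<lambda>t. A t + (A t)\<^sup>2) t :> A t + 3 * (A t)\<^sup>2 + 2 * (A t) ^ 3"
        by (rule derivative_eq_intros dA[OF that(2)] refl)+ (simp add: power2_eq_square power3_eq_cube algebra_simps)
      then show ?thesis using 3 by (simp add: D_def numeral_2_eq_2 numeral_3_eq_3)
    next
      case 4
      have "DERIV (\<lambda>t. A t + 3 * (A t)\<^sup>2 + 2 * (A t) ^ 3) t :> (1 + 6 * A t + 6 * (A t)\<^sup>2) * (A t + (A t)\<^sup>2)"
        by (rule derivative_eq_intros dA[OF that(2)] refl)+ (simp add: power2_eq_square power3_eq_cube algebra_simps)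
      then show ?thesis using 4 by (simp add: D_def)
    qed
  qed
  define K where "K = (1 + 6 * A t0 + 6 * (A t0)\<^sup>2) * (A t0 + (A t0)\<^sup>2)"
  have A0: "0 < A t0" "0 < A 0" using Apos[of t0] Apos[of 0] t0 by auto
  have K: "0 < K" unfolding K_def using A0 by (intro mult_pos_pos add_pos_pos) auto
  have bd: "\<bar>D 4 t\<bar> \<le> K" if "t \<le> t0" for t
  proof -
    have a: "0 \<le> A t" "A t \<le> A t0" using Apos[OF that] Amono[OF that] by auto
    then have "(A t)\<^sup>2 \<le> (A t0)\<^sup>2" by (intro power_mono) auto
    then have "(1 + 6 * A t + 6 * (A t)\<^sup>2) * (A t + (A t)\<^sup>2) \<le> K"
      unfolding K_def using a by (intro mult_mono add_mono mult_left_mono) auto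
    moreover have "0 \<le> (1 + 6 * A t + 6 * (A t)\<^sup>2) * (A t + (A t)\<^sup>2)" using a by (intro mult_nonneg_nonneg) auto
    ultimately show ?thesis by (simp add: D_def)
  qed
  have main: "\<bar>f t - (f 0 + A 0 * t + (A 0 + (A 0)\<^sup>2) / 2 * t\<^sup>2 + (A 0 + 3 * (A 0)\<^sup>2 + 2 * (A 0) ^ 3) / 6 * t ^ 3)\<bar> \<le> K * t ^ 4"
    if t: "\<bar>t\<bar> \<le> t0" for t
  proof (cases "t = 0")
    case True
    then show ?thesis by simp
  next
    case False
    have "\<exists>x. (if t < 0 then t < x \<and> x < 0 else 0 < x \<and> x < t) \<and>
       f t = (\<Sum>m<4. D m 0 / fact m * (t - 0) ^ m) + D 4 x / fact 4 * (t - 0) ^ 4"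
      using der t t0 False by (intro Taylor[of 4 D f "- t0" t0 0 t]) (auto simp: D_def)
    then obtain x where x': "if t < 0 then t < x \<and> x < 0 else 0 < x \<and> x < t"
      and x'': "f t = (\<Sum>m<4. D m 0 / fact m * t ^ m) + D 4 x / fact 4 * t ^ 4" by auto
    have "x \<le> t0" using x' t t0 by (simp split: if_splits)
    with x'' have x: "x \<le> t0" "f t = (\<Sum>m<4. D m 0 / fact m * t ^ m) + D 4 x / fact 4 * t ^ 4"
      by auto
    have "(\<Sum>m<4. D m 0 / fact m * t ^ m) = f 0 + A 0 * t + (A 0 + (A 0)\<^sup>2) / 2 * t\<^sup>2 + (A 0 + 3 * (A 0)\<^sup>2 + 2 * (A 0) ^ 3) / 6 * t ^ 3"
      by (simp add: D_def lessThan_nat_numeral lessThan_Suc numeral_eq_Suc fact_numeral)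
    then have "\<bar>f t - (f 0 + A 0 * t + (A 0 + (A 0)\<^sup>2) / 2 * t\<^sup>2 + (A 0 + 3 * (A 0)\<^sup>2 + 2 * (A 0) ^ 3) / 6 * t ^ 3)\<bar> = \<bar>D 4 x\<bar> / 24 * t ^ 4"
      using x(2) by (simp add: abs_mult fact_numeral)
    also have "\<dots> \<le> K * t ^ 4" using bd[OF x(1)] K by (intro mult_right_mono) auto
    finally show ?thesis .
  qed
  show ?thesis
    by (rule exI[of _ t0], intro conjI t0, rule exI[of _ K], intro conjI K ct0,
        rule exI[of _ "f 0"], rule exI[of _ "A 0"], rule exI[of _ "(A 0 + (A 0)\<^sup>2) / 2"],
        rule exI[of _ "(A 0 + 3 * (A 0)\<^sup>2 + 2 * (A 0) ^ 3) / 6"])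
       (use main A0 in \<open>auto simp: f_def add_pos_pos\<close>)
qed

text \<open>The cubic term of \<open>Lam\<close> is positive, so \<open>x\<close> can be chosen strictly between the slopes of
  \<open>Lam\<close> over \<open>[0, d]\<close> and over \<open>[d / 2, d]\<close>.\<close>

lemma exit_exponent:
  assumes "0 < c" "c < 1"
  shows "\<exists>d0>0. \<exists>\<kappa>>0. \<exists>C>0. c * exp d0 < 1 \<and> (\<forall>d n N m. 0 < d \<and> d \<le> d0 \<and> 0 < n \<and>
    n \<le> real N \<and> real N \<le> 4 * n \<and> n \<le> real m \<and> real m \<le> 4 * n \<and> \<bar>real N - real m\<bar> \<le> \<kappa> * n * d \<longrightarrow>
    (\<exists>x. Lam c N m d - Lam c N m 0 - d * x \<le> - C * n * d ^ 3 \<and>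
      Lam c N m (d / 2) - Lam c N m 0 - d / 2 * x \<le> - C * n * d ^ 3 \<and>
      Lam c N m (d / 2) - Lam c N m d + d / 2 * x \<le> - C * n * d ^ 3))"
proof -
  obtain t0 K a0 a1 a2 a3 where t0: "0 < t0" "0 < K" "c * exp t0 < 1" "0 < a3"
    and T: "\<And>t. \<bar>t\<bar> \<le> t0 \<Longrightarrow> \<bar>- ln (1 - c * exp t) - (a0 + a1 * t + a2 * t\<^sup>2 + a3 * t ^ 3)\<bar> \<le> K * t ^ 4"
    using ln_taylor[OF assms] by metis
  \<comment> \<open>\<open>d0\<close> keeps the quartic error below n d^3 a3 / 40.
    \<open>\<kappa>\<close> keeps the quadratic term, which arises only when N and m differ, below n
    d^3 a3 / 20.\<close>
  define d0 where "d0 = min t0 (a3 / (320 * K))"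
  define \<kappa> where "\<kappa> = a3 / (20 * (1 + \<bar>a2\<bar>))"
  have d0: "0 < d0" "d0 \<le> t0" "320 * K * d0 \<le> a3" using t0 by (auto simp: d0_def min_def field_simps)
  have \<kappa>: "0 < \<kappa>" "\<bar>a2\<bar> * \<kappa> \<le> a3 / 20"
    using t0 by (auto simp: \<kappa>_def field_simps)
  show ?thesis
  proof (rule exI[of _ d0], rule conjI[OF d0(1)], rule exI[of _ \<kappa>], rule conjI[OF \<kappa>(1)],
      rule exI[of _ "a3 / 5"], intro conjI allI impI)
    have "c * exp d0 \<le> c * exp t0" using d0 assms by simp
    then show "c * exp d0 < 1" using t0 by linarith
    show "0 < a3 / 5" using t0 by auto
    fix d n :: real and N m :: nat
    assume H: "0 < d \<and> d \<le> d0 \<and> 0 < n \<and> n \<le> real N \<and> real N \<le> 4 * n \<and> n \<le> real m \<and> real m \<le> 4 * n \<and> \<bar>real N - real m\<bar> \<le> \<kappa> * n * d"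
    define S where "S = real N + real m"
    define P where "P = (real N - real m) * a2"
    define E where "E = n * d ^ 3 * (a3 / 40)"
    have S: "2 * n \<le> S" "S \<le> 8 * n" using H by (auto simp: S_def)
    have P: "\<bar>P\<bar> * d\<^sup>2 \<le> n * d ^ 3 * (a3 / 20)"
    proof -
      have "\<bar>P\<bar> \<le> (\<kappa> * n * d) * \<bar>a2\<bar>" unfolding P_def abs_mult using H by (intro mult_right_mono) auto
      also have "\<dots> = (\<bar>a2\<bar> * \<kappa>) * (n * d)" by simp
      also have "\<dots> \<le> (a3 / 20) * (n * d)" using \<kappa> H by (intro mult_right_mono) auto
      finally have "\<bar>P\<bar> * d\<^sup>2 \<le> (a3 / 20) * (n * d) * d\<^sup>2" by (rule mult_right_mono) auto
      then show ?thesis by (simp add: power2_eq_square power3_eq_cube mult_ac)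
    qed
    have L: "\<bar>Lam c N m t - (Lam c N m 0 + S * a1 * t + P * t\<^sup>2 + S * a3 * t ^ 3)\<bar> \<le> E" if t: "0 < t" "t \<le> d" for t
    proof -
      define e1 where "e1 = - ln (1 - c * exp t) - (a0 + a1 * t + a2 * t\<^sup>2 + a3 * t ^ 3)"
      define e2 where "e2 = - ln (1 - c * exp (- t)) - (a0 + a1 * (- t) + a2 * (- t)\<^sup>2 + a3 * (- t) ^ 3)"
      have e0: "ln (1 - c) = - a0" using T[of 0] t0 by simp
      have e: "\<bar>e1\<bar> \<le> K * t ^ 4" "\<bar>e2\<bar> \<le> K * t ^ 4"
        using T[of t] T[of "- t"] t H d0 by (auto simp: e1_def e2_def)
      have "Lam c N m t - Lam c N m 0 = real N * (e1 + a1 * t + a2 * t\<^sup>2 + a3 * t ^ 3) -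
          real m * (e2 - a1 * t + a2 * t\<^sup>2 - a3 * t ^ 3)"
        using e0 unfolding Lam_def e1_def e2_def by (simp add: algebra_simps)
      then have "\<bar>Lam c N m t - (Lam c N m 0 + S * a1 * t + P * t\<^sup>2 + S * a3 * t ^ 3)\<bar> = \<bar>real N * e1 - real m * e2\<bar>"
        by (simp add: S_def P_def algebra_simps)
      also have "\<dots> \<le> real N * \<bar>e1\<bar> + real m * \<bar>e2\<bar>" 
        using abs_triangle_ineq4[of "real N * e1" "real m * e2"] by (simp add: abs_mult)
      also have "\<dots> \<le> real N * (K * t ^ 4) + real m * (K * t ^ 4)"
        using e by (intro add_mono mult_left_mono) auto
      also have "\<dots> = S * (K * t ^ 4)" by (simp add: S_def algebra_simps)
      also have "\<dots> \<le> (8 * n) * (K * d ^ 4)"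
        using S t t0 H by (intro mult_mono power_mono) auto
      also have "\<dots> = n * d ^ 3 * (8 * K * d)" by (simp add: power_eq_if)
      also have "\<dots> \<le> n * d ^ 3 * (a3 / 40)"
      proof (rule mult_left_mono)
        have "K * d \<le> K * d0" using H t0 by simp
        then show "8 * K * d \<le> a3 / 40" using d0 by linarith
      qed (use H in auto)
      finally show ?thesis by (simp add: E_def)
    qed
    define Q where "Q = S * a3 * d ^ 3"
    have Q: "2 * (n * d ^ 3 * a3) \<le> Q"
    proof -
      have "2 * n * (a3 * d ^ 3) \<le> S * (a3 * d ^ 3)" using S t0 H by (intro mult_right_mono) auto
      then show ?thesis by (simp add: Q_def mult_ac)
    qed
    have pos: "0 < n * d ^ 3 * a3" using H t0 by simp
    define R where "R = n * d ^ 3 * a3"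
    have L1: "\<bar>Lam c N m d - (Lam c N m 0 + S * a1 * d + P * d\<^sup>2 + Q)\<bar> \<le> R / 40"
      using L[of d] H by (simp add: E_def Q_def R_def)
    have L2: "\<bar>Lam c N m (d / 2) - (Lam c N m 0 + S * a1 * d / 2 + P * d\<^sup>2 / 4 + Q / 8)\<bar> \<le> R / 40"
      using L[of "d / 2"] H by (simp add: E_def Q_def R_def power_divide)
    have P': "\<bar>P * d\<^sup>2\<bar> \<le> R / 20" using P by (simp add: abs_mult R_def)
    \<comment> \<open>Relative to S a1 and in units of S a3 d^2, the slope of \<open>Lam\<close> is
      about 1 over [0, d] and about 7/4 over [d / 2, d]. The value 13/10 lies between them, and
      above the slope 1/4 over [0, d / 2].\<close>
    define x where "x = S * a1 + 13 / 10 * (S * a3 * d\<^sup>2)"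
    have x: "d * x = S * a1 * d + 13 / 10 * Q" "d / 2 * x = S * a1 * d / 2 + 13 / 20 * Q"
      by (simp_all add: x_def Q_def power2_eq_square power3_eq_cube algebra_simps)
    have R: "- (a3 / 5) * n * d ^ 3 = - R / 5" "0 < R" "2 * R \<le> Q" using pos Q by (auto simp: R_def)
    note L = L1[unfolded abs_le_iff] L2[unfolded abs_le_iff] P'[unfolded abs_le_iff]
    show "\<exists>x. Lam c N m d - Lam c N m 0 - d * x \<le> - (a3 / 5) * n * d ^ 3 \<and>
      Lam c N m (d / 2) - Lam c N m 0 - d / 2 * x \<le> - (a3 / 5) * n * d ^ 3 \<and>
      Lam c N m (d / 2) - Lam c N m d + d / 2 * x \<le> - (a3 / 5) * n * d ^ 3"
    proof (intro exI[of _ x] conjI)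
      show "Lam c N m d - Lam c N m 0 - d * x \<le> - (a3 / 5) * n * d ^ 3"
        unfolding R x using L R by linarith
      show "Lam c N m (d / 2) - Lam c N m 0 - d / 2 * x \<le> - (a3 / 5) * n * d ^ 3"
        unfolding R x using L R by linarith
      show "Lam c N m (d / 2) - Lam c N m d + d / 2 * x \<le> - (a3 / 5) * n * d ^ 3"
        unfolding R x using L R by linarith
    qed
  qed
qed

text \<open>The second estimate is the first one after exchanging the axes, which turns the
  parameter -d into d.\<close>

lemma exit_bound:
  assumes "0 < c" "c < 1"
  shows "\<exists>d0>0. \<exists>\<kappa>>0. \<exists>C>0. c * exp d0 < 1 \<and> (\<forall>d n N m. 0 < d \<and> d \<le> d0 \<and> 0 < n \<and>
    n \<le> real N \<and> real N \<le> 4 * n \<and> n \<le> real m \<and> real m \<le> 4 * n \<and> \<bar>real N - real m\<bar> \<le> \<kappa> * n * d \<longrightarrow>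
    measure_pmf.prob (blaw c d d N m) {s. lp (zero_left s) N m \<le> lp (zero_bot s) N m} \<le> 3 * exp (- C * n * d ^ 3) \<and>
    measure_pmf.prob (blaw c (- d) (- d) N m) {s. lp (zero_bot s) N m \<le> lp (zero_left s) N m} \<le> 3 * exp (- C * n * d ^ 3))"
proof -
  obtain d0 \<kappa> C where D: "0 < d0" "0 < \<kappa>" "0 < C" "c * exp d0 < 1" and
    E: "\<And>d n N m. 0 < d \<and> d \<le> d0 \<and> 0 < n \<and>
    n \<le> real N \<and> real N \<le> 4 * n \<and> n \<le> real m \<and> real m \<le> 4 * n \<and> \<bar>real N - real m\<bar> \<le> \<kappa> * n * d \<Longrightarrow>
    \<exists>x. Lam c N m d - Lam c N m 0 - d * x \<le> - C * n * d ^ 3 \<and>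
      Lam c N m (d / 2) - Lam c N m 0 - d / 2 * x \<le> - C * n * d ^ 3 \<and>
      Lam c N m (d / 2) - Lam c N m d + d / 2 * x \<le> - C * n * d ^ 3"
    using exit_exponent[OF assms] by metis
  have B: "measure_pmf.prob (blaw c d d N m) {s. lp (zero_left s) N m \<le> lp (zero_bot s) N m} \<le> 3 * exp (- C * n * d ^ 3)"
    if H: "0 < d \<and> d \<le> d0 \<and> 0 < n \<and>
    n \<le> real N \<and> real N \<le> 4 * n \<and> n \<le> real m \<and> real m \<le> 4 * n \<and> \<bar>real N - real m\<bar> \<le> \<kappa> * n * d" for d n N m
  proof -
    obtain x where x: "Lam c N m d - Lam c N m 0 - d * x \<le> - C * n * d ^ 3"
      "Lam c N m (d / 2) - Lam c N m 0 - d / 2 * x \<le> - C * n * d ^ 3"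
      "Lam c N m (d / 2) - Lam c N m d + d / 2 * x \<le> - C * n * d ^ 3" using E[OF H] by blast
    have "c * exp d \<le> c * exp d0" using H assms by simp
    then have "c * exp d < 1" using D by linarith
    then have "measure_pmf.prob (blaw c d d N m) {s. lp (zero_left s) N m \<le> lp (zero_bot s) N m} \<le>
      exp (Lam c N m d - Lam c N m 0 - d * x) + exp (Lam c N m (d / 2) - Lam c N m 0 - d / 2 * x) +
      exp (Lam c N m (d / 2) - Lam c N m d + d / 2 * x)"
      using exit_prob[of c d N m x] H assms by simp
    also have "\<dots> \<le> exp (- C * n * d ^ 3) + exp (- C * n * d ^ 3) + exp (- C * n * d ^ 3)"
      using x by (intro add_mono) auto
    finally show ?thesis by simp
  qed
  have B': "measure_pmf.prob (blaw c (- d) (- d) N m) {s. lp (zero_bot s) N m \<le> lp (zero_left s) N m} \<le> 3 * exp (- C * n * d ^ 3)"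
    if H: "0 < d \<and> d \<le> d0 \<and> 0 < n \<and>
    n \<le> real N \<and> real N \<le> 4 * n \<and> n \<le> real m \<and> real m \<le> 4 * n \<and> \<bar>real N - real m\<bar> \<le> \<kappa> * n * d" for d n N m
  proof -
    have z: "zero_bot (s \<circ> prod.swap) = zero_left s \<circ> prod.swap" "zero_left (s \<circ> prod.swap) = zero_bot s \<circ> prod.swap" for s
      by (auto simp: fun_eq_iff zero_left_def zero_bot_def)
    have "measure_pmf.prob (blaw c (- d) (- d) N m) {s. lp (zero_bot s) N m \<le> lp (zero_left s) N m} = 
      measure_pmf.prob (map_pmf (\<lambda>s. s \<circ> prod.swap) (blaw c d d m N)) {s. lp (zero_bot s) N m \<le> lp (zero_left s) N m}"
      by (simp only: blaw_swap)
    also have "\<dots> = measure_pmf.prob (blaw c d d m N) {s. lp (zero_left s) m N \<le> lp (zero_bot s) m N}"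
      unfolding measure_map_pmf by (simp add: vimage_def z lp_swap)
    also have "\<dots> \<le> 3 * exp (- C * n * d ^ 3)" by (rule B) (use H in auto)
    finally show ?thesis .
  qed
  show ?thesis
    by (rule exI[of _ d0], rule conjI[OF D(1)], rule exI[of _ \<kappa>], rule conjI[OF D(2)], rule exI[of _ C],
        rule conjI[OF D(3)], rule conjI[OF D(4)], intro allI impI conjI) (erule B B')+
qed

section \<open>Fubini for discrete laws\<close>

lemma
  fixes f :: "'b \<Rightarrow> real"
  assumes f: "integrable (measure_pmf (bind_pmf M N)) f"
  shows integral_bind_pmf_Fubini: "(\<integral>x. f x \<partial>bind_pmf M N) = (\<integral>x. (\<integral>y. f y \<partial>N x) \<partial>M)"
    and integrable_bind_pmf_Fubini: "integrable M (\<lambda>x. \<integral>y. f y \<partial>N x)"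
proof -
  define P where "P = (\<lambda>x. \<integral>\<^sup>+y. ennreal (f y) \<partial>N x)"
  define Q where "Q = (\<lambda>x. \<integral>\<^sup>+y. ennreal (- f y) \<partial>N x)"
  have P: "(\<integral>\<^sup>+x. P x \<partial>M) = (\<integral>\<^sup>+x. ennreal (f x) \<partial>bind_pmf M N)"
    and Q: "(\<integral>\<^sup>+x. Q x \<partial>M) = (\<integral>\<^sup>+x. ennreal (- f x) \<partial>bind_pmf M N)" by (simp_all add: P_def Q_def)
  have fin: "(\<integral>\<^sup>+x. P x \<partial>M) \<noteq> \<infinity>" "(\<integral>\<^sup>+x. Q x \<partial>M) \<noteq> \<infinity>"
    using f unfolding P Q real_integrable_def by auto
  have AE: "AE x in M. P x \<noteq> \<infinity>" "AE x in M. Q x \<noteq> \<infinity>"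
    by (rule nn_integral_PInf_AE[OF _ fin(1)], simp) (rule nn_integral_PInf_AE[OF _ fin(2)], simp)
  have ae: "AE x in M. integrable (N x) f"
    using AE by eventually_elim (simp add: real_integrable_def P_def Q_def)
  have iP: "integrable M (\<lambda>x. enn2real (P x))" "(\<integral>x. enn2real (P x) \<partial>M) = enn2real (\<integral>\<^sup>+x. P x \<partial>M)"
  proof -
    have e: "(\<integral>\<^sup>+x. ennreal (enn2real (P x)) \<partial>M) = (\<integral>\<^sup>+x. P x \<partial>M)"
      using AE(1) by (intro nn_integral_cong_AE) (auto simp: less_top[symmetric] elim!: eventually_mono)
    show "integrable M (\<lambda>x. enn2real (P x))"
      by (rule integrableI_nonneg) (use e fin(1) in \<open>auto simp: less_top[symmetric]\<close>)
    show "(\<integral>x. enn2real (P x) \<partial>M) = enn2real (\<integral>\<^sup>+x. P x \<partial>M)"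
      using e by (subst integral_eq_nn_integral) auto
  qed
  have iQ: "integrable M (\<lambda>x. enn2real (Q x))" "(\<integral>x. enn2real (Q x) \<partial>M) = enn2real (\<integral>\<^sup>+x. Q x \<partial>M)"
  proof -
    have e: "(\<integral>\<^sup>+x. ennreal (enn2real (Q x)) \<partial>M) = (\<integral>\<^sup>+x. Q x \<partial>M)"
      using AE(2) by (intro nn_integral_cong_AE) (auto simp: less_top[symmetric] elim!: eventually_mono)
    show "integrable M (\<lambda>x. enn2real (Q x))"
      by (rule integrableI_nonneg) (use e fin(2) in \<open>auto simp: less_top[symmetric]\<close>)
    show "(\<integral>x. enn2real (Q x) \<partial>M) = enn2real (\<integral>\<^sup>+x. Q x \<partial>M)"
      using e by (subst integral_eq_nn_integral) auto
  qed
  have PQ: "AE x in M. (\<integral>y. f y \<partial>N x) = enn2real (P x) - enn2real (Q x)"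
    using ae by eventually_elim (simp add: real_lebesgue_integral_def P_def Q_def)
  have "integrable M (\<lambda>x. enn2real (P x) - enn2real (Q x))" using iP iQ by auto
  then show "integrable M (\<lambda>x. \<integral>y. f y \<partial>N x)"
    by (rule integrable_cong_AE_imp) (use PQ in \<open>auto elim!: eventually_mono\<close>)
  have "(\<integral>x. (\<integral>y. f y \<partial>N x) \<partial>M) = (\<integral>x. enn2real (P x) - enn2real (Q x) \<partial>M)"
    by (rule integral_cong_AE) (use PQ in auto)
  also have "\<dots> = (\<integral>x. f x \<partial>bind_pmf M N)"
    using iP iQ f by (simp add: P Q real_lebesgue_integral_def)
  finally show "(\<integral>x. f x \<partial>bind_pmf M N) = (\<integral>x. (\<integral>y. f y \<partial>N x) \<partial>M)" ..
qed

lemma pair_pmf_conv_bind: "pair_pmf A B = bind_pmf A (\<lambda>x. map_pmf (Pair x) B)"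
  by (simp add: pair_pmf_def map_pmf_def)

lemma
  fixes f :: "'a \<times> 'b \<Rightarrow> real"
  assumes f: "integrable (measure_pmf (pair_pmf A B)) f"
  shows integral_pair_pmf: "(\<integral>z. f z \<partial>pair_pmf A B) = (\<integral>x. (\<integral>y. f (x, y) \<partial>B) \<partial>A)"
    and integrable_pair_pmf: "integrable A (\<lambda>x. \<integral>y. f (x, y) \<partial>B)"
  using integral_bind_pmf_Fubini[OF f[unfolded pair_pmf_conv_bind]]
    integrable_bind_pmf_Fubini[OF f[unfolded pair_pmf_conv_bind]]
  by (simp_all add: pair_pmf_conv_bind)

lemma integrable_pair_pmf_mult:
  fixes f :: "'a \<Rightarrow> real" and g :: "'b \<Rightarrow> real"
  assumes "integrable (measure_pmf A) f" "integrable (measure_pmf B) g"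
  shows "integrable (measure_pmf (pair_pmf A B)) (\<lambda>z. f (fst z) * g (snd z))"
proof (rule integrableI_bounded)
  have "(\<integral>\<^sup>+z. ennreal (norm (f (fst z) * g (snd z))) \<partial>pair_pmf A B) =
     (\<integral>\<^sup>+x. ennreal \<bar>f x\<bar> \<partial>A) * (\<integral>\<^sup>+y. ennreal \<bar>g y\<bar> \<partial>B)"
    by (simp add: nn_integral_pair_pmf' abs_mult ennreal_mult nn_integral_cmult nn_integral_multc)
  also have "\<dots> < \<infinity>" using assms unfolding integrable_iff_bounded by (auto simp: ennreal_mult_less_top)
  finally show "(\<integral>\<^sup>+z. ennreal (norm (f (fst z) * g (snd z))) \<partial>pair_pmf A B) < \<infinity>" .
qed simp

lemma integral_pair_pmf_mult:
  fixes f :: "'a \<Rightarrow> real" and g :: "'b \<Rightarrow> real"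
  assumes "integrable (measure_pmf A) f" "integrable (measure_pmf B) g"
  shows "(\<integral>z. f (fst z) * g (snd z) \<partial>pair_pmf A B) = (\<integral>x. f x \<partial>A) * (\<integral>y. g y \<partial>B)"
  by (subst integral_pair_pmf[OF integrable_pair_pmf_mult[OF assms]]) simp

subsection \<open>Moments of geometric weights\<close>

text \<open>An exponential moment dominates every power. It is uniform in r \<le> r1 because
  \<open>t\<close> is chosen so that r1 exp t is the square root of r1.\<close>

lemma geo_moment:
  assumes "0 < r1" "r1 < 1"
  shows "\<exists>K\<ge>0. \<forall>r. 0 \<le> r \<and> r \<le> r1 \<longrightarrow> (\<integral>\<^sup>+k. ennreal (real k ^ m) \<partial>geo r) \<le> ennreal K"
proof -
  define t where "t = - ln r1 / 2"
  have t: "0 < t" using assms by (simp add: t_def)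
  have "ln r1 + t < 0" using assms by (simp add: t_def)
  then have "exp (ln r1 + t) < 1" by simp
  then have rt: "r1 * exp t < 1" using assms by (simp add: exp_add)
  have le: "real k ^ m \<le> fact m / t ^ m * exp (t * real k)" for k
  proof -
    have "(t * real k) ^ m / fact m \<le> (\<Sum>n. (t * real k) ^ n / fact n)"
      using t by (intro sum_le_suminf[of _ "{m}", simplified] summable_exp_generic[of "t * real k", unfolded scaleR_conv_of_real, simplified])
        (auto simp: divide_inverse mult.commute intro!: summable_exp)
    also have "\<dots> = exp (t * real k)" by (simp add: exp_def divide_inverse scaleR_conv_of_real mult.commute)
    finally show ?thesis using t by (simp add: field_simps power_mult_distrib)
  qed
  define K where "K = fact m / t ^ m * (1 / (1 - r1 * exp t))"
  show ?thesis
  proof (intro exI[of _ K] conjI allI impI)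
    show "0 \<le> K" using t rt by (simp add: K_def)
    fix r assume r: "0 \<le> r \<and> r \<le> r1"
    have r': "r * exp t \<le> r1 * exp t" using r by simp
    have "(\<integral>\<^sup>+k. ennreal (real k ^ m) \<partial>geo r) \<le> (\<integral>\<^sup>+k. ennreal (fact m / t ^ m) * ennreal (exp (t * real k)) \<partial>geo r)"
      using le t by (intro nn_integral_mono) (simp add: ennreal_mult'[symmetric])
    also have "\<dots> = ennreal (fact m / t ^ m) * ennreal ((1 - r) / (1 - r * exp t))"
    proof -
      have "0 \<le> r" "r < 1" "r * exp t < 1" using r r' rt assms by linarith+
      then show ?thesis by (subst nn_integral_cmult) (simp_all add: nn_integral_exp_geo)
    qed
    also have "\<dots> = ennreal (fact m / t ^ m * ((1 - r) / (1 - r * exp t)))"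
      using t by (intro ennreal_mult'[symmetric]) simp
    also have "\<dots> \<le> ennreal K"
      unfolding K_def using r r' rt assms t
      by (intro ennreal_leI mult_left_mono frac_le) auto
    finally show "(\<integral>\<^sup>+k. ennreal (real k ^ m) \<partial>geo r) \<le> ennreal K" .
  qed
qed

lemma sum_pow4:
  fixes f :: "'a \<Rightarrow> real"
  assumes "finite A"
  shows "(\<Sum>x\<in>A. f x) ^ 4 \<le> real (card A) ^ 3 * (\<Sum>x\<in>A. f x ^ 4)"
proof -
  have "(\<Sum>x\<in>A. f x) ^ 4 = ((\<Sum>x\<in>A. f x)\<^sup>2)\<^sup>2" by simp
  also have "\<dots> \<le> ((\<Sum>x\<in>A. (f x)\<^sup>2) * real (card A))\<^sup>2"
    by (intro power_mono sum_squared_le_sum_of_squares assms) auto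
  also have "\<dots> = (\<Sum>x\<in>A. (f x)\<^sup>2)\<^sup>2 * real (card A) ^ 2" by (simp add: power_mult_distrib)
  also have "\<dots> \<le> ((\<Sum>x\<in>A. ((f x)\<^sup>2)\<^sup>2) * real (card A)) * real (card A) ^ 2"
    by (intro mult_right_mono sum_squared_le_sum_of_squares assms) auto
  finally show ?thesis by (simp add: power_eq_if mult_ac)
qed

text \<open>A crude bound, polynomial in the number of sites, is enough: it serves for integrability
  and on events whose probability decays faster than any power.\<close>

lemma Pi_geo_moment4:
  assumes "0 < r1" "r1 < 1"
  shows "\<exists>K\<ge>0. \<forall>(A :: (nat \<times> nat) set) r. finite A \<longrightarrow> (\<forall>x\<in>A. 0 \<le> r x \<and> r x \<le> r1) \<longrightarrow>
    integrable (Pi_pmf A 0 (\<lambda>x. geo (r x))) (\<lambda>s. (\<Sum>x\<in>A. real (s x)) ^ 4) \<and>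
    (\<integral>s. (\<Sum>x\<in>A. real (s x)) ^ 4 \<partial>Pi_pmf A 0 (\<lambda>x. geo (r x))) \<le> K * real (card A) ^ 4"
proof -
  obtain K where K: "0 \<le> K" "\<And>r. 0 \<le> r \<Longrightarrow> r \<le> r1 \<Longrightarrow> (\<integral>\<^sup>+k. ennreal (real k ^ 4) \<partial>geo r) \<le> ennreal K"
    using geo_moment[OF assms, of 4] by blast
  have "integrable (Pi_pmf A 0 (\<lambda>x. geo (r x))) (\<lambda>s. (\<Sum>x\<in>A. real (s x)) ^ 4) \<and>
    (\<integral>s. (\<Sum>x\<in>A. real (s x)) ^ 4 \<partial>Pi_pmf A 0 (\<lambda>x. geo (r x))) \<le> K * real (card A) ^ 4"
    if A: "finite A" and r: "\<forall>x\<in>A. 0 \<le> r x \<and> r x \<le> r1" for A :: "(nat \<times> nat) set" and r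
  proof -
    let ?M = "Pi_pmf A 0 (\<lambda>x. geo (r x))"
    have comp: "(\<integral>\<^sup>+s. ennreal (real (s x) ^ 4) \<partial>?M) \<le> ennreal K" if "x \<in> A" for x
    proof -
      have "(\<integral>\<^sup>+s. ennreal (real (s x) ^ 4) \<partial>?M) = (\<integral>\<^sup>+k. ennreal (real k ^ 4) \<partial>map_pmf (\<lambda>s. s x) ?M)"
        by simp
      also have "map_pmf (\<lambda>s. s x) ?M = geo (r x)" using A that by (subst Pi_pmf_component) auto
      finally show ?thesis using K(2)[of "r x"] r that by simp
    qed
    have "(\<integral>\<^sup>+s. ennreal ((\<Sum>x\<in>A. real (s x)) ^ 4) \<partial>?M) \<le>
       (\<integral>\<^sup>+s. ennreal (real (card A) ^ 3) * (\<Sum>x\<in>A. ennreal (real (s x) ^ 4)) \<partial>?M)"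
    proof (rule nn_integral_mono)
      fix s :: "nat \<times> nat \<Rightarrow> nat"
      have "ennreal ((\<Sum>x\<in>A. real (s x)) ^ 4) \<le> ennreal (real (card A) ^ 3 * (\<Sum>x\<in>A. real (s x) ^ 4))"
        by (rule ennreal_leI[OF sum_pow4[OF A]])
      also have "\<dots> = ennreal (real (card A) ^ 3) * (\<Sum>x\<in>A. ennreal (real (s x) ^ 4))"
        by (simp add: ennreal_mult' sum_ennreal)
      finally show "ennreal ((\<Sum>x\<in>A. real (s x)) ^ 4) \<le> ennreal (real (card A) ^ 3) * (\<Sum>x\<in>A. ennreal (real (s x) ^ 4))" .
    qed
    also have "\<dots> = ennreal (real (card A) ^ 3) * (\<Sum>x\<in>A. (\<integral>\<^sup>+s. ennreal (real (s x) ^ 4) \<partial>?M))"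
      by (simp add: nn_integral_cmult nn_integral_sum del: sum_ennreal)
    also have "\<dots> \<le> ennreal (real (card A) ^ 3) * (\<Sum>x\<in>A. ennreal K)"
      using comp by (intro mult_left_mono sum_mono) auto
    also have "\<dots> = ennreal (K * real (card A) ^ 4)"
      using K(1) by (simp add: ennreal_mult'[symmetric] ennreal_of_nat_eq_real_of_nat power_eq_if mult_ac)
    finally have b: "(\<integral>\<^sup>+s. ennreal ((\<Sum>x\<in>A. real (s x)) ^ 4) \<partial>?M) \<le> ennreal (K * real (card A) ^ 4)" .
    then have i: "integrable ?M (\<lambda>s. (\<Sum>x\<in>A. real (s x)) ^ 4)"
      by (intro integrableI_bounded) (auto intro: le_less_trans)
    moreover have "(\<integral>s. (\<Sum>x\<in>A. real (s x)) ^ 4 \<partial>?M) \<le> K * real (card A) ^ 4"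
      using b K(1) by (subst (asm) nn_integral_eq_integral[OF i]) (auto simp: ennreal_le_iff)
    ultimately show ?thesis by blast
  qed
  with K(1) show ?thesis by blast
qed

lemma integrable_pow4_bound:
  fixes f :: "'a \<Rightarrow> real"
  assumes "integrable (measure_pmf M) (\<lambda>s. S s ^ 4)" "\<And>s. s \<in> set_pmf M \<Longrightarrow> \<bar>f s\<bar> \<le> C * (1 + S s ^ 4)"
  shows "integrable (measure_pmf M) f"
proof (rule Bochner_Integration.integrable_bound)
  show "integrable (measure_pmf M) (\<lambda>s. C * (1 + S s ^ 4))" using assms(1) by auto
  show "AE s in M. norm (f s) \<le> norm (C * (1 + S s ^ 4))"
    using assms(2) by (intro AE_pmfI) (smt (verit) real_norm_def)
qed simp

subsection \<open>Sums of independent geometric variables\<close>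

definition walk :: "nat \<Rightarrow> real \<Rightarrow> nat pmf" where
  "walk k a = map_pmf (\<lambda>s. \<Sum>i<k. s i) (Pi_pmf {..<k} 0 (\<lambda>_. geo a))"

lemma walk_0: "walk 0 a = return_pmf 0"
  by (simp add: walk_def)

lemma walk_Suc: "walk (Suc k) a = map_pmf (\<lambda>z. fst z + snd z) (pair_pmf (geo a) (walk k a))"
proof -
  have "walk (Suc k) a = map_pmf (\<lambda>z. \<Sum>i<Suc k. ((snd z)(k := fst z)) i) (pair_pmf (geo a) (Pi_pmf {..<k} 0 (\<lambda>_. geo a)))"
    unfolding walk_def lessThan_Suc by (subst Pi_pmf_insert) (auto simp: pmf.map_comp o_def case_prod_unfold)
  also have "\<dots> = map_pmf (\<lambda>z. fst z + (\<Sum>i<k. snd z i)) (pair_pmf (geo a) (Pi_pmf {..<k} 0 (\<lambda>_. geo a)))"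
    by (intro map_pmf_cong refl) (auto simp: lessThan_Suc)
  also have "\<dots> = map_pmf (\<lambda>z. fst z + snd z) (pair_pmf (geo a) (walk k a))"
    by (simp add: walk_def pair_map_pmf2 pmf.map_comp o_def case_prod_unfold)
  finally show ?thesis .
qed

lemma geo_mean:
  assumes "0 \<le> a" "a < 1"
  shows "integrable (geo a) real" "(\<integral>k. real k \<partial>geo a) = a / (1 - a)"
  using integrable_real_geometric_pmf[of "1 - a"] expectation_geometric_pmf[of "1 - a"] assms by (auto simp: geo_def)

lemma walk_moments:
  assumes "0 < r1" "r1 < 1"
  shows "\<exists>K\<ge>0. \<forall>a k. 0 \<le> a \<and> a \<le> r1 \<longrightarrow> integrable (walk k a) real \<and> integrable (walk k a) (\<lambda>x. (real x)\<^sup>2) \<and>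
    (\<integral>x. real x \<partial>walk k a) = real k * (a / (1 - a)) \<and>
    (\<integral>x. (real x - real k * (a / (1 - a)))\<^sup>2 \<partial>walk k a) \<le> K * real k"
proof -
  obtain K where K: "0 \<le> K" "\<And>r. 0 \<le> r \<Longrightarrow> r \<le> r1 \<Longrightarrow> (\<integral>\<^sup>+k. ennreal (real k ^ 2) \<partial>geo r) \<le> ennreal K"
    using geo_moment[OF assms, of 2] by blast
  have "integrable (walk k a) real \<and> integrable (walk k a) (\<lambda>x. (real x)\<^sup>2) \<and>
    (\<integral>x. real x \<partial>walk k a) = real k * (a / (1 - a)) \<and>
    (\<integral>x. (real x - real k * (a / (1 - a)))\<^sup>2 \<partial>walk k a) \<le> K * real k" if a: "0 \<le> a" "a \<le> r1" for a k
  proof -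
    define \<mu> where "\<mu> = a / (1 - a)"
    have a1: "a < 1" using a assms by simp
    have i1: "integrable (geo a) real" and e1: "(\<integral>k. real k \<partial>geo a) = \<mu>"
      using geo_mean[OF a(1) a1] by (auto simp: \<mu>_def)
    have i2: "integrable (geo a) (\<lambda>k. (real k)\<^sup>2)"
      using K(2)[OF a] by (intro integrableI_bounded) (auto intro: le_less_trans)
    have e2: "(\<integral>k. (real k)\<^sup>2 \<partial>geo a) \<le> K"
      using K(2)[OF a] K(1) by (subst (asm) nn_integral_eq_integral[OF i2]) (auto simp: ennreal_le_iff)
    have v: "(\<integral>k. (real k - \<mu>)\<^sup>2 \<partial>geo a) \<le> K"
    proof -
      have "(\<integral>k. (real k - \<mu>)\<^sup>2 \<partial>geo a) = (\<integral>k. (real k)\<^sup>2 - 2 * \<mu> * real k + \<mu>\<^sup>2 \<partial>geo a)"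
        by (simp add: power2_diff algebra_simps)
      also have "\<dots> = (\<integral>k. (real k)\<^sup>2 \<partial>geo a) - \<mu>\<^sup>2"
        using i1 i2 by (simp add: e1 power2_eq_square)
      also have "\<dots> \<le> K" using e2 by (simp add: add_increasing2 power2_eq_square) (smt (verit) zero_le_square)
      finally show ?thesis .
    qed
    show ?thesis
    proof (induction k)
      case 0
      then show ?case by (simp add: walk_0 integrable_measure_pmf_finite)
    next
      case (Suc k)
      let ?W = "walk k a" and ?P = "pair_pmf (geo a) (walk k a)"
      have W1: "integrable ?W real" and W2: "integrable ?W (\<lambda>x. (real x)\<^sup>2)"
        and EW: "(\<integral>x. real x \<partial>?W) = real k * \<mu>" and VW: "(\<integral>x. (real x - real k * \<mu>)\<^sup>2 \<partial>?W) \<le> K * real k"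
        using Suc by (auto simp: \<mu>_def)
      have one: "integrable ?W (\<lambda>_. 1 :: real)" "integrable (geo a) (\<lambda>_. 1 :: real)" by auto
      note I = integrable_pair_pmf_mult integral_pair_pmf_mult
      have p: "integrable ?P (\<lambda>z. real (fst z))" "integrable ?P (\<lambda>z. real (snd z))"
        "integrable ?P (\<lambda>z. (real (fst z))\<^sup>2)" "integrable ?P (\<lambda>z. (real (snd z))\<^sup>2)"
        "integrable ?P (\<lambda>z. real (fst z) * real (snd z))"
        using I(1)[OF i1 one(1)] I(1)[OF one(2) W1] I(1)[OF i2 one(1)] I(1)[OF one(2) W2] I(1)[OF i1 W1] by simp_all
      have m1: "integrable (walk (Suc k) a) real" unfolding walk_Suc using p by simp
      have m2: "integrable (walk (Suc k) a) (\<lambda>x. (real x)\<^sup>2)"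
      proof -
        have "(\<lambda>z. (real (fst z + snd z))\<^sup>2) = (\<lambda>z::nat\<times>nat. (real (fst z))\<^sup>2 + (real (snd z))\<^sup>2 + 2 * (real (fst z) * real (snd z)))"
          by (auto simp: fun_eq_iff power2_sum)
        then show ?thesis unfolding walk_Suc integrable_map_pmf_eq using p by simp
      qed
      have m3: "(\<integral>x. real x \<partial>walk (Suc k) a) = real (Suc k) * \<mu>"
        unfolding walk_Suc using p I(2)[OF i1 one(1)] I(2)[OF one(2) W1] EW e1
        by (simp add: algebra_simps)
      have "(\<integral>x. (real x - real (Suc k) * \<mu>)\<^sup>2 \<partial>walk (Suc k) a) =
         (\<integral>z. (real (fst z) - \<mu>)\<^sup>2 * 1 + 1 * (real (snd z) - real k * \<mu>)\<^sup>2 + 2 * ((real (fst z) - \<mu>) * (real (snd z) - real k * \<mu>)) \<partial>?P)"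
        unfolding walk_Suc integral_map_pmf
        by (intro Bochner_Integration.integral_cong refl) (simp add: power2_eq_square algebra_simps)
      also have "\<dots> = (\<integral>k. (real k - \<mu>)\<^sup>2 \<partial>geo a) * 1 + 1 * (\<integral>x. (real x - real k * \<mu>)\<^sup>2 \<partial>?W) +
          2 * ((\<integral>k. (real k - \<mu>) \<partial>geo a) * (\<integral>x. (real x - real k * \<mu>) \<partial>?W))"
      proof -
        have j: "integrable (geo a) (\<lambda>k. (real k - \<mu>)\<^sup>2)" "integrable ?W (\<lambda>x. (real x - real k * \<mu>)\<^sup>2)"
          "integrable (geo a) (\<lambda>k. real k - \<mu>)" "integrable ?W (\<lambda>x. real x - real k * \<mu>)"
          unfolding power2_diff using i1 i2 W1 W2 by auto
        note J = I(1)[OF j(1) one(1)] I(1)[OF one(2) j(2)] I(1)[OF j(3,4)]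
        note L = I(2)[OF j(1) one(1)] I(2)[OF one(2) j(2)] I(2)[OF j(3,4)]
        show ?thesis
          by (subst Bochner_Integration.integral_add Bochner_Integration.integral_mult_right_zero, (use J in \<open>auto\<close>)[2])+
             (simp add: L[simplified])
      qed
      also have "\<dots> \<le> K + K * real k" using v VW i1 e1 by simp
      finally show ?case using m1 m2 m3 by (simp add: \<mu>_def algebra_simps)
    qed
  qed
  with K(1) show ?thesis by blast
qed

lemma abs_one_minus_cos_le: "1 - cos y \<le> \<bar>y\<bar>" for y :: real
proof -
  have "1 - cos y = 2 * (sin (y / 2))\<^sup>2" using cos_double_sin[of "y / 2"] by simp
  also have "\<dots> = 2 * (\<bar>sin (y / 2)\<bar> * \<bar>sin (y / 2)\<bar>)" by (simp add: power2_eq_square)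
  also have "\<dots> \<le> 2 * (\<bar>y / 2\<bar> * 1)"
    by (intro mult_left_mono mult_mono abs_sin_x_le_abs_x) auto
  finally show ?thesis by simp
qed

text \<open>The squared modulus of the characteristic function at \<open>\<theta>\<close>, written
  without complex numbers.\<close>

definition charsq :: "nat pmf \<Rightarrow> real \<Rightarrow> real" where
  "charsq M \<theta> = (\<integral>x. cos (\<theta> * real x) \<partial>M)\<^sup>2 + (\<integral>x. sin (\<theta> * real x) \<partial>M)\<^sup>2"

lemma integrable_cos_sin:
  fixes f :: "'a \<Rightarrow> real"
  shows "integrable (measure_pmf M) (\<lambda>x. cos (f x))" "integrable (measure_pmf M) (\<lambda>x. sin (f x))"
  by (rule measure_pmf.integrable_const_bound[of _ 1]; simp)+

lemma charsq_walk: "charsq (walk k a) \<theta> = charsq (geo a) \<theta> ^ k"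
proof (induction k)
  case 0
  then show ?case by (simp add: charsq_def walk_0)
next
  case (Suc k)
  let ?W = "walk k a" and ?P = "pair_pmf (geo a) (walk k a)"
  note I = integrable_cos_sin[of "geo a" "\<lambda>x. \<theta> * real x"] integrable_cos_sin[of ?W "\<lambda>x. \<theta> * real x"]
  have "(\<integral>x. cos (\<theta> * real x) \<partial>walk (Suc k) a) =
      (\<integral>z. cos (\<theta> * real (fst z)) * cos (\<theta> * real (snd z)) - sin (\<theta> * real (fst z)) * sin (\<theta> * real (snd z)) \<partial>?P)"
    by (simp add: walk_Suc cos_add algebra_simps)
  also have "\<dots> = (\<integral>z. cos (\<theta> * real (fst z)) * cos (\<theta> * real (snd z)) \<partial>?P) - 
      (\<integral>z. sin (\<theta> * real (fst z)) * sin (\<theta> * real (snd z)) \<partial>?P)"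
    by (rule Bochner_Integration.integral_diff; rule integrable_pair_pmf_mult; rule I)
  also have "\<dots> = (\<integral>x. cos (\<theta> * real x) \<partial>geo a) * (\<integral>x. cos (\<theta> * real x) \<partial>?W) -
       (\<integral>x. sin (\<theta> * real x) \<partial>geo a) * (\<integral>x. sin (\<theta> * real x) \<partial>?W)"
    by (simp only: integral_pair_pmf_mult[OF I(1,3)] integral_pair_pmf_mult[OF I(2,4)])
  finally have C: "(\<integral>x. cos (\<theta> * real x) \<partial>walk (Suc k) a) = \<dots>" .
  have "(\<integral>x. sin (\<theta> * real x) \<partial>walk (Suc k) a) =
      (\<integral>z. sin (\<theta> * real (fst z)) * cos (\<theta> * real (snd z)) + cos (\<theta> * real (fst z)) * sin (\<theta> * real (snd z)) \<partial>?P)"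
    by (simp add: walk_Suc sin_add algebra_simps)
  also have "\<dots> = (\<integral>z. sin (\<theta> * real (fst z)) * cos (\<theta> * real (snd z)) \<partial>?P) + 
      (\<integral>z. cos (\<theta> * real (fst z)) * sin (\<theta> * real (snd z)) \<partial>?P)"
    by (rule Bochner_Integration.integral_add; rule integrable_pair_pmf_mult; rule I)
  also have "\<dots> = (\<integral>x. sin (\<theta> * real x) \<partial>geo a) * (\<integral>x. cos (\<theta> * real x) \<partial>?W) +
       (\<integral>x. cos (\<theta> * real x) \<partial>geo a) * (\<integral>x. sin (\<theta> * real x) \<partial>?W)"
    by (simp only: integral_pair_pmf_mult[OF I(2,3)] integral_pair_pmf_mult[OF I(1,4)])
  finally have S: "(\<integral>x. sin (\<theta> * real x) \<partial>walk (Suc k) a) = \<dots>" .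
  have "charsq (walk (Suc k) a) \<theta> = charsq (geo a) \<theta> * charsq ?W \<theta>"
    unfolding charsq_def C S by algebra
  then show ?case by (simp add: Suc)
qed

lemma charsq_conv_pair: "charsq M \<theta> = (\<integral>z. cos (\<theta> * (real (fst z) - real (snd z))) \<partial>pair_pmf M M)"
proof -
  note I = integrable_cos_sin[of M "\<lambda>x. \<theta> * real x"]
  have "(\<integral>z. cos (\<theta> * (real (fst z) - real (snd z))) \<partial>pair_pmf M M) =
     (\<integral>z. cos (\<theta> * real (fst z)) * cos (\<theta> * real (snd z)) + sin (\<theta> * real (fst z)) * sin (\<theta> * real (snd z)) \<partial>pair_pmf M M)"
    by (simp add: cos_diff algebra_simps)
  also have "\<dots> = (\<integral>z. cos (\<theta> * real (fst z)) * cos (\<theta> * real (snd z)) \<partial>pair_pmf M M) + 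
      (\<integral>z. sin (\<theta> * real (fst z)) * sin (\<theta> * real (snd z)) \<partial>pair_pmf M M)"
    by (rule Bochner_Integration.integral_add; rule integrable_pair_pmf_mult; rule I)
  also have "\<dots> = charsq M \<theta>"
    by (simp only: integral_pair_pmf_mult[OF I(1,1)] integral_pair_pmf_mult[OF I(2,2)] charsq_def power2_eq_square)
  finally show ?thesis ..
qed

text \<open>The squared modulus is the characteristic function of the difference of two independent
  copies. The pairs (0, 1) and (1, 0), of total mass 2 a (1 - a)^2, contribute 1 - cos \<theta> to
  its defect from 1.\<close>

lemma charsq_geo_le:
  assumes "0 \<le> a" "a < 1"
  shows "charsq (geo a) \<theta> \<le> 1 - 2 * a * (1 - a)\<^sup>2 * (1 - cos \<theta>)"
proof -
  let ?P = "pair_pmf (geo a) (geo a)" and ?A = "{(0, 1), (1, 0)} :: (nat \<times> nat) set"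
  have "measure_pmf.prob ?P ?A = pmf ?P (0, 1) + pmf ?P (1, 0)"
    by (subst measure_measure_pmf_finite) auto
  also have "\<dots> = 2 * a * (1 - a)\<^sup>2" using assms by (simp add: pmf_pair pmf_geo power2_eq_square)
  finally have P: "measure_pmf.prob ?P ?A = 2 * a * (1 - a)\<^sup>2" .
  have "(1 - cos \<theta>) * measure_pmf.prob ?P ?A = (\<integral>z. (1 - cos \<theta>) * indicator ?A z \<partial>?P)"
    by simp
  also have "\<dots> \<le> (\<integral>z. 1 - cos (\<theta> * (real (fst z) - real (snd z))) \<partial>?P)"
  proof (rule integral_mono)
    show "integrable ?P (\<lambda>z. (1 - cos \<theta>) * indicator ?A z)"
      by (rule measure_pmf.integrable_const_bound[of _ 2]) (auto simp: indicator_def abs_if intro: order_trans[OF _ one_le_numeral] )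
    show "integrable ?P (\<lambda>z. 1 - cos (\<theta> * (real (fst z) - real (snd z))))"
      using integrable_cos_sin(1)[of ?P] by simp
  qed (auto simp: indicator_def)
  also have "\<dots> = 1 - charsq (geo a) \<theta>"
    using integrable_cos_sin(1)[of ?P] by (simp add: charsq_conv_pair)
  finally have "(1 - cos \<theta>) * (2 * a * (1 - a)\<^sup>2) \<le> 1 - charsq (geo a) \<theta>" unfolding P .
  then show ?thesis by (simp add: algebra_simps)
qed

text \<open>A lower bound in L1, not merely for the variance, is needed because the later
  approximations hold in L1. It follows from 1 - cos y \<le> |y| at frequency 1 / sqrt k, where the
  modulus of the characteristic function of the walk is bounded away from 1.\<close>

lemma walk_spread:
  assumes "0 < a1" "a1 \<le> r1" "r1 < 1"
  shows "\<exists>c>0. \<forall>\<^sub>F k in sequentially. \<forall>a z. a1 \<le> a \<and> a \<le> r1 \<longrightarrow> c * sqrt (real k) \<le> (\<integral>x. \<bar>real x - z\<bar> \<partial>walk k a)"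
proof -
  define \<beta> where "\<beta> = a1 * (1 - r1)\<^sup>2 / 2"
  have \<beta>: "0 < \<beta>" using assms by (simp add: \<beta>_def)
  define c where "c = 1 - exp (- \<beta> / 2)"
  have "\<forall>\<^sub>F k in sequentially. 1 - cos (1 / sqrt (real k)) \<ge> 1 / (4 * real k)" by real_asymp
  then have "\<forall>\<^sub>F k in sequentially. \<forall>a z. a1 \<le> a \<and> a \<le> r1 \<longrightarrow> c * sqrt (real k) \<le> (\<integral>x. \<bar>real x - z\<bar> \<partial>walk k a)"
    using eventually_gt_at_top[of 0]
  proof eventually_elim
    case (elim k)
    show ?case
    proof (intro allI impI)
      fix a z :: real assume a: "a1 \<le> a \<and> a \<le> r1"
      define \<theta> where "\<theta> = 1 / sqrt (real k)"
      have k: "real k > 0" using elim by simp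
      then have \<theta>: "0 < \<theta>" "\<theta> * sqrt (real k) = 1" by (auto simp: \<theta>_def)
      have "a1 * (1 - r1)\<^sup>2 \<le> a * (1 - a)\<^sup>2" using a assms by (intro mult_mono power_mono) auto
      then have "2 * (a1 * (1 - r1)\<^sup>2) * (1 / (4 * real k)) \<le> 2 * (a * (1 - a)\<^sup>2) * (1 - cos \<theta>)"
        using elim a assms unfolding \<theta>_def by (intro mult_mono mult_left_mono) auto
      then have "\<beta> / real k \<le> 2 * a * (1 - a)\<^sup>2 * (1 - cos \<theta>)" by (simp add: \<beta>_def)
      with charsq_geo_le[of a \<theta>] a assms have "charsq (geo a) \<theta> \<le> 1 - \<beta> / real k" by simp
      also have "\<dots> \<le> exp (- (\<beta> / real k))" using exp_ge_add_one_self[of "- (\<beta> / real k)"] by simp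
      finally have "charsq (geo a) \<theta> ^ k \<le> exp (- (\<beta> / real k)) ^ k"
        by (intro power_mono) (auto simp: charsq_def)
      also have "\<dots> = exp (- \<beta>)" using k by (simp add: exp_of_nat_mult[symmetric])
      finally have R: "charsq (walk k a) \<theta> \<le> exp (- \<beta>)" by (simp add: charsq_walk)
      let ?C = "\<integral>x. cos (\<theta> * real x) \<partial>walk k a" and ?S = "\<integral>x. sin (\<theta> * real x) \<partial>walk k a"
      obtain K where W: "integrable (walk k a) real"
        using walk_moments[of r1] assms a by (metis less_le_trans order_trans less_imp_le)
      have "(\<integral>x. cos (\<theta> * (real x - z)) \<partial>walk k a) = (\<integral>x. cos (\<theta> * real x) * cos (\<theta> * z) + sin (\<theta> * real x) * sin (\<theta> * z) \<partial>walk k a)"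
        by (simp add: cos_diff algebra_simps)
      also have "\<dots> = ?C * cos (\<theta> * z) + ?S * sin (\<theta> * z)"
        by (subst Bochner_Integration.integral_add) (auto intro!: integrable_mult_left integrable_cos_sin)
      \<comment> \<open>The left side is the projection of the vector (?C, ?S) onto a unit
        direction, so its square is at most \<open>charsq\<close>.\<close>
      also have "\<dots> \<le> sqrt (exp (- \<beta>))"
      proof (rule real_le_rsqrt)
        have "(?C * cos (\<theta> * z) + ?S * sin (\<theta> * z))\<^sup>2 + (?C * sin (\<theta> * z) - ?S * cos (\<theta> * z))\<^sup>2 = 
          (?C\<^sup>2 + ?S\<^sup>2) * ((sin (\<theta> * z))\<^sup>2 + (cos (\<theta> * z))\<^sup>2)"
          by algebra
        then have "(?C * cos (\<theta> * z) + ?S * sin (\<theta> * z))\<^sup>2 \<le> charsq (walk k a) \<theta>"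
          unfolding sin_cos_squared_add charsq_def by (smt (verit) zero_le_power2)
        then show "(?C * cos (\<theta> * z) + ?S * sin (\<theta> * z))\<^sup>2 \<le> exp (- \<beta>)" using R by simp
      qed
      also have "sqrt (exp (- \<beta>)) = exp (- \<beta> / 2)"
        by (rule real_sqrt_unique) (simp_all add: power2_eq_square exp_add[symmetric])
      finally have cs: "(\<integral>x. cos (\<theta> * (real x - z)) \<partial>walk k a) \<le> exp (- \<beta> / 2)" .
      have "1 - (\<integral>x. cos (\<theta> * (real x - z)) \<partial>walk k a) = (\<integral>x. 1 - cos (\<theta> * (real x - z)) \<partial>walk k a)"
        using integrable_cos_sin(1)[of "walk k a"] by simp
      also have "\<dots> \<le> (\<integral>x. \<theta> * \<bar>real x - z\<bar> \<partial>walk k a)"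
      proof (rule integral_mono)
        show "1 - cos (\<theta> * (real x - z)) \<le> \<theta> * \<bar>real x - z\<bar>" for x
          using abs_one_minus_cos_le[of "\<theta> * (real x - z)"] \<theta> by (simp add: abs_mult)
        show "integrable (walk k a) (\<lambda>x. \<theta> * \<bar>real x - z\<bar>)" using W by simp
        show "integrable (walk k a) (\<lambda>x. 1 - cos (\<theta> * (real x - z)))"
          using integrable_cos_sin(1)[of "walk k a"] by simp
      qed
      finally have "c \<le> \<theta> * (\<integral>x. \<bar>real x - z\<bar> \<partial>walk k a)" using cs by (simp add: c_def)
      then have "c * sqrt (real k) \<le> \<theta> * (\<integral>x. \<bar>real x - z\<bar> \<partial>walk k a) * sqrt (real k)"
        by (rule mult_right_mono) simp
      also have "\<dots> = (\<theta> * sqrt (real k)) * (\<integral>x. \<bar>real x - z\<bar> \<partial>walk k a)" by (simp only: mult_ac)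
      also have "\<dots> = (\<integral>x. \<bar>real x - z\<bar> \<partial>walk k a)" using \<theta> by simp
      finally show "c * sqrt (real k) \<le> (\<integral>x. \<bar>real x - z\<bar> \<partial>walk k a)" .
    qed
  qed
  moreover have "0 < c" using \<beta> by (simp add: c_def)
  ultimately show ?thesis by blast
qed

subsection \<open>Comparison of bulk and stationary increments\<close>

definition ilaw :: "real \<Rightarrow> nat \<Rightarrow> nat \<Rightarrow> (nat \<times> nat \<Rightarrow> nat) pmf" where
  "ilaw q N m = Pi_pmf ({..N} \<times> {..m}) 0 (\<lambda>_. geo q)"

definition Hinc :: "(nat \<times> nat \<Rightarrow> nat) \<Rightarrow> nat \<Rightarrow> nat \<Rightarrow> nat \<Rightarrow> real" where
  "Hinc w N m k = real (lp w (N + k) m) - real (lp w N m)"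

lemma map_bulk_law:
  assumes "\<And>w w'. (\<And>i j. i \<le> N \<Longrightarrow> j \<le> m \<Longrightarrow> w (i, j) = w' (i, j)) \<Longrightarrow> F w = F w'"
  shows "map_pmf (\<lambda>s. F (bulk s)) (blaw c u v (Suc N) (Suc m)) = map_pmf F (ilaw (c\<^sup>2) N m)"
proof -
  let ?h = "\<lambda>(i, j). (Suc i, Suc j)"
  have b: "s \<circ> ?h = bulk s" for s :: "nat \<times> nat \<Rightarrow> nat" by (simp add: fun_eq_iff bulk_def)
  have "map_pmf (\<lambda>s. F (s \<circ> ?h)) (blaw c u v (Suc N) (Suc m)) = 
    map_pmf F (Pi_pmf ({..N} \<times> {..m}) 0 ((\<lambda>x. geo (rate c u v x)) \<circ> ?h))"
    unfolding blaw_def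
  proof (rule map_pmf_reindex)
    show "F w = F w'" if "\<And>b. b \<in> {..N} \<times> {..m} \<Longrightarrow> w b = w' b" for w w'
      by (rule assms) (rule that, simp)
  qed (auto simp: bx_def inj_on_def)
  also have "Pi_pmf ({..N} \<times> {..m}) 0 ((\<lambda>x. geo (rate c u v x)) \<circ> ?h) = ilaw (c\<^sup>2) N m"
    unfolding ilaw_def by (intro Pi_pmf_cong) (auto simp: rate_def)
  finally show ?thesis unfolding b .
qed

lemma map_blaw_restrict:
  assumes "N \<le> N'" "m \<le> m'"
    "\<And>w w'. (\<And>x. x \<in> bx N m \<Longrightarrow> w x = w' x) \<Longrightarrow> F w = F w'"
  shows "map_pmf F (blaw c u v N' m') = map_pmf F (blaw c u v N m)"
proof -
  have "map_pmf (\<lambda>s. F (s \<circ> id)) (Pi_pmf (bx N' m') 0 (\<lambda>x. geo (rate c u v x))) =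
    map_pmf F (Pi_pmf (bx N m) 0 ((\<lambda>x. geo (rate c u v x)) \<circ> id))"
  proof (rule map_pmf_reindex)
    show "id ` bx N m \<subseteq> bx N' m'" using assms(1,2) by (auto simp: bx_def)
    show "F w = F w'" if "\<And>b. b \<in> bx N m \<Longrightarrow> w b = w' b" for w w'
      by (rule assms(3)) (rule that)
  qed auto
  then show ?thesis by (simp add: blaw_def)
qed

text \<open>Moving the boundary up to height \<open>m\<close> by the Burke property turns the
  horizontal increments there into bottom weights, which are i.i.d.\<close>

lemma walk_law:
  assumes "0 < c" "c < 1" "c * exp u < 1" "c * exp (- u) < 1"
  shows "map_pmf (\<lambda>s. lp s (N + k) m - lp s N m) (blaw c u u (N + k) m) = walk k (c * exp u)"
proof -
  obtain g where g: "map_pmf g (blaw c u u (N + k) (m + 0)) = blaw c u u (N + k) 0" "burke_map 0 m (N + k) 0 g"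
    using burke_up[OF assms] by blast
  have "map_pmf (\<lambda>s. lp s (N + k) m - lp s N m) (blaw c u u (N + k) m) =
     map_pmf (\<lambda>s. \<Sum>i<k. g s (Suc (N + i), 0)) (blaw c u u (N + k) m)"
  proof (intro map_pmf_cong refl)
    fix s assume s: "s \<in> set_pmf (blaw c u u (N + k) m)"
    note D = burke_mapD(2)[where s = s, OF g(2) set_blaw_origin[OF s]]
    have "lp w (N + k) 0 = lp w N 0 + (\<Sum>i<k. w (Suc (N + i), 0))" for w by (induction k) auto
    then show "lp s (N + k) m - lp s N m = (\<Sum>i<k. g s (Suc (N + i), 0))"
      using D[of "N + k" 0] D[of N 0] by simp
  qed
  also have "\<dots> = map_pmf (\<lambda>s. \<Sum>i<k. s (Suc (N + i), 0)) (map_pmf g (blaw c u u (N + k) m))"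
    by (simp add: pmf.map_comp o_def)
  also have "\<dots> = map_pmf (\<lambda>s. (\<lambda>s. \<Sum>i<k. s i) (s \<circ> (\<lambda>i. (Suc (N + i), 0)))) (blaw c u u (N + k) 0)"
    using g(1) by (simp add: o_def)
  also have "\<dots> = map_pmf (\<lambda>s. \<Sum>i<k. s i) (Pi_pmf {..<k} 0 ((\<lambda>x. geo (rate c u u x)) \<circ> (\<lambda>i. (Suc (N + i), 0))))"
    unfolding blaw_def by (rule map_pmf_reindex) (auto simp: bx_def inj_on_def)
  also have "Pi_pmf {..<k} 0 ((\<lambda>x. geo (rate c u u x)) \<circ> (\<lambda>i. (Suc (N + i), 0))) = Pi_pmf {..<k} 0 (\<lambda>_. geo (c * exp u))"
    by (intro Pi_pmf_cong) (auto simp: rate_def)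
  finally show ?thesis by (simp add: walk_def)
qed

definition gmean :: "real \<Rightarrow> real \<Rightarrow> real" where
  "gmean c t = c * exp t / (1 - c * exp t)"

lemma gmean_lipschitz:
  assumes "0 < c" "c < 1" "0 < d0" "c * exp d0 < 1"
  shows "\<exists>K\<ge>0. \<forall>t. \<bar>t\<bar> \<le> d0 \<longrightarrow> \<bar>gmean c t - gmean c 0\<bar> \<le> K * \<bar>t\<bar>"
proof -
  define K where "K = 1 / (1 - c * exp d0)\<^sup>2"
  have lt: "c * exp t \<le> c * exp d0" if "t \<le> d0" for t using assms that by simp
  have der: "DERIV (gmean c) t :> c * exp t / (1 - c * exp t)\<^sup>2" if "t \<le> d0" for t
  proof -
    have "1 - c * exp t \<noteq> 0" using lt[OF that] assms(4) by linarith
    then have "DERIV (\<lambda>t. c * exp t / (1 - c * exp t)) t :> c * exp t / (1 - c * exp t)\<^sup>2"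
      by (auto intro!: derivative_eq_intros simp: power2_eq_square algebra_simps)
    then show ?thesis by (simp add: gmean_def[abs_def])
  qed
  have bd: "\<bar>c * exp t / (1 - c * exp t)\<^sup>2\<bar> \<le> K" if "t \<le> d0" for t
  proof -
    have "c * exp t \<le> 1" "0 < 1 - c * exp d0" "1 - c * exp d0 \<le> 1 - c * exp t"
      using lt[OF that] assms(4) by linarith+
    then have "c * exp t / (1 - c * exp t)\<^sup>2 \<le> 1 / (1 - c * exp d0)\<^sup>2"
      by (intro frac_le power_mono; (assumption | simp))
    then show ?thesis using assms by (simp add: K_def)
  qed
  have "\<bar>gmean c t - gmean c 0\<bar> \<le> K * \<bar>t\<bar>" if t: "\<bar>t\<bar> \<le> d0" for t
  proof -
    have "norm (gmean c t - gmean c 0) \<le> K * norm (t - 0)"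
    proof (rule field_differentiable_bound[of "{- d0..d0}"])
      show "(gmean c has_field_derivative c * exp z / (1 - c * exp z)\<^sup>2) (at z within {- d0..d0})" if "z \<in> {- d0..d0}" for z
        using der[of z] that by (auto intro: has_field_derivative_at_within)
      show "norm (c * exp z / (1 - c * exp z)\<^sup>2) \<le> K" if "z \<in> {- d0..d0}" for z
        using bd[of z] that by simp
    qed (use t assms in auto)
    then show ?thesis by simp
  qed
  moreover have "0 \<le> K" by (simp add: K_def)
  ultimately show ?thesis by blast
qed

text \<open>Collects constants that serve all box sizes and all tilts up to \<open>d0\<close>, so
  that the tilt can be tied to the size of the box later.\<close>

locale sandwich =
  fixes c d0 \<kappa> C K :: real
  assumes c: "0 < c" "c < 1" and d0: "0 < d0" "c * exp d0 < 1" and pos: "0 < \<kappa>" "0 < C" "1 \<le> K"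
    and exits: "\<And>d n N m. 0 < d \<Longrightarrow> d \<le> d0 \<Longrightarrow> 0 < n \<Longrightarrow> n \<le> real N \<Longrightarrow> real N \<le> 4 * n \<Longrightarrow> n \<le> real m \<Longrightarrow>
      real m \<le> 4 * n \<Longrightarrow> \<bar>real N - real m\<bar> \<le> \<kappa> * n * d \<Longrightarrow>
    measure_pmf.prob (blaw c d d N m) {s. lp (zero_left s) N m \<le> lp (zero_bot s) N m} \<le> 3 * exp (- C * n * d ^ 3) \<and>
    measure_pmf.prob (blaw c (- d) (- d) N m) {s. lp (zero_bot s) N m \<le> lp (zero_left s) N m} \<le> 3 * exp (- C * n * d ^ 3)"
    and moment4: "\<And>u N m. \<bar>u\<bar> \<le> d0 \<Longrightarrow> integrable (blaw c u u N m) (\<lambda>s. (\<Sum>x\<in>bx N m. real (s x)) ^ 4) \<and>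
      (\<integral>s. (\<Sum>x\<in>bx N m. real (s x)) ^ 4 \<partial>blaw c u u N m) \<le> K * real (card (bx N m)) ^ 4"
    and walkm: "\<And>u k. \<bar>u\<bar> \<le> d0 \<Longrightarrow> integrable (walk k (c * exp u)) real \<and> integrable (walk k (c * exp u)) (\<lambda>x. (real x)\<^sup>2) \<and>
      (\<integral>x. real x \<partial>walk k (c * exp u)) = real k * gmean c u \<and>
      (\<integral>x. (real x - real k * gmean c u)\<^sup>2 \<partial>walk k (c * exp u)) \<le> K * real k"
    and lip: "\<And>t. \<bar>t\<bar> \<le> d0 \<Longrightarrow> \<bar>gmean c t - gmean c 0\<bar> \<le> K * \<bar>t\<bar>"

lemma sandwich_exists:
  assumes c: "0 < c" "c < 1"
  shows "\<exists>d0 \<kappa> C K. sandwich c d0 \<kappa> C K"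
proof -
  obtain d0 \<kappa> C where D: "0 < d0" "0 < \<kappa>" "0 < C" "c * exp d0 < 1" and
    E: "\<forall>d n N m. 0 < d \<and> d \<le> d0 \<and> 0 < n \<and>
    n \<le> real N \<and> real N \<le> 4 * n \<and> n \<le> real m \<and> real m \<le> 4 * n \<and> \<bar>real N - real m\<bar> \<le> \<kappa> * n * d \<longrightarrow>
    measure_pmf.prob (blaw c d d N m) {s. lp (zero_left s) N m \<le> lp (zero_bot s) N m} \<le> 3 * exp (- C * n * d ^ 3) \<and>
    measure_pmf.prob (blaw c (- d) (- d) N m) {s. lp (zero_bot s) N m \<le> lp (zero_left s) N m} \<le> 3 * exp (- C * n * d ^ 3)"
    by (insert exit_bound[OF c], elim exE conjE, rule that; assumption)
  have lt: "c * exp t \<le> c * exp d0" if "t \<le> d0" for t using c that by simp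
  have r1: "0 < c * exp d0" "c * exp d0 < 1" using c D by auto
  obtain K1 where K1: "K1 \<ge> 0" "\<And>t. \<bar>t\<bar> \<le> d0 \<Longrightarrow> \<bar>gmean c t - gmean c 0\<bar> \<le> K1 * \<bar>t\<bar>"
    using gmean_lipschitz[OF c D(1,4)] by blast
  obtain K2 where K2: "K2 \<ge> 0" "\<And>a k. 0 \<le> a \<and> a \<le> c * exp d0 \<Longrightarrow> integrable (walk k a) real \<and> integrable (walk k a) (\<lambda>x. (real x)\<^sup>2) \<and>
    (\<integral>x. real x \<partial>walk k a) = real k * (a / (1 - a)) \<and>
    (\<integral>x. (real x - real k * (a / (1 - a)))\<^sup>2 \<partial>walk k a) \<le> K2 * real k"
    using walk_moments[OF r1] by metis
  obtain K3 where K3: "K3 \<ge> 0" "\<And>(A :: (nat \<times> nat) set) r. finite A \<Longrightarrow> (\<forall>x\<in>A. 0 \<le> r x \<and> r x \<le> c * exp d0) \<Longrightarrow>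
    integrable (Pi_pmf A 0 (\<lambda>x. geo (r x))) (\<lambda>s. (\<Sum>x\<in>A. real (s x)) ^ 4) \<and>
    (\<integral>s. (\<Sum>x\<in>A. real (s x)) ^ 4 \<partial>Pi_pmf A 0 (\<lambda>x. geo (r x))) \<le> K3 * real (card A) ^ 4"
    using Pi_geo_moment4[OF r1] by metis
  define K where "K = 1 + K1 + K2 + K3"
  have K: "1 \<le> K" "K1 \<le> K" "K2 \<le> K" "K3 \<le> K" using K1 K2 K3 by (auto simp: K_def)
  have "sandwich c d0 \<kappa> C K"
  proof
    show "0 < c" "c < 1" "0 < d0" "c * exp d0 < 1" "0 < \<kappa>" "0 < C" "1 \<le> K" using c D K by auto
  next
    fix t assume "\<bar>t\<bar> \<le> d0"
    then have "\<bar>gmean c t - gmean c 0\<bar> \<le> K1 * \<bar>t\<bar>" by (rule K1)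
    also have "\<dots> \<le> K * \<bar>t\<bar>" using K by (intro mult_right_mono) auto
    finally show "\<bar>gmean c t - gmean c 0\<bar> \<le> K * \<bar>t\<bar>" .
  next
    fix u k assume u: "\<bar>u\<bar> \<le> d0"
    have "0 \<le> c * exp u \<and> c * exp u \<le> c * exp d0" using u lt[of u] c by auto
    note W = K2(2)[OF this, of k]
    have "K2 * real k \<le> K * real k" using K by (intro mult_right_mono) auto
    with W show "integrable (walk k (c * exp u)) real \<and> integrable (walk k (c * exp u)) (\<lambda>x. (real x)\<^sup>2) \<and>
      (\<integral>x. real x \<partial>walk k (c * exp u)) = real k * gmean c u \<and>
      (\<integral>x. (real x - real k * gmean c u)\<^sup>2 \<partial>walk k (c * exp u)) \<le> K * real k"
      by (auto simp: gmean_def)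
  next
    fix u N m assume u: "\<bar>u\<bar> \<le> d0"
    have "c\<^sup>2 \<le> c" using c by (simp add: power2_eq_square mult_left_le)
    also have "c \<le> c * exp d0" using c D by simp
    finally have "c\<^sup>2 \<le> c * exp d0" .
    then have "\<forall>x\<in>bx N m. 0 \<le> rate c u u x \<and> rate c u u x \<le> c * exp d0"
      using lt[of u] lt[of "- u"] u c by (auto simp: rate_def)
    from K3(2)[OF finite_bx this]
    have "integrable (blaw c u u N m) (\<lambda>s. (\<Sum>x\<in>bx N m. real (s x)) ^ 4) \<and>
      (\<integral>s. (\<Sum>x\<in>bx N m. real (s x)) ^ 4 \<partial>blaw c u u N m) \<le> K3 * real (card (bx N m)) ^ 4" by (simp add: blaw_def)
    moreover have "K3 * real (card (bx N m)) ^ 4 \<le> K * real (card (bx N m)) ^ 4"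
      using K by (intro mult_right_mono) auto
    ultimately show "integrable (blaw c u u N m) (\<lambda>s. (\<Sum>x\<in>bx N m. real (s x)) ^ 4) \<and>
      (\<integral>s. (\<Sum>x\<in>bx N m. real (s x)) ^ 4 \<partial>blaw c u u N m) \<le> K * real (card (bx N m)) ^ 4" by linarith
  qed (rule E[rule_format], intro conjI)
  then show ?thesis by blast
qed

context sandwich
begin

text \<open>The comparison adds a boundary row and column, hence the successors. The summand
  \<open>real k\<close> in the last clause makes the exit bounds available at both ends of the
  interval, N and N + k.\<close>

definition cond :: "real \<Rightarrow> real \<Rightarrow> nat \<Rightarrow> nat \<Rightarrow> nat \<Rightarrow> bool" where
  "cond d n N m k \<longleftrightarrow> 0 < d \<and> d \<le> d0 \<and> 1 \<le> n \<and> n \<le> real (Suc N) \<and> real (Suc (N + k)) \<le> 4 * n \<and>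
    n \<le> real (Suc m) \<and> real (Suc m) \<le> 4 * n \<and> \<bar>real N - real m\<bar> + real k \<le> \<kappa> * n * d"

text \<open>A box has at most (5 n)^2 sites, and the fourth moment of the sum of their weights is of
  order (5 n)^8. Half of the exit exponent is spent on trading this moment against the probability
  of the bad event.\<close>

definition err :: "real \<Rightarrow> real \<Rightarrow> real" where
  "err d n = (3 + K) * (5 * n) ^ 8 * exp (- C * n * d ^ 3 / 2)"

lemma lt1: "\<bar>u\<bar> \<le> d0 \<Longrightarrow> c * exp u < 1" "\<bar>u\<bar> \<le> d0 \<Longrightarrow> c * exp (- u) < 1"
proof -
  have "c * exp t < 1" if "t \<le> d0" for t
  proof -
    have "c * exp t \<le> c * exp d0" using c that by simp
    also have "\<dots> < 1" by (rule d0)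
    finally show ?thesis .
  qed
  then show "\<bar>u\<bar> \<le> d0 \<Longrightarrow> c * exp u < 1" "\<bar>u\<bar> \<le> d0 \<Longrightarrow> c * exp (- u) < 1" by auto
qed

abbreviation Sm :: "nat \<Rightarrow> nat \<Rightarrow> (nat \<times> nat \<Rightarrow> nat) \<Rightarrow> real" where
  "Sm N m s \<equiv> \<Sum>x\<in>bx N m. real (s x)"

lemma bad_moment:
  assumes u: "\<bar>u\<bar> \<le> d0" and n: "1 \<le> n" "real N \<le> 4 * n" "real m \<le> 4 * n"
    and B: "measure_pmf.prob (blaw c u u N m) B \<le> 3 * exp (- C * n * d ^ 3)"
  shows "integrable (blaw c u u N m) (\<lambda>s. indicator B s * (Sm N m s)\<^sup>2)"
    and "(\<integral>s. indicator B s * (Sm N m s)\<^sup>2 \<partial>blaw c u u N m) \<le> err d n"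
proof -
  let ?M = "blaw c u u N m" and ?z = "C * n * d ^ 3"
  note m4 = moment4[OF u, of N m]
  show i: "integrable ?M (\<lambda>s. indicator B s * (Sm N m s)\<^sup>2)"
  proof (rule integrable_pow4_bound[of _ "Sm N m" _ 1])
    show "\<bar>indicator B s * (Sm N m s)\<^sup>2\<bar> \<le> 1 * (1 + Sm N m s ^ 4)" for s
    proof -
      have "x\<^sup>2 \<le> 1 + x ^ 4" for x :: real
      proof -
        have "0 \<le> (x\<^sup>2 - 1)\<^sup>2 + x\<^sup>2" by simp
        then show ?thesis by (simp add: power2_diff) 
      qed
      from this[of "Sm N m s"] show ?thesis by (simp add: indicator_def)
    qed
  qed (use m4 in blast)
  have "real (card (bx N m)) \<le> (5 * n)\<^sup>2"
  proof -
    have "card (bx N m) \<le> card ({..N} \<times> {..m})" by (rule card_mono) (auto simp: bx_def)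
    then have "real (card (bx N m)) \<le> real (card ({..N} \<times> {..m}))" by (rule of_nat_mono)
    also have "\<dots> = real (Suc N) * real (Suc m)" by (simp only: card_cartesian_product card_atMost of_nat_mult)
    also have "\<dots> \<le> (5 * n) * (5 * n)" using n by (intro mult_mono) auto
    finally show ?thesis by (simp add: power2_eq_square)
  qed
  then have "real (card (bx N m)) ^ 4 \<le> ((5 * n)\<^sup>2) ^ 4" by (rule power_mono) simp
  then have c4: "real (card (bx N m)) ^ 4 \<le> (5 * n) ^ 8" by (simp flip: power_mult)
  have n8: "1 \<le> (5 * n) ^ 8" using n by (intro one_le_power) auto
  have "(\<integral>s. indicator B s * (Sm N m s)\<^sup>2 \<partial>?M) \<le>
    (\<integral>s. exp (?z / 2) * indicator B s + exp (- ?z / 2) * Sm N m s ^ 4 \<partial>?M)"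
  proof (rule integral_mono[OF i])
    show "integrable ?M (\<lambda>s. exp (?z / 2) * indicator B s + exp (- ?z / 2) * Sm N m s ^ 4)"
      using m4 by (intro Bochner_Integration.integrable_add integrable_mult_right) (auto intro!: measure_pmf.integrable_const_bound[of _ 1])
    fix s
    show "indicator B s * (Sm N m s)\<^sup>2 \<le> exp (?z / 2) * indicator B s + exp (- ?z / 2) * Sm N m s ^ 4"
    proof (cases "s \<in> B")
      case True
      have ee: "exp (?z / 2) * exp (- ?z / 2) = 1" by (simp flip: exp_add)
      \<comment> \<open>A weighted arithmetic-geometric inequality in place of Cauchy-Schwarz, to be
        used with the weights exp (z / 2) and exp (- z / 2), where z = C n d^3.\<close>
      have "y \<le> a + b * y\<^sup>2" if "a * b = 1" "0 < a" "0 < b" for a b y :: real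
      proof -
        have "0 \<le> b * (y - a)\<^sup>2" using that by simp
        also have "\<dots> = b * y\<^sup>2 - 2 * (a * b) * y + (a * b) * a" by (simp add: power2_eq_square algebra_simps)
        finally have "2 * y \<le> a + b * y\<^sup>2" using that by simp
        moreover have "0 \<le> a + b * y\<^sup>2" using that by simp
        ultimately show ?thesis by linarith
      qed
      from this[OF ee, of "(Sm N m s)\<^sup>2"] show ?thesis using True by simp
    qed simp
  qed
  also have "\<dots> = exp (?z / 2) * measure_pmf.prob ?M B + exp (- ?z / 2) * (\<integral>s. Sm N m s ^ 4 \<partial>?M)"
    using m4 by (subst Bochner_Integration.integral_add) (auto intro!: integrable_mult_right measure_pmf.integrable_const_bound[of _ 1])
  also have "\<dots> \<le> exp (?z / 2) * (3 * exp (- ?z)) + exp (- ?z / 2) * (K * (5 * n) ^ 8)"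
  proof (intro add_mono mult_left_mono)
    show "(\<integral>s. Sm N m s ^ 4 \<partial>?M) \<le> K * (5 * n) ^ 8"
      using m4 mult_left_mono[OF c4, of K] pos by linarith
  qed (use B in auto)
  also have "exp (?z / 2) * (3 * exp (- ?z)) = 3 * exp (- ?z / 2)"
    by (simp flip: exp_add)
  also have "3 * exp (- ?z / 2) + exp (- ?z / 2) * (K * (5 * n) ^ 8) \<le> exp (- ?z / 2) * (3 * (5 * n) ^ 8) + exp (- ?z / 2) * (K * (5 * n) ^ 8)"
    using n8 by simp
  also have "\<dots> = err d n" by (simp add: err_def algebra_simps)
  finally show "(\<integral>s. indicator B s * (Sm N m s)\<^sup>2 \<partial>?M) \<le> err d n" .
qed

text \<open>The stationary increment is a walk with mean k gmean c u. Recentring it at the untilted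
  mean costs the squared bias (K k |u|)^2.\<close>

lemma Uinc_moments:
  assumes u: "\<bar>u\<bar> \<le> d0"
  shows "integrable (blaw c u u (N + k) m) (\<lambda>s. Hinc s N m k)"
    "integrable (blaw c u u (N + k) m) (\<lambda>s. (Hinc s N m k - z)\<^sup>2)"
    "(\<integral>s. Hinc s N m k \<partial>blaw c u u (N + k) m) = real k * gmean c u"
    "(\<integral>s. (Hinc s N m k - real k * gmean c 0)\<^sup>2 \<partial>blaw c u u (N + k) m) \<le> 2 * K * real k + 2 * (K * real k * \<bar>u\<bar>)\<^sup>2"
proof -
  let ?M = "blaw c u u (N + k) m" and ?W = "walk k (c * exp u)"
  have law: "map_pmf (\<lambda>s. lp s (N + k) m - lp s N m) ?M = ?W"
    by (rule walk_law) (use c lt1[OF u] in auto)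
  have H: "Hinc s N m k = real (lp s (N + k) m - lp s N m)" for s
    using lp_mono_endpoint[of N "N + k" s m] by (simp add: Hinc_def)
  note W = walkm[OF u, of k]
  have I: "integrable ?M (\<lambda>s. f (Hinc s N m k)) \<longleftrightarrow> integrable ?W (\<lambda>x. f (real x))"
    "(\<integral>s. f (Hinc s N m k) \<partial>?M) = (\<integral>x. f (real x) \<partial>?W)" for f :: "real \<Rightarrow> real"
    unfolding H law[symmetric] by simp_all
  have W2: "integrable ?W (\<lambda>x. (real x - z)\<^sup>2)" for z
    unfolding power2_diff using W by (intro Bochner_Integration.integrable_add Bochner_Integration.integrable_diff) auto
  show "integrable ?M (\<lambda>s. Hinc s N m k)" "(\<integral>s. Hinc s N m k \<partial>?M) = real k * gmean c u"
    using I[of "\<lambda>x. x"] W by auto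
  show "integrable ?M (\<lambda>s. (Hinc s N m k - z)\<^sup>2)" using I(1)[of "\<lambda>x. (x - z)\<^sup>2"] W2 by simp
  have "(\<integral>s. (Hinc s N m k - real k * gmean c 0)\<^sup>2 \<partial>?M) = (\<integral>x. (real x - real k * gmean c 0)\<^sup>2 \<partial>?W)"
    by (rule I(2)[of "\<lambda>x. (x - real k * gmean c 0)\<^sup>2"])
  also have "\<dots> \<le> (\<integral>x. 2 * (real x - real k * gmean c u)\<^sup>2 + 2 * (real k * (gmean c u - gmean c 0))\<^sup>2 \<partial>?W)"
  proof (rule integral_mono)
    show "integrable ?W (\<lambda>x. 2 * (real x - real k * gmean c u)\<^sup>2 + 2 * (real k * (gmean c u - gmean c 0))\<^sup>2)"
      using W2[of "real k * gmean c u"] by simp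
    fix x
    have "(a - b)\<^sup>2 \<le> 2 * (a - e)\<^sup>2 + 2 * (e - b)\<^sup>2" for a b e :: real
    proof -
      have "2 * (a - e)\<^sup>2 + 2 * (e - b)\<^sup>2 - (a - b)\<^sup>2 = (a - 2 * e + b)\<^sup>2" by (simp add: power2_eq_square algebra_simps)
      then show ?thesis by (smt (verit) zero_le_power2)
    qed
    then show "(real x - real k * gmean c 0)\<^sup>2 \<le> 2 * (real x - real k * gmean c u)\<^sup>2 + 2 * (real k * (gmean c u - gmean c 0))\<^sup>2"
      by (simp add: right_diff_distrib)
  qed (rule W2)
  also have "\<dots> = 2 * (\<integral>x. (real x - real k * gmean c u)\<^sup>2 \<partial>?W) + 2 * (real k * (gmean c u - gmean c 0))\<^sup>2"
    using W2[of "real k * gmean c u"] by simp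
  also have "\<dots> \<le> 2 * (K * real k) + 2 * (K * real k * \<bar>u\<bar>)\<^sup>2"
  proof (intro add_mono mult_left_mono)
    have "\<bar>real k * (gmean c u - gmean c 0)\<bar> \<le> \<bar>K * real k * \<bar>u\<bar>\<bar>"
      using mult_left_mono[OF lip[OF u], of "real k"] pos by (simp add: abs_mult mult_ac)
    then show "(real k * (gmean c u - gmean c 0))\<^sup>2 \<le> (K * real k * \<bar>u\<bar>)\<^sup>2" by (rule abs_le_square_iff[THEN iffD1])
  qed (use W in auto)
  finally show "(\<integral>s. (Hinc s N m k - real k * gmean c 0)\<^sup>2 \<partial>?M) \<le> 2 * K * real k + 2 * (K * real k * \<bar>u\<bar>)\<^sup>2" by simp
qed

text \<open>All increments are dominated by the total weight \<open>S\<close>. As \<open>S\<close>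
  is a natural number, S \<le> S^2, so that one second moment on the bad event controls linear and
  quadratic errors alike.\<close>

lemma inc_bounds:
  assumes s: "s \<in> set_pmf (blaw c u u (Suc N + k) (Suc m))"
  defines "S \<equiv> Sm (Suc N + k) (Suc m) s"
  shows "0 \<le> Hinc s (Suc N) (Suc m) k" "Hinc s (Suc N) (Suc m) k \<le> S"
    "0 \<le> Hinc (bulk s) N m k" "Hinc (bulk s) N m k \<le> S" "S \<le> S\<^sup>2"
proof -
  have s0: "s (0, 0) = 0" by (rule set_blaw_origin[OF s])
  have "lp s (Suc N + k) (Suc m) \<le> sum s ({..Suc N + k} \<times> {..Suc m})" by (rule lp_le_sum)
  also have "\<dots> = sum s (bx (Suc N + k) (Suc m))"
    unfolding bx_def using s0 by (intro sum.mono_neutral_right) auto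
  finally have l: "lp s (Suc N + k) (Suc m) \<le> sum s (bx (Suc N + k) (Suc m))" .
  have "lp (bulk s) (N + k) m \<le> lp s (Suc N + k) (Suc m)"
    unfolding lp_bulk by (simp del: lp.simps, rule lp_mono_weights) (simp add: zero_left_def zero_bot_def)
  with l have l': "lp (bulk s) (N + k) m \<le> sum s (bx (Suc N + k) (Suc m))" by simp
  have S: "S = real (sum s (bx (Suc N + k) (Suc m)))" by (simp add: S_def)
  show "0 \<le> Hinc s (Suc N) (Suc m) k" "0 \<le> Hinc (bulk s) N m k"
    using lp_mono_endpoint[of "Suc N" "Suc N + k" s "Suc m"] lp_mono_endpoint[of N "N + k" "bulk s" m]
    by (auto simp: Hinc_def)
  show "Hinc s (Suc N) (Suc m) k \<le> S" "Hinc (bulk s) N m k \<le> S"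
    unfolding S Hinc_def using l l' by linarith+
  show "S \<le> S\<^sup>2" unfolding S power2_eq_square of_nat_mult[symmetric] of_nat_le_iff by (rule le_square)
qed

text \<open>With tilt +d the stationary increment lies above the bulk increment off
  \<open>B\<close>. The event \<open>B\<close> is decided in the box ending at \<open>Suc N\<close>,
  so its probability may be computed there.\<close>

lemma upper_bad:
  assumes "cond d n N m k"
  defines "B \<equiv> {s. lp (zero_left s) (Suc N) (Suc m) \<le> lp (zero_bot s) (Suc N) (Suc m)}"
  shows "measure_pmf.prob (blaw c d d (Suc N + k) (Suc m)) B \<le> 3 * exp (- C * n * d ^ 3)"
    and "s (0, 0) = 0 \<Longrightarrow> s \<notin> B \<Longrightarrow> Hinc (bulk s) N m k \<le> Hinc s (Suc N) (Suc m) k"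
proof -
  have "map_pmf (\<lambda>s. s \<in> B) (blaw c d d (Suc N + k) (Suc m)) = map_pmf (\<lambda>s. s \<in> B) (blaw c d d (Suc N) (Suc m))"
  proof (rule map_blaw_restrict)
    fix w w' :: "nat \<times> nat \<Rightarrow> nat" assume e: "\<And>x. x \<in> bx (Suc N) (Suc m) \<Longrightarrow> w x = w' x"
    define v where "v = (\<lambda>w :: nat \<times> nat \<Rightarrow> nat. w((0, 0) := 0))"
    have z: "lp (zero_left w) (Suc N) (Suc m) = lp (zero_left w') (Suc N) (Suc m)"
       "lp (zero_bot w) (Suc N) (Suc m) = lp (zero_bot w') (Suc N) (Suc m)"
      by (rule lp_cong; use e in \<open>auto simp: zero_left_def zero_bot_def bx_def\<close>)+
    then show "(w \<in> B) = (w' \<in> B)" by (simp add: B_def del: lp.simps)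
  qed auto
  moreover have pr: "measure_pmf.prob M B = measure_pmf.prob (map_pmf (\<lambda>s. s \<in> B) M) {True}" for M
    by (simp add: vimage_def)
  ultimately have "measure_pmf.prob (blaw c d d (Suc N + k) (Suc m)) B = measure_pmf.prob (blaw c d d (Suc N) (Suc m)) B"
    by (subst (1 2) pr) (simp only:)
  also have "\<dots> \<le> 3 * exp (- C * n * d ^ 3)" unfolding B_def
    using assms(1) exits[of d n "Suc N" "Suc m"] by (auto simp: cond_def)
  finally show "measure_pmf.prob (blaw c d d (Suc N + k) (Suc m)) B \<le> 3 * exp (- C * n * d ^ 3)" .
  assume s: "s (0, 0) = 0" "s \<notin> B"
  then have "lp (zero_bot s) (Suc N) (Suc m) \<le> lp (zero_left s) (Suc N) (Suc m)" by (simp add: B_def del: lp.simps)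
  from bulk_increment_le[where s = s, OF s(1) this, of k]
  have "real_of_int (int (lp (bulk s) (N + k) m) - lp (bulk s) N m) \<le>
    real_of_int (int (lp s (Suc (N + k)) (Suc m)) - lp s (Suc N) (Suc m))" by (rule of_int_le_iff[THEN iffD2])
  then show "Hinc (bulk s) N m k \<le> Hinc s (Suc N) (Suc m) k" by (simp add: Hinc_def del: lp.simps)
qed

text \<open>With tilt -d the stationary increment lies below the bulk increment off
  \<open>B\<close>. The event is now taken at the right end of the interval, as
  \<open>bulk_increment_ge\<close> requires.\<close>

lemma lower_bad:
  assumes "cond d n N m k"
  defines "B \<equiv> {s. lp (zero_bot s) (Suc N + k) (Suc m) \<le> lp (zero_left s) (Suc N + k) (Suc m)}"
  shows "measure_pmf.prob (blaw c (- d) (- d) (Suc N + k) (Suc m)) B \<le> 3 * exp (- C * n * d ^ 3)"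
    and "s (0, 0) = 0 \<Longrightarrow> s \<notin> B \<Longrightarrow> Hinc s (Suc N) (Suc m) k \<le> Hinc (bulk s) N m k"
proof -
  show "measure_pmf.prob (blaw c (- d) (- d) (Suc N + k) (Suc m)) B \<le> 3 * exp (- C * n * d ^ 3)" unfolding B_def
    using assms(1) exits[of d n "Suc N + k" "Suc m"] by (auto simp: cond_def)
  assume s: "s (0, 0) = 0" "s \<notin> B"
  then have "lp (zero_left s) (Suc (N + k)) (Suc m) \<le> lp (zero_bot s) (Suc (N + k)) (Suc m)" by (simp add: B_def del: lp.simps)
  from bulk_increment_ge[where s = s, OF s(1) this]
  have "real_of_int (int (lp s (Suc (N + k)) (Suc m)) - lp s (Suc N) (Suc m)) \<le>
    real_of_int (int (lp (bulk s) (N + k) m) - lp (bulk s) N m)" by (rule of_int_le_iff[THEN iffD2])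
  then show "Hinc s (Suc N) (Suc m) k \<le> Hinc (bulk s) N m k" by (simp add: Hinc_def del: lp.simps)
qed

end

section \<open>Moments and spread of the bulk increments\<close>

context sandwich
begin

lemma Hinc_bulk_law:
  "map_pmf (\<lambda>s. f (Hinc (bulk s) N m k)) (blaw c u v (Suc N + k) (Suc m)) =
   map_pmf (\<lambda>w. f (Hinc w N m k)) (ilaw (c\<^sup>2) (N + k) m)"
proof -
  have "map_pmf (\<lambda>s. (\<lambda>w. f (Hinc w N m k)) (bulk s)) (blaw c u v (Suc (N + k)) (Suc m)) =
     map_pmf (\<lambda>w. f (Hinc w N m k)) (ilaw (c\<^sup>2) (N + k) m)"
  proof (rule map_bulk_law)
    fix w w' :: "nat \<times> nat \<Rightarrow> nat" assume e: "\<And>i j. i \<le> N + k \<Longrightarrow> j \<le> m \<Longrightarrow> w (i, j) = w' (i, j)"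
    have "lp w (N + k) m = lp w' (N + k) m" "lp w N m = lp w' N m"
      by (rule lp_cong; use e in simp)+
    then show "f (Hinc w N m k) = f (Hinc w' N m k)" by (simp add: Hinc_def)
  qed
  then show ?thesis by simp
qed

lemma Hinc_ilaw:
  fixes f :: "real \<Rightarrow> real"
  shows "(\<integral>w. f (Hinc w N m k) \<partial>ilaw (c\<^sup>2) (N + k) m) = (\<integral>s. f (Hinc (bulk s) N m k) \<partial>blaw c u v (Suc N + k) (Suc m))"
    "integrable (ilaw (c\<^sup>2) (N + k) m) (\<lambda>w. f (Hinc w N m k)) \<longleftrightarrow>
     integrable (blaw c u v (Suc N + k) (Suc m)) (\<lambda>s. f (Hinc (bulk s) N m k))"
proof -
  note L = Hinc_bulk_law[of f N m k u v]
  have "(\<integral>w. f (Hinc w N m k) \<partial>ilaw (c\<^sup>2) (N + k) m) = (\<integral>x. x \<partial>map_pmf (\<lambda>w. f (Hinc w N m k)) (ilaw (c\<^sup>2) (N + k) m))"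
    by simp
  also have "\<dots> = (\<integral>s. f (Hinc (bulk s) N m k) \<partial>blaw c u v (Suc N + k) (Suc m))" unfolding L[symmetric] by simp
  finally show "(\<integral>w. f (Hinc w N m k) \<partial>ilaw (c\<^sup>2) (N + k) m) = \<dots>" .
  have "integrable (ilaw (c\<^sup>2) (N + k) m) (\<lambda>w. f (Hinc w N m k)) \<longleftrightarrow> integrable (map_pmf (\<lambda>w. f (Hinc w N m k)) (ilaw (c\<^sup>2) (N + k) m)) (\<lambda>x. x)"
    by simp
  also have "\<dots> \<longleftrightarrow> integrable (blaw c u v (Suc N + k) (Suc m)) (\<lambda>s. f (Hinc (bulk s) N m k))" unfolding L[symmetric] by simp
  finally show "integrable (ilaw (c\<^sup>2) (N + k) m) (\<lambda>w. f (Hinc w N m k)) \<longleftrightarrow> \<dots>" .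
qed

lemma integrable_Hinc_bulk:
  assumes u: "\<bar>u\<bar> \<le> d0"
  shows "integrable (blaw c u u (Suc N + k) (Suc m)) (\<lambda>s. Hinc (bulk s) N m k)"
    "integrable (blaw c u u (Suc N + k) (Suc m)) (\<lambda>s. (Hinc (bulk s) N m k)\<^sup>2)"
proof -
  let ?M = "blaw c u u (Suc N + k) (Suc m)" and ?S = "Sm (Suc N + k) (Suc m)"
  have sq: "x \<le> 1 + x ^ 4" "x\<^sup>2 \<le> 1 + x ^ 4" for x :: real
  proof -
    have "0 \<le> (x\<^sup>2 - 1)\<^sup>2 + x\<^sup>2" "0 \<le> (x\<^sup>2 - 1 / 2)\<^sup>2 + (x - 1 / 2)\<^sup>2" by simp_all
    then show "x\<^sup>2 \<le> 1 + x ^ 4" "x \<le> 1 + x ^ 4" by (simp_all add: power2_diff power_divide)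
  qed
  note B = inc_bounds(3,4)[of _ u N k m]
  show "integrable ?M (\<lambda>s. Hinc (bulk s) N m k)"
    by (rule integrable_pow4_bound[of _ ?S _ 1])
       (use moment4[OF u] B sq(1) in \<open>fastforce intro: order_trans\<close>)+
  show "integrable ?M (\<lambda>s. (Hinc (bulk s) N m k)\<^sup>2)"
  proof (rule integrable_pow4_bound[of _ ?S _ 1])
    fix s assume s: "s \<in> set_pmf ?M"
    have "(Hinc (bulk s) N m k)\<^sup>2 \<le> (?S s)\<^sup>2" using B[OF s] by (intro power_mono) auto
    with sq(2)[of "?S s"] show "\<bar>(Hinc (bulk s) N m k)\<^sup>2\<bar> \<le> 1 * (1 + ?S s ^ 4)" by simp
  qed (use moment4[OF u] in blast)
qed

text \<open>The two sides of the sandwich live in different fields, one for each sign of the tilt,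
  which share only the law of the bulk. So the positive part of the centred increment is estimated
  in one field and the negative part in the other, and the two integrals are added under
  \<open>ilaw\<close>.\<close>

lemma Hinc_second_moment:
  assumes cd: "cond d n N m k"
  shows "(\<integral>w. (Hinc w N m k - real k * gmean c 0)\<^sup>2 \<partial>ilaw (c\<^sup>2) (N + k) m) \<le>
     8 * K * real k + 8 * (K * real k * d)\<^sup>2 + 4 * err d n"
    "integrable (ilaw (c\<^sup>2) (N + k) m) (\<lambda>w. (Hinc w N m k - z)\<^sup>2)"
proof -
  define \<mu> where "\<mu> = real k * gmean c 0"
  have d: "0 < d" "d \<le> d0" and n: "1 \<le> n" "real (Suc N + k) \<le> 4 * n" "real (Suc m) \<le> 4 * n"
    using cd by (auto simp: cond_def)
  then have ud: "\<bar>d\<bar> \<le> d0" "\<bar>- d\<bar> \<le> d0" by auto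
  let ?I = "ilaw (c\<^sup>2) (N + k) m" and ?M = "blaw c d d (Suc N + k) (Suc m)" and ?L = "blaw c (- d) (- d) (Suc N + k) (Suc m)"
  let ?S = "Sm (Suc N + k) (Suc m)"
  let ?H = "\<lambda>s. Hinc (bulk s) N m k" and ?U = "\<lambda>s. Hinc s (Suc N) (Suc m) k"
  have iH: "integrable (blaw c u u (Suc N + k) (Suc m)) (\<lambda>s. (?H s - z)\<^sup>2)" if "\<bar>u\<bar> \<le> d0" for u z
    unfolding power2_diff using integrable_Hinc_bulk[OF that, of N k m] by simp
  then show "integrable ?I (\<lambda>w. (Hinc w N m k - z)\<^sup>2)" for z
    using Hinc_ilaw(2)[where f = "\<lambda>x. (x - z)\<^sup>2" and N = N and k = k and m = m and u = d and v = d] ud by simp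
  have iF: "integrable (blaw c u u (Suc N + k) (Suc m)) (\<lambda>s. (max 0 (?H s - \<mu>))\<^sup>2)"
    and iG: "integrable (blaw c u u (Suc N + k) (Suc m)) (\<lambda>s. (max 0 (\<mu> - ?H s))\<^sup>2)" if "\<bar>u\<bar> \<le> d0" for u
    by (rule Bochner_Integration.integrable_bound[OF iH[OF that, of \<mu>]]; auto simp: max_def power2_commute)+
  define BU where "BU = {s. lp (zero_left s) (Suc N) (Suc m) \<le> lp (zero_bot s) (Suc N) (Suc m)}"
  define BL where "BL = {s. lp (zero_bot s) (Suc N + k) (Suc m) \<le> lp (zero_left s) (Suc N + k) (Suc m)}"
  note U = upper_bad[OF cd, folded BU_def] and L = lower_bad[OF cd, folded BL_def]
  note bU = bad_moment[OF ud(1) n U(1)] and bL = bad_moment[OF ud(2) n L(1)]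
  note mU = Uinc_moments[OF ud(1), of "Suc N" k "Suc m"] and mL = Uinc_moments[OF ud(2), of "Suc N" k "Suc m"]
  have sq: "(a + b)\<^sup>2 \<le> 2 * a\<^sup>2 + 2 * b\<^sup>2" for a b :: real
    using zero_le_power2[of "a - b"] by (simp add: power2_eq_square algebra_simps)
  have one: "(\<integral>s. (max 0 (?H s - \<mu>))\<^sup>2 \<partial>?M) \<le> 2 * (2 * K * real k + 2 * (K * real k * d)\<^sup>2) + 2 * err d n"
  proof -
    have "(\<integral>s. (max 0 (?H s - \<mu>))\<^sup>2 \<partial>?M) \<le> (\<integral>s. 2 * (?U s - \<mu>)\<^sup>2 + 2 * (indicator BU s * (?S s)\<^sup>2) \<partial>?M)"
    proof (rule integral_mono_AE[OF iF[OF ud(1)] _ AE_pmfI])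
      show "integrable ?M (\<lambda>s. 2 * (?U s - \<mu>)\<^sup>2 + 2 * (indicator BU s * (?S s)\<^sup>2))"
        using mU(2)[of \<mu>] bU(1) by simp
      fix s assume s: "s \<in> set_pmf ?M"
      note B = inc_bounds[OF s]
      show "(max 0 (?H s - \<mu>))\<^sup>2 \<le> 2 * (?U s - \<mu>)\<^sup>2 + 2 * (indicator BU s * (?S s)\<^sup>2)"
      proof -
        have "max 0 (?H s - \<mu>) \<le> \<bar>?U s - \<mu>\<bar> + indicator BU s * ?S s"
        proof (cases "s \<in> BU")
          case True
          then show ?thesis using B gmean_def[of c 0] c by (simp add: \<mu>_def) (smt (verit) mult_nonneg_nonneg of_nat_0_le_iff divide_nonneg_pos)
        next
          case False
          then show ?thesis using U(2)[OF set_blaw_origin[OF s] False] by simp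
        qed
        then have "(max 0 (?H s - \<mu>))\<^sup>2 \<le> (\<bar>?U s - \<mu>\<bar> + indicator BU s * ?S s)\<^sup>2" by (intro power_mono) auto
        also have "\<dots> \<le> 2 * \<bar>?U s - \<mu>\<bar>\<^sup>2 + 2 * (indicator BU s * ?S s)\<^sup>2" by (rule sq)
        finally show ?thesis by (cases "s \<in> BU") simp_all
      qed
    qed
    also have "\<dots> = 2 * (\<integral>s. (?U s - \<mu>)\<^sup>2 \<partial>?M) + 2 * (\<integral>s. indicator BU s * (?S s)\<^sup>2 \<partial>?M)"
      using mU(2)[of \<mu>] bU(1) by simp
    also have "\<dots> \<le> 2 * (2 * K * real k + 2 * (K * real k * d)\<^sup>2) + 2 * err d n"
      using mU(4) bU(2) d by (intro add_mono mult_left_mono) (auto simp: \<mu>_def)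
    finally show ?thesis .
  qed
  have two: "(\<integral>s. (max 0 (\<mu> - ?H s))\<^sup>2 \<partial>?L) \<le> 2 * (2 * K * real k + 2 * (K * real k * d)\<^sup>2) + 2 * err d n"
  proof -
    have "(\<integral>s. (max 0 (\<mu> - ?H s))\<^sup>2 \<partial>?L) \<le> (\<integral>s. 2 * (?U s - \<mu>)\<^sup>2 + 2 * (indicator BL s * (?S s)\<^sup>2) \<partial>?L)"
    proof (rule integral_mono_AE[OF iG[OF ud(2)] _ AE_pmfI])
      show "integrable ?L (\<lambda>s. 2 * (?U s - \<mu>)\<^sup>2 + 2 * (indicator BL s * (?S s)\<^sup>2))"
        using mL(2)[of \<mu>] bL(1) by simp
      fix s assume s: "s \<in> set_pmf ?L"
      note B = inc_bounds[OF s]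
      show "(max 0 (\<mu> - ?H s))\<^sup>2 \<le> 2 * (?U s - \<mu>)\<^sup>2 + 2 * (indicator BL s * (?S s)\<^sup>2)"
      proof -
        have "max 0 (\<mu> - ?H s) \<le> \<bar>?U s - \<mu>\<bar> + indicator BL s * ?S s"
        proof (cases "s \<in> BL")
          case True
          then show ?thesis using B by simp
        next
          case False
          then show ?thesis using L(2)[OF set_blaw_origin[OF s] False] by simp
        qed
        then have "(max 0 (\<mu> - ?H s))\<^sup>2 \<le> (\<bar>?U s - \<mu>\<bar> + indicator BL s * ?S s)\<^sup>2" by (intro power_mono) auto
        also have "\<dots> \<le> 2 * \<bar>?U s - \<mu>\<bar>\<^sup>2 + 2 * (indicator BL s * ?S s)\<^sup>2" by (rule sq)
        finally show ?thesis by (cases "s \<in> BL") simp_all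
      qed
    qed
    also have "\<dots> = 2 * (\<integral>s. (?U s - \<mu>)\<^sup>2 \<partial>?L) + 2 * (\<integral>s. indicator BL s * (?S s)\<^sup>2 \<partial>?L)"
      using mL(2)[of \<mu>] bL(1) by simp
    also have "\<dots> \<le> 2 * (2 * K * real k + 2 * (K * real k * d)\<^sup>2) + 2 * err d n"
      using mL(4) bL(2) d by (intro add_mono mult_left_mono) (auto simp: \<mu>_def)
    finally show ?thesis .
  qed
  have "(\<integral>w. (Hinc w N m k - \<mu>)\<^sup>2 \<partial>?I) = (\<integral>w. (max 0 (Hinc w N m k - \<mu>))\<^sup>2 + (max 0 (\<mu> - Hinc w N m k))\<^sup>2 \<partial>?I)"
    by (intro Bochner_Integration.integral_cong refl) (auto simp: max_def power2_commute)
  also have "\<dots> = (\<integral>w. (max 0 (Hinc w N m k - \<mu>))\<^sup>2 \<partial>?I) + (\<integral>w. (max 0 (\<mu> - Hinc w N m k))\<^sup>2 \<partial>?I)"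
    using iF[OF ud(1)] iG[OF ud(1)] Hinc_ilaw(2)[where f = "\<lambda>x. (max 0 (x - \<mu>))\<^sup>2" and N = N and k = k and m = m and u = d and v = d]
      Hinc_ilaw(2)[where f = "\<lambda>x. (max 0 (\<mu> - x))\<^sup>2" and N = N and k = k and m = m and u = d and v = d]
    by (intro Bochner_Integration.integral_add) auto
  also have "\<dots> = (\<integral>s. (max 0 (?H s - \<mu>))\<^sup>2 \<partial>?M) + (\<integral>s. (max 0 (\<mu> - ?H s))\<^sup>2 \<partial>?L)"
    using Hinc_ilaw(1)[where f = "\<lambda>x. (max 0 (x - \<mu>))\<^sup>2" and N = N and k = k and m = m and u = d and v = d] Hinc_ilaw(1)[where f = "\<lambda>x. (max 0 (\<mu> - x))\<^sup>2" and N = N and k = k and m = m and u = "- d" and v = "- d"]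
    by simp
  also have "\<dots> \<le> 8 * K * real k + 8 * (K * real k * d)\<^sup>2 + 4 * err d n"
    using one two by simp
  finally show "(\<integral>w. (Hinc w N m k - real k * gmean c 0)\<^sup>2 \<partial>?I) \<le>
     8 * K * real k + 8 * (K * real k * d)\<^sup>2 + 4 * err d n" by (simp add: \<mu>_def)
qed

text \<open>Off a small event the difference is nonnegative, so its L1 norm is essentially a
  difference of means. The mean of the bulk increment is bounded below in the field with tilt -d,
  which leaves k (gmean c d - gmean c (-d)), of order k d.\<close>

lemma Hinc_close:
  assumes cd: "cond d n N m k"
  shows "(\<integral>s. \<bar>Hinc s (Suc N) (Suc m) k - Hinc (bulk s) N m k\<bar> \<partial>blaw c d d (Suc N + k) (Suc m)) \<le>
     2 * K * real k * d + 3 * err d n"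
    "integrable (blaw c d d (Suc N + k) (Suc m)) (\<lambda>s. \<bar>Hinc s (Suc N) (Suc m) k - Hinc (bulk s) N m k\<bar>)"
proof -
  have d: "0 < d" "d \<le> d0" and n: "1 \<le> n" "real (Suc N + k) \<le> 4 * n" "real (Suc m) \<le> 4 * n"
    using cd by (auto simp: cond_def)
  then have ud: "\<bar>d\<bar> \<le> d0" "\<bar>- d\<bar> \<le> d0" by auto
  let ?M = "blaw c d d (Suc N + k) (Suc m)" and ?L = "blaw c (- d) (- d) (Suc N + k) (Suc m)"
  let ?S = "Sm (Suc N + k) (Suc m)"
  let ?H = "\<lambda>s. Hinc (bulk s) N m k" and ?U = "\<lambda>s. Hinc s (Suc N) (Suc m) k"
  define BU where "BU = {s. lp (zero_left s) (Suc N) (Suc m) \<le> lp (zero_bot s) (Suc N) (Suc m)}"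
  define BL where "BL = {s. lp (zero_bot s) (Suc N + k) (Suc m) \<le> lp (zero_left s) (Suc N + k) (Suc m)}"
  note U = upper_bad[OF cd, folded BU_def] and L = lower_bad[OF cd, folded BL_def]
  note bU = bad_moment[OF ud(1) n U(1)] and bL = bad_moment[OF ud(2) n L(1)]
  note mU = Uinc_moments[OF ud(1), of "Suc N" k "Suc m"] and mL = Uinc_moments[OF ud(2), of "Suc N" k "Suc m"]
  note iH = integrable_Hinc_bulk(1)[OF ud(1), of N k m] integrable_Hinc_bulk(1)[OF ud(2), of N k m]
  show i: "integrable ?M (\<lambda>s. \<bar>?U s - ?H s\<bar>)" using iH(1) mU(1) by auto
  have "(\<integral>s. \<bar>?U s - ?H s\<bar> \<partial>?M) \<le> (\<integral>s. (?U s - ?H s) + 2 * (indicator BU s * (?S s)\<^sup>2) \<partial>?M)"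
  proof (rule integral_mono_AE[OF i _ AE_pmfI])
    show "integrable ?M (\<lambda>s. (?U s - ?H s) + 2 * (indicator BU s * (?S s)\<^sup>2))"
      using iH(1) mU(1) bU(1) by auto
    fix s assume s: "s \<in> set_pmf ?M"
    note B = inc_bounds[OF s]
    show "\<bar>?U s - ?H s\<bar> \<le> (?U s - ?H s) + 2 * (indicator BU s * (?S s)\<^sup>2)"
    proof (cases "s \<in> BU")
      case True
      then show ?thesis using B by simp
    next
      case False
      then show ?thesis using U(2)[OF set_blaw_origin[OF s] False] by simp
    qed
  qed
  also have "\<dots> = (\<integral>s. ?U s \<partial>?M) - (\<integral>s. ?H s \<partial>?M) + 2 * (\<integral>s. indicator BU s * (?S s)\<^sup>2 \<partial>?M)"
    using iH(1) mU(1) bU(1) by simp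
  also have "(\<integral>s. ?H s \<partial>?M) = (\<integral>s. ?H s \<partial>?L)"
    using Hinc_ilaw(1)[where f = "\<lambda>x. x" and N = N and k = k and m = m and u = d and v = d] Hinc_ilaw(1)[where f = "\<lambda>x. x" and N = N and k = k and m = m and u = "- d" and v = "- d"] by simp
  also have "(\<integral>s. ?U s \<partial>?M) - (\<integral>s. ?H s \<partial>?L) + 2 * (\<integral>s. indicator BU s * (?S s)\<^sup>2 \<partial>?M) \<le>
    real k * gmean c d - (real k * gmean c (- d) - err d n) + 2 * err d n"
  proof (intro add_mono diff_mono mult_left_mono)
    have "(\<integral>s. ?U s - indicator BL s * (?S s)\<^sup>2 \<partial>?L) \<le> (\<integral>s. ?H s \<partial>?L)"
    proof (rule integral_mono_AE[OF _ iH(2) AE_pmfI])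
      show "integrable ?L (\<lambda>s. ?U s - indicator BL s * (?S s)\<^sup>2)" using mL(1) bL(1) by auto
      fix s assume s: "s \<in> set_pmf ?L"
      note B = inc_bounds[OF s]
      show "?U s - indicator BL s * (?S s)\<^sup>2 \<le> ?H s"
      proof (cases "s \<in> BL")
        case True
        then show ?thesis using B by simp
      next
        case False
        then show ?thesis using L(2)[OF set_blaw_origin[OF s] False] by simp
      qed
    qed
    moreover have "(\<integral>s. ?U s - indicator BL s * (?S s)\<^sup>2 \<partial>?L) = real k * gmean c (- d) - (\<integral>s. indicator BL s * (?S s)\<^sup>2 \<partial>?L)"
      using mL(1,3) bL(1) by simp
    ultimately show "real k * gmean c (- d) - err d n \<le> (\<integral>s. ?H s \<partial>?L)" using bL(2) by linarith
  qed (use mU(3) bU(2) in auto)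
  also have "\<dots> \<le> 2 * K * real k * d + 3 * err d n"
  proof -
    have "gmean c d - gmean c (- d) \<le> 2 * (K * d)" using lip[OF ud(1)] lip[OF ud(2)] d by simp
    then have "real k * (gmean c d - gmean c (- d)) \<le> real k * (2 * (K * d))" by (rule mult_left_mono) simp
    then show ?thesis by (simp add: algebra_simps)
  qed
  finally show "(\<integral>s. \<bar>?U s - ?H s\<bar> \<partial>?M) \<le> 2 * K * real k * d + 3 * err d n" .
qed

text \<open>The stationary increment is a walk and hence spread out; the L1 error of
  \<open>Hinc_close\<close> is subtracted.\<close>

lemma cond_walk_spread:
  "\<exists>b>0. \<forall>\<^sub>F k in sequentially. \<forall>d n N m z. cond d n N m k \<longrightarrow>
    b * sqrt (real k) - (2 * K * real k * d + 3 * err d n) \<le> (\<integral>w. \<bar>Hinc w N m k - z\<bar> \<partial>ilaw (c\<^sup>2) (N + k) m)"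
proof -
  have "c \<le> c * exp d0" using c d0 by simp
  then obtain b where b: "0 < b" "\<forall>\<^sub>F k in sequentially. \<forall>a z. c \<le> a \<and> a \<le> c * exp d0 \<longrightarrow> b * sqrt (real k) \<le> (\<integral>x. \<bar>real x - z\<bar> \<partial>walk k a)"
    using walk_spread[of c "c * exp d0"] c d0 by blast
  have "\<forall>\<^sub>F k in sequentially. \<forall>d n N m z. cond d n N m k \<longrightarrow>
    b * sqrt (real k) - (2 * K * real k * d + 3 * err d n) \<le> (\<integral>w. \<bar>Hinc w N m k - z\<bar> \<partial>ilaw (c\<^sup>2) (N + k) m)"
    using b(2)
  proof eventually_elim
    case (elim k)
    show ?case
    proof (intro allI impI)
      fix d n N m z assume cd: "cond d n N m k"
      have d: "0 < d" "d \<le> d0" using cd by (auto simp: cond_def)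
      then have ud: "\<bar>d\<bar> \<le> d0" by auto
      let ?M = "blaw c d d (Suc N + k) (Suc m)"
      let ?H = "\<lambda>s. Hinc (bulk s) N m k" and ?U = "\<lambda>s. Hinc s (Suc N) (Suc m) k"
      have law: "map_pmf (\<lambda>s. lp s (Suc N + k) (Suc m) - lp s (Suc N) (Suc m)) ?M = walk k (c * exp d)"
        by (rule walk_law) (use c lt1[OF ud] in auto)
      have "b * sqrt (real k) \<le> (\<integral>x. \<bar>real x - z\<bar> \<partial>walk k (c * exp d))" using elim c d by simp
      also have "\<dots> = (\<integral>s. \<bar>?U s - z\<bar> \<partial>?M)"
        unfolding law[symmetric] integral_map_pmf Hinc_def
        by (intro Bochner_Integration.integral_cong refl) (use lp_mono_endpoint[of "Suc N" "Suc N + k" _ "Suc m"] in \<open>simp add: of_nat_diff del: lp.simps\<close>)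
      also have "\<dots> \<le> (\<integral>s. \<bar>?H s - z\<bar> + \<bar>?U s - ?H s\<bar> \<partial>?M)"
        by (rule integral_mono) (use integrable_Hinc_bulk(1)[OF ud, of N k m] Uinc_moments(1)[OF ud, of "Suc N" k "Suc m"] in auto)
      also have "\<dots> = (\<integral>s. \<bar>?H s - z\<bar> \<partial>?M) + (\<integral>s. \<bar>?U s - ?H s\<bar> \<partial>?M)"
        by (rule Bochner_Integration.integral_add) (use integrable_Hinc_bulk(1)[OF ud, of N k m] Uinc_moments(1)[OF ud, of "Suc N" k "Suc m"] in auto)
      also have "(\<integral>s. \<bar>?H s - z\<bar> \<partial>?M) = (\<integral>w. \<bar>Hinc w N m k - z\<bar> \<partial>ilaw (c\<^sup>2) (N + k) m)"
        using Hinc_ilaw(1)[where f = "\<lambda>x. \<bar>x - z\<bar>" and N = N and k = k and m = m and u = d and v = d] by simp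
      finally show "b * sqrt (real k) - (2 * K * real k * d + 3 * err d n) \<le> (\<integral>w. \<bar>Hinc w N m k - z\<bar> \<partial>ilaw (c\<^sup>2) (N + k) m)"
        using Hinc_close(1)[OF cd] by linarith
    qed
  qed
  with b(1) show ?thesis by blast
qed

text \<open>Both the increment seen from the corner of the large box and the one seen from the corner
  \<open>(x, y)\<close> lie just below the same stationary increment: by the Burke property the stationary field
  restricts to a stationary field on the small box.\<close>

lemma Hinc_localize:
  assumes cd: "cond d n (x + N) (y + m) k" "cond d n' N m k"
  shows "(\<integral>w. \<bar>Hinc w (x + N) (y + m) k - Hinc (sh x y w) N m k\<bar> \<partial>ilaw (c\<^sup>2) (x + N + k) (y + m)) \<le>
     4 * K * real k * d + 3 * err d n + 3 * err d n'"
    "integrable (ilaw (c\<^sup>2) (x + N + k) (y + m)) (\<lambda>w. \<bar>Hinc w (x + N) (y + m) k - Hinc (sh x y w) N m k\<bar>)"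
proof -
  have d: "0 < d" "d \<le> d0" using cd by (auto simp: cond_def)
  then have ud: "\<bar>d\<bar> \<le> d0" by auto
  let ?M = "blaw c d d (Suc (x + N) + k) (Suc (y + m))"
  let ?M' = "blaw c d d (Suc N + k) (Suc m)"
  let ?H = "\<lambda>s. Hinc (bulk s) (x + N) (y + m) k" and ?U = "\<lambda>s. Hinc s (Suc (x + N)) (Suc (y + m)) k"
  let ?H' = "\<lambda>s. Hinc (bulk s) N m k" and ?U' = "\<lambda>s. Hinc s (Suc N) (Suc m) k"
  obtain g where g: "map_pmf g (blaw c d d (x + (Suc N + k)) (y + Suc m)) = ?M'" "burke_map x y (Suc N + k) (Suc m) g"
    using burke[of c d x "Suc N + k" y "Suc m"] c lt1[OF ud] by auto
  have g1: "map_pmf g ?M = ?M'" using g(1) by (simp add: add.assoc)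
  have gU: "?U' (g s) = ?U s" "?H' (g s) = Hinc (sh x y (bulk s)) N m k" if s: "s \<in> set_pmf ?M" for s
  proof -
    note D = burke_mapD[where s = s, OF g(2) set_blaw_origin[OF s]]
    show "?U' (g s) = ?U s"
      using D(2)[of "Suc N + k" "Suc m"] D(2)[of "Suc N" "Suc m"]
      by (simp add: Hinc_def add.assoc del: lp.simps)
    have "lp (bulk (g s)) i m = lp (sh x y (bulk s)) i m" if "i \<le> N + k" for i
      by (rule lp_cong) (use that D(3) in \<open>simp add: bulk_def sh_def add.commute\<close>)
    then show "?H' (g s) = Hinc (sh x y (bulk s)) N m k" by (simp add: Hinc_def)
  qed
  have T: "(\<integral>s. \<bar>?U s - Hinc (sh x y (bulk s)) N m k\<bar> \<partial>?M) = (\<integral>s. \<bar>?U' s - ?H' s\<bar> \<partial>?M')"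
    unfolding g1[symmetric] integral_map_pmf by (rule integral_cong_AE) (auto intro!: AE_pmfI simp: gU)
  have I: "integrable ?M (\<lambda>s. \<bar>?U s - Hinc (sh x y (bulk s)) N m k\<bar>)"
  proof -
    have "integrable ?M (\<lambda>s. \<bar>?U' (g s) - ?H' (g s)\<bar>)"
      using Hinc_close(2)[OF cd(2)] unfolding g1[symmetric] integrable_map_pmf_eq .
    then show ?thesis by (rule integrable_cong_AE_imp) (auto intro!: AE_pmfI simp: gU)
  qed
  have law: "map_pmf (\<lambda>s. \<bar>?H s - Hinc (sh x y (bulk s)) N m k\<bar>) ?M =
    map_pmf (\<lambda>w. \<bar>Hinc w (x + N) (y + m) k - Hinc (sh x y w) N m k\<bar>) (ilaw (c\<^sup>2) (x + N + k) (y + m))"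
  proof -
    have "map_pmf (\<lambda>s. (\<lambda>w. \<bar>Hinc w (x + N) (y + m) k - Hinc (sh x y w) N m k\<bar>) (bulk s)) (blaw c d d (Suc (x + N + k)) (Suc (y + m))) =
      map_pmf (\<lambda>w. \<bar>Hinc w (x + N) (y + m) k - Hinc (sh x y w) N m k\<bar>) (ilaw (c\<^sup>2) (x + N + k) (y + m))"
    proof (rule map_bulk_law)
      fix w w' :: "nat \<times> nat \<Rightarrow> nat" assume e: "\<And>i j. i \<le> x + N + k \<Longrightarrow> j \<le> y + m \<Longrightarrow> w (i, j) = w' (i, j)"
      have "lp w (x + N + k) (y + m) = lp w' (x + N + k) (y + m)" "lp w (x + N) (y + m) = lp w' (x + N) (y + m)"
        "lp (sh x y w) (N + k) m = lp (sh x y w') (N + k) m" "lp (sh x y w) N m = lp (sh x y w') N m"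
        by (rule lp_cong; use e in \<open>simp add: sh_def\<close>)+
      then show "\<bar>Hinc w (x + N) (y + m) k - Hinc (sh x y w) N m k\<bar> = \<bar>Hinc w' (x + N) (y + m) k - Hinc (sh x y w') N m k\<bar>"
        by (simp add: Hinc_def)
    qed
    then show ?thesis by simp
  qed
  have J: "integrable ?M (\<lambda>s. \<bar>?H s - Hinc (sh x y (bulk s)) N m k\<bar>)"
    by (rule Bochner_Integration.integrable_bound[OF Bochner_Integration.integrable_add[OF I Hinc_close(2)[OF cd(1)]]]) auto
  have "integrable (map_pmf (\<lambda>s. \<bar>?H s - Hinc (sh x y (bulk s)) N m k\<bar>) ?M) (\<lambda>z. z)" using J by simp
  then show "integrable (ilaw (c\<^sup>2) (x + N + k) (y + m)) (\<lambda>w. \<bar>Hinc w (x + N) (y + m) k - Hinc (sh x y w) N m k\<bar>)"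
    unfolding law by simp
  have "(\<integral>w. \<bar>Hinc w (x + N) (y + m) k - Hinc (sh x y w) N m k\<bar> \<partial>ilaw (c\<^sup>2) (x + N + k) (y + m)) =
     (\<integral>z. z \<partial>map_pmf (\<lambda>s. \<bar>?H s - Hinc (sh x y (bulk s)) N m k\<bar>) ?M)" unfolding law by simp
  also have "\<dots> = (\<integral>s. \<bar>?H s - Hinc (sh x y (bulk s)) N m k\<bar> \<partial>?M)" by simp
  also have "\<dots> \<le> (\<integral>s. \<bar>?U s - Hinc (sh x y (bulk s)) N m k\<bar> + \<bar>?U s - ?H s\<bar> \<partial>?M)"
    by (rule integral_mono[OF J]) (use I Hinc_close(2)[OF cd(1)] in auto)
  also have "\<dots> = (\<integral>s. \<bar>?U' s - ?H' s\<bar> \<partial>?M') + (\<integral>s. \<bar>?U s - ?H s\<bar> \<partial>?M)"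
    unfolding T[symmetric] by (rule Bochner_Integration.integral_add[OF I Hinc_close(2)[OF cd(1)]])
  also have "\<dots> \<le> (2 * K * real k * d + 3 * err d n') + (2 * K * real k * d + 3 * err d n)"
    by (intro add_mono Hinc_close(1) cd)
  finally show "(\<integral>w. \<bar>Hinc w (x + N) (y + m) k - Hinc (sh x y w) N m k\<bar> \<partial>ilaw (c\<^sup>2) (x + N + k) (y + m)) \<le>
     4 * K * real k * d + 3 * err d n + 3 * err d n'" by (simp add: algebra_simps)
qed

end

subsection \<open>Translates of the passage time\<close>

lemma map_ilaw_reindex:
  assumes "inj_on h ({..N} \<times> {..m})" "h ` ({..N} \<times> {..m}) \<subseteq> {..R} \<times> {..R'}"
    and "\<And>w w'. (\<And>i j. i \<le> N \<Longrightarrow> j \<le> m \<Longrightarrow> w (i, j) = w' (i, j)) \<Longrightarrow> F w = F w'"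
  shows "map_pmf (\<lambda>w. F (w \<circ> h)) (ilaw q R R') = map_pmf F (ilaw q N m)"
proof -
  have "map_pmf (\<lambda>w. F (w \<circ> h)) (ilaw q R R') = map_pmf F (Pi_pmf ({..N} \<times> {..m}) 0 ((\<lambda>_. geo q) \<circ> h))"
    unfolding ilaw_def
  proof (rule map_pmf_reindex)
    show "F w = F w'" if "\<And>b. b \<in> {..N} \<times> {..m} \<Longrightarrow> w b = w' b" for w w'
      by (rule assms(3)) (rule that, simp)
  qed (use assms(1,2) in auto)
  then show ?thesis by (simp add: ilaw_def o_def)
qed

lemma
  fixes F :: "(nat \<times> nat \<Rightarrow> nat) \<Rightarrow> real"
  assumes "inj_on h ({..N} \<times> {..m})" "h ` ({..N} \<times> {..m}) \<subseteq> {..R} \<times> {..R'}"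
    and "\<And>w w'. (\<And>i j. i \<le> N \<Longrightarrow> j \<le> m \<Longrightarrow> w (i, j) = w' (i, j)) \<Longrightarrow> F w = F w'"
  shows integral_ilaw_reindex: "(\<integral>w. F (w \<circ> h) \<partial>ilaw q R R') = (\<integral>w. F w \<partial>ilaw q N m)"
    and integrable_ilaw_reindex: "integrable (ilaw q R R') (\<lambda>w. F (w \<circ> h)) \<longleftrightarrow> integrable (ilaw q N m) F"
proof -
  note L = map_ilaw_reindex[where F = F and q = q, OF assms]
  have "(\<integral>w. F (w \<circ> h) \<partial>ilaw q R R') = (\<integral>x. x \<partial>map_pmf (\<lambda>w. F (w \<circ> h)) (ilaw q R R'))" by simp
  also have "\<dots> = (\<integral>w. F w \<partial>ilaw q N m)"
    using arg_cong[where f = "\<lambda>M. \<integral>x. x \<partial>measure_pmf M", OF L] by simp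
  finally show "(\<integral>w. F (w \<circ> h) \<partial>ilaw q R R') = \<dots>" .
  have "integrable (ilaw q R R') (\<lambda>w. F (w \<circ> h)) \<longleftrightarrow> integrable (map_pmf (\<lambda>w. F (w \<circ> h)) (ilaw q R R')) (\<lambda>x. x)"
    by simp
  also have "\<dots> \<longleftrightarrow> integrable (ilaw q N m) F"
    using arg_cong[where f = "\<lambda>M. integrable (measure_pmf M) (\<lambda>x. x)", OF L] by simp
  finally show "integrable (ilaw q R R') (\<lambda>w. F (w \<circ> h)) \<longleftrightarrow> \<dots>" .
qed

lemma sh_conv_comp: "sh x y w = w \<circ> (\<lambda>(i, j). (i + x, j + y))"
  by (auto simp: sh_def fun_eq_iff)

lemma rot_conv_comp: "rot x y w = w \<circ> (\<lambda>(i, j). (x - i, y - j))"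
  by (auto simp: rot_def fun_eq_iff)

lemma Hinc_cong:
  assumes "\<And>i j. i \<le> N + k \<Longrightarrow> j \<le> m \<Longrightarrow> w (i, j) = w' (i, j)"
  shows "Hinc w N m k = Hinc w' N m k"
proof -
  have "lp w (N + k) m = lp w' (N + k) m" "lp w N m = lp w' N m" by (rule lp_cong; use assms in simp)+
  then show ?thesis by (simp add: Hinc_def)
qed

text \<open>A translate of the passage time differs from the original one by an increment at its end and
  an increment at its start, and the latter becomes an increment at the end after rotation.\<close>

lemma translate_diff:
  assumes "k \<le> n"
  shows "real (lp (sh k 0 w) n n) - real (lp w n n) = Hinc (sh k 0 w) (n - k) n k - Hinc (rot n n w) (n - k) n k"
proof -
  have "lp (sh k 0 w) (n - k) n = lp (rot (n - k) n (sh k 0 w)) (n - k) n" by (rule lp_rot[symmetric])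
  also have "\<dots> = lp (rot n n w) (n - k) n"
    by (rule lp_cong) (use assms in \<open>auto simp: rot_def sh_def\<close>)
  finally have 1: "lp (sh k 0 w) (n - k) n = lp (rot n n w) (n - k) n" .
  have 2: "lp (rot n n w) n n = lp w n n" by (rule lp_rot)
  show ?thesis unfolding Hinc_def using assms 1 2 by simp
qed

text \<open>Given the first component, the value of \<open>f\<close> is a constant, and the last
  hypothesis applies to every constant.\<close>

lemma pair_lower_bound:
  fixes f :: "'a \<Rightarrow> real" and g :: "'b \<Rightarrow> real"
  assumes "integrable (measure_pmf A) f" "integrable (measure_pmf B) g" "\<And>z. b \<le> (\<integral>y. \<bar>g y - z\<bar> \<partial>B)"
  shows "b \<le> (\<integral>z. \<bar>g (snd z) - f (fst z)\<bar> \<partial>pair_pmf A B)"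
proof -
  have "integrable (pair_pmf A B) (\<lambda>z. f (fst z) * 1)" "integrable (pair_pmf A B) (\<lambda>z. 1 * g (snd z))"
    by (rule integrable_pair_pmf_mult; use assms in simp)+
  then have i: "integrable (pair_pmf A B) (\<lambda>z. \<bar>g (snd z) - f (fst z)\<bar>)" by auto
  have "b = (\<integral>x. b \<partial>A)" by simp
  also have "\<dots> \<le> (\<integral>x. (\<integral>y. \<bar>g (snd (x, y)) - f (fst (x, y))\<bar> \<partial>B) \<partial>A)"
    by (rule integral_mono) (use integrable_pair_pmf[OF i] assms(3) in auto)
  also have "\<dots> = (\<integral>z. \<bar>g (snd z) - f (fst z)\<bar> \<partial>pair_pmf A B)" by (rule integral_pair_pmf[OF i, symmetric])
  finally show ?thesis .
qed

context sandwich
begin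

abbreviation "q \<equiv> c\<^sup>2"

text \<open>By \<open>translate_diff\<close> the quantity is a difference of two increments. Shift
  and rotation both pull the i.i.d. field back to an i.i.d. field on the smaller box, so each
  increment obeys the same second moment bound.\<close>

lemma translate_second_moment:
  assumes cd: "cond d \<nu> (n - k) n k" and k: "k \<le> n"
  shows "(\<integral>w. (real (lp (sh k 0 w) n n) - real (lp w n n))\<^sup>2 \<partial>ilaw q (n + k) n) \<le>
     4 * (8 * K * real k + 8 * (K * real k * d)\<^sup>2 + 4 * err d \<nu>)"
    and "integrable (ilaw q (n + k) n) (\<lambda>w. (real (lp (sh k 0 w) n n) - real (lp w n n))\<^sup>2)"
proof -
  define \<mu> where "\<mu> = real k * gmean c 0"
  let ?I = "ilaw q (n + k) n"
  let ?F = "\<lambda>w. (Hinc w (n - k) n k - \<mu>)\<^sup>2"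
  have dep: "?F w = ?F w'" if "\<And>i j. i \<le> n \<Longrightarrow> j \<le> n \<Longrightarrow> w (i, j) = w' (i, j)" for w w'
    using Hinc_cong[of "n - k" k n w w'] that k by auto
  have i: "integrable (ilaw q n n) ?F" and b: "(\<integral>w. ?F w \<partial>ilaw q n n) \<le> 8 * K * real k + 8 * (K * real k * d)\<^sup>2 + 4 * err d \<nu>"
    using Hinc_second_moment[OF cd] k by (auto simp: \<mu>_def)
  have 1: "inj_on (\<lambda>(i, j). (i + k, j + 0)) ({..n} \<times> {..n})" "(\<lambda>(i, j). (i + k, j + 0)) ` ({..n} \<times> {..n}) \<subseteq> {..n + k} \<times> {..n}"
    by (auto simp: inj_on_def)
  have 2: "inj_on (\<lambda>(i, j). (n - i, n - j)) ({..n} \<times> {..n})" "(\<lambda>(i, j). (n - i, n - j)) ` ({..n} \<times> {..n}) \<subseteq> {..n + k} \<times> {..n}"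
    by (auto simp: inj_on_def)
  have s1: "(\<integral>w. ?F (sh k 0 w) \<partial>?I) = (\<integral>w. ?F w \<partial>ilaw q n n)" "integrable ?I (\<lambda>w. ?F (sh k 0 w))"
    unfolding sh_conv_comp using integral_ilaw_reindex[where F = ?F, OF 1 dep] integrable_ilaw_reindex[where F = ?F, OF 1 dep] i by auto
  have s2: "(\<integral>w. ?F (rot n n w) \<partial>?I) = (\<integral>w. ?F w \<partial>ilaw q n n)" "integrable ?I (\<lambda>w. ?F (rot n n w))"
    unfolding rot_conv_comp using integral_ilaw_reindex[where F = ?F, OF 2 dep] integrable_ilaw_reindex[where F = ?F, OF 2 dep] i by auto
  have pt: "(real (lp (sh k 0 w) n n) - real (lp w n n))\<^sup>2 \<le> 2 * ?F (sh k 0 w) + 2 * ?F (rot n n w)" for w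
  proof -
    have "(a - b)\<^sup>2 \<le> 2 * (a - e)\<^sup>2 + 2 * (b - e)\<^sup>2" for a b e :: real
    proof -
      have "2 * (a - e)\<^sup>2 + 2 * (b - e)\<^sup>2 - (a - b)\<^sup>2 = (a - 2 * e + b)\<^sup>2" by (simp add: power2_eq_square algebra_simps)
      then show ?thesis by (smt (verit) zero_le_power2)
    qed
    then show ?thesis unfolding translate_diff[OF k] .
  qed
  show j: "integrable ?I (\<lambda>w. (real (lp (sh k 0 w) n n) - real (lp w n n))\<^sup>2)"
  proof (rule Bochner_Integration.integrable_bound)
    show "integrable ?I (\<lambda>w. 2 * ?F (sh k 0 w) + 2 * ?F (rot n n w))" using s1 s2 by simp
    show "AE w in ?I. norm ((real (lp (sh k 0 w) n n) - real (lp w n n))\<^sup>2) \<le> norm (2 * ?F (sh k 0 w) + 2 * ?F (rot n n w))"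
      using pt by (intro AE_pmfI) auto
  qed simp
  have "(\<integral>w. (real (lp (sh k 0 w) n n) - real (lp w n n))\<^sup>2 \<partial>?I) \<le> (\<integral>w. 2 * ?F (sh k 0 w) + 2 * ?F (rot n n w) \<partial>?I)"
    by (rule integral_mono[OF j _ pt]) (use s1 s2 in simp)
  also have "\<dots> = 4 * (\<integral>w. ?F w \<partial>ilaw q n n)" using s1 s2 by simp
  finally show "(\<integral>w. (real (lp (sh k 0 w) n n) - real (lp w n n))\<^sup>2 \<partial>?I) \<le>
     4 * (8 * K * real k + 8 * (K * real k * d)\<^sup>2 + 4 * err d \<nu>)" using b by simp
qed

text \<open>The two increments of the preceding decomposition are, up to a small error, functions of disjoint
  sets of rows, hence independent.\<close>

lemma translate_spread:
  assumes k: "k + y \<le> n" "k + y' \<le> n" "n < y + y'" "y \<le> n" "y' \<le> n"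
    and cd: "cond d \<nu> (n - k) n k" "cond d \<nu> (n - k - y) (n - y) k" "cond d \<nu> (n - k - y') (n - y') k"
    and b: "\<And>z. b \<le> (\<integral>w. \<bar>Hinc w (n - k - y) (n - y) k - z\<bar> \<partial>ilaw q (n - k - y + k) (n - y))"
  shows "b - 2 * (4 * K * real k * d + 6 * err d \<nu>) \<le>
    (\<integral>w. \<bar>real (lp (sh k 0 w) n n) - real (lp w n n)\<bar> \<partial>ilaw q (n + k) n)"
proof -
  let ?I = "ilaw q (n + k) n"
  let ?D = "\<lambda>y w. \<bar>Hinc w (n - k) n k - Hinc (sh y y w) (n - k - y) (n - y) k\<bar>"
  have D: "(\<integral>w. ?D z w \<partial>ilaw q n n) \<le> 4 * K * real k * d + 6 * err d \<nu>" "integrable (ilaw q n n) (?D z)"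
    if "cond d \<nu> (n - k - z) (n - z) k" "k + z \<le> n" for z
    using Hinc_localize[of d \<nu> z "n - k - z" z "n - z" k \<nu>] cd(1) that by auto
  have dep: "?D z w = ?D z w'" if "\<And>i j. i \<le> n \<Longrightarrow> j \<le> n \<Longrightarrow> w (i, j) = w' (i, j)" "k + z \<le> n" for w w' z
  proof -
    have "Hinc w (n - k) n k = Hinc w' (n - k) n k" by (rule Hinc_cong) (use that in auto)
    moreover have "Hinc (sh z z w) (n - k - z) (n - z) k = Hinc (sh z z w') (n - k - z) (n - z) k"
      by (rule Hinc_cong) (use that in \<open>auto simp: sh_def\<close>)
    ultimately show ?thesis by simp
  qed
  have 1: "inj_on (\<lambda>(i, j). (i + k, j + 0)) ({..n} \<times> {..n})" "(\<lambda>(i, j). (i + k, j + 0)) ` ({..n} \<times> {..n}) \<subseteq> {..n + k} \<times> {..n}"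
    by (auto simp: inj_on_def)
  have 2: "inj_on (\<lambda>(i, j). (n - i, n - j)) ({..n} \<times> {..n})" "(\<lambda>(i, j). (n - i, n - j)) ` ({..n} \<times> {..n}) \<subseteq> {..n + k} \<times> {..n}"
    by (auto simp: inj_on_def)
  have s1: "(\<integral>w. ?D y (sh k 0 w) \<partial>?I) \<le> 4 * K * real k * d + 6 * err d \<nu>" "integrable ?I (\<lambda>w. ?D y (sh k 0 w))"
    unfolding sh_conv_comp[of k 0] using integral_ilaw_reindex[where F = "?D y" and q = q, OF 1 dep] k(1)
      integrable_ilaw_reindex[where F = "?D y" and q = q, OF 1 dep] D[OF cd(2) k(1)] by auto
  have s2: "(\<integral>w. ?D y' (rot n n w) \<partial>?I) \<le> 4 * K * real k * d + 6 * err d \<nu>" "integrable ?I (\<lambda>w. ?D y' (rot n n w))"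
    unfolding rot_conv_comp using integral_ilaw_reindex[where F = "?D y'" and q = q, OF 2 dep] k(2)
      integrable_ilaw_reindex[where F = "?D y'" and q = q, OF 2 dep] D[OF cd(3) k(2)] by auto
  define P where "P = (\<lambda>w. Hinc (sh y y (sh k 0 w)) (n - k - y) (n - y) k)"
  define Q where "Q = (\<lambda>w. Hinc (sh y' y' (rot n n w)) (n - k - y') (n - y') k)"
  \<comment> \<open>The localized increment \<open>P\<close> reads rows from \<open>y\<close>
    upwards, and \<open>Q\<close>, after the rotation, rows up to n - y'. These are disjoint because
    n < y + y'.\<close>
  define A where "A = {..n + k} \<times> {..<y}"
  define B where "B = {..n + k} \<times> {y..n}"
  have AB: "finite A" "finite B" "A \<inter> B = {}" "A \<union> B = {..n + k} \<times> {..n}" using k by (auto simp: A_def B_def)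
  have depP: "P w = P w'" if "\<And>x. x \<in> B \<Longrightarrow> w x = w' x" for w w'
    unfolding P_def
  proof (rule Hinc_cong)
    fix i j assume "i \<le> n - k - y + k" "j \<le> n - y"
    then have "w (i + y + k, j + y) = w' (i + y + k, j + y)" using k by (intro that) (auto simp: B_def)
    then show "sh y y (sh k 0 w) (i, j) = sh y y (sh k 0 w') (i, j)" by (simp add: sh_def)
  qed
  have depQ: "Q w = Q w'" if "\<And>x. x \<in> A \<Longrightarrow> w x = w' x" for w w'
    unfolding Q_def
  proof (rule Hinc_cong)
    fix i j assume "i \<le> n - k - y' + k" "j \<le> n - y'"
    then have "w (n - (i + y'), n - (j + y')) = w' (n - (i + y'), n - (j + y'))" using k by (intro that) (auto simp: A_def)
    then show "sh y' y' (rot n n w) (i, j) = sh y' y' (rot n n w') (i, j)" by (simp add: sh_def rot_def)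
  qed
  let ?PA = "Pi_pmf A 0 (\<lambda>_. geo q)" and ?PB = "Pi_pmf B 0 (\<lambda>_. geo q)"
  have law: "?I = map_pmf (\<lambda>z x. if x \<in> A then fst z x else snd z x) (pair_pmf ?PA ?PB)"
    unfolding ilaw_def AB(4)[symmetric] by (subst Pi_pmf_union[OF AB(1-3)]) (simp add: case_prod_unfold)
  have ev: "P (\<lambda>x. if x \<in> A then fst z x else snd z x) = P (snd z)" "Q (\<lambda>x. if x \<in> A then fst z x else snd z x) = Q (fst z)" for z
    by (rule depP depQ; use AB in auto)+
  have mP: "map_pmf P ?PB = map_pmf (\<lambda>w. Hinc w (n - k - y) (n - y) k) (ilaw q (n - k - y + k) (n - y))"
  proof -
    have "P = (\<lambda>w. (\<lambda>w. Hinc w (n - k - y) (n - y) k) (w \<circ> (\<lambda>(i, j). (i + y + k, j + y))))"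
      unfolding P_def by (intro ext Hinc_cong) (auto simp: sh_def)
    moreover have "map_pmf (\<lambda>w. (\<lambda>w. Hinc w (n - k - y) (n - y) k) (w \<circ> (\<lambda>(i, j). (i + y + k, j + y)))) ?PB =
       map_pmf (\<lambda>w. Hinc w (n - k - y) (n - y) k) (Pi_pmf ({..n - k - y + k} \<times> {..n - y}) 0 ((\<lambda>_. geo q) \<circ> (\<lambda>(i, j). (i + y + k, j + y))))"
    proof (rule map_pmf_reindex)
      show "Hinc w (n - k - y) (n - y) k = Hinc w' (n - k - y) (n - y) k"
        if "\<And>b. b \<in> {..n - k - y + k} \<times> {..n - y} \<Longrightarrow> w b = w' b" for w w'
        by (rule Hinc_cong) (rule that, simp)
      show "(\<lambda>(i, j). (i + y + k, j + y)) ` ({..n - k - y + k} \<times> {..n - y}) \<subseteq> B"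
        using k by (auto simp: B_def)
    qed (simp_all add: AB(2) inj_on_def)
    ultimately show ?thesis by (simp add: ilaw_def o_def)
  qed
  have mean: "integrable ?I P" "integrable ?I Q"
  proof -
    have h1: "integrable (ilaw q n n) (\<lambda>w. (Hinc w (n - k) n k - 0)\<^sup>2)" using Hinc_second_moment(2)[OF cd(1), of 0] k by simp
    have h2: "integrable (ilaw q n n) (\<lambda>w. Hinc w (n - k) n k)"
      using measure_pmf.square_integrable_imp_integrable[of "\<lambda>w. Hinc w (n - k) n k" "ilaw q n n"] h1 by simp
    have dH: "Hinc w (n - k) n k = Hinc w' (n - k) n k" if "\<And>i j. i \<le> n \<Longrightarrow> j \<le> n \<Longrightarrow> w (i, j) = w' (i, j)" for w w'
      by (rule Hinc_cong) (use that k in auto)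
    have h3: "integrable ?I (\<lambda>w. Hinc (sh k 0 w) (n - k) n k)"
      unfolding sh_conv_comp[of k 0]
      using integrable_ilaw_reindex[where F = "\<lambda>w. Hinc w (n - k) n k" and q = q, OF 1 dH] h2 by simp
    have h4: "integrable ?I (\<lambda>w. Hinc (rot n n w) (n - k) n k)"
      unfolding rot_conv_comp
      using integrable_ilaw_reindex[where F = "\<lambda>w. Hinc w (n - k) n k" and q = q, OF 2 dH] h2 by simp
    have "integrable ?I (\<lambda>w. \<bar>Hinc (sh k 0 w) (n - k) n k\<bar> + ?D y (sh k 0 w))" using h3 s1(2) by auto
    then show "integrable ?I P"
    proof (rule Bochner_Integration.integrable_bound)
      show "AE w in ?I. norm (P w) \<le> norm (\<bar>Hinc (sh k 0 w) (n - k) n k\<bar> + ?D y (sh k 0 w))"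
        unfolding P_def real_norm_def by (intro AE_pmfI) linarith
    qed simp
    have "integrable ?I (\<lambda>w. \<bar>Hinc (rot n n w) (n - k) n k\<bar> + ?D y' (rot n n w))" using h4 s2(2) by auto
    then show "integrable ?I Q"
    proof (rule Bochner_Integration.integrable_bound)
      show "AE w in ?I. norm (Q w) \<le> norm (\<bar>Hinc (rot n n w) (n - k) n k\<bar> + ?D y' (rot n n w))"
        unfolding Q_def real_norm_def by (intro AE_pmfI) linarith
    qed simp
  qed
  have iPQ: "integrable ?PB P" "integrable ?PA Q"
  proof -
    have "map_pmf snd (pair_pmf ?PA ?PB) = ?PB" "map_pmf fst (pair_pmf ?PA ?PB) = ?PA"
      by (simp_all add: map_snd_pair_pmf map_fst_pair_pmf)
    moreover have "integrable (map_pmf snd (pair_pmf ?PA ?PB)) P" "integrable (map_pmf fst (pair_pmf ?PA ?PB)) Q"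
      using mean unfolding law integrable_map_pmf_eq ev by simp_all
    ultimately show "integrable ?PB P" "integrable ?PA Q" by simp_all
  qed
  have "b \<le> (\<integral>z. \<bar>P (snd z) - Q (fst z)\<bar> \<partial>pair_pmf ?PA ?PB)"
  proof (rule pair_lower_bound[OF iPQ(2,1)])
    fix z
    have "(\<integral>w. \<bar>P w - z\<bar> \<partial>?PB) = (\<integral>x. \<bar>x - z\<bar> \<partial>map_pmf P ?PB)" by simp
    also have "\<dots> = (\<integral>w. \<bar>Hinc w (n - k - y) (n - y) k - z\<bar> \<partial>ilaw q (n - k - y + k) (n - y))" unfolding mP by simp
    finally show "b \<le> (\<integral>w. \<bar>P w - z\<bar> \<partial>?PB)" using b by simp
  qed
  also have "\<dots> = (\<integral>w. \<bar>P w - Q w\<bar> \<partial>?I)" unfolding law integral_map_pmf ev ..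
  also have "\<dots> \<le> (\<integral>w. \<bar>real (lp (sh k 0 w) n n) - real (lp w n n)\<bar> + ?D y (sh k 0 w) + ?D y' (rot n n w) \<partial>?I)"
  proof (rule integral_mono)
    show "integrable ?I (\<lambda>w. \<bar>P w - Q w\<bar>)" using mean by auto
    have "integrable ?I (\<lambda>w. real (lp (sh k 0 w) n n) - real (lp w n n))"
    proof (rule measure_pmf.square_integrable_imp_integrable)
      show "integrable ?I (\<lambda>w. (real (lp (sh k 0 w) n n) - real (lp w n n))\<^sup>2)"
        by (rule translate_second_moment(2)[OF cd(1)]) (use k in simp)
    qed simp
    then show "integrable ?I (\<lambda>w. \<bar>real (lp (sh k 0 w) n n) - real (lp w n n)\<bar> + ?D y (sh k 0 w) + ?D y' (rot n n w))"
      using s1(2) s2(2) by auto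
    show "\<bar>P w - Q w\<bar> \<le> \<bar>real (lp (sh k 0 w) n n) - real (lp w n n)\<bar> + ?D y (sh k 0 w) + ?D y' (rot n n w)" for w
    proof -
      have "k \<le> n" using k by simp
      have abs4: "\<bar>a - b\<bar> \<le> \<bar>t\<bar> + \<bar>h - a\<bar> + \<bar>r - b\<bar>" if "t = h - r" for a b t h r :: real using that by linarith
      show ?thesis unfolding P_def Q_def by (rule abs4[OF translate_diff[OF \<open>k \<le> n\<close>, of w]])
    qed
  qed
  also have "\<dots> = (\<integral>w. \<bar>real (lp (sh k 0 w) n n) - real (lp w n n)\<bar> \<partial>?I) + (\<integral>w. ?D y (sh k 0 w) \<partial>?I) + (\<integral>w. ?D y' (rot n n w) \<partial>?I)"
  proof -
    have "integrable ?I (\<lambda>w. real (lp (sh k 0 w) n n) - real (lp w n n))"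
    proof (rule measure_pmf.square_integrable_imp_integrable)
      show "integrable ?I (\<lambda>w. (real (lp (sh k 0 w) n n) - real (lp w n n))\<^sup>2)"
        by (rule translate_second_moment(2)[OF cd(1)]) (use k in simp)
    qed simp
    then have i0: "integrable ?I (\<lambda>w. \<bar>real (lp (sh k 0 w) n n) - real (lp w n n)\<bar>)" by (rule integrable_abs)
    show ?thesis
      unfolding Bochner_Integration.integral_add[OF Bochner_Integration.integrable_add[OF i0 s1(2)] s2(2)]
        Bochner_Integration.integral_add[OF i0 s1(2)] ..
  qed
  finally have f: "b \<le> (\<integral>w. \<bar>real (lp (sh k 0 w) n n) - real (lp w n n)\<bar> \<partial>?I) + (\<integral>w. ?D y (sh k 0 w) \<partial>?I) + (\<integral>w. ?D y' (rot n n w) \<partial>?I)" .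
  have "b' - 2 * t \<le> x" if "b' \<le> x + u + v" "u \<le> t" "v \<le> t" for b' x u v t :: real
    using that by simp
  from this[OF f s1(1) s2(1)] show ?thesis .
qed

end

section \<open>Integrability, translation invariance and the variance\<close>

lemma integrable_ilaw:
  fixes f :: "(nat \<times> nat \<Rightarrow> nat) \<Rightarrow> real"
  assumes q: "0 < q" "q < 1" and f: "\<And>w. \<bar>f w\<bar> \<le> C * (1 + (\<Sum>x\<in>{..N} \<times> {..m}. real (w x)) ^ 4)"
  shows "integrable (ilaw q N m) f"
proof -
  obtain K where K: "\<And>(A :: (nat \<times> nat) set) r. finite A \<Longrightarrow> (\<forall>x\<in>A. 0 \<le> r x \<and> r x \<le> q) \<Longrightarrow>
    integrable (Pi_pmf A 0 (\<lambda>x. geo (r x))) (\<lambda>s. (\<Sum>x\<in>A. real (s x)) ^ 4) \<and>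
    (\<integral>s. (\<Sum>x\<in>A. real (s x)) ^ 4 \<partial>Pi_pmf A 0 (\<lambda>x. geo (r x))) \<le> K * real (card A) ^ 4"
    using Pi_geo_moment4[OF q] by metis
  have "integrable (ilaw q N m) (\<lambda>w. (\<Sum>x\<in>{..N} \<times> {..m}. real (w x)) ^ 4)"
    unfolding ilaw_def using K[of "{..N} \<times> {..m}" "\<lambda>_. q"] q by simp
  then show ?thesis
  proof (rule integrable_pow4_bound[where S = "\<lambda>w. \<Sum>x\<in>{..N} \<times> {..m}. real (w x)" and C = C])
    show "\<bar>f w\<bar> \<le> C * (1 + (\<Sum>x\<in>{..N} \<times> {..m}. real (w x)) ^ 4)" for w by (rule f)
  qed
qed

lemma lp_sh_le_sum:
  assumes "a + i \<le> N" "b + j \<le> m"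
  shows "real (lp (sh a b w) i j) \<le> (\<Sum>x\<in>{..N} \<times> {..m}. real (w x))"
proof -
  have "lp (sh a b w) i j \<le> sum (sh a b w) ({..i} \<times> {..j})" by (rule lp_le_sum)
  also have "\<dots> = sum w ((\<lambda>(i, j). (i + a, j + b)) ` ({..i} \<times> {..j}))"
    by (subst sum.reindex) (auto simp: inj_on_def sh_conv_comp)
  also have "\<dots> \<le> sum w ({..N} \<times> {..m})" using assms by (intro sum_mono2) auto
  finally show ?thesis by (simp flip: of_nat_sum)
qed

lemma power_le_one_plus_pow4: "x ^ e \<le> 1 + x ^ 4" if "0 \<le> x" "e \<le> 4" for x :: real
proof (cases "x \<le> 1")
  case True
  then have "x ^ e \<le> 1" using that by (simp add: power_le_one)
  moreover have "0 \<le> x ^ 4" using that by simp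
  ultimately show ?thesis by linarith
next
  case False
  then have "x ^ e \<le> x ^ 4" using that by (intro power_increasing) auto
  then show ?thesis by linarith
qed

lemma integrable_lp:
  assumes q: "0 < q" "q < 1" and "a + i \<le> N" "b + j \<le> m"
  shows "integrable (ilaw q N m) (\<lambda>w. (real (lp (sh a b w) i j))\<^sup>2)" "integrable (ilaw q N m) (\<lambda>w. real (lp (sh a b w) i j))"
proof -
  let ?S = "\<lambda>w. \<Sum>x\<in>{..N} \<times> {..m}. real (w x)"
  have le: "real (lp (sh a b w) i j) \<le> ?S w" for w using assms(3,4) by (rule lp_sh_le_sum)
  show i: "integrable (ilaw q N m) (\<lambda>w. (real (lp (sh a b w) i j))\<^sup>2)"
  proof (rule integrable_ilaw[OF q, of _ 1])
    fix w
    have "(real (lp (sh a b w) i j))\<^sup>2 \<le> (?S w)\<^sup>2" using le by (intro power_mono) auto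
    moreover have "(?S w)\<^sup>2 \<le> 1 + ?S w ^ 4" by (rule power_le_one_plus_pow4) (auto intro: sum_nonneg)
    ultimately show "\<bar>(real (lp (sh a b w) i j))\<^sup>2\<bar> \<le> 1 * (1 + (?S w) ^ 4)" unfolding abs_power2 mult_1 by (rule order_trans)
  qed
  show "integrable (ilaw q N m) (\<lambda>w. real (lp (sh a b w) i j))"
    by (rule measure_pmf.square_integrable_imp_integrable) (use i in auto)
qed

lemma sh_0 [simp]: "sh 0 0 w = w" by (simp add: sh_def)

lemma ilaw_translate:
  assumes "a + n \<le> N" "b + n \<le> m"
  shows "(\<integral>w. f (real (lp (sh a b w) n n)) \<partial>ilaw q N m) = (\<integral>w. (f (real (lp w n n)) :: real) \<partial>ilaw q n n)"
proof -
  have "(\<integral>w. (\<lambda>w. f (real (lp w n n))) (w \<circ> (\<lambda>(i, j). (i + a, j + b))) \<partial>ilaw q N m) = (\<integral>w. f (real (lp w n n)) \<partial>ilaw q n n)"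
  proof (rule integral_ilaw_reindex)
    show "f (real (lp w n n)) = f (real (lp w' n n))" if "\<And>i j. i \<le> n \<Longrightarrow> j \<le> n \<Longrightarrow> w (i, j) = w' (i, j)" for w w'
      using lp_cong[of n n w w'] that by simp
  qed (use assms in \<open>auto simp: inj_on_def\<close>)
  then show ?thesis by (simp add: sh_conv_comp)
qed

definition lpvar :: "real \<Rightarrow> nat \<Rightarrow> real" where
  "lpvar q n = (\<integral>w. (real (lp w n n) - (\<integral>w. real (lp w n n) \<partial>ilaw q n n))\<^sup>2 \<partial>ilaw q n n)"

text \<open>Both passage times have the same law, so their L2 distance is at most twice the standard
  deviation, whatever their dependence.\<close>

lemma translate_le_lpvar:
  assumes q: "0 < q" "q < 1"
  shows "(\<integral>w. \<bar>real (lp (sh k 0 w) n n) - real (lp w n n)\<bar> \<partial>ilaw q (n + k) n)\<^sup>2 \<le> 4 * lpvar q n"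
proof -
  let ?I = "ilaw q (n + k) n" and ?T = "\<lambda>w. real (lp w n n)"
  define m where "m = (\<integral>w. real (lp w n n) \<partial>ilaw q n n)"
  define z where "z = (\<integral>w. \<bar>?T (sh k 0 w) - ?T w\<bar> \<partial>?I)"
  note i1 = integrable_lp[OF q, of k n "n + k" 0 n n] and i2 = integrable_lp[OF q, of 0 n "n + k" 0 n n]
  have j1: "integrable ?I (\<lambda>w. (?T (sh k 0 w) - m)\<^sup>2)" and j2: "integrable ?I (\<lambda>w. (?T w - m)\<^sup>2)"
    unfolding power2_diff using i1 i2 by simp_all
  have e: "(\<integral>w. (?T (sh k 0 w) - m)\<^sup>2 \<partial>?I) = lpvar q n" "(\<integral>w. (?T w - m)\<^sup>2 \<partial>?I) = lpvar q n"
    using ilaw_translate[where a = k and n = n and N = "n + k" and b = 0 and m = n and f = "\<lambda>x. (x - m)\<^sup>2" and q = q]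
    ilaw_translate[where a = 0 and n = n and N = "n + k" and b = 0 and m = n and f = "\<lambda>x. (x - m)\<^sup>2" and q = q]
    by (simp_all add: lpvar_def m_def)
  have iz: "integrable ?I (\<lambda>w. \<bar>?T (sh k 0 w) - ?T w\<bar>)" using i1 i2 by auto
  \<comment> \<open>For X = |a - b| the bound 2 z X - z^2 \<le> X^2, with \<open>z\<close> the mean
    of X, serves as Jensen's inequality.\<close>
  have "2 * z * z - z\<^sup>2 = (\<integral>w. 2 * z * \<bar>?T (sh k 0 w) - ?T w\<bar> - z\<^sup>2 \<partial>?I)"
    using iz by (simp add: z_def)
  also have "\<dots> \<le> (\<integral>w. 2 * (?T (sh k 0 w) - m)\<^sup>2 + 2 * (?T w - m)\<^sup>2 \<partial>?I)"
  proof (rule integral_mono)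
    show "integrable ?I (\<lambda>w. 2 * z * \<bar>?T (sh k 0 w) - ?T w\<bar> - z\<^sup>2)" using iz by simp
    show "integrable ?I (\<lambda>w. 2 * (?T (sh k 0 w) - m)\<^sup>2 + 2 * (?T w - m)\<^sup>2)" using j1 j2 by simp
    fix w
    have "2 * z * \<bar>a - b\<bar> - z\<^sup>2 \<le> 2 * (a - m)\<^sup>2 + 2 * (b - m)\<^sup>2" for a b
    proof -
      have "0 \<le> (\<bar>a - b\<bar> - z)\<^sup>2 + (a + b - 2 * m)\<^sup>2" by simp
      moreover have "\<bar>a - b\<bar>\<^sup>2 = (a - b)\<^sup>2" by simp
      ultimately show ?thesis by (simp add: power2_eq_square algebra_simps)
    qed
    then show "2 * z * \<bar>?T (sh k 0 w) - ?T w\<bar> - z\<^sup>2 \<le> 2 * (?T (sh k 0 w) - m)\<^sup>2 + 2 * (?T w - m)\<^sup>2" .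
  qed
  also have "\<dots> = 4 * lpvar q n" using j1 j2 e by simp
  finally show ?thesis by (simp add: z_def power2_eq_square)
qed

section \<open>Choice of scales\<close>

context sandwich
begin

text \<open>The exponent is slightly above -1/3, so that n d^3 = n^0.04 still tends to infinity and
  \<open>err\<close>, in spite of its factor n^8, tends to 0.\<close>

definition dn :: "nat \<Rightarrow> real" where "dn n = real n powr (- 0.32)"

lemma err_small: "(\<lambda>n. err (dn n) (real n / 3)) \<longlonglongrightarrow> 0"
proof -
  have "0 < C" using pos by simp
  then have "(\<lambda>n. (3 + K) * (5 * (real n / 3)) ^ 8 * exp (- C * (real n / 3) * (real n powr (- 0.32)) ^ 3 / 2)) \<longlonglongrightarrow> 0"
    by real_asymp
  then show ?thesis by (simp add: err_def dn_def)
qed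

text \<open>The range of \<open>k\<close> covers both uses: n^0.6 for the variance and sqrt n + 1
  for the translates. The range of \<open>y\<close> reaches just beyond the middle row.\<close>

lemma cond_eventually:
  "\<forall>\<^sub>F n in sequentially. \<forall>k y. real k \<le> 2 * real n powr 0.6 \<and> real y \<le> real n / 2 + 1 \<longrightarrow>
     k + y \<le> n \<and> cond (dn n) (real n / 3) (n - k - y) (n - y) k"
proof -
  have "0 < d0" "0 < \<kappa>" using d0 pos by auto
  have "\<forall>\<^sub>F n in sequentially. 0 < real n powr (- 0.32)" by real_asymp
  moreover have "\<forall>\<^sub>F n in sequentially. real n powr (- 0.32) \<le> d0" using \<open>0 < d0\<close> by real_asymp
  moreover have "\<forall>\<^sub>F n in sequentially. 4 * real n powr 0.6 \<le> \<kappa> * (real n / 3) * real n powr (- 0.32)"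
    using \<open>0 < \<kappa>\<close> by real_asymp
  moreover have "\<forall>\<^sub>F n in sequentially. 2 * real n powr 0.6 \<le> real n / 6 - 2" by real_asymp
  moreover have "\<forall>\<^sub>F n in sequentially. 12 \<le> real n" by real_asymp
  ultimately show ?thesis
  proof eventually_elim
    case (elim n)
    show ?case
    proof (intro allI impI)
      fix k y assume ky: "real k \<le> 2 * real n powr 0.6 \<and> real y \<le> real n / 2 + 1"
      then have "real k + real y \<le> real n" using elim by linarith
      then have le: "k + y \<le> n" by (simp flip: of_nat_add)
      have e: "real (n - k - y) = real n - real k - real y" "real (n - y) = real n - real y" using le by auto
      have "cond (dn n) (real n / 3) (n - k - y) (n - y) k"
        unfolding cond_def dn_def of_nat_Suc of_nat_add e using elim ky by (auto simp: dn_def)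
      then show "k + y \<le> n \<and> cond (dn n) (real n / 3) (n - k - y) (n - y) k" using le by simp
    qed
  qed
qed

text \<open>For \<open>k\<close> near sqrt n the bias term (k d)^2 is of order n^0.36 and is
  absorbed by the diffusive term of order k.\<close>

lemma translate_upper:
  "\<exists>B>0. \<forall>\<^sub>F n in sequentially. \<forall>k. real k \<le> sqrt (real n) + 1 \<longrightarrow>
    integrable (ilaw q (n + k) n) (\<lambda>w. (real (lp (sh k 0 w) n n) - real (lp w n n))\<^sup>2) \<and>
    (\<integral>w. (real (lp (sh k 0 w) n n) - real (lp w n n))\<^sup>2 \<partial>ilaw q (n + k) n) \<le> B * sqrt (real n)"
proof -
  have K: "1 \<le> K" using pos by simp
  have "\<forall>\<^sub>F n in sequentially. err (dn n) (real n / 3) < 1"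
    by (rule order_tendstoD[OF err_small]) simp
  moreover have "\<forall>\<^sub>F n in sequentially. sqrt (real n) + 1 \<le> 2 * real n powr 0.6" by real_asymp
  moreover have "\<forall>\<^sub>F n in sequentially. ((sqrt (real n) + 1) * real n powr (- 0.32))\<^sup>2 \<le> sqrt (real n)" by real_asymp
  moreover have "\<forall>\<^sub>F n in sequentially. 1 \<le> sqrt (real n)" by real_asymp
  ultimately have "\<forall>\<^sub>F n in sequentially. \<forall>k. real k \<le> sqrt (real n) + 1 \<longrightarrow>
    integrable (ilaw q (n + k) n) (\<lambda>w. (real (lp (sh k 0 w) n n) - real (lp w n n))\<^sup>2) \<and>
    (\<integral>w. (real (lp (sh k 0 w) n n) - real (lp w n n))\<^sup>2 \<partial>ilaw q (n + k) n) \<le> (64 * K + 32 * K\<^sup>2 + 16) * sqrt (real n)"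
    using cond_eventually
  proof eventually_elim
    case (elim n)
    show ?case
    proof (intro allI impI)
      fix k assume k: "real k \<le> sqrt (real n) + 1"
      have "k + 0 \<le> n \<and> cond (dn n) (real n / 3) (n - k - 0) (n - 0) k" 
        by (rule elim(5)[rule_format]) (use k elim(2) in auto)
      then have cd: "cond (dn n) (real n / 3) (n - k) n k" and kn: "k \<le> n" by auto
      note S = translate_second_moment[OF cd kn]
      have "(K * real k * dn n)\<^sup>2 \<le> (K * ((sqrt (real n) + 1) * real n powr (- 0.32)))\<^sup>2"
        using k K by (intro power_mono) (auto simp: dn_def mult.assoc intro!: mult_left_mono mult_right_mono)
      also have "\<dots> = K\<^sup>2 * ((sqrt (real n) + 1) * real n powr (- 0.32))\<^sup>2" by (simp only: power_mult_distrib)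
      also have "\<dots> \<le> K\<^sup>2 * sqrt (real n)" using elim by (intro mult_left_mono) auto
      finally have 1: "(K * real k * dn n)\<^sup>2 \<le> K\<^sup>2 * sqrt (real n)" .
      have "real k \<le> 2 * sqrt (real n)" using k elim(4) by linarith
      then have 2: "K * real k \<le> K * (2 * sqrt (real n))" using K by (intro mult_left_mono) auto
      have "4 * (8 * K * real k + 8 * (K * real k * dn n)\<^sup>2 + 4 * err (dn n) (real n / 3)) \<le> 
        4 * (8 * (K * (2 * sqrt (real n))) + 8 * (K\<^sup>2 * sqrt (real n)) + 4 * sqrt (real n))"
      proof -
        have gen: "4 * (8 * x + 8 * y + 4 * e) \<le> 4 * (8 * x' + 8 * y' + 4 * s)" if "x \<le> x'" "y \<le> y'" "e \<le> s" for x x' y y' e s :: real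
          by (intro mult_left_mono add_mono that) simp_all
        have e: "8 * K * real k = 8 * (K * real k)" by simp
        have "err (dn n) (real n / 3) \<le> sqrt (real n)" using elim(1,4) by linarith
        with 1 2 show ?thesis unfolding e by (intro gen)
      qed
      also have "\<dots> = (64 * K + 32 * K\<^sup>2 + 16) * sqrt (real n)" by (simp add: algebra_simps)
      finally have "4 * (8 * K * real k + 8 * (K * real k * dn n)\<^sup>2 + 4 * err (dn n) (real n / 3)) \<le> (64 * K + 32 * K\<^sup>2 + 16) * sqrt (real n)" .
      with S(1) have "(\<integral>w. (real (lp (sh k 0 w) n n) - real (lp w n n))\<^sup>2 \<partial>ilaw q (n + k) n) \<le>
         (64 * K + 32 * K\<^sup>2 + 16) * sqrt (real n)" by linarith
      then show "integrable (ilaw q (n + k) n) (\<lambda>w. (real (lp (sh k 0 w) n n) - real (lp w n n))\<^sup>2) \<and>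
        (\<integral>w. (real (lp (sh k 0 w) n n) - real (lp w n n))\<^sup>2 \<partial>ilaw q (n + k) n) \<le> (64 * K + 32 * K\<^sup>2 + 16) * sqrt (real n)"
        using S(2) by blast
    qed
  qed
  then show ?thesis using K by (intro exI[of _ "64 * K + 32 * K\<^sup>2 + 16"] conjI) (auto intro!: add_nonneg_pos)
qed

lemma variance_lower:
  "\<exists>b>0. \<forall>\<^sub>F n in sequentially. b * real n powr 0.6 \<le> lpvar q n"
proof -
  have q: "0 < q" "q < 1" using c by (auto simp: power_less_one_iff)
  obtain b where b: "0 < b" and sp: "\<forall>\<^sub>F k in sequentially. \<forall>d n N m z. cond d n N m k \<longrightarrow>
    b * sqrt (real k) - (2 * K * real k * d + 3 * err d n) \<le> (\<integral>w. \<bar>Hinc w N m k - z\<bar> \<partial>ilaw q (N + k) m)"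
    using cond_walk_spread by blast
  define kn where "kn = (\<lambda>n::nat. nat \<lfloor>real n powr 0.6\<rfloor>)"
  have kn: "real (kn n) \<le> real n powr 0.6" "real n powr 0.6 - 1 \<le> real (kn n)" for n
    by (auto simp: kn_def)
  have "filterlim kn at_top sequentially" unfolding kn_def by real_asymp
  from eventually_compose_filterlim[OF sp this]
  have sp': "\<forall>\<^sub>F n in sequentially. \<forall>d \<nu> N m z. cond d \<nu> N m (kn n) \<longrightarrow>
    b * sqrt (real (kn n)) - (2 * K * real (kn n) * d + 3 * err d \<nu>) \<le> (\<integral>w. \<bar>Hinc w N m (kn n) - z\<bar> \<partial>ilaw q (N + kn n) m)" .
  have K: "0 < K" using pos by simp
  have e1: "\<forall>\<^sub>F n in sequentially. err (dn n) (real n / 3) < 1"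
    by (rule order_tendstoD[OF err_small]) simp
  \<comment> \<open>The 10 collects 2 from the spread estimate and twice 4 from the two
    localizations; the 15 stands for 3 plus twice 6 multiples of \<open>err\<close>, each below 1.
    The bias n^0.28 is negligible against n^0.3.\<close>
  have e2: "\<forall>\<^sub>F n in sequentially. b / 2 * real n powr 0.3 \<le> b * sqrt (real n powr 0.6 - 1) - (10 * K * (real n powr 0.6 * real n powr (- 0.32)) + 15)"
    using b K by real_asymp
  have e3: "\<forall>\<^sub>F n in sequentially. 12 \<le> real n" by real_asymp
  have "\<forall>\<^sub>F n in sequentially. b\<^sup>2 / 16 * real n powr 0.6 \<le> lpvar q n"
    using sp' e1 e2 e3 cond_eventually
  proof eventually_elim
    case (elim n)
    \<comment> \<open>Here y + y' = n + 1, the least sum for which the two sets of rows are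
      disjoint.\<close>
    let ?k = "kn n" and ?y = "n div 2 + 1" and ?y' = "n - n div 2"
    have k2: "real ?k \<le> 2 * real n powr 0.6" using kn(1)[of n] by (smt (verit) powr_ge_zero)
    have y: "real ?y \<le> real n / 2 + 1" "real ?y' \<le> real n / 2 + 1" by linarith+
    have y0: "real 0 \<le> real n / 2 + 1" by simp
    have c1: "?k + ?y \<le> n" "cond (dn n) (real n / 3) (n - ?k - ?y) (n - ?y) ?k"
      and c2: "?k + ?y' \<le> n" "cond (dn n) (real n / 3) (n - ?k - ?y') (n - ?y') ?k"
      and c0: "?k + 0 \<le> n" "cond (dn n) (real n / 3) (n - ?k - 0) (n - 0) ?k"
      using elim(5)[rule_format, of ?k ?y] elim(5)[rule_format, of ?k ?y'] elim(5)[rule_format, of ?k 0] k2 y y0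
      by blast+
    define B where "B = b * sqrt (real ?k) - (2 * K * real ?k * dn n + 3 * err (dn n) (real n / 3))"
    have sB: "B \<le> (\<integral>w. \<bar>Hinc w (n - ?k - ?y) (n - ?y) ?k - z\<bar> \<partial>ilaw q (n - ?k - ?y + ?k) (n - ?y))" for z
      unfolding B_def using elim(1) c1(2) by blast
    have "B - 2 * (4 * K * real ?k * dn n + 6 * err (dn n) (real n / 3)) \<le>
      (\<integral>w. \<bar>real (lp (sh ?k 0 w) n n) - real (lp w n n)\<bar> \<partial>ilaw q (n + ?k) n)"
      by (rule translate_spread[OF c1(1) c2(1) _ _ _ _ c1(2) c2(2) sB]) (use c0 c1 in auto)
    moreover have "b / 2 * real n powr 0.3 \<le> B - 2 * (4 * K * real ?k * dn n + 6 * err (dn n) (real n / 3))"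
    proof -
      have "b * sqrt (real n powr 0.6 - 1) \<le> b * sqrt (real ?k)" using kn(2)[of n] b by simp
      moreover have "K * (real ?k * dn n) \<le> K * (real n powr 0.6 * real n powr (- 0.32))"
        unfolding dn_def using kn(1)[of n] K by (intro mult_left_mono mult_right_mono) auto
      ultimately show ?thesis unfolding B_def using elim(2,3) by (simp add: algebra_simps)
    qed
    ultimately have X: "b / 2 * real n powr 0.3 \<le> (\<integral>w. \<bar>real (lp (sh ?k 0 w) n n) - real (lp w n n)\<bar> \<partial>ilaw q (n + ?k) n)" by linarith
    have "b\<^sup>2 / 4 * real n powr 0.6 = (b / 2 * real n powr 0.3)\<^sup>2"
      by (simp add: power_mult_distrib power_divide power2_eq_square[of "real n powr _"] flip: powr_add)
    also have "\<dots> \<le> (\<integral>w. \<bar>real (lp (sh ?k 0 w) n n) - real (lp w n n)\<bar> \<partial>ilaw q (n + ?k) n)\<^sup>2"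
      using X b by (intro power_mono) auto
    also have "\<dots> \<le> 4 * lpvar q n" by (rule translate_le_lpvar[OF q])
    finally show ?case by simp
  qed
  then show ?thesis using b by (intro exI[of _ "b\<^sup>2 / 16"]) auto
qed

end

section \<open>Inequalities for powers and for integrals over finite laws\<close>

lemma powr_quadratic_lower:
  fixes q X :: real
  assumes q: "1 < q" "q < 2" and "1 \<le> X"
  shows "\<exists>\<kappa>>0. \<forall>x. 0 \<le> x \<and> x \<le> X \<longrightarrow> 1 + q * (x - 1) + \<kappa> * (x - 1)\<^sup>2 \<le> x powr q"
proof -
  \<comment> \<open>The first bound makes \<open>g''\<close> nonnegative on the open interval up to
    X + 1; the second settles x = 0, which the convexity argument on positive x does not
    reach.\<close>
  define \<kappa> where "\<kappa> = min (q * (q - 1) / 2 * (X + 1) powr (q - 2)) (q - 1)"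
  have \<kappa>: "0 < \<kappa>" "\<kappa> \<le> q - 1" "2 * \<kappa> \<le> q * (q - 1) * (X + 1) powr (q - 2)"
    using assms by (auto simp: \<kappa>_def min_def)
  define g where "g = (\<lambda>x. x powr q - 1 - q * (x - 1) - \<kappa> * (x - 1)\<^sup>2)"
  define g' where "g' = (\<lambda>x. q * x powr (q - 1) - q - 2 * \<kappa> * (x - 1))"
  define g'' where "g'' = (\<lambda>x. q * (q - 1) * x powr (q - 2) - 2 * \<kappa>)"
  have d1: "(g has_real_derivative g' x) (at x)" if "0 < x" for x
    unfolding g_def g'_def using that by (auto intro!: derivative_eq_intros)
  have d2: "(g' has_real_derivative g'' x) (at x)" if "0 < x" for x
    unfolding g'_def g''_def using that by (auto intro!: derivative_eq_intros simp: algebra_simps)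
  have nn: "0 \<le> g'' x" if "0 < x" "x < X + 1" for x
  proof -
    have "(X + 1) powr (q - 2) \<le> x powr (q - 2)" using that assms by (intro powr_mono2') auto
    then have "q * (q - 1) * (X + 1) powr (q - 2) \<le> q * (q - 1) * x powr (q - 2)"
      using q by (intro mult_left_mono) auto
    with \<kappa>(3) show ?thesis unfolding g''_def by linarith
  qed
  have conv: "convex_on {0<..<X + 1} g"
    by (rule f''_ge0_imp_convex[where f' = g' and f'' = g'']) (use d1 d2 nn in auto)
  have "1 + q * (x - 1) + \<kappa> * (x - 1)\<^sup>2 \<le> x powr q" if x: "0 \<le> x" "x \<le> X" for x
  proof (cases "x = 0")
    case True
    then show ?thesis using \<kappa>(2) q by simp
  next
    case False
    have "g x - g 1 \<ge> g' 1 * (x - 1)"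
    proof (rule convex_on_imp_above_tangent[OF conv])
      show "(g has_real_derivative g' 1) (at 1 within {0<..<X + 1})"
        using d1[of 1] by (auto intro: has_field_derivative_at_within)
    qed (use x False assms in \<open>auto simp: interior_open\<close>)
    then show ?thesis by (simp add: g_def g'_def)
  qed
  with \<kappa>(1) show ?thesis by blast
qed

text \<open>Convexity enters through the tangent of x powr q at 1, after normalizing by the mean of
  |g|.\<close>

lemma Jensen_powr:
  fixes g :: "'a \<Rightarrow> real"
  assumes "finite (set_pmf M)" "1 < q" "q < 2"
  shows "\<bar>\<integral>x. g x \<partial>M\<bar> powr q \<le> (\<integral>x. \<bar>g x\<bar> powr q \<partial>M)"
proof (cases "(\<integral>x. \<bar>g x\<bar> \<partial>M) = 0")
  case True
  have "\<bar>\<integral>x. g x \<partial>M\<bar> \<le> (\<integral>x. \<bar>g x\<bar> \<partial>M)" by (rule integral_abs_bound)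
  then show ?thesis using True by simp
next
  case False
  define m where "m = (\<integral>x. \<bar>g x\<bar> \<partial>M)"
  have m: "0 < m" using False by (simp add: m_def less_le)
  note I = integrable_measure_pmf_finite[where 'b = real, OF assms(1)]
  have t: "1 + q * (x - 1) \<le> x powr q" if "0 \<le> x" for x
  proof -
    obtain \<kappa> where \<kappa>: "0 < \<kappa>" "\<forall>y. 0 \<le> y \<and> y \<le> max x 1 \<longrightarrow> 1 + q * (y - 1) + \<kappa> * (y - 1)\<^sup>2 \<le> y powr q"
      using powr_quadratic_lower[OF assms(2,3), of "max x 1"] by auto
    from \<kappa>(2) that have \<kappa>2: "1 + q * (x - 1) + \<kappa> * (x - 1)\<^sup>2 \<le> x powr q" by simp
    have "0 \<le> \<kappa> * (x - 1)\<^sup>2" using \<kappa> by simp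
    with \<kappa>2 show ?thesis by linarith
  qed
  have "m powr q = m powr q * (\<integral>x. 1 + q * (\<bar>g x\<bar> / m - 1) \<partial>M)"
    using I m by (simp add: m_def[symmetric])
  also have "\<dots> \<le> m powr q * (\<integral>x. (\<bar>g x\<bar> / m) powr q \<partial>M)"
    using t m by (intro mult_left_mono integral_mono I) auto
  also have "\<dots> = (\<integral>x. \<bar>g x\<bar> powr q \<partial>M)"
    using m by (simp add: powr_divide)
  finally have "m powr q \<le> (\<integral>x. \<bar>g x\<bar> powr q \<partial>M)" .
  moreover have "\<bar>\<integral>x. g x \<partial>M\<bar> powr q \<le> m powr q"
    using assms by (intro powr_mono2) (auto simp: m_def integral_abs_bound)
  ultimately show ?thesis by linarith
qed

lemma CS_pmf:
  fixes a b :: "'a \<Rightarrow> real"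
  assumes "finite (set_pmf M)"
  shows "(\<integral>x. a x * b x \<partial>M)\<^sup>2 \<le> (\<integral>x. (a x)\<^sup>2 \<partial>M) * (\<integral>x. (b x)\<^sup>2 \<partial>M)"
proof -
  note I = integrable_measure_pmf_finite[where 'b = real, OF assms]
  let ?A = "\<integral>x. (a x)\<^sup>2 \<partial>M" and ?B = "\<integral>x. (b x)\<^sup>2 \<partial>M" and ?C = "\<integral>x. a x * b x \<partial>M"
  have q: "0 \<le> ?A - 2 * t * ?C + t\<^sup>2 * ?B" for t
  proof -
    have "0 \<le> (\<integral>x. (a x - t * b x)\<^sup>2 \<partial>M)" by simp
    also have "\<dots> = (\<integral>x. (a x)\<^sup>2 - 2 * t * (a x * b x) + t\<^sup>2 * (b x)\<^sup>2 \<partial>M)"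
      by (intro Bochner_Integration.integral_cong refl) (simp add: power2_eq_square algebra_simps)
    also have "\<dots> = ?A - 2 * t * ?C + t\<^sup>2 * ?B" using I by simp
    finally show ?thesis .
  qed
  show ?thesis
  proof (cases "?B = 0")
    case True
    have "?C = 0"
    proof (rule ccontr)
      assume "?C \<noteq> 0"
      then show False using q[of "(?A + 1) / (2 * ?C)"] True by (simp add: field_simps)
    qed
    then show ?thesis by (simp add: True)
  next
    case False
    then have B: "0 < ?B" by (simp add: less_le)
    have "(?C / ?B)\<^sup>2 * ?B = ?C\<^sup>2 / ?B" "2 * (?C / ?B) * ?C = 2 * (?C\<^sup>2 / ?B)"
      using False by (simp_all add: power2_eq_square)
    then have "0 \<le> ?A - ?C\<^sup>2 / ?B" using q[of "?C / ?B"] by linarith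
    then show ?thesis using B by (simp add: field_simps)
  qed
qed

subsection \<open>Hypercontractivity\<close>

text \<open>Hypercontractivity in its two-function form, with the same exponent on both sides. In
  this form it tensorizes by two successive applications, without reference to a noise
  operator.\<close>

definition hyper :: "real \<Rightarrow> ('a \<times> 'a) pmf \<Rightarrow> bool" where
  "hyper q P \<longleftrightarrow> finite (set_pmf P) \<and> (\<forall>f g. (\<forall>x. 0 \<le> f x) \<longrightarrow> (\<forall>x. 0 \<le> g x) \<longrightarrow>
     (\<integral>z. f (fst z) * g (snd z) \<partial>P) \<le>
     (\<integral>z. f (fst z) powr q \<partial>P) powr (1 / q) * (\<integral>z. g (snd z) powr q \<partial>P) powr (1 / q))"

definition zip_law :: "('a \<times> 'a) pmf \<Rightarrow> ('b \<times> 'b) pmf \<Rightarrow> (('a \<times> 'b) \<times> ('a \<times> 'b)) pmf" where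
  "zip_law P R = map_pmf (\<lambda>z. ((fst (fst z), fst (snd z)), (snd (fst z), snd (snd z)))) (pair_pmf P R)"

lemma finite_zip_law: "finite (set_pmf P) \<Longrightarrow> finite (set_pmf R) \<Longrightarrow> finite (set_pmf (zip_law P R))"
  by (simp add: zip_law_def)

lemma integral_zip_law:
  fixes f :: "_ \<Rightarrow> real"
  assumes "finite (set_pmf P)" "finite (set_pmf R)"
  shows "(\<integral>z. f z \<partial>zip_law P R) = (\<integral>x. (\<integral>y. f ((fst x, fst y), (snd x, snd y)) \<partial>R) \<partial>P)"
  unfolding zip_law_def integral_map_pmf
  by (subst integral_pair_pmf) (simp_all add: assms integrable_measure_pmf_finite)

text \<open>The inequality for \<open>R\<close> is applied with the first components fixed; the
  partial norms \<open>F\<close> and \<open>G\<close> are then the functions to which the inequality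
  for \<open>P\<close> applies.\<close>

lemma hyper_zip:
  assumes q: "1 < q" and P: "hyper q P" and R: "hyper q R"
  shows "hyper q (zip_law P R)"
  unfolding hyper_def
proof (intro conjI allI impI)
  have fin: "finite (set_pmf P)" "finite (set_pmf R)" using P R by (auto simp: hyper_def)
  then show "finite (set_pmf (zip_law P R))" by (rule finite_zip_law)
  note I = integrable_measure_pmf_finite[where 'b = real, OF fin(1)]
  fix f g :: "'a \<times> 'b \<Rightarrow> real" assume f: "\<forall>x. 0 \<le> f x" and g: "\<forall>x. 0 \<le> g x"
  define F where "F = (\<lambda>a. (\<integral>y. f (a, fst y) powr q \<partial>R) powr (1 / q))"
  define G where "G = (\<lambda>a. (\<integral>y. g (a, snd y) powr q \<partial>R) powr (1 / q))"
  have Fq: "F a powr q = (\<integral>y. f (a, fst y) powr q \<partial>R)" and Gq: "G a powr q = (\<integral>y. g (a, snd y) powr q \<partial>R)" for a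
    unfolding F_def G_def using q by (simp_all add: powr_powr)
  have "(\<integral>z. f (fst z) * g (snd z) \<partial>zip_law P R) = (\<integral>x. (\<integral>y. f (fst x, fst y) * g (snd x, snd y) \<partial>R) \<partial>P)"
    by (simp add: integral_zip_law[OF fin])
  also have "\<dots> \<le> (\<integral>x. F (fst x) * G (snd x) \<partial>P)"
  proof (intro integral_mono I)
    fix x
    show "(\<integral>y. f (fst x, fst y) * g (snd x, snd y) \<partial>R) \<le> F (fst x) * G (snd x)"
      unfolding F_def G_def using R f g unfolding hyper_def
      by (elim conjE allE[of _ "\<lambda>y. f (fst x, y)"] allE[of _ "\<lambda>y. g (snd x, y)"]) simp
  qed
  also have "\<dots> \<le> (\<integral>x. F (fst x) powr q \<partial>P) powr (1 / q) * (\<integral>x. G (snd x) powr q \<partial>P) powr (1 / q)"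
    using P unfolding hyper_def by (elim conjE allE[of _ F] allE[of _ G]) (simp add: F_def G_def)
  also have "\<dots> = (\<integral>z. f (fst z) powr q \<partial>zip_law P R) powr (1 / q) * (\<integral>z. g (snd z) powr q \<partial>zip_law P R) powr (1 / q)"
    by (simp add: integral_zip_law[OF fin] Fq Gq)
  finally show "(\<integral>z. f (fst z) * g (snd z) \<partial>zip_law P R) \<le> \<dots>" .
qed

lemma hyper_map:
  assumes "hyper q P"
  shows "hyper q (map_pmf (\<lambda>z. (h (fst z), h (snd z))) P)"
  unfolding hyper_def
proof (intro conjI allI impI)
  show "finite (set_pmf (map_pmf (\<lambda>z. (h (fst z), h (snd z))) P))" using assms by (simp add: hyper_def)
  fix f g :: "'b \<Rightarrow> real" assume "\<forall>x. 0 \<le> f x" "\<forall>x. 0 \<le> g x"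
  then show "(\<integral>z. f (fst z) * g (snd z) \<partial>map_pmf (\<lambda>z. (h (fst z), h (snd z))) P) \<le>
     (\<integral>z. f (fst z) powr q \<partial>map_pmf (\<lambda>z. (h (fst z), h (snd z))) P) powr (1 / q) *
     (\<integral>z. g (snd z) powr q \<partial>map_pmf (\<lambda>z. (h (fst z), h (snd z))) P) powr (1 / q)"
    using assms unfolding hyper_def
    by (elim conjE allE[of _ "f \<circ> h"] allE[of _ "g \<circ> h"]) simp
qed

lemma hyper_return: "1 < q \<Longrightarrow> hyper q (return_pmf (x, x))"
  by (auto simp: hyper_def powr_powr)

text \<open>With probability \<open>\<rho>\<close> the bit is kept, otherwise it is redrawn;
  resampling up to time t corresponds to \<open>\<rho> = exp (- t)\<close>.\<close>

definition bitk :: "real \<Rightarrow> real \<Rightarrow> bool \<Rightarrow> bool pmf" where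
  "bitk p \<rho> b = bind_pmf (bernoulli_pmf \<rho>) (\<lambda>k. if k then return_pmf b else bernoulli_pmf p)"

definition bitp :: "real \<Rightarrow> real \<Rightarrow> (bool \<times> bool) pmf" where
  "bitp p \<rho> = bind_pmf (bernoulli_pmf p) (\<lambda>b. map_pmf (Pair b) (bitk p \<rho> b))"

lemma finite_bool_pmf [simp]: "finite (set_pmf (M :: (bool \<times> bool) pmf))" "finite (set_pmf (M' :: bool pmf))"
  by (rule finite_subset[OF subset_UNIV], simp)+

lemma integral_bind_bool:
  fixes f :: "_ \<Rightarrow> real"
  assumes "finite (set_pmf (bind_pmf M N))"
  shows "(\<integral>x. f x \<partial>bind_pmf M N) = (\<integral>x. (\<integral>y. f y \<partial>N x) \<partial>M)"
  by (rule integral_bind_pmf_Fubini) (rule integrable_measure_pmf_finite[where 'b = real, OF assms])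

lemma integral_bitk:
  fixes f :: "bool \<Rightarrow> real"
  assumes "0 \<le> p" "p \<le> 1" "0 \<le> \<rho>" "\<rho> \<le> 1"
  shows "(\<integral>x. f x \<partial>bitk p \<rho> b) = \<rho> * f b + (1 - \<rho>) * (p * f True + (1 - p) * f False)"
  unfolding bitk_def using assms by (subst integral_bind_bool) (simp_all add: algebra_simps)

lemma integral_bitp:
  fixes f :: "bool \<times> bool \<Rightarrow> real"
  assumes "0 \<le> p" "p \<le> 1" "0 \<le> \<rho>" "\<rho> \<le> 1"
  shows "(\<integral>z. f z \<partial>bitp p \<rho>) =
    p * (\<rho> * f (True, True) + (1 - \<rho>) * (p * f (True, True) + (1 - p) * f (True, False))) +
    (1 - p) * (\<rho> * f (False, False) + (1 - \<rho>) * (p * f (False, True) + (1 - p) * f (False, False)))"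
  unfolding bitp_def using assms by (subst integral_bind_bool) (simp_all add: integral_bitk algebra_simps)

text \<open>The left side is (1 - \<rho>) E f E g + \<rho> E (f g), a nonnegative bilinear form, so
  Cauchy-Schwarz reduces the claim to f = g. After division by E f it reads 1 + \<rho> V \<le> (E
  x^q)^(2/q), with V the variance of x, and the quadratic gain in
  \<open>powr_quadratic_lower\<close> provides E x^q \<ge> 1 + \<kappa> V.\<close>

lemma hyper_bit:
  assumes p: "0 < p" "p < 1" and q: "1 < q" "q < 2"
  shows "\<exists>\<rho>0>0. \<rho>0 \<le> 1 \<and> (\<forall>\<rho>. 0 \<le> \<rho> \<and> \<rho> \<le> \<rho>0 \<longrightarrow> hyper q (bitp p \<rho>))"
proof -
  define m where "m = min p (1 - p)"
  have m: "0 < m" "m \<le> p" "m \<le> 1 - p" "m < 1" using p by (auto simp: m_def)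
  obtain \<kappa> where \<kappa>: "0 < \<kappa>" "\<And>x. 0 \<le> x \<Longrightarrow> x \<le> 1 / m \<Longrightarrow> 1 + q * (x - 1) + \<kappa> * (x - 1)\<^sup>2 \<le> x powr q"
    using powr_quadratic_lower[OF q, of "1 / m"] m by auto
  define E where "E = (\<lambda>f :: bool \<Rightarrow> real. p * f True + (1 - p) * f False)"
  have Ed: "E h = p * h True + (1 - p) * h False" for h by (simp add: E_def)
  define N where "N = (\<lambda>f :: bool \<Rightarrow> real. E (\<lambda>b. f b powr q) powr (1 / q))"
  have key: "(1 - \<rho>) * (E f)\<^sup>2 + \<rho> * E (\<lambda>b. (f b)\<^sup>2) \<le> (N f)\<^sup>2"
    if \<rho>: "0 \<le> \<rho>" "\<rho> \<le> \<kappa>" and f: "\<And>b. 0 \<le> f b" for \<rho> f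
  proof (cases "E f = 0")
    case True
    then have "p * f True + (1 - p) * f False = 0" by (simp add: E_def)
    moreover have "0 \<le> p * f True" "0 \<le> (1 - p) * f False" using p f by auto
    ultimately have "p * f True = 0" "(1 - p) * f False = 0" by linarith+
    then have "f True = 0" "f False = 0" using p by auto
    then show ?thesis using q by (simp add: E_def N_def)
  next
    case False
    have "0 \<le> p * f True" "0 \<le> (1 - p) * f False" using p f by auto
    then have E0: "0 < E f" using False by (simp add: E_def less_le)
    define x where "x = (\<lambda>b. f b / E f)"
    have x0: "0 \<le> x b" for b using f E0 by (simp add: x_def)
    have Ex: "E x = 1" using E0 by (simp add: x_def E_def add_divide_distrib[symmetric])
    \<comment> \<open>A nonnegative function of mean 1 is at most the reciprocal of the smallest
      mass, which bounds the range on which the quadratic gain is needed.\<close>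
    have xm: "x b \<le> 1 / m" for b
    proof -
      have "m * x b \<le> E x"
      proof (cases b)
        case True
        have "m * x True \<le> p * x True" using m x0 by (intro mult_right_mono) auto
        moreover have "0 \<le> (1 - p) * x False" using p x0 by auto
        ultimately show ?thesis using True by (simp add: E_def)
      next
        case False
        have "m * x False \<le> (1 - p) * x False" using m x0 by (intro mult_right_mono) auto
        moreover have "0 \<le> p * x True" using p x0 by auto
        ultimately show ?thesis using False by (simp add: E_def)
      qed
      then show ?thesis using Ex m by (simp add: field_simps)
    qed
    define V where "V = E (\<lambda>b. (x b - 1)\<^sup>2)"
    have V0: "0 \<le> V" using p by (simp add: V_def E_def)
    have V: "V = E (\<lambda>b. (x b)\<^sup>2) - 1"
    proof -
      have "V = E (\<lambda>b. (x b)\<^sup>2) - 2 * E x + 1" by (simp add: V_def E_def power2_eq_square algebra_simps)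
      then show ?thesis using Ex by simp
    qed
    have "1 + \<kappa> * V = E (\<lambda>b. 1 + q * (x b - 1) + \<kappa> * (x b - 1)\<^sup>2)"
    proof -
      have "E (\<lambda>b. 1 + q * (x b - 1) + \<kappa> * (x b - 1)\<^sup>2) = 1 + q * (E x - 1) + \<kappa> * V"
        by (simp add: E_def V_def algebra_simps)
      then show ?thesis using Ex by simp
    qed
    also have "\<dots> \<le> E (\<lambda>b. x b powr q)"
      unfolding E_def using p x0 xm by (intro add_mono mult_left_mono \<kappa>(2)) auto
    finally have 1: "1 + \<kappa> * V \<le> E (\<lambda>b. x b powr q)" .
    have one: "1 \<le> 1 + \<kappa> * V" using \<kappa> V0 by simp
    have "1 + \<kappa> * V = (1 + \<kappa> * V) powr 1" using one by simp
    also have "\<dots> \<le> (1 + \<kappa> * V) powr (2 / q)" using one q by (intro powr_mono) auto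
    also have "\<dots> \<le> E (\<lambda>b. x b powr q) powr (2 / q)" using 1 one q by (intro powr_mono2) auto
    finally have 2: "1 + \<kappa> * V \<le> E (\<lambda>b. x b powr q) powr (2 / q)" .
    have fx: "f b = E f * x b" for b using E0 by (simp add: x_def)
    have e1: "E (\<lambda>b. (f b)\<^sup>2) = (E f)\<^sup>2 * E (\<lambda>b. (x b)\<^sup>2)"
    proof -
      have "E (\<lambda>b. (e * x b)\<^sup>2) = e\<^sup>2 * E (\<lambda>b. (x b)\<^sup>2)" for e unfolding E_def by (simp add: power_mult_distrib algebra_simps)
      from this[of "E f"] show ?thesis unfolding fx[symmetric] .
    qed
    have e2: "E (\<lambda>b. f b powr q) = E f powr q * E (\<lambda>b. x b powr q)"
    proof -
      have "E (\<lambda>b. (e * x b) powr q) = e powr q * E (\<lambda>b. x b powr q)" if "0 < e" for e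
        using that x0 unfolding E_def by (simp add: powr_mult algebra_simps)
      from this[OF E0] show ?thesis unfolding fx[symmetric] .
    qed
    have "(N f)\<^sup>2 = E (\<lambda>b. f b powr q) powr (2 / q)"
      unfolding N_def by (simp add: power2_eq_square flip: powr_add)
    also have "\<dots> = (E f)\<^sup>2 * E (\<lambda>b. x b powr q) powr (2 / q)"
    proof -
      have "0 \<le> E (\<lambda>b. x b powr q)" using 1 one by linarith
      then show ?thesis unfolding e2 using E0 q by (simp add: powr_mult powr_powr)
    qed
    finally have N2: "(N f)\<^sup>2 = (E f)\<^sup>2 * E (\<lambda>b. x b powr q) powr (2 / q)" .
    have "(1 - \<rho>) * (E f)\<^sup>2 + \<rho> * E (\<lambda>b. (f b)\<^sup>2) = (E f)\<^sup>2 * (1 + \<rho> * V)"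
      unfolding e1 V by (simp add: algebra_simps)
    also have "\<dots> \<le> (E f)\<^sup>2 * (1 + \<kappa> * V)"
      using \<rho> V0 by (intro mult_left_mono add_left_mono mult_right_mono) auto
    also have "\<dots> \<le> (N f)\<^sup>2" unfolding N2 by (rule mult_left_mono[OF 2]) simp
    finally show ?thesis .
  qed
  have "hyper q (bitp p \<rho>)" if \<rho>: "0 \<le> \<rho>" "\<rho> \<le> min \<kappa> 1" for \<rho>
    unfolding hyper_def
  proof (intro conjI allI impI)
    fix f g :: "bool \<Rightarrow> real" assume fg: "\<forall>x. 0 \<le> f x" "\<forall>x. 0 \<le> g x"
    note pr = less_imp_le[OF p(1)] less_imp_le[OF p(2)] \<rho>(1)
    have r1: "\<rho> \<le> 1" using \<rho> by simp
    have m1: "(\<integral>z. f (fst z) powr q \<partial>bitp p \<rho>) = E (\<lambda>b. f b powr q)" 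
      unfolding E_def by (simp add: integral_bitp[OF pr r1] algebra_simps)
    have m2: "(\<integral>z. g (snd z) powr q \<partial>bitp p \<rho>) = E (\<lambda>b. g b powr q)" 
      unfolding E_def by (simp add: integral_bitp[OF pr r1] algebra_simps)
    let ?X = "(1 - \<rho>) * (E f * E g) + \<rho> * E (\<lambda>b. f b * g b)"
    let ?A = "\<lambda>f. (1 - \<rho>) * (E f)\<^sup>2 + \<rho> * E (\<lambda>b. (f b)\<^sup>2)"
    have X: "(\<integral>z. f (fst z) * g (snd z) \<partial>bitp p \<rho>) = ?X"
      unfolding E_def by (simp add: integral_bitp[OF pr r1] algebra_simps)
    have CS: "?X\<^sup>2 \<le> ?A f * ?A g"
    proof -
      have 3: "(a * x * x' + b * y * y' + c * z * z')\<^sup>2 \<le> (a * x\<^sup>2 + b * y\<^sup>2 + c * z\<^sup>2) * (a * x'\<^sup>2 + b * y'\<^sup>2 + c * z'\<^sup>2)"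
        if "0 \<le> a" "0 \<le> b" "0 \<le> c" for a b c x y z x' y' z' :: real
      proof -
        have "(a * x\<^sup>2 + b * y\<^sup>2 + c * z\<^sup>2) * (a * x'\<^sup>2 + b * y'\<^sup>2 + c * z'\<^sup>2) - (a * x * x' + b * y * y' + c * z * z')\<^sup>2 =
          (a * b) * (x * y' - y * x')\<^sup>2 + (a * c) * (x * z' - z * x')\<^sup>2 + (b * c) * (y * z' - z * y')\<^sup>2"
          by (simp add: power2_eq_square algebra_simps)
        also have "\<dots> \<ge> 0" using that by simp
        finally show ?thesis by simp
      qed
      have xe: "?X = (1 - \<rho>) * E f * E g + (\<rho> * p) * f True * g True + (\<rho> * (1 - p)) * f False * g False"
        "?A f = (1 - \<rho>) * (E f)\<^sup>2 + (\<rho> * p) * (f True)\<^sup>2 + (\<rho> * (1 - p)) * (f False)\<^sup>2"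
        "?A g = (1 - \<rho>) * (E g)\<^sup>2 + (\<rho> * p) * (g True)\<^sup>2 + (\<rho> * (1 - p)) * (g False)\<^sup>2"
        unfolding Ed[of "\<lambda>b. f b * g b"] Ed[of "\<lambda>b. (f b)\<^sup>2"] Ed[of "\<lambda>b. (g b)\<^sup>2"] by (simp_all add: algebra_simps)
      show ?thesis unfolding xe by (rule 3) (use \<rho> p in auto)
    qed
    have A0: "0 \<le> ?A g" using \<rho> p by (simp add: E_def)
    have "?A f * ?A g \<le> (N f)\<^sup>2 * (N g)\<^sup>2"
    proof (rule mult_mono)
      show "?A f \<le> (N f)\<^sup>2" "?A g \<le> (N g)\<^sup>2" using \<rho> fg by (auto intro!: key)
    qed (use A0 in auto)
    with CS have "?X\<^sup>2 \<le> (N f)\<^sup>2 * (N g)\<^sup>2" by (rule order_trans)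
    then have "?X\<^sup>2 \<le> (N f * N g)\<^sup>2" by (simp add: power_mult_distrib)
    then have "?X \<le> N f * N g" by (rule power2_le_imp_le) (simp add: N_def)
    then show "(\<integral>z. f (fst z) * g (snd z) \<partial>bitp p \<rho>) \<le> (\<integral>z. f (fst z) powr q \<partial>bitp p \<rho>) powr (1 / q) * (\<integral>z. g (snd z) powr q \<partial>bitp p \<rho>) powr (1 / q)"
      unfolding X m1 m2 N_def .
  qed simp
  then show ?thesis using \<kappa>(1) by (intro exI[of _ "min \<kappa> 1"]) auto
qed

subsection \<open>Noise on products of truncated geometric laws\<close>

text \<open>The recursion for the index of the first true bit: the first bit together with that
  index for the remaining bits.\<close>

definition hb :: "bool \<times> nat \<Rightarrow> nat" where
  "hb z = (if fst z then 0 else Suc (snd z))"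

text \<open>The joint law of a geometric variable and its perturbation, both truncated to their first
  \<open>N\<close> bits.\<close>

primrec slaw :: "real \<Rightarrow> real \<Rightarrow> nat \<Rightarrow> (nat \<times> nat) pmf" where
  "slaw p \<rho> 0 = return_pmf (0, 0)"
| "slaw p \<rho> (Suc N) = map_pmf (\<lambda>z. (hb (fst z), hb (snd z))) (zip_law (bitp p \<rho>) (slaw p \<rho> N))"

definition tgeo :: "real \<Rightarrow> nat \<Rightarrow> nat pmf" where
  "tgeo p N = map_pmf (\<lambda>x. min x N) (geometric_pmf p)"

lemma finite_slaw [simp]: "finite (set_pmf (slaw p \<rho> N))"
  by (induction N) (auto simp: finite_zip_law)

lemma finite_tgeo [simp]: "finite (set_pmf (tgeo p N))"
  by (rule finite_subset[of _ "{..N}"]) (auto simp: tgeo_def)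

lemma tgeo_Suc:
  assumes "0 < p" "p < 1"
  shows "tgeo p (Suc N) = map_pmf hb (pair_pmf (bernoulli_pmf p) (tgeo p N))"
proof -
  have "tgeo p (Suc N) = map_pmf (\<lambda>x. min x (Suc N)) (bind_pmf (bernoulli_pmf p)
      (\<lambda>b. if b then return_pmf 0 else map_pmf Suc (geometric_pmf p)))"
    unfolding tgeo_def using assms by (subst geometric_bind_pmf_unfold) auto
  also have "\<dots> = bind_pmf (bernoulli_pmf p) (\<lambda>b. map_pmf (\<lambda>x. hb (b, x)) (tgeo p N))"
    unfolding map_bind_pmf
  proof (intro bind_pmf_cong refl)
    fix b
    show "map_pmf (\<lambda>x. min x (Suc N)) (if b then return_pmf 0 else map_pmf Suc (geometric_pmf p)) =
      map_pmf (\<lambda>x. hb (b, x)) (tgeo p N)"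
      by (simp add: hb_def tgeo_def pmf.map_comp o_def)
  qed
  also have "\<dots> = map_pmf hb (pair_pmf (bernoulli_pmf p) (tgeo p N))"
    by (simp add: pair_pmf_conv_bind map_bind_pmf pmf.map_comp o_def)
  finally show ?thesis .
qed

lemma zip_law_fst: "map_pmf fst (zip_law P R) = pair_pmf (map_pmf fst P) (map_pmf fst R)"
  and zip_law_snd: "map_pmf snd (zip_law P R) = pair_pmf (map_pmf snd P) (map_pmf snd R)"
  by (simp_all add: zip_law_def pmf.map_comp o_def map_pair pair_map_pmf1 pair_map_pmf2 case_prod_unfold)

lemma pmf_bitk:
  assumes "0 \<le> p" "p \<le> 1" "0 \<le> \<rho>" "\<rho> \<le> 1"
  shows "pmf (bitk p \<rho> b) b' = \<rho> * of_bool (b = b') + (1 - \<rho>) * (if b' then p else 1 - p)"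
  unfolding bitk_def using assms by (cases b') (simp_all add: pmf_bind pmf_return indicator_def algebra_simps)

lemma bitp_marginals:
  assumes "0 \<le> p" "p \<le> 1" "0 \<le> \<rho>" "\<rho> \<le> 1"
  shows "map_pmf fst (bitp p \<rho>) = bernoulli_pmf p" "map_pmf snd (bitp p \<rho>) = bernoulli_pmf p"
proof -
  show "map_pmf fst (bitp p \<rho>) = bernoulli_pmf p"
    by (simp add: bitp_def map_bind_pmf pmf.map_comp o_def bind_return_pmf' map_pmf_const)
  show "map_pmf snd (bitp p \<rho>) = bernoulli_pmf p"
  proof (rule pmf_eqI)
    fix b
    show "pmf (map_pmf snd (bitp p \<rho>)) b = pmf (bernoulli_pmf p) b"
      using assms by (cases b) (simp_all add: bitp_def map_bind_pmf pmf.map_comp o_def pmf_bind pmf_bitk algebra_simps)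
  qed
qed

lemma slaw_marginals:
  assumes "0 < p" "p < 1" "0 \<le> \<rho>" "\<rho> \<le> 1"
  shows "map_pmf fst (slaw p \<rho> N) = tgeo p N" "map_pmf snd (slaw p \<rho> N) = tgeo p N"
proof -
  have a: "map_pmf fst (map_pmf (\<lambda>z. (hb (fst z), hb (snd z))) Z) = map_pmf hb (map_pmf fst Z)"
    "map_pmf snd (map_pmf (\<lambda>z. (hb (fst z), hb (snd z))) Z) = map_pmf hb (map_pmf snd Z)" for Z
    by (simp_all add: pmf.map_comp o_def)
  have t0: "tgeo p 0 = return_pmf 0" by (simp add: tgeo_def map_pmf_const)
  have "map_pmf fst (slaw p \<rho> N) = tgeo p N \<and> map_pmf snd (slaw p \<rho> N) = tgeo p N"
  proof (induction N)
    case 0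
    show ?case by (simp add: t0)
  next
    case (Suc N)
    then show ?case using assms bitp_marginals[of p \<rho>]
      unfolding slaw.simps a zip_law_fst zip_law_snd by (simp add: tgeo_Suc)
  qed
  then show "map_pmf fst (slaw p \<rho> N) = tgeo p N" "map_pmf snd (slaw p \<rho> N) = tgeo p N" by auto
qed

lemma hyper_slaw:
  assumes "1 < q" "hyper q (bitp p \<rho>)"
  shows "hyper q (slaw p \<rho> N)"
  by (induction N) (auto simp: hyper_return assms hyper_map hyper_zip)

section \<open>Correlated product fields\<close>

lemma Pi_pmf_pair:
  fixes A :: "'v \<Rightarrow> 'c pmf" and A' :: "'v \<Rightarrow> 'd pmf"
  assumes "finite B"
  shows "map_pmf (\<lambda>\<zeta>. (fst \<circ> \<zeta>, snd \<circ> \<zeta>)) (Pi_pmf B (d, d') (\<lambda>v. pair_pmf (A v) (A' v))) =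
    pair_pmf (Pi_pmf B d A) (Pi_pmf B d' A')"
proof (rule pmf_eqI)
  fix z :: "('v \<Rightarrow> 'c) \<times> ('v \<Rightarrow> 'd)"
  let ?g = "\<lambda>\<zeta> :: 'v \<Rightarrow> 'c \<times> 'd. (fst \<circ> \<zeta>, snd \<circ> \<zeta>)"
  obtain w w' where z: "z = (w, w')" by (cases z) auto
  have inj: "inj ?g" by (auto simp: inj_on_def fun_eq_iff prod_eq_iff)
  have e: "z = ?g (\<lambda>v. (w v, w' v))" by (simp add: z o_def)
  have "pmf (map_pmf ?g (Pi_pmf B (d, d') (\<lambda>v. pair_pmf (A v) (A' v)))) z =
     pmf (Pi_pmf B (d, d') (\<lambda>v. pair_pmf (A v) (A' v))) (\<lambda>v. (w v, w' v))"
    unfolding e by (rule pmf_map_inj'[OF inj])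
  also have "\<dots> = pmf (Pi_pmf B d A) w * pmf (Pi_pmf B d' A') w'"
    using assms by (auto simp: pmf_Pi pmf_pair prod.distrib)
  also have "\<dots> = pmf (pair_pmf (Pi_pmf B d A) (Pi_pmf B d' A')) z" by (simp add: z pmf_pair)
  finally show "pmf (map_pmf ?g (Pi_pmf B (d, d') (\<lambda>v. pair_pmf (A v) (A' v)))) z = \<dots>" .
qed

definition plaw :: "real \<Rightarrow> real \<Rightarrow> nat \<Rightarrow> 'v set \<Rightarrow> (('v \<Rightarrow> nat) \<times> ('v \<Rightarrow> nat)) pmf" where
  "plaw p \<rho> N B = map_pmf (\<lambda>\<zeta>. (fst \<circ> \<zeta>, snd \<circ> \<zeta>)) (Pi_pmf B (0, 0) (\<lambda>_. slaw p \<rho> N))"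

definition mlaw :: "real \<Rightarrow> nat \<Rightarrow> 'v set \<Rightarrow> ('v \<Rightarrow> nat) pmf" where
  "mlaw p N B = Pi_pmf B 0 (\<lambda>_. tgeo p N)"

lemma finite_Pi: "finite B \<Longrightarrow> (\<And>v. finite (set_pmf (P v))) \<Longrightarrow> finite (set_pmf (Pi_pmf B d P))"
  by (simp add: set_Pi_pmf finite_PiE_dflt)

lemma finite_plaw [simp]: "finite B \<Longrightarrow> finite (set_pmf (plaw p \<rho> N B))"
  by (simp add: plaw_def finite_Pi)

lemma finite_mlaw [simp]: "finite B \<Longrightarrow> finite (set_pmf (mlaw p N B))"
  by (simp add: mlaw_def finite_Pi)

lemma plaw_marginals:
  assumes "finite B" "0 < p" "p < 1" "0 \<le> \<rho>" "\<rho> \<le> 1"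
  shows "map_pmf fst (plaw p \<rho> N B) = mlaw p N B" "map_pmf snd (plaw p \<rho> N B) = mlaw p N B"
  using Pi_pmf_map[OF assms(1), of fst "(0, 0)" 0 "\<lambda>_. slaw p \<rho> N"] Pi_pmf_map[OF assms(1), of snd "(0, 0)" 0 "\<lambda>_. slaw p \<rho> N"]
    slaw_marginals[OF assms(2-5)]
  by (simp_all add: plaw_def mlaw_def pmf.map_comp o_def)

text \<open>Written so that the same map acts on both components of a \<open>zip_law\<close>, the
  form to which \<open>hyper_map\<close> and \<open>hyper_zip\<close> apply.\<close>

lemma plaw_insert:
  assumes "finite B" "v \<notin> B"
  shows "plaw p \<rho> N (insert v B) =
    map_pmf (\<lambda>z. ((\<lambda>y. (fst y)(v := snd y)) (fst z), (\<lambda>y. (fst y)(v := snd y)) (snd z))) (zip_law (plaw p \<rho> N B) (slaw p \<rho> N))"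
proof -
  have "plaw p \<rho> N (insert v B) = map_pmf (\<lambda>z. (fst \<circ> (snd z)(v := fst z), snd \<circ> (snd z)(v := fst z)))
     (pair_pmf (slaw p \<rho> N) (Pi_pmf B (0, 0) (\<lambda>_. slaw p \<rho> N)))"
    unfolding plaw_def by (subst Pi_pmf_insert[OF assms]) (simp add: pmf.map_comp o_def case_prod_unfold)
  also have "\<dots> = map_pmf (\<lambda>z. (fst \<circ> (fst z)(v := snd z), snd \<circ> (fst z)(v := snd z)))
     (pair_pmf (Pi_pmf B (0, 0) (\<lambda>_. slaw p \<rho> N)) (slaw p \<rho> N))"
    unfolding pair_commute_pmf[of "slaw p \<rho> N" "Pi_pmf B (0, 0) (\<lambda>_. slaw p \<rho> N)"] pmf.map_comp
    by (intro map_pmf_cong refl) (simp add: case_prod_unfold)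
  also have "\<dots> = map_pmf (\<lambda>z. ((fst \<circ> fst z)(v := fst (snd z)), (snd \<circ> fst z)(v := snd (snd z))))
     (pair_pmf (Pi_pmf B (0, 0) (\<lambda>_. slaw p \<rho> N)) (slaw p \<rho> N))"
    by (intro map_pmf_cong refl) (auto simp: fun_eq_iff)
  finally show ?thesis
    by (simp add: plaw_def zip_law_def pair_map_pmf1 pmf.map_comp o_def case_prod_unfold)
qed

lemma mlaw_insert:
  assumes "finite B" "v \<notin> B"
  shows "mlaw p N (insert v B) = map_pmf (\<lambda>y. (fst y)(v := snd y)) (pair_pmf (mlaw p N B) (tgeo p N))"
  unfolding mlaw_def
  by (subst Pi_pmf_insert[OF assms], subst pair_commute_pmf) (simp add: pmf.map_comp o_def case_prod_unfold)

lemma plaw_empty: "plaw p \<rho> N {} = return_pmf (\<lambda>_. 0, \<lambda>_. 0)"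
  by (simp add: plaw_def o_def)

lemma hyper_plaw:
  assumes "1 < q" "hyper q (bitp p \<rho>)" "finite B"
  shows "hyper q (plaw p \<rho> N B)"
  using assms(3)
proof (induction B rule: finite_induct)
  case empty
  show ?case unfolding plaw_empty by (rule hyper_return[OF assms(1)])
next
  case (insert v B)
  show ?case unfolding plaw_insert[OF insert(1,2)]
    by (intro hyper_map hyper_zip hyper_slaw insert assms)
qed

lemma integral_mlaw_insert:
  fixes f :: "_ \<Rightarrow> real"
  assumes "finite B" "v \<notin> B"
  shows "(\<integral>w. f w \<partial>mlaw p N (insert v B)) = (\<integral>w. (\<integral>x. f (w(v := x)) \<partial>tgeo p N) \<partial>mlaw p N B)"
  unfolding mlaw_insert[OF assms] integral_map_pmf
  by (subst integral_pair_pmf) (simp_all add: assms integrable_measure_pmf_finite)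

lemma powr_diff_le:
  fixes a b q :: real
  assumes "0 < q"
  shows "\<bar>a - b\<bar> powr q \<le> 2 powr q * (\<bar>a\<bar> powr q + \<bar>b\<bar> powr q)"
proof -
  have "\<bar>a - b\<bar> powr q \<le> (2 * max \<bar>a\<bar> \<bar>b\<bar>) powr q" using assms by (intro powr_mono2) auto
  also have "\<dots> = 2 powr q * max \<bar>a\<bar> \<bar>b\<bar> powr q" by (simp add: powr_mult)
  also have "\<dots> \<le> 2 powr q * (\<bar>a\<bar> powr q + \<bar>b\<bar> powr q)" by (intro mult_left_mono) (auto simp: max_def)
  finally show ?thesis .
qed

text \<open>The martingale decomposition of \<open>f\<close> along the sites, combined with hypercontractivity for
  each martingale increment.\<close>

lemma noise_Efron_Stein:
  assumes p: "0 < p" "p < 1" and \<rho>: "0 \<le> \<rho>" "\<rho> \<le> 1" and q: "1 < q" "q < 2" and H: "hyper q (bitp p \<rho>)"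
    and B: "finite B"
  shows "(\<integral>z. f (fst z) * f (snd z) \<partial>plaw p \<rho> N B) - (\<integral>w. f w \<partial>mlaw p N B)\<^sup>2 \<le>
     (\<Sum>v\<in>B. 16 * (\<integral>w. \<bar>f w - f (w(v := 0))\<bar> powr q \<partial>mlaw p N B) powr (2 / q))"
  using B
proof (induction B arbitrary: f rule: finite_induct)
  case empty
  show ?case by (simp add: plaw_empty mlaw_def power2_eq_square)
next
  case (insert v B)
  note fB = insert(1,2)
  note I = integrable_measure_pmf_finite
  let ?P = "plaw p \<rho> N B" and ?S = "slaw p \<rho> N" and ?M = "mlaw p N B" and ?T = "tgeo p N"
  let ?P' = "plaw p \<rho> N (insert v B)" and ?M' = "mlaw p N (insert v B)"
  define fb where "fb = (\<lambda>w. \<integral>x. f (w(v := x)) \<partial>?T)"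
  \<comment> \<open>\<open>h\<close> is the martingale increment at the site \<open>v\<close>: what
    averaging over \<open>v\<close> removes from \<open>f\<close>.\<close>
  define h where "h = (\<lambda>w. f w - fb w)"
  have fbv: "fb (w(v := x)) = fb w" for w x by (simp add: fb_def)
  have fin: "finite (set_pmf ?P)" "finite (set_pmf ?S)" "finite (set_pmf ?M)" "finite (set_pmf ?M')"
    using fB by simp_all
  have Z: "(\<integral>z. F z \<partial>?P') = (\<integral>y. (\<integral>z. F ((fst y)(v := fst z), (snd y)(v := snd z)) \<partial>?S) \<partial>?P)" for F :: "_ \<Rightarrow> real"
    unfolding plaw_insert[OF fB] integral_map_pmf by (subst integral_zip_law) (simp_all add: fB)
  have S1: "(\<integral>z. g (fst z) \<partial>?S) = (\<integral>x. g x \<partial>?T)" "(\<integral>z. g (snd z) \<partial>?S) = (\<integral>x. g x \<partial>?T)" for g :: "nat \<Rightarrow> real"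
    unfolding slaw_marginals(1)[OF p \<rho>, of N, symmetric]
    by (simp, unfold slaw_marginals(1)[OF p \<rho>, of N] slaw_marginals(2)[OF p \<rho>, of N, symmetric], simp)
  have h0: "(\<integral>x. h (w(v := x)) \<partial>?T) = 0" for w
    by (simp add: h_def fbv I) (simp add: fb_def)
  \<comment> \<open>The cross terms vanish since \<open>h\<close> has mean zero in the site
    \<open>v\<close> under either marginal.\<close>
  have inner: "(\<integral>z. f (w(v := fst z)) * f (w'(v := snd z)) \<partial>?S) = fb w * fb w' + (\<integral>z. h (w(v := fst z)) * h (w'(v := snd z)) \<partial>?S)" for w w'
  proof -
    have fh: "f (w(v := x)) = fb w + h (w(v := x))" for w x by (simp add: h_def fbv)
    have "(\<integral>z. f (w(v := fst z)) * f (w'(v := snd z)) \<partial>?S) =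
      (\<integral>z. fb w * fb w' + fb w * h (w'(v := snd z)) + fb w' * h (w(v := fst z)) + h (w(v := fst z)) * h (w'(v := snd z)) \<partial>?S)"
      unfolding fh by (simp add: algebra_simps)
    also have "\<dots> = fb w * fb w' + fb w * (\<integral>z. h (w'(v := snd z)) \<partial>?S) + fb w' * (\<integral>z. h (w(v := fst z)) \<partial>?S) + (\<integral>z. h (w(v := fst z)) * h (w'(v := snd z)) \<partial>?S)"
      by (simp add: I)
    also have "(\<integral>z. h (w'(v := snd z)) \<partial>?S) = 0" using S1(2)[of "\<lambda>x. h (w'(v := x))"] h0 by simp
    also have "(\<integral>z. h (w(v := fst z)) \<partial>?S) = 0" using S1(1)[of "\<lambda>x. h (w(v := x))"] h0 by simp
    finally show ?thesis by (simp only: mult_zero_right add_0_right)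
  qed
  have split: "(\<integral>z. f (fst z) * f (snd z) \<partial>?P') = (\<integral>y. fb (fst y) * fb (snd y) \<partial>?P) + (\<integral>z. h (fst z) * h (snd z) \<partial>?P')"
    unfolding Z by (simp add: inner I fin)
  have mean: "(\<integral>w. f w \<partial>?M') = (\<integral>w. fb w \<partial>?M)"
    by (simp add: integral_mlaw_insert[OF fB] fb_def)
  have jen: "(\<integral>w. \<bar>\<integral>x. g (w(v := x)) \<partial>?T\<bar> powr q \<partial>?M) \<le> (\<integral>w. \<bar>g w\<bar> powr q \<partial>?M')" for g
    unfolding integral_mlaw_insert[OF fB] by (intro integral_mono I fin Jensen_powr q) simp
  have term1: "(\<integral>y. fb (fst y) * fb (snd y) \<partial>?P) - (\<integral>w. fb w \<partial>?M)\<^sup>2 \<le>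
     (\<Sum>u\<in>B. 16 * (\<integral>w. \<bar>f w - f (w(u := 0))\<bar> powr q \<partial>?M') powr (2 / q))"
  proof -
    have "(\<integral>w. \<bar>fb w - fb (w(u := 0))\<bar> powr q \<partial>?M) \<le> (\<integral>w. \<bar>f w - f (w(u := 0))\<bar> powr q \<partial>?M')" if "u \<in> B" for u
    proof -
      have "u \<noteq> v" using that fB by auto
      then have "fb w - fb (w(u := 0)) = (\<integral>x. f (w(v := x)) - f ((w(v := x))(u := 0)) \<partial>?T)" for w
        by (simp add: fb_def I fun_upd_twist)
      then show ?thesis using jen[of "\<lambda>w. f w - f (w(u := 0))"] by simp
    qed
    then have "(\<Sum>u\<in>B. 16 * (\<integral>w. \<bar>fb w - fb (w(u := 0))\<bar> powr q \<partial>?M) powr (2 / q)) \<le>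
      (\<Sum>u\<in>B. 16 * (\<integral>w. \<bar>f w - f (w(u := 0))\<bar> powr q \<partial>?M') powr (2 / q))"
      using q by (intro sum_mono mult_left_mono powr_mono2) auto
    with insert(3)[of fb] show ?thesis by linarith
  qed
  have term2: "(\<integral>z. h (fst z) * h (snd z) \<partial>?P') \<le> 16 * (\<integral>w. \<bar>f w - f (w(v := 0))\<bar> powr q \<partial>?M') powr (2 / q)"
  proof -
    let ?g = "\<lambda>w. f w - f (w(v := 0))" and ?Y = "\<integral>w. \<bar>f w - f (w(v := 0))\<bar> powr q \<partial>?M'"
    have Y0: "0 \<le> ?Y" by simp
    have fP': "finite (set_pmf ?P')" using fB by simp
    have hq: "hyper q ?P'" by (rule hyper_plaw) (use q H fB in auto)
    have mf: "(\<integral>z. g (fst z) \<partial>?P') = (\<integral>w. g w \<partial>?M')" "(\<integral>z. g (snd z) \<partial>?P') = (\<integral>w. g w \<partial>?M')" for g :: "_ \<Rightarrow> real"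
      using plaw_marginals[of "insert v B" p \<rho> N] fB p \<rho> by (metis finite_insert integral_map_pmf)+
    have "(\<integral>z. h (fst z) * h (snd z) \<partial>?P') \<le> (\<integral>z. \<bar>h (fst z)\<bar> * \<bar>h (snd z)\<bar> \<partial>?P')"
      by (intro integral_mono I fP') (simp flip: abs_mult)
    also have "\<dots> \<le> (\<integral>z. \<bar>h (fst z)\<bar> powr q \<partial>?P') powr (1 / q) * (\<integral>z. \<bar>h (snd z)\<bar> powr q \<partial>?P') powr (1 / q)"
      using hq unfolding hyper_def by (elim conjE allE[of _ "\<lambda>w. \<bar>h w\<bar>"]) simp
    also have "\<dots> = (\<integral>w. \<bar>h w\<bar> powr q \<partial>?M') powr (2 / q)"
      using mf(1)[of "\<lambda>w. \<bar>h w\<bar> powr q"] mf(2)[of "\<lambda>w. \<bar>h w\<bar> powr q"] by (simp flip: powr_add)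
    also have "\<dots> \<le> (2 powr q * (?Y + ?Y)) powr (2 / q)"
    proof (rule powr_mono2)
      have hg: "h w = ?g w - (\<integral>x. ?g (w(v := x)) \<partial>?T)" for w
        by (simp add: h_def fb_def I)
      have "(\<integral>w. \<bar>h w\<bar> powr q \<partial>?M') \<le> (\<integral>w. 2 powr q * (\<bar>?g w\<bar> powr q + \<bar>\<integral>x. ?g (w(v := x)) \<partial>?T\<bar> powr q) \<partial>?M')"
        unfolding hg using q by (intro integral_mono I fin powr_diff_le) auto
      also have "\<dots> = 2 powr q * (?Y + (\<integral>w. \<bar>\<integral>x. ?g (w(v := x)) \<partial>?T\<bar> powr q \<partial>?M'))"
        by (simp add: I fin)
      also have "\<dots> \<le> 2 powr q * (?Y + ?Y)"
      proof (intro mult_left_mono add_left_mono)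
        have "(\<integral>w. \<bar>\<integral>x. ?g (w(v := x)) \<partial>?T\<bar> powr q \<partial>?M') = (\<integral>w. \<bar>\<integral>x. ?g (w(v := x)) \<partial>?T\<bar> powr q \<partial>?M)"
          by (subst integral_mlaw_insert[OF fB]) simp
        also have "\<dots> \<le> ?Y" by (rule jen)
        finally show "(\<integral>w. \<bar>\<integral>x. ?g (w(v := x)) \<partial>?T\<bar> powr q \<partial>?M') \<le> ?Y" .
      qed simp
      finally show "(\<integral>w. \<bar>h w\<bar> powr q \<partial>?M') \<le> 2 powr q * (?Y + ?Y)" .
    qed (use q in auto)
    also have "\<dots> = (2 powr (q + 1) * ?Y) powr (2 / q)" by (simp add: powr_add mult.assoc)
    also have "\<dots> = 2 powr ((q + 1) * (2 / q)) * ?Y powr (2 / q)" by (simp add: powr_mult powr_powr)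
    \<comment> \<open>The exponent 2 (q + 1) / q is at most 4 for q \<ge> 1, which is the origin of
      the factor 16.\<close>
    also have "\<dots> \<le> 2 powr 4 * ?Y powr (2 / q)"
    proof (intro mult_right_mono powr_mono)
      show "(q + 1) * (2 / q) \<le> 4" using q by (simp add: field_simps)
    qed auto
    finally show ?thesis by simp
  qed
  show ?case unfolding split mean sum.insert[OF fB] using term1 term2 by linarith
qed

text \<open>The first \<open>N\<close> bits of a site determine the truncated geometric variable (\<open>hval\<close>), and given
  these bits the perturbed variable has law \<open>hker\<close>. Unlike the geometric variables, the bits form a
  reversible Markov chain.\<close>

primrec bits :: "real \<Rightarrow> nat \<Rightarrow> bool list pmf" where
  "bits p 0 = return_pmf []"
| "bits p (Suc N) = bind_pmf (bernoulli_pmf p) (\<lambda>b. map_pmf (Cons b) (bits p N))"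

primrec hval :: "bool list \<Rightarrow> nat" where
  "hval [] = 0"
| "hval (b # bs) = hb (b, hval bs)"

primrec hker :: "real \<Rightarrow> real \<Rightarrow> bool list \<Rightarrow> nat pmf" where
  "hker p \<rho> [] = return_pmf 0"
| "hker p \<rho> (b # bs) = bind_pmf (bitk p \<rho> b) (\<lambda>b'. map_pmf (\<lambda>u. hb (b', u)) (hker p \<rho> bs))"

lemma finite_bits [simp]: "finite (set_pmf (bits p N))"
  by (induction N) auto

lemma finite_hker [simp]: "finite (set_pmf (hker p \<rho> z))"
  by (induction z) auto

lemma slaw_Suc_bind:
  "slaw p \<rho> (Suc N) = bind_pmf (bitp p \<rho>) (\<lambda>x. map_pmf (\<lambda>y. (hb (fst x, fst y), hb (snd x, snd y))) (slaw p \<rho> N))"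
  by (simp add: zip_law_def pair_pmf_conv_bind map_bind_pmf pmf.map_comp o_def)

lemma slaw_conv_bits:
  "slaw p \<rho> N = bind_pmf (bits p N) (\<lambda>z. map_pmf (Pair (hval z)) (hker p \<rho> z))"
proof (induction N)
  case (Suc N)
  have "bind_pmf (bits p (Suc N)) (\<lambda>z. map_pmf (Pair (hval z)) (hker p \<rho> z)) =
    bind_pmf (bernoulli_pmf p) (\<lambda>b. bind_pmf (bits p N) (\<lambda>bs. bind_pmf (bitk p \<rho> b) (\<lambda>b'.
      map_pmf (\<lambda>u. (hb (b, hval bs), hb (b', u))) (hker p \<rho> bs))))"
    by (simp add: bind_assoc_pmf bind_map_pmf map_bind_pmf pmf.map_comp o_def)
  also have "\<dots> = bind_pmf (bernoulli_pmf p) (\<lambda>b. bind_pmf (bitk p \<rho> b) (\<lambda>b'. bind_pmf (bits p N) (\<lambda>bs.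
      map_pmf (\<lambda>u. (hb (b, hval bs), hb (b', u))) (hker p \<rho> bs))))"
    by (intro bind_pmf_cong refl bind_commute_pmf)
  also have "\<dots> = slaw p \<rho> (Suc N)"
    unfolding slaw_Suc_bind Suc bitp_def
    by (simp add: bind_assoc_pmf bind_map_pmf map_bind_pmf pmf.map_comp o_def)
  finally show ?case ..
qed (simp add: bind_return_pmf)

text \<open>Two independent noisy copies both keep the original bit with probability \<rho>^2;
  otherwise at least one of them is redrawn, independently of the other. This is the semigroup
  property in reversible form.\<close>

lemma bitp_semigroup:
  assumes "0 \<le> p" "p \<le> 1" "0 \<le> \<rho>" "\<rho> \<le> 1"
  shows "bitp p (\<rho>\<^sup>2) = bind_pmf (bernoulli_pmf p) (\<lambda>b. pair_pmf (bitk p \<rho> b) (bitk p \<rho> b))"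
proof (rule pmf_eqI)
  fix z :: "bool \<times> bool"
  have r: "0 \<le> \<rho>\<^sup>2" "\<rho>\<^sup>2 \<le> 1" using assms by (auto simp: power_le_one)
  have k: "pmf (map_pmf (Pair b) M) (x, y) = of_bool (b = x) * pmf M y" for b x y :: bool and M
    by (simp add: pair_return_pmf1[symmetric] pmf_pair pmf_return indicator_def)
  obtain x y where z: "z = (x, y)" by (cases z) auto
  have 1: "pmf (bitp p (\<rho>\<^sup>2)) (x, y) = p * (of_bool x * pmf (bitk p (\<rho>\<^sup>2) True) y) + (1 - p) * (of_bool (\<not> x) * pmf (bitk p (\<rho>\<^sup>2) False) y)"
    unfolding bitp_def pmf_bind using assms by (subst integral_bernoulli_pmf) (simp_all add: k)
  have 2: "pmf (bind_pmf (bernoulli_pmf p) (\<lambda>b. pair_pmf (bitk p \<rho> b) (bitk p \<rho> b))) (x, y) =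
    p * (pmf (bitk p \<rho> True) x * pmf (bitk p \<rho> True) y) + (1 - p) * (pmf (bitk p \<rho> False) x * pmf (bitk p \<rho> False) y)"
    unfolding pmf_bind using assms by (subst integral_bernoulli_pmf) (simp_all add: pmf_pair)
  show "pmf (bitp p (\<rho>\<^sup>2)) z = pmf (bind_pmf (bernoulli_pmf p) (\<lambda>b. pair_pmf (bitk p \<rho> b) (bitk p \<rho> b))) z"
    unfolding z 1 2 pmf_bitk[OF assms] pmf_bitk[OF assms(1,2) r]
    by (cases x; cases y; simp; algebra)
qed

text \<open>Bit by bit, \<open>bitp_semigroup\<close> says that two perturbations which are
  independent given the bits of a site form the pair with parameter \<rho>^2.\<close>

lemma slaw_square_conv_bits:
  assumes "0 \<le> p" "p \<le> 1" "0 \<le> \<rho>" "\<rho> \<le> 1"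
  shows "slaw p (\<rho>\<^sup>2) N = bind_pmf (bits p N) (\<lambda>z. pair_pmf (hker p \<rho> z) (hker p \<rho> z))"
proof (induction N)
  case 0
  show ?case by (simp add: pair_return_pmf1 bind_return_pmf)
next
  case (Suc N)
  let ?R = "\<lambda>b1 u b2 v. return_pmf (hb (b1, u), hb (b2, v))"
  have "bind_pmf (bits p (Suc N)) (\<lambda>z. pair_pmf (hker p \<rho> z) (hker p \<rho> z)) =
    bind_pmf (bernoulli_pmf p) (\<lambda>b. bind_pmf (bits p N) (\<lambda>bs. bind_pmf (bitk p \<rho> b) (\<lambda>b1. bind_pmf (hker p \<rho> bs) (\<lambda>u.
      bind_pmf (bitk p \<rho> b) (\<lambda>b2. bind_pmf (hker p \<rho> bs) (\<lambda>v. ?R b1 u b2 v))))))"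
    by (simp add: pair_pmf_def map_pmf_def bind_assoc_pmf bind_return_pmf)
  also have "\<dots> = bind_pmf (bernoulli_pmf p) (\<lambda>b. bind_pmf (bits p N) (\<lambda>bs. bind_pmf (bitk p \<rho> b) (\<lambda>b1. bind_pmf (bitk p \<rho> b) (\<lambda>b2.
      bind_pmf (hker p \<rho> bs) (\<lambda>u. bind_pmf (hker p \<rho> bs) (\<lambda>v. ?R b1 u b2 v))))))"
    by (rule bind_pmf_cong[OF refl], rule bind_pmf_cong[OF refl], rule bind_pmf_cong[OF refl], rule bind_commute_pmf)
  also have "\<dots> = bind_pmf (bernoulli_pmf p) (\<lambda>b. bind_pmf (bitk p \<rho> b) (\<lambda>b1. bind_pmf (bits p N) (\<lambda>bs. bind_pmf (bitk p \<rho> b) (\<lambda>b2.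
      bind_pmf (hker p \<rho> bs) (\<lambda>u. bind_pmf (hker p \<rho> bs) (\<lambda>v. ?R b1 u b2 v))))))"
    by (rule bind_pmf_cong[OF refl], rule bind_commute_pmf)
  also have "\<dots> = bind_pmf (bernoulli_pmf p) (\<lambda>b. bind_pmf (bitk p \<rho> b) (\<lambda>b1. bind_pmf (bitk p \<rho> b) (\<lambda>b2. bind_pmf (bits p N) (\<lambda>bs.
      bind_pmf (hker p \<rho> bs) (\<lambda>u. bind_pmf (hker p \<rho> bs) (\<lambda>v. ?R b1 u b2 v))))))"
    by (rule bind_pmf_cong[OF refl], rule bind_pmf_cong[OF refl], rule bind_commute_pmf)
  also have "\<dots> = slaw p (\<rho>\<^sup>2) (Suc N)"
    unfolding slaw_Suc_bind Suc bitp_semigroup[OF assms]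
    by (simp add: pair_pmf_def map_pmf_def bind_assoc_pmf bind_return_pmf)
  finally show ?case ..
qed

lemma integral_bind_finite:
  fixes f :: "_ \<Rightarrow> real"
  assumes "finite (set_pmf M)" "\<And>x. finite (set_pmf (N x))"
  shows "(\<integral>x. f x \<partial>bind_pmf M N) = (\<integral>x. (\<integral>y. f y \<partial>N x) \<partial>M)"
  by (rule integral_bind_pmf_Fubini) (rule integrable_measure_pmf_finite, simp add: assms)

lemma Pi_pmf_pair_integral:
  fixes f g :: "('v \<Rightarrow> nat) \<Rightarrow> real"
  assumes B: "finite B" and fin: "\<And>v. finite (set_pmf (A v))" "\<And>v. finite (set_pmf (A' v))"
  shows "(\<integral>\<zeta>. f (fst \<circ> \<zeta>) * g (snd \<circ> \<zeta>) \<partial>Pi_pmf B (0, 0) (\<lambda>v. pair_pmf (A v) (A' v))) =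
    (\<integral>w. f w \<partial>Pi_pmf B 0 A) * (\<integral>w. g w \<partial>Pi_pmf B 0 A')"
proof -
  have "(\<integral>\<zeta>. f (fst \<circ> \<zeta>) * g (snd \<circ> \<zeta>) \<partial>Pi_pmf B (0, 0) (\<lambda>v. pair_pmf (A v) (A' v))) =
    (\<integral>z. f (fst z) * g (snd z) \<partial>map_pmf (\<lambda>\<zeta>. (fst \<circ> \<zeta>, snd \<circ> \<zeta>)) (Pi_pmf B (0, 0) (\<lambda>v. pair_pmf (A v) (A' v))))"
    by simp
  also have "\<dots> = (\<integral>w. f w \<partial>Pi_pmf B 0 A) * (\<integral>w. g w \<partial>Pi_pmf B 0 A')"
    unfolding Pi_pmf_pair[OF B] by (rule integral_pair_pmf_mult) (simp_all add: integrable_measure_pmf_finite finite_Pi B fin)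
  finally show ?thesis .
qed

text \<open>The left side is the square of E (f G), where \<open>G\<close> is the conditional
  expectation of the perturbed value given the bits. Cauchy-Schwarz gives E f^2 times E G^2, and E
  G^2 belongs to two conditionally independent perturbations, which have parameter \<rho>^2.\<close>

lemma noise_doubling:
  fixes f :: "('v \<Rightarrow> nat) \<Rightarrow> real"
  assumes p: "0 < p" "p < 1" and \<rho>: "0 \<le> \<rho>" "\<rho> \<le> 1" and B: "finite B"
  shows "(\<integral>z. f (fst z) * f (snd z) \<partial>plaw p \<rho> N B)\<^sup>2 \<le>
    (\<integral>w. (f w)\<^sup>2 \<partial>mlaw p N B) * (\<integral>z. f (fst z) * f (snd z) \<partial>plaw p (\<rho>\<^sup>2) N B)"
proof -
  let ?M = "Pi_pmf B [] (\<lambda>_. bits p N)"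
  define V where "V = (\<lambda>Z :: 'v \<Rightarrow> bool list. \<lambda>v. if v \<in> B then hval (Z v) else 0)"
  define G where "G = (\<lambda>Z :: 'v \<Rightarrow> bool list. \<integral>w. f w \<partial>Pi_pmf B 0 (\<lambda>v. hker p \<rho> (Z v)))"
  have fM: "finite (set_pmf ?M)" by (simp add: finite_Pi B)
  have e1: "(\<integral>z. g (fst z) * h (snd z) \<partial>plaw p \<rho> N B) = (\<integral>Z. g (V Z) * (\<integral>w. h w \<partial>Pi_pmf B 0 (\<lambda>v. hker p \<rho> (Z v))) \<partial>?M)"
    for g h :: "('v \<Rightarrow> nat) \<Rightarrow> real"
  proof -
    have "(\<integral>z. g (fst z) * h (snd z) \<partial>plaw p \<rho> N B) =
      (\<integral>\<zeta>. g (fst \<circ> \<zeta>) * h (snd \<circ> \<zeta>) \<partial>bind_pmf ?M (\<lambda>Z. Pi_pmf B (0, 0) (\<lambda>v. pair_pmf (return_pmf (hval (Z v))) (hker p \<rho> (Z v)))))"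
      unfolding plaw_def integral_map_pmf slaw_conv_bits
      by (subst Pi_pmf_bind[OF B, where d' = "[]"]) (simp add: pair_return_pmf1)
    also have "\<dots> = (\<integral>Z. (\<integral>\<zeta>. g (fst \<circ> \<zeta>) * h (snd \<circ> \<zeta>) \<partial>Pi_pmf B (0, 0) (\<lambda>v. pair_pmf (return_pmf (hval (Z v))) (hker p \<rho> (Z v)))) \<partial>?M)"
      by (rule integral_bind_finite) (simp_all add: fM finite_Pi B)
    also have "\<dots> = (\<integral>Z. g (V Z) * (\<integral>w. h w \<partial>Pi_pmf B 0 (\<lambda>v. hker p \<rho> (Z v))) \<partial>?M)"
      by (subst Pi_pmf_pair_integral[OF B]) (simp_all add: B V_def)
    finally show ?thesis .
  qed
  have e2: "(\<integral>z. f (fst z) * f (snd z) \<partial>plaw p (\<rho>\<^sup>2) N B) = (\<integral>Z. (G Z)\<^sup>2 \<partial>?M)"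
  proof -
    have "(\<integral>z. f (fst z) * f (snd z) \<partial>plaw p (\<rho>\<^sup>2) N B) =
      (\<integral>\<zeta>. f (fst \<circ> \<zeta>) * f (snd \<circ> \<zeta>) \<partial>bind_pmf ?M (\<lambda>Z. Pi_pmf B (0, 0) (\<lambda>v. pair_pmf (hker p \<rho> (Z v)) (hker p \<rho> (Z v)))))"
      unfolding plaw_def integral_map_pmf slaw_square_conv_bits[OF less_imp_le[OF p(1)] less_imp_le[OF p(2)] \<rho>]
      by (subst Pi_pmf_bind[OF B, where d' = "[]"]) simp
    also have "\<dots> = (\<integral>Z. (\<integral>\<zeta>. f (fst \<circ> \<zeta>) * f (snd \<circ> \<zeta>) \<partial>Pi_pmf B (0, 0) (\<lambda>v. pair_pmf (hker p \<rho> (Z v)) (hker p \<rho> (Z v)))) \<partial>?M)"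
      by (rule integral_bind_finite) (simp_all add: fM finite_Pi B)
    also have "\<dots> = (\<integral>Z. (G Z)\<^sup>2 \<partial>?M)"
      by (subst Pi_pmf_pair_integral[OF B]) (simp_all add: G_def power2_eq_square)
    finally show ?thesis .
  qed
  have "(\<integral>w. (f w)\<^sup>2 \<partial>mlaw p N B) = (\<integral>z. (f (fst z))\<^sup>2 * 1 \<partial>plaw p \<rho> N B)"
    unfolding plaw_marginals(1)[OF B p \<rho>, symmetric] by simp
  also have "\<dots> = (\<integral>Z. (f (V Z))\<^sup>2 \<partial>?M)" using e1[of "\<lambda>w. (f w)\<^sup>2" "\<lambda>_. 1"] by simp
  finally have e3: "(\<integral>w. (f w)\<^sup>2 \<partial>mlaw p N B) = (\<integral>Z. (f (V Z))\<^sup>2 \<partial>?M)" .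
  have "(\<integral>z. f (fst z) * f (snd z) \<partial>plaw p \<rho> N B) = (\<integral>Z. f (V Z) * G Z \<partial>?M)"
    unfolding e1[of f f] G_def ..
  then show ?thesis unfolding e2 e3 using CS_pmf[OF fM, of "\<lambda>Z. f (V Z)" G] by simp
qed

subsection \<open>Influences of the averaged passage time\<close>

text \<open>An essential site lies on every maximal path. Working with essential sites avoids the
  choice of a maximal path among ties.\<close>

definition ess :: "nat \<Rightarrow> (nat \<times> nat \<Rightarrow> nat) \<Rightarrow> nat \<times> nat \<Rightarrow> bool" where
  "ess n w u \<longleftrightarrow> lp (w(u := 0)) n n < lp w n n"

lemma lp_zero_le:
  "lp (w(u := 0)) i j \<le> lp w i j" "lp w i j \<le> lp (w(u := 0)) i j + w u"
proof -
  show "lp (w(u := 0)) i j \<le> lp w i j" by (rule lp_mono_weights) simp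
  obtain P where P: "finite P" "lp w i j = sum w P" "\<forall>w'. sum w' P \<le> lp w' i j" using lp_path[of i j w] by blast
  have "sum w P \<le> sum (\<lambda>x. (w(u := 0)) x + (if x = u then w u else 0)) P" by (rule sum_mono) simp
  also have "\<dots> \<le> sum (w(u := 0)) P + w u" using P(1) by (simp add: sum.distrib sum.delta)
  finally show "lp w i j \<le> lp (w(u := 0)) i j + w u" using P(2) P(3)[rule_format, of "w(u := 0)"] by linarith
qed

lemma ess_card:
  assumes "finite S" "\<And>a b. (a, b) \<in> S \<Longrightarrow> s \<le> a + b \<and> a + b < s + k"
  shows "card {u \<in> S. ess n w u} \<le> k"
proof -
  obtain P where P: "finite P" "inj_on (\<lambda>(a, b). a + b) P" "lp w n n = sum w P" "\<forall>w'. sum w' P \<le> lp w' n n"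
    using lp_path[of n n w] by blast
  have "u \<in> P" if "ess n w u" for u
  proof (rule ccontr)
    assume "u \<notin> P"
    then have "sum (w(u := 0)) P = sum w P" by (intro sum.cong) auto
    then show False using that P(3,4) unfolding ess_def by (metis leD)
  qed
  then have sub: "{u \<in> S. ess n w u} \<subseteq> P" by auto
  have "card {u \<in> S. ess n w u} = card ((\<lambda>(a, b). a + b) ` {u \<in> S. ess n w u})"
    by (rule card_image[symmetric]) (rule inj_on_subset[OF P(2) sub])
  also have "\<dots> \<le> card {s..<s + k}" using assms by (intro card_mono) auto
  finally show ?thesis by simp
qed

lemma ess_range: "ess n w u \<Longrightarrow> u \<in> {..n} \<times> {..n}"
proof (rule ccontr)
  assume e: "ess n w u" and "u \<notin> {..n} \<times> {..n}"
  then have "lp (w(u := 0)) n n = lp w n n" by (intro lp_cong) auto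
  then show False using e by (simp add: ess_def)
qed

lemma sh_upd:
  "sh i j (w(v := 0)) = (if i \<le> fst v \<and> j \<le> snd v then (sh i j w)((fst v - i, snd v - j) := 0) else sh i j w)"
  by (cases v) (auto simp: sh_def fun_eq_iff)

definition avT :: "nat \<Rightarrow> nat \<Rightarrow> (nat \<times> nat \<Rightarrow> nat) \<Rightarrow> real" where
  "avT n L w = (\<Sum>z\<in>{..<L} \<times> {..<L}. real (lp (sh (fst z) (snd z) w) n n)) / (real L)\<^sup>2"

definition essi :: "nat \<Rightarrow> (nat \<times> nat \<Rightarrow> nat) \<Rightarrow> nat \<times> nat \<Rightarrow> nat \<times> nat \<Rightarrow> real" where
  "essi n w v z = of_bool (fst z \<le> fst v \<and> snd z \<le> snd v \<and> ess n (sh (fst z) (snd z) w) (fst v - fst z, snd v - snd z))"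

definition avW :: "nat \<Rightarrow> nat \<Rightarrow> (nat \<times> nat \<Rightarrow> nat) \<Rightarrow> nat \<times> nat \<Rightarrow> real" where
  "avW n L w v = (\<Sum>z\<in>{..<L} \<times> {..<L}. essi n w v z) / (real L)\<^sup>2"

lemma avW_bounds: "0 \<le> avW n L w v" "avW n L w v \<le> 1"
proof -
  show "0 \<le> avW n L w v" by (auto simp: avW_def essi_def intro!: divide_nonneg_nonneg sum_nonneg)
  have "(\<Sum>z\<in>{..<L} \<times> {..<L}. essi n w v z) \<le> (\<Sum>z\<in>{..<L} \<times> {..<L}. 1)" by (rule sum_mono) (simp add: essi_def)
  also have "\<dots> = (real L)\<^sup>2" by (simp add: power2_eq_square)
  finally show "avW n L w v \<le> 1" unfolding avW_def by (cases "L = 0") (auto simp: divide_le_eq)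
qed

text \<open>Setting a weight to zero lowers a passage time by at most that weight, and only when the
  site is essential for the translate in question.\<close>

lemma avT_influence: "\<bar>avT n L w - avT n L (w(v := 0))\<bar> \<le> real (w v) * avW n L w v"
proof -
  have pt: "0 \<le> real (lp (sh i j w) n n) - real (lp (sh i j (w(v := 0))) n n) \<and>
    real (lp (sh i j w) n n) - real (lp (sh i j (w(v := 0))) n n) \<le> real (w v) * essi n w v (i, j)" for i j
  proof (cases "i \<le> fst v \<and> j \<le> snd v")
    case False
    then show ?thesis by (simp only: sh_upd if_not_P[OF False]) (use False in \<open>auto simp: essi_def\<close>)
  next
    case True
    let ?s = "sh i j w" and ?u = "(fst v - i, snd v - j)"
    have "?s ?u = w v" using True by (simp add: sh_def)
    then have "lp (?s(?u := 0)) n n \<le> lp ?s n n" "lp ?s n n \<le> lp (?s(?u := 0)) n n + w v"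
      using lp_zero_le[where w = ?s and u = ?u and i = n and j = n] by auto
    then show ?thesis using True unfolding sh_upd by (auto simp: essi_def ess_def)
  qed
  have "avT n L w - avT n L (w(v := 0)) =
    (\<Sum>z\<in>{..<L} \<times> {..<L}. real (lp (sh (fst z) (snd z) w) n n) - real (lp (sh (fst z) (snd z) (w(v := 0))) n n)) / (real L)\<^sup>2"
    unfolding avT_def sum_subtractf diff_divide_distrib ..
  moreover have "0 \<le> (\<Sum>z\<in>{..<L} \<times> {..<L}. real (lp (sh (fst z) (snd z) w) n n) - real (lp (sh (fst z) (snd z) (w(v := 0))) n n))"
    using pt by (intro sum_nonneg) simp
  moreover have "(\<Sum>z\<in>{..<L} \<times> {..<L}. real (lp (sh (fst z) (snd z) w) n n) - real (lp (sh (fst z) (snd z) (w(v := 0))) n n)) \<le>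
     (\<Sum>z\<in>{..<L} \<times> {..<L}. real (w v) * essi n w v z)"
  proof (rule sum_mono)
    fix z
    show "real (lp (sh (fst z) (snd z) w) n n) - real (lp (sh (fst z) (snd z) (w(v := 0))) n n) \<le> real (w v) * essi n w v z"
      using pt[of "fst z" "snd z"] by (simp only: prod.collapse)
  qed
  ultimately show ?thesis
    unfolding avW_def by (simp add: sum_distrib_left[symmetric] divide_right_mono)
qed

lemma mlaw_translate:
  fixes F :: "(nat \<times> nat \<Rightarrow> nat) \<Rightarrow> real"
  assumes "\<And>w w'. (\<And>a b. a \<le> n \<Longrightarrow> b \<le> n \<Longrightarrow> w (a, b) = w' (a, b)) \<Longrightarrow> F w = F w'"
    and "n + i \<le> R" "n + j \<le> R"
  shows "(\<integral>w. F (sh i j w) \<partial>mlaw p N ({..R} \<times> {..R})) = (\<integral>w. F w \<partial>mlaw p N ({..n} \<times> {..n}))"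
proof -
  have "map_pmf (\<lambda>w. F (w \<circ> (\<lambda>(a, b). (a + i, b + j)))) (mlaw p N ({..R} \<times> {..R})) = 
    map_pmf F (Pi_pmf ({..n} \<times> {..n}) 0 ((\<lambda>_. tgeo p N) \<circ> (\<lambda>(a, b). (a + i, b + j))))"
    unfolding mlaw_def
  proof (rule map_pmf_reindex)
    show "F w = F w'" if "\<And>b. b \<in> {..n} \<times> {..n} \<Longrightarrow> w b = w' b" for w w'
      by (rule assms(1)) (rule that, simp)
  qed (use assms(2,3) in \<open>auto simp: inj_on_def\<close>)
  then have "map_pmf (\<lambda>w. F (sh i j w)) (mlaw p N ({..R} \<times> {..R})) = map_pmf F (mlaw p N ({..n} \<times> {..n}))"
    by (simp add: sh_conv_comp mlaw_def o_def)
  from arg_cong[where f = "\<lambda>M. \<integral>x. x \<partial>measure_pmf M", OF this] show ?thesis by simp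
qed

lemma integral_sum_finite:
  fixes f :: "'b \<Rightarrow> 'a \<Rightarrow> real"
  assumes "finite (set_pmf M)"
  shows "(\<integral>x. (\<Sum>i\<in>I. f i x) \<partial>M) = (\<Sum>i\<in>I. \<integral>x. f i x \<partial>M)"
  by (rule Bochner_Integration.integral_sum) (rule integrable_measure_pmf_finite[where 'b = real, OF assms])

text \<open>Seen from the translates, \<open>v\<close> runs over an L \<times> L block, which meets
  fewer than 2 L antidiagonals and so contains at most 2 L essential sites of one field. Division by
  the L^2 translates leaves 2 / L, without any information about the influence of a single
  site.\<close>

lemma avW_mean:
  fixes p :: real and N n L R :: nat
  assumes L: "1 \<le> L" and R: "n + L \<le> R"
  defines "B \<equiv> {..R} \<times> {..R}"
  defines "e \<equiv> (\<lambda>v. \<integral>w. avW n L w v \<partial>mlaw p N B)"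
  shows "0 \<le> e v" "e v \<le> 2 / real L" "(\<Sum>v\<in>B. e v) \<le> 2 * real n + 1"
proof -
  have fB: "finite B" by (simp add: B_def)
  define \<pi> where "\<pi> = (\<lambda>u. \<integral>w. of_bool (ess n w u) \<partial>mlaw p N ({..n} \<times> {..n}) :: real)"
  have fin: "finite (set_pmf (mlaw p N B))" "finite (set_pmf (mlaw p N ({..n} \<times> {..n})))" using fB by simp_all
  show "0 \<le> e v" unfolding e_def by (simp add: avW_bounds)
  have essi_mean: "(\<integral>w. essi n w v z \<partial>mlaw p N B) = (if fst z \<le> fst v \<and> snd z \<le> snd v then \<pi> (fst v - fst z, snd v - snd z) else 0)"
    if "z \<in> {..<L} \<times> {..<L}" for v z
  proof (cases "fst z \<le> fst v \<and> snd z \<le> snd v")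
    case True
    let ?u = "(fst v - fst z, snd v - snd z)"
    have "(\<integral>w. of_bool (ess n (sh (fst z) (snd z) w) ?u) \<partial>mlaw p N ({..R} \<times> {..R})) = \<pi> ?u"
      unfolding \<pi>_def
    proof (rule mlaw_translate)
      fix w w' :: "nat \<times> nat \<Rightarrow> nat" assume h: "\<And>a b. a \<le> n \<Longrightarrow> b \<le> n \<Longrightarrow> w (a, b) = w' (a, b)"
      have "lp w n n = lp w' n n" "lp (w(?u := 0)) n n = lp (w'(?u := 0)) n n" by (rule lp_cong; use h in simp)+
      then show "(of_bool (ess n w ?u) :: real) = of_bool (ess n w' ?u)" by (simp add: ess_def)
    qed (use that R in auto)
    then show ?thesis using True by (simp add: essi_def B_def)
  next
    case False
    then show ?thesis by (auto simp: essi_def)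
  qed
  have ev: "e v = (\<Sum>z\<in>{..<L} \<times> {..<L}. \<integral>w. essi n w v z \<partial>mlaw p N B) / (real L)\<^sup>2" for v
    unfolding e_def avW_def by (simp add: integral_sum_finite fin)
  have card_mean: "(\<Sum>u\<in>S. \<pi> u) \<le> real k"
    if "finite S" "\<And>a b. (a, b) \<in> S \<Longrightarrow> s \<le> a + b \<and> a + b < s + k" for S s k
  proof -
    have "(\<Sum>u\<in>S. \<pi> u) = (\<integral>w. (\<Sum>u\<in>S. of_bool (ess n w u)) \<partial>mlaw p N ({..n} \<times> {..n}))"
      unfolding \<pi>_def by (simp add: integral_sum_finite fin)
    also have "\<dots> = (\<integral>w. real (card {u \<in> S. ess n w u}) \<partial>mlaw p N ({..n} \<times> {..n}))"
      using that(1) by (simp add: of_bool_def sum.If_cases Int_def)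
    also have "\<dots> \<le> (\<integral>w. real k \<partial>mlaw p N ({..n} \<times> {..n}))"
      by (intro integral_mono integrable_measure_pmf_finite fin) (use ess_card[OF that] in simp)
    finally show ?thesis by simp
  qed
  have \<pi>0: "0 \<le> \<pi> u" for u by (simp add: \<pi>_def)
  show "e v \<le> 2 / real L"
  proof -
    let ?Z = "{z \<in> {..<L} \<times> {..<L}. fst z \<le> fst v \<and> snd z \<le> snd v}"
    let ?h = "\<lambda>z. (fst v - fst z, snd v - snd z)"
    have "(\<Sum>z\<in>{..<L} \<times> {..<L}. \<integral>w. essi n w v z \<partial>mlaw p N B) = (\<Sum>z\<in>?Z. \<pi> (?h z))"
      by (simp add: essi_mean sum.If_cases Int_def)
    also have "\<dots> = (\<Sum>u\<in>?h ` ?Z. \<pi> u)"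
      by (subst sum.reindex) (auto simp: inj_on_def)
    also have "\<dots> \<le> real (2 * L)"
    \<comment> \<open>The truncated subtraction takes care of sites near the origin, where fewer
      antidiagonals are met.\<close>
    proof (rule card_mean[where s = "fst v + snd v + 1 - 2 * L"])
      show "finite (?h ` ?Z)" by (rule finite_imageI) (rule finite_subset[of _ "{..<L} \<times> {..<L}"], auto)
    qed (use L in auto)
    finally have "e v \<le> real (2 * L) / (real L)\<^sup>2" unfolding ev by (rule divide_right_mono) simp
    also have "\<dots> = 2 / real L" using L by (simp add: power2_eq_square)
    finally show ?thesis .
  qed
  show "(\<Sum>v\<in>B. e v) \<le> 2 * real n + 1"
  proof -
    have "(\<Sum>v\<in>B. \<Sum>z\<in>{..<L} \<times> {..<L}. \<integral>w. essi n w v z \<partial>mlaw p N B) = (\<Sum>z\<in>{..<L} \<times> {..<L}. \<Sum>v\<in>B. \<integral>w. essi n w v z \<partial>mlaw p N B)"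
      by (rule sum.swap)
    also have "\<dots> \<le> (\<Sum>z\<in>{..<L} \<times> {..<L}. real (2 * n + 1))"
    proof (rule sum_mono)
      fix z assume z: "z \<in> {..<L} \<times> {..<L}"
      let ?V = "{v \<in> B. fst z \<le> fst v \<and> snd z \<le> snd v}"
      let ?h = "\<lambda>v. (fst v - fst z, snd v - snd z)"
      have "(\<Sum>v\<in>B. \<integral>w. essi n w v z \<partial>mlaw p N B) = (\<Sum>v\<in>?V. \<pi> (?h v))"
        using z fB by (simp add: essi_mean sum.If_cases Int_def)
      also have "\<dots> = (\<Sum>u\<in>?h ` ?V. \<pi> u)"
        by (subst sum.reindex) (auto simp: inj_on_def)
      also have "\<dots> = (\<Sum>u\<in>?h ` ?V \<inter> {..n} \<times> {..n}. \<pi> u)"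
      proof (rule sum.mono_neutral_right)
        show "finite (?h ` ?V)" using fB by simp
        have "\<pi> u = 0" if "u \<notin> {..n} \<times> {..n}" for u
        proof -
          have "\<not> ess n w u" for w using ess_range[of n w u] that by blast
          then show ?thesis by (simp add: \<pi>_def)
        qed
        then show "\<forall>i\<in>?h ` ?V - ?h ` ?V \<inter> {..n} \<times> {..n}. \<pi> i = 0" by blast
      qed auto
      also have "\<dots> \<le> real (2 * n + 1)"
        by (rule card_mean[where s = 0]) auto
      finally show "(\<Sum>v\<in>B. \<integral>w. essi n w v z \<partial>mlaw p N B) \<le> real (2 * n + 1)" .
    qed
    also have "\<dots> = real (2 * n + 1) * (real L)\<^sup>2" by (simp add: power2_eq_square)
    finally have "(\<Sum>v\<in>B. e v) \<le> real (2 * n + 1) * (real L)\<^sup>2 / (real L)\<^sup>2"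
      unfolding ev sum_divide_distrib[symmetric] by (rule divide_right_mono) simp
    then show ?thesis using L by simp
  qed
qed

section \<open>Weights against influences\<close>

lemma tgeo_moment:
  assumes "0 < p" "p < 1"
  shows "\<exists>K\<ge>0. \<forall>N. (\<integral>x. real x ^ m \<partial>tgeo p N) \<le> K"
proof -
  obtain K where K: "0 \<le> K" "(\<integral>\<^sup>+k. ennreal (real k ^ m) \<partial>geo (1 - p)) \<le> ennreal K"
    using geo_moment[of "1 - p" m] assms by (metis diff_gt_0_iff_gt diff_less_eq less_add_same_cancel1 less_eq_real_def)
  have "(\<integral>x. real x ^ m \<partial>tgeo p N) \<le> K" for N
  proof -
    have "ennreal (\<integral>x. real x ^ m \<partial>tgeo p N) = (\<integral>\<^sup>+x. ennreal (real x ^ m) \<partial>tgeo p N)"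
      by (rule nn_integral_eq_integral[symmetric]) (simp_all add: integrable_measure_pmf_finite)
    also have "\<dots> = (\<integral>\<^sup>+x. ennreal (real (min x N) ^ m) \<partial>geo (1 - p))"
      by (simp add: tgeo_def geo_def)
    also have "\<dots> \<le> (\<integral>\<^sup>+x. ennreal (real x ^ m) \<partial>geo (1 - p))"
      by (intro nn_integral_mono ennreal_leI power_mono) auto
    also have "\<dots> \<le> ennreal K" by (rule K)
    finally show ?thesis using K(1) by (simp add: ennreal_le_iff)
  qed
  with K(1) show ?thesis by blast
qed

text \<open>The unbounded factor is cut at X^2 \<le> l. Below this level it costs a factor l; above
  it, the 40th moment pays l^(-19). With e the mean of \<open>W\<close> and l = e^(-1/20), both
  terms are multiples of e^(19/20), so only 1/20 of the exponent is lost.\<close>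

lemma weighted_moment:
  fixes W :: "'a \<Rightarrow> real" and X :: "'a \<Rightarrow> nat"
  assumes fin: "finite (set_pmf M)" and W: "\<And>x. 0 \<le> W x" "\<And>x. W x \<le> 1"
    and K: "(\<integral>x. real (X x) ^ 40 \<partial>M) \<le> K" "0 \<le> K"
  shows "(\<integral>x. (real (X x))\<^sup>2 * W x \<partial>M) \<le> (1 + K) * (\<integral>x. W x \<partial>M) powr (19 / 20)"
proof -
  note I = integrable_measure_pmf_finite[where 'b = real, OF fin]
  define e where "e = (\<integral>x. W x \<partial>M)"
  have e0: "0 \<le> e" using W by (simp add: e_def)
  show ?thesis
  proof (cases "e = 0")
    case True
    have "(\<integral>x. (real (X x))\<^sup>2 * sqrt (W x) * sqrt (W x) \<partial>M)\<^sup>2 \<le> (\<integral>x. ((real (X x))\<^sup>2 * sqrt (W x))\<^sup>2 \<partial>M) * (\<integral>x. (sqrt (W x))\<^sup>2 \<partial>M)"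
      by (rule CS_pmf[OF fin])
    also have "(\<integral>x. (sqrt (W x))\<^sup>2 \<partial>M) = e" using W by (simp add: e_def)
    finally have "(\<integral>x. (real (X x))\<^sup>2 * W x \<partial>M)\<^sup>2 \<le> 0" using True W by (simp add: mult.assoc)
    then have "(\<integral>x. (real (X x))\<^sup>2 * W x \<partial>M) = 0" by simp
    then show ?thesis using True by (simp add: e_def)
  next
    case False
    then have e: "0 < e" using e0 by simp
    define l where "l = e powr (- 1 / 20)"
    have l: "0 < l" using e by (simp add: l_def)
    have pt: "y\<^sup>2 * v \<le> l * v + y ^ 40 / l ^ 19" if y: "0 \<le> y" and v: "0 \<le> v" "v \<le> 1" for y v :: real
    proof (cases "y\<^sup>2 \<le> l")
      case True
      then have "y\<^sup>2 * v \<le> l * v" using v by (intro mult_right_mono) auto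
      moreover have "0 \<le> y ^ 40 / l ^ 19" using y l by simp
      ultimately show ?thesis by linarith
    next
      case False
      then have "l ^ 19 \<le> (y\<^sup>2) ^ 19" using l by (intro power_mono) auto
      then have "y\<^sup>2 * l ^ 19 \<le> y\<^sup>2 * (y\<^sup>2) ^ 19" by (intro mult_left_mono) auto
      also have "\<dots> = y ^ 40" by (simp flip: power_mult power_add)
      finally have "y\<^sup>2 \<le> y ^ 40 / l ^ 19" using l by (simp add: field_simps)
      moreover have "y\<^sup>2 * v \<le> y\<^sup>2" using v by (simp add: mult_left_le)
      moreover have "0 \<le> l * v" using l v by simp
      ultimately show ?thesis by linarith
    qed
    have "(\<integral>x. (real (X x))\<^sup>2 * W x \<partial>M) \<le> (\<integral>x. l * W x + real (X x) ^ 40 / l ^ 19 \<partial>M)"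
      using pt W by (intro integral_mono I) auto
    also have "\<dots> = l * e + (\<integral>x. real (X x) ^ 40 \<partial>M) / l ^ 19" by (simp add: I e_def)
    also have "\<dots> \<le> l * e + K / l ^ 19" using K l by (intro add_left_mono divide_right_mono) auto
    also have "l * e = e powr (19 / 20)" 
    proof -
      have "l * e = e powr (- 1 / 20) * e powr 1" using e by (simp add: l_def)
      also have "\<dots> = e powr (- 1 / 20 + 1)" by (rule powr_add[symmetric])
      also have "\<dots> = e powr (19 / 20)" by simp
      finally show ?thesis .
    qed
    also have "K / l ^ 19 = K * e powr (19 / 20)"
    proof -
      have "l ^ 19 = e powr (- 1 / 20 * 19)" using e by (simp add: l_def powr_power)
      also have "\<dots> = inverse (e powr (19 / 20))" by (simp flip: powr_minus)
      finally show ?thesis by (simp only: divide_inverse inverse_inverse_eq)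
    qed
    finally show ?thesis by (simp add: e_def algebra_simps)
  qed
qed

text \<open>The exponents 19/20 and 99/50 multiply to 1.881. One power of the mean influence is kept
  for the sum over the sites, of order n, and the remaining 0.881 is bounded through the supremum 2
  / L. That 100/99 is close to 1 and the moment is high brings this remainder close to 1.\<close>

lemma influence_sum:
  assumes p: "0 < p" "p < 1"
  shows "\<exists>K>0. \<forall>n L R N. 1 \<le> L \<longrightarrow> n + L \<le> R \<longrightarrow>
    (\<Sum>v\<in>{..R} \<times> {..R}. 16 * (\<integral>w. \<bar>avT n L w - avT n L (w(v := 0))\<bar> powr (100 / 99) \<partial>mlaw p N ({..R} \<times> {..R})) powr (2 / (100 / 99)))
    \<le> K * (2 * real n + 1) * (2 / real L) powr 0.881"
proof -
  obtain K where K: "0 \<le> K" "\<And>N. (\<integral>x. real x ^ 40 \<partial>tgeo p N) \<le> K"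
    using tgeo_moment[OF p, of 40] by blast
  define K' where "K' = 16 * (1 + K) powr (99 / 50)"
  have "(\<Sum>v\<in>{..R} \<times> {..R}. 16 * (\<integral>w. \<bar>avT n L w - avT n L (w(v := 0))\<bar> powr (100 / 99) \<partial>mlaw p N ({..R} \<times> {..R})) powr (2 / (100 / 99)))
    \<le> K' * (2 * real n + 1) * (2 / real L) powr 0.881" if L: "1 \<le> L" and R: "n + L \<le> R" for n L R N
  proof -
    define B where "B = {..R} \<times> {..R}"
    let ?M = "mlaw p N B"
    have fB: "finite B" by (simp add: B_def)
    have fin: "finite (set_pmf ?M)" using fB by simp
    define e where "e = (\<lambda>v. \<integral>w. avW n L w v \<partial>?M)"
    have E: "0 \<le> e v" "e v \<le> 2 / real L" "(\<Sum>v\<in>B. e v) \<le> 2 * real n + 1" for v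
      unfolding e_def B_def by (rule avW_mean[OF L R])+
    have one: "16 * (\<integral>w. \<bar>avT n L w - avT n L (w(v := 0))\<bar> powr (100 / 99) \<partial>?M) powr (2 / (100 / 99)) \<le>
      K' * (2 / real L) powr 0.881 * e v" if v: "v \<in> B" for v
    proof -
      define J where "J = (\<integral>w. \<bar>avT n L w - avT n L (w(v := 0))\<bar> powr (100 / 99) \<partial>?M)"
      have m40: "(\<integral>w. real (w v) ^ 40 \<partial>?M) \<le> K"
      proof -
        have "map_pmf (\<lambda>w. w v) ?M = tgeo p N" unfolding mlaw_def using fB v by (simp add: Pi_pmf_component)
        then have "(\<integral>w. real (w v) ^ 40 \<partial>?M) = (\<integral>x. real x ^ 40 \<partial>tgeo p N)"
          by (metis (no_types, lifting) integral_map_pmf Bochner_Integration.integral_cong)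
        then show ?thesis using K(2) by simp
      qed
      have "J \<le> (\<integral>w. (real (w v))\<^sup>2 * avW n L w v \<partial>?M)"
        unfolding J_def
      proof (intro integral_mono integrable_measure_pmf_finite fin)
        fix w
        have "\<bar>avT n L w - avT n L (w(v := 0))\<bar> powr (100 / 99) \<le> (real (w v) * avW n L w v) powr (100 / 99)"
          using avT_influence[of n L w v] by (intro powr_mono2) auto
        also have "\<dots> = real (w v) powr (100 / 99) * avW n L w v powr (100 / 99)"
          by (rule powr_mult; simp add: avW_bounds)
        also have "\<dots> \<le> (real (w v))\<^sup>2 * avW n L w v"
        proof (rule mult_mono)
          show "real (w v) powr (100 / 99) \<le> (real (w v))\<^sup>2"
          proof (cases "w v = 0")
            case False
            then have "1 \<le> real (w v)" by simp
            then have "real (w v) powr (100 / 99) \<le> real (w v) powr 2" by (intro powr_mono) auto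
            then show ?thesis using False by simp
          qed simp
          show "avW n L w v powr (100 / 99) \<le> avW n L w v"
            using powr_mono'[of 1 "100 / 99" "avW n L w v"] avW_bounds[of n L w v] by simp
        qed (auto simp: avW_bounds)
        finally show "\<bar>avT n L w - avT n L (w(v := 0))\<bar> powr (100 / 99) \<le> (real (w v))\<^sup>2 * avW n L w v" .
      qed
      also have "\<dots> \<le> (1 + K) * e v powr (19 / 20)"
        unfolding e_def by (rule weighted_moment[OF fin]) (use avW_bounds m40 K in auto)
      finally have "J powr (99 / 50) \<le> ((1 + K) * e v powr (19 / 20)) powr (99 / 50)"
        by (intro powr_mono2) (auto simp: J_def)
      also have "\<dots> = (1 + K) powr (99 / 50) * e v powr 1.881"
        using K by (simp add: powr_mult powr_powr)
      also have "e v powr 1.881 = e v powr (1 + 0.881)" by simp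
      also have "\<dots> = e v * e v powr 0.881" using E(1)[of v] by (simp only: powr_add powr_one)
      also have "(1 + K) powr (99 / 50) * (e v * e v powr 0.881) \<le> (1 + K) powr (99 / 50) * (e v * (2 / real L) powr 0.881)"
        by (intro mult_left_mono powr_mono2 E) auto
      finally have "16 * J powr (2 / (100 / 99)) \<le> K' * (2 / real L) powr 0.881 * e v" by (simp add: K'_def mult_ac)
      then show ?thesis by (simp only: J_def)
    qed
    have "(\<Sum>v\<in>B. 16 * (\<integral>w. \<bar>avT n L w - avT n L (w(v := 0))\<bar> powr (100 / 99) \<partial>?M) powr (2 / (100 / 99))) \<le>
      (\<Sum>v\<in>B. K' * (2 / real L) powr 0.881 * e v)" by (rule sum_mono[OF one])
    also have "\<dots> = K' * (2 / real L) powr 0.881 * (\<Sum>v\<in>B. e v)" by (simp add: sum_distrib_left)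
    also have "\<dots> \<le> K' * (2 / real L) powr 0.881 * (2 * real n + 1)"
      using E(3) K by (intro mult_left_mono) (auto simp: K'_def)
    finally show ?thesis by (simp add: B_def mult_ac)
  qed
  moreover have "0 < K'" using K by (simp add: K'_def)
  ultimately show ?thesis by blast
qed

subsection \<open>Bounding the covariance\<close>

text \<open>Iterated \<open>noise_doubling\<close>. The inequality is squared at each step, which
  needs a nonnegative left side; hence the powers are even from the start.\<close>

lemma noise_iterate:
  fixes f :: "('v \<Rightarrow> nat) \<Rightarrow> real"
  assumes p: "0 < p" "p < 1" and \<rho>: "0 \<le> \<rho>" "\<rho> \<le> 1" and B: "finite B"
  shows "(\<integral>z. f (fst z) * f (snd z) \<partial>plaw p \<rho> N B) ^ (2 ^ Suc k) \<le>
    (\<integral>w. (f w)\<^sup>2 \<partial>mlaw p N B) ^ (2 ^ Suc k - 1) * (\<integral>z. f (fst z) * f (snd z) \<partial>plaw p (\<rho> ^ (2 ^ Suc k)) N B)"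
proof -
  define v where "v = (\<integral>w. (f w)\<^sup>2 \<partial>mlaw p N B)"
  define C where "C = (\<lambda>\<rho>. \<integral>z. f (fst z) * f (snd z) \<partial>plaw p \<rho> N B)"
  have v: "0 \<le> v" by (simp add: v_def)
  have dbl: "(C r)\<^sup>2 \<le> v * C (r\<^sup>2)" if "0 \<le> r" "r \<le> 1" for r
    unfolding C_def v_def by (rule noise_doubling) (use p B that in auto)
  have "C \<rho> ^ (2 ^ Suc k) \<le> v ^ (2 ^ Suc k - 1) * C (\<rho> ^ (2 ^ Suc k))"
  proof (induction k)
    case 0
    then show ?case using dbl[OF \<rho>] by (simp add: power2_eq_square)
  next
    case (Suc k)
    define m :: nat where "m = 2 ^ Suc k"
    have m: "1 \<le> m" "even m" "2 ^ Suc (Suc k) = m * 2" by (simp_all add: m_def)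
    have "C \<rho> ^ (2 ^ Suc (Suc k)) = (C \<rho> ^ m)\<^sup>2" by (simp only: m(3) power_mult[of _ m 2])
    also have "\<dots> \<le> (v ^ (m - 1) * C (\<rho> ^ m))\<^sup>2"
      using Suc.IH m(2) by (intro power_mono) (simp_all add: m_def)
    also have "\<dots> = (v ^ (m - 1))\<^sup>2 * (C (\<rho> ^ m))\<^sup>2" by (rule power_mult_distrib)
    also have "\<dots> \<le> (v ^ (m - 1))\<^sup>2 * (v * C ((\<rho> ^ m)\<^sup>2))"
      using dbl[of "\<rho> ^ m"] \<rho> by (intro mult_left_mono) (auto simp: power_le_one)
    also have "\<dots> = v ^ ((m - 1) * 2 + 1) * C (\<rho> ^ (m * 2))"
      by (simp only: power_mult power_add power_one_right mult.assoc)
    also have "(m - 1) * 2 + 1 = m * 2 - 1" using m(1) by simp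
    finally show ?case by (simp only: m(3))
  qed
  then show ?thesis by (simp only: C_def v_def)
qed

lemma integral_plaw_fst_snd:
  fixes \<phi> :: "_ \<Rightarrow> real"
  assumes "finite B" "0 < p" "p < 1" "0 \<le> \<rho>" "\<rho> \<le> 1"
  shows "(\<integral>z. \<phi> (fst z) \<partial>plaw p \<rho> N B) = (\<integral>w. \<phi> w \<partial>mlaw p N B)"
    and "(\<integral>z. \<phi> (snd z) \<partial>plaw p \<rho> N B) = (\<integral>w. \<phi> w \<partial>mlaw p N B)"
  using arg_cong[where f = "\<lambda>M. \<integral>w. \<phi> w \<partial>measure_pmf M", OF plaw_marginals(1)[OF assms, of N]]
    arg_cong[where f = "\<lambda>M. \<integral>w. \<phi> w \<partial>measure_pmf M", OF plaw_marginals(2)[OF assms, of N]]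
  by simp_all

lemma plaw_CS:
  fixes a b :: "('v \<Rightarrow> nat) \<Rightarrow> real"
  assumes "finite B" "0 < p" "p < 1" "0 \<le> \<rho>" "\<rho> \<le> 1"
  shows "(\<integral>z. a (fst z) * b (snd z) \<partial>plaw p \<rho> N B) \<le> sqrt ((\<integral>w. (a w)\<^sup>2 \<partial>mlaw p N B) * (\<integral>w. (b w)\<^sup>2 \<partial>mlaw p N B))"
proof -
  have "(\<integral>z. a (fst z) * b (snd z) \<partial>plaw p \<rho> N B)\<^sup>2 \<le>
    (\<integral>z. (a (fst z))\<^sup>2 \<partial>plaw p \<rho> N B) * (\<integral>z. (b (snd z))\<^sup>2 \<partial>plaw p \<rho> N B)"
    by (rule CS_pmf) (simp add: assms)
  also have "\<dots> = (\<integral>w. (a w)\<^sup>2 \<partial>mlaw p N B) * (\<integral>w. (b w)\<^sup>2 \<partial>mlaw p N B)"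
    using integral_plaw_fst_snd(1)[OF assms, where \<phi> = "\<lambda>w. (a w)\<^sup>2" and N = N]
      integral_plaw_fst_snd(2)[OF assms, where \<phi> = "\<lambda>w. (b w)\<^sup>2" and N = N] by simp
  finally show ?thesis by (rule real_le_rsqrt)
qed

lemma variance_le_square:
  fixes g :: "_ \<Rightarrow> real"
  assumes "finite (set_pmf M)"
  shows "(\<integral>w. (g w - (\<integral>w. g w \<partial>M))\<^sup>2 \<partial>M) \<le> (\<integral>w. (g w)\<^sup>2 \<partial>M)"
proof -
  note I = integrable_measure_pmf_finite[where 'b = real, OF assms]
  define m where "m = (\<integral>w. g w \<partial>M)"
  have "(\<integral>w. (g w - m)\<^sup>2 \<partial>M) = (\<integral>w. (g w)\<^sup>2 - 2 * m * g w + m\<^sup>2 \<partial>M)"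
    by (intro Bochner_Integration.integral_cong) (simp_all add: power2_eq_square algebra_simps)
  also have "\<dots> = (\<integral>w. (g w)\<^sup>2 \<partial>M) - m\<^sup>2" by (simp add: I power2_eq_square flip: m_def)
  finally show ?thesis by (simp add: m_def)
qed

text \<open>Hypercontractivity is only available at the small correlation \<open>\<rho> ^ 2 ^ Suc k\<close>, and only the
  approximation \<open>h\<close> of \<open>f\<close> has small influences.\<close>

lemma noise_covariance_bound:
  fixes f h :: "('v \<Rightarrow> nat) \<Rightarrow> real"
  assumes p: "0 < p" "p < 1" and \<rho>: "0 \<le> \<rho>" "\<rho> \<le> 1" and B: "finite B"
    and q: "1 < q" "q < 2" and H: "hyper q (bitp p (\<rho> ^ (2 ^ Suc k)))"
    and I: "(\<Sum>v\<in>B. 16 * (\<integral>w. \<bar>h w - h (w(v := 0))\<bar> powr q \<partial>mlaw p N B) powr (2 / q)) \<le> I"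
  defines "m \<equiv> \<integral>w. f w \<partial>mlaw p N B"
  defines "V \<equiv> \<integral>w. (f w - m)\<^sup>2 \<partial>mlaw p N B"
  defines "G \<equiv> \<integral>w. (f w - h w)\<^sup>2 \<partial>mlaw p N B"
  shows "((\<integral>z. f (fst z) * f (snd z) \<partial>plaw p \<rho> N B) - m\<^sup>2) ^ (2 ^ Suc k) \<le>
    V ^ (2 ^ Suc k - 1) * (I + 2 * sqrt ((2 * V + 2 * G) * G) + G)"
proof -
  let ?M = "mlaw p N B" and ?P = "\<lambda>\<rho>. plaw p \<rho> N B"
  define r where "r = \<rho> ^ (2 ^ Suc k)"
  have r: "0 \<le> r" "r \<le> 1" using \<rho> by (simp_all add: r_def power_le_one)
  note IM = integrable_measure_pmf_finite[where 'b = real, OF finite_mlaw[OF B]] and IP = integrable_measure_pmf_finite[where 'b = real, OF finite_plaw[OF B]]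
  define mh where "mh = (\<integral>w. h w \<partial>?M)"
  define f' where "f' = (\<lambda>w. f w - m)"
  define h' where "h' = (\<lambda>w. h w - mh)"
  define g' where "g' = (\<lambda>w. f' w - h' w)"
  define W where "W = (\<integral>w. (g' w)\<^sup>2 \<partial>?M)"
  have cen: "(\<integral>z. (e (fst z) - c) * (e (snd z) - c) \<partial>?P s) = (\<integral>z. e (fst z) * e (snd z) \<partial>?P s) - c\<^sup>2"
    if "0 \<le> s" "s \<le> 1" "c = (\<integral>w. e w \<partial>?M)" for e and s c :: real
  proof -
    have "(\<integral>z. (e (fst z) - c) * (e (snd z) - c) \<partial>?P s) = (\<integral>z. e (fst z) * e (snd z) - c * e (fst z) - c * e (snd z) + c\<^sup>2 \<partial>?P s)"
      by (intro Bochner_Integration.integral_cong) (simp_all add: power2_eq_square algebra_simps)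
    also have "\<dots> = (\<integral>z. e (fst z) * e (snd z) \<partial>?P s) - c * (\<integral>z. e (fst z) \<partial>?P s) - c * (\<integral>z. e (snd z) \<partial>?P s) + c\<^sup>2"
      by (simp add: IP)
    also have "\<dots> = (\<integral>z. e (fst z) * e (snd z) \<partial>?P s) - c\<^sup>2"
      unfolding integral_plaw_fst_snd(1)[OF B p that(1,2), where \<phi> = e]
        integral_plaw_fst_snd(2)[OF B p that(1,2), where \<phi> = e] that(3)[symmetric]
      by (simp add: power2_eq_square)
    finally show ?thesis .
  qed
  have W0: "0 \<le> W" "0 \<le> V" "0 \<le> G" by (simp_all add: W_def V_def G_def)
  \<comment> \<open>Centring the error can only decrease its mean square.\<close>
  have WG: "W \<le> G"
  proof -
    have d: "(\<integral>w. f w - h w \<partial>?M) = m - mh" by (simp add: IM m_def mh_def)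
    have "g' = (\<lambda>w. f w - h w - (m - mh))" by (simp add: fun_eq_iff g'_def f'_def h'_def)
    then have "W = (\<integral>w. (f w - h w - (\<integral>w. f w - h w \<partial>?M))\<^sup>2 \<partial>?M)" by (simp only: W_def d)
    also have "\<dots> \<le> G" unfolding G_def by (rule variance_le_square) (simp add: B)
    finally show ?thesis .
  qed
  have Vh: "(\<integral>w. (h' w)\<^sup>2 \<partial>?M) \<le> 2 * V + 2 * W"
  proof -
    have "(\<integral>w. (h' w)\<^sup>2 \<partial>?M) \<le> (\<integral>w. 2 * (f' w)\<^sup>2 + 2 * (g' w)\<^sup>2 \<partial>?M)"
    proof (intro integral_mono IM)
      fix w
      have "0 \<le> (f' w + g' w)\<^sup>2" by simp
      then show "(h' w)\<^sup>2 \<le> 2 * (f' w)\<^sup>2 + 2 * (g' w)\<^sup>2"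
        unfolding g'_def power2_eq_square by (simp add: algebra_simps)
    qed
    also have "\<dots> = 2 * V + 2 * W" by (simp add: IM V_def W_def f'_def)
    finally show ?thesis .
  qed
  have sq: "sqrt (a * b) \<le> sqrt ((2 * V + 2 * G) * G)" if "0 \<le> a" "0 \<le> b" "a \<le> 2 * V + 2 * G" "b \<le> G" for a b
    using that W0 by (intro real_sqrt_le_mono mult_mono) auto
  have hh: "(\<integral>z. h' (fst z) * h' (snd z) \<partial>?P r) \<le> I"
  proof -
    have "(\<integral>z. h' (fst z) * h' (snd z) \<partial>?P r) = (\<integral>z. h (fst z) * h (snd z) \<partial>?P r) - mh\<^sup>2"
      unfolding h'_def by (rule cen) (use r in \<open>auto simp: mh_def\<close>)
    also have "\<dots> \<le> (\<Sum>v\<in>B. 16 * (\<integral>w. \<bar>h w - h (w(v := 0))\<bar> powr q \<partial>?M) powr (2 / q))"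
      unfolding mh_def by (rule noise_Efron_Stein) (use p r q H B in \<open>auto simp: r_def\<close>)
    finally show ?thesis using I by linarith
  qed
  have hg: "(\<integral>z. h' (fst z) * g' (snd z) \<partial>?P r) \<le> sqrt ((2 * V + 2 * G) * G)"
    by (rule order_trans[OF plaw_CS[OF B p r, where a = h' and b = g' and N = N] sq]) (use Vh WG W0 in \<open>auto simp flip: W_def\<close>)
  have gh: "(\<integral>z. g' (fst z) * h' (snd z) \<partial>?P r) \<le> sqrt ((2 * V + 2 * G) * G)"
    by (rule order_trans[OF plaw_CS[OF B p r, where a = g' and b = h' and N = N]], subst mult.commute, rule sq)
      (use Vh WG W0 in \<open>auto simp flip: W_def\<close>)
  have gg: "(\<integral>z. g' (fst z) * g' (snd z) \<partial>?P r) \<le> G"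
    using plaw_CS[OF B p r, where a = g' and b = g' and N = N] WG W0 by (simp add: W_def)
  \<comment> \<open>f' = h' + g' is multiplied out: the main term obeys the influence bound, and
    each term with the error \<open>g'\<close> is bounded by Cauchy-Schwarz.\<close>
  have "(\<integral>z. f' (fst z) * f' (snd z) \<partial>?P r) =
    (\<integral>z. h' (fst z) * h' (snd z) + h' (fst z) * g' (snd z) + g' (fst z) * h' (snd z) + g' (fst z) * g' (snd z) \<partial>?P r)"
    by (intro Bochner_Integration.integral_cong) (simp_all add: g'_def algebra_simps)
  also have "\<dots> = (\<integral>z. h' (fst z) * h' (snd z) \<partial>?P r) + (\<integral>z. h' (fst z) * g' (snd z) \<partial>?P r) +
    (\<integral>z. g' (fst z) * h' (snd z) \<partial>?P r) + (\<integral>z. g' (fst z) * g' (snd z) \<partial>?P r)"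
    by (simp add: IP)
  also have "\<dots> \<le> I + 2 * sqrt ((2 * V + 2 * G) * G) + G" using hh hg gh gg by linarith
  finally have fr: "(\<integral>z. f' (fst z) * f' (snd z) \<partial>?P r) \<le> I + 2 * sqrt ((2 * V + 2 * G) * G) + G" .
  have "((\<integral>z. f (fst z) * f (snd z) \<partial>?P \<rho>) - m\<^sup>2) = (\<integral>z. f' (fst z) * f' (snd z) \<partial>?P \<rho>)"
    unfolding f'_def by (rule cen[symmetric]) (use \<rho> in \<open>auto simp: m_def\<close>)
  then have "((\<integral>z. f (fst z) * f (snd z) \<partial>?P \<rho>) - m\<^sup>2) ^ (2 ^ Suc k) \<le> V ^ (2 ^ Suc k - 1) * (\<integral>z. f' (fst z) * f' (snd z) \<partial>?P r)"
    using noise_iterate[OF p \<rho> B, where f = f' and N = N and k = k] by (simp only: V_def f'_def r_def)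
  also have "\<dots> \<le> V ^ (2 ^ Suc k - 1) * (I + 2 * sqrt ((2 * V + 2 * G) * G) + G)"
    using fr W0 by (intro mult_left_mono) auto
  finally show ?thesis .
qed

subsection \<open>The bits as a discrete law\<close>

text \<open>The index of the first true bit, cut off at \<open>N\<close>. The alternative
  \<open>N \<le> i\<close> makes the least element exist for every bit sequence and leaves only the
  first \<open>N\<close> bits relevant.\<close>

definition trunc :: "nat \<Rightarrow> (nat \<Rightarrow> bool) \<Rightarrow> nat" where
  "trunc N b = (LEAST i. b i \<or> N \<le> i)"

lemma trunc_0: "trunc 0 b = 0"
  by (simp add: trunc_def)

lemma trunc_Suc: "trunc (Suc N) b = hb (b 0, trunc N (\<lambda>i. b (Suc i)))"
proof (cases "b 0")
  case True
  then show ?thesis by (simp add: trunc_def hb_def)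
next
  case False
  have "trunc (Suc N) b = Suc (LEAST i. b (Suc i) \<or> Suc N \<le> Suc i)"
    unfolding trunc_def by (rule Least_Suc[of _ "Suc N"]) (use False in auto)
  then show ?thesis using False by (simp add: trunc_def hb_def)
qed

lemma trunc_cong:
  assumes "\<And>i. i < N \<Longrightarrow> b i = b' i"
  shows "trunc N b = trunc N b'"
proof -
  have "b i \<or> N \<le> i \<longleftrightarrow> b' i \<or> N \<le> i" for i using assms[of i] by (cases "i < N") auto
  then show ?thesis by (simp add: trunc_def)
qed

lemma trunc_True: "trunc N (\<lambda>_. True) = 0"
  by (simp add: trunc_def)

lemma trunc_le_Least: "\<exists>i. b i \<Longrightarrow> trunc N b \<le> (LEAST i. b i)"
  unfolding trunc_def by (intro Least_le disjI1) (rule LeastI_ex)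

lemma trunc_eq_Least:
  assumes "b i" "i \<le> N"
  shows "trunc N b = (LEAST i. b i)"
proof (rule antisym)
  show "trunc N b \<le> (LEAST i. b i)" using assms(1) by (intro trunc_le_Least) blast
  have "(LEAST i. b i) \<le> i" using assms(1) by (rule Least_le)
  moreover have "b (trunc N b) \<or> N \<le> trunc N b" unfolding trunc_def by (rule LeastI[of _ N]) simp
  ultimately show "(LEAST i. b i) \<le> trunc N b" using assms(2) by (auto intro: Least_le)
qed

lemma slaw_trunc:
  "map_pmf (\<lambda>\<beta>. (trunc N (fst \<circ> \<beta>), trunc N (snd \<circ> \<beta>))) (Pi_pmf {..<N} (True, True) (\<lambda>_. bitp p \<rho>)) = slaw p \<rho> N"
proof (induction N)
  case 0
  then show ?case by (simp add: trunc_0)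
next
  case (Suc N)
  let ?t = "\<lambda>N \<beta>. (trunc N (fst \<circ> \<beta>), trunc N (snd \<circ> \<beta>))"
  let ?Q = "Pi_pmf (Suc ` {..<N}) (True, True) (\<lambda>_. bitp p \<rho>)"
  have t: "?t (Suc N) (f(0 := y)) = (hb (fst y, fst (?t N (f \<circ> Suc))), hb (snd y, snd (?t N (f \<circ> Suc))))" for f y
    by (simp add: trunc_Suc o_def)
  have "map_pmf (\<lambda>f. ?t N (f \<circ> Suc)) ?Q = map_pmf (?t N) (Pi_pmf {..<N} (True, True) ((\<lambda>_. bitp p \<rho>) \<circ> Suc))"
  proof (rule map_pmf_reindex)
    fix w w' :: "nat \<Rightarrow> bool \<times> bool" assume h: "\<And>b. b \<in> {..<N} \<Longrightarrow> w b = w' b"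
    have "trunc N (fst \<circ> w) = trunc N (fst \<circ> w')" "trunc N (snd \<circ> w) = trunc N (snd \<circ> w')"
      by (rule trunc_cong, use h in simp)+
    then show "?t N w = ?t N w'" by simp
  qed auto
  also have "\<dots> = slaw p \<rho> N" using Suc.IH by (simp add: o_def)
  finally have Q: "map_pmf (\<lambda>f. ?t N (f \<circ> Suc)) ?Q = slaw p \<rho> N" .
  have "map_pmf (?t (Suc N)) (Pi_pmf {..<Suc N} (True, True) (\<lambda>_. bitp p \<rho>)) =
    map_pmf (\<lambda>z. ?t (Suc N) ((snd z)(0 := fst z))) (pair_pmf (bitp p \<rho>) ?Q)"
    unfolding lessThan_Suc_eq_insert_0
    by (subst Pi_pmf_insert) (auto simp: pmf.map_comp o_def case_prod_unfold)
  also have "\<dots> = map_pmf (\<lambda>z. (hb (fst (fst z), fst (snd z)), hb (snd (fst z), snd (snd z))))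
    (pair_pmf (bitp p \<rho>) (map_pmf (\<lambda>f. ?t N (f \<circ> Suc)) ?Q))"
    unfolding t pair_map_pmf2 pmf.map_comp by (simp add: o_def case_prod_unfold)
  also have "\<dots> = slaw p \<rho> (Suc N)" unfolding Q by (simp add: zip_law_def pmf.map_comp o_def)
  finally show ?case .
qed

lemma Pi_pmf_curry:
  assumes A: "finite A" and B: "finite B"
  shows "map_pmf curry (Pi_pmf (A \<times> B) d (\<lambda>_. P)) = Pi_pmf A (\<lambda>_. d) (\<lambda>_. Pi_pmf B d (\<lambda>_. P))"
proof (rule pmf_eqI)
  fix z :: "'a \<Rightarrow> 'b \<Rightarrow> 'c"
  have inj: "inj (curry :: ('a \<times> 'b \<Rightarrow> 'c) \<Rightarrow> _)" by (rule inj_on_inverseI[of _ case_prod]) simp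
  have "pmf (map_pmf curry (Pi_pmf (A \<times> B) d (\<lambda>_. P))) (curry (case_prod z)) = pmf (Pi_pmf (A \<times> B) d (\<lambda>_. P)) (case_prod z)"
    by (rule pmf_map_inj'[OF inj])
  also have "\<dots> = pmf (Pi_pmf A (\<lambda>_. d) (\<lambda>_. Pi_pmf B d (\<lambda>_. P))) z"
  proof (cases "\<forall>a b. (a, b) \<notin> A \<times> B \<longrightarrow> z a b = d")
    case True
    then have "\<forall>x. x \<notin> A \<times> B \<longrightarrow> case_prod z x = d" "\<forall>x. x \<notin> A \<longrightarrow> z x = (\<lambda>_. d)"
      "\<And>a. a \<in> A \<Longrightarrow> \<forall>x. x \<notin> B \<longrightarrow> z a x = d" by (auto simp: fun_eq_iff)
    then show ?thesis using A B by (simp add: pmf_Pi prod.cartesian_product case_prod_unfold)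
  next
    case False
    then obtain a b where ab: "(a, b) \<notin> A \<times> B" "z a b \<noteq> d" by blast
    have "pmf (Pi_pmf (A \<times> B) d (\<lambda>_. P)) (case_prod z) = 0"
      by (rule pmf_Pi_outside) (use A B ab in auto)
    moreover have "pmf (Pi_pmf A (\<lambda>_. d) (\<lambda>_. Pi_pmf B d (\<lambda>_. P))) z = 0"
    proof (cases "a \<in> A")
      case True
      then have "pmf (Pi_pmf B d (\<lambda>_. P)) (z a) = 0" using ab B by (intro pmf_Pi_outside) auto
      then show ?thesis using True A by (auto simp: pmf_Pi)
    next
      case False
      then show ?thesis using ab A by (intro pmf_Pi_outside) auto
    qed
    ultimately show ?thesis by simp
  qed
  finally show "pmf (map_pmf curry (Pi_pmf (A \<times> B) d (\<lambda>_. P))) z = pmf (Pi_pmf A (\<lambda>_. d) (\<lambda>_. Pi_pmf B d (\<lambda>_. P))) z"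
    by simp
qed

lemma plaw_bits:
  assumes "finite B"
  shows "plaw p \<rho> N B = map_pmf (\<lambda>\<beta>. (\<lambda>v. trunc N (\<lambda>i. fst (\<beta> (v, i))), \<lambda>v. trunc N (\<lambda>i. snd (\<beta> (v, i)))))
    (Pi_pmf (B \<times> {..<N}) (True, True) (\<lambda>_. bitp p \<rho>))"
proof -
  let ?t = "\<lambda>\<beta>. (trunc N (fst \<circ> \<beta>), trunc N (snd \<circ> \<beta>))"
  have "Pi_pmf B (0, 0) (\<lambda>_. slaw p \<rho> N) =
     map_pmf (\<lambda>h. ?t \<circ> h) (Pi_pmf B (\<lambda>_. (True, True)) (\<lambda>_. Pi_pmf {..<N} (True, True) (\<lambda>_. bitp p \<rho>)))"
    unfolding slaw_trunc[symmetric] by (rule Pi_pmf_map[OF assms]) (simp add: o_def trunc_True)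
  also have "\<dots> = map_pmf (\<lambda>\<beta>. ?t \<circ> curry \<beta>) (Pi_pmf (B \<times> {..<N}) (True, True) (\<lambda>_. bitp p \<rho>))"
    unfolding Pi_pmf_curry[OF assms finite_lessThan, symmetric] by (simp add: pmf.map_comp o_def)
  finally show ?thesis unfolding plaw_def by (simp add: pmf.map_comp o_def curry_def)
qed

text \<open>The clock exceeds \<open>t\<close> with probability exp (- t), which is the probability
  of keeping the bit; otherwise X' supplies an independent one.\<close>

lemma coord_law:
  assumes p: "0 < p" "p < 1" and t: "0 < t"
  shows "{x. (fst x, if t < snd (snd x) then fst x else fst (snd x)) = z} \<in> sets (coord_measure p)" (is "?S \<in> _")
    and "emeasure (coord_measure p) {x. (fst x, if t < snd (snd x) then fst x else fst (snd x)) = z} = ennreal (pmf (bitp p (exp (- t))) z)"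
proof -
  let ?Q = "measure_pmf (bernoulli_pmf p)" and ?E = "density lborel (exponential_density 1)"
  interpret E: prob_space ?E by (rule prob_space_exponential_density) simp
  interpret QE: pair_prob_space ?Q ?E ..
  have dist: "distributed ?E lborel (\<lambda>x. x) (exponential_density 1)"
    by (auto simp: distributed_def distr_id2)
  have sp: "space ?E = UNIV" by simp
  have "E.prob {x \<in> space ?E. t < x} = exp (- t)"
    using E.exponential_distributedD_gt[OF dist, of t] t by simp
  then have gt: "emeasure ?E {t<..} = ennreal (exp (- t))"
    by (simp add: E.emeasure_eq_measure greaterThan_def)
  have "E.prob {x \<in> space ?E. x \<le> t} = 1 - exp (- t)"
    using E.exponential_distributedD_le[OF dist, of t] t by simp
  then have le: "emeasure ?E {..t} = ennreal (1 - exp (- t))"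
    by (simp add: E.emeasure_eq_measure atMost_def)
  have Q1: "emeasure ?Q {c} = ennreal (if c then p else 1 - p)" for c
    using p by (cases c) (simp_all add: emeasure_pmf_single)
  obtain b b' where z: "z = (b, b')" by fastforce
  \<comment> \<open>The admissible values of (X', U) once X = b: a late clock leaves X' free but
    forces b = b'.\<close>
  define D where "D = (if b = b' then UNIV \<times> {t<..} \<union> {b'} \<times> {..t} else {b'} \<times> {..t})"
  have S: "?S = {b} \<times> D"
    unfolding z D_def by (auto split: if_splits)
  have Dm [measurable]: "D \<in> sets (?Q \<Otimes>\<^sub>M ?E)" unfolding D_def by auto
  have SM: "{b} \<times> D \<in> sets (?Q \<Otimes>\<^sub>M (?Q \<Otimes>\<^sub>M ?E))" by (intro pair_measureI Dm) simp
  then show "?S \<in> sets (coord_measure p)" unfolding S coord_measure_def .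
  have rect: "emeasure (?Q \<Otimes>\<^sub>M ?E) (A \<times> C) = emeasure ?Q A * emeasure ?E C" if "C \<in> sets borel" for A C
    by (rule E.emeasure_pair_measure_Times) (use that in auto)
  have De: "emeasure (?Q \<Otimes>\<^sub>M ?E) D =
     ennreal ((if b = b' then exp (- t) else 0) + (if b' then p else 1 - p) * (1 - exp (- t)))"
  proof (cases "b = b'")
    case True
    have "emeasure (?Q \<Otimes>\<^sub>M ?E) D = emeasure (?Q \<Otimes>\<^sub>M ?E) (UNIV \<times> {t<..}) + emeasure (?Q \<Otimes>\<^sub>M ?E) ({b'} \<times> {..t})"
      using True unfolding D_def by (simp add: plus_emeasure[symmetric] disjoint_iff)
    also have "\<dots> = ennreal (exp (- t)) + ennreal (if b' then p else 1 - p) * ennreal (1 - exp (- t))"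
      using measure_pmf.emeasure_space_1[of "bernoulli_pmf p"] by (simp add: rect gt le Q1)
    finally show ?thesis using True p t by (simp add: ennreal_mult'' ennreal_plus)
  next
    case False
    then show ?thesis using p t by (simp add: D_def rect le Q1 ennreal_mult'')
  qed
  have "emeasure (coord_measure p) ?S = emeasure ?Q {b} * emeasure (?Q \<Otimes>\<^sub>M ?E) D"
    unfolding S coord_measure_def by (rule QE.emeasure_pair_measure_Times) (use Dm in auto)
  also have "\<dots> = ennreal ((if b then p else 1 - p) * ((if b = b' then exp (- t) else 0) + (if b' then p else 1 - p) * (1 - exp (- t))))"
    unfolding De Q1 using p t by (intro ennreal_mult[symmetric]) (auto intro!: add_nonneg_nonneg mult_nonneg_nonneg)
  also have "\<dots> = ennreal (pmf (bitp p (exp (- t))) z)"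
  proof -
    have "pmf (bitp p (exp (- t))) z = (\<integral>x. indicator {z} x \<partial>bitp p (exp (- t)))" by (simp add: measure_pmf_single)
    also have "\<dots> = (if b then p else 1 - p) * ((if b = b' then exp (- t) else 0) + (if b' then p else 1 - p) * (1 - exp (- t)))"
      using p t by (subst integral_bitp) (auto simp: z indicator_def algebra_simps)
    finally show ?thesis by simp
  qed
  finally show "emeasure (coord_measure p) ?S = ennreal (pmf (bitp p (exp (- t))) z)" .
qed

text \<open>Only sites of the nonnegative quadrant enter the passage time, and they are indexed by
  naturals from here on.\<close>

definition bt :: "real \<Rightarrow> ((site \<times> nat) \<Rightarrow> bool \<times> bool \<times> real) \<Rightarrow> (nat \<times> nat) \<times> nat \<Rightarrow> bool \<times> bool" where
  "bt t s k = (let v = (int (fst (fst k)), int (snd (fst k))) in (X s v (snd k), Xt t s v (snd k)))"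

lemma prob_space_coord: "prob_space (coord_measure p)"
proof -
  let ?E = "density lborel (exponential_density 1)"
  interpret E: prob_space ?E by (rule prob_space_exponential_density) simp
  interpret QE: pair_prob_space "measure_pmf (bernoulli_pmf p)" ?E ..
  interpret QQE: pair_prob_space "measure_pmf (bernoulli_pmf p)" "measure_pmf (bernoulli_pmf p) \<Otimes>\<^sub>M ?E" ..
  show ?thesis unfolding coord_measure_def by unfold_locales
qed

lemma cylinder:
  assumes p: "0 < p" "p < 1" and t: "0 < t" and K: "finite K"
  shows "{s. \<forall>k\<in>K. bt t s k = z k} \<in> sets (Omega p)" 
    and "emeasure (Omega p) {s. \<forall>k\<in>K. bt t s k = z k} = ennreal (\<Prod>k\<in>K. pmf (bitp p (exp (- t))) (z k))"
proof -
  interpret C: prob_space "coord_measure p" by (rule prob_space_coord)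
  interpret P: product_prob_space "\<lambda>_. coord_measure p" UNIV ..
  define h where "h = (\<lambda>k :: (nat \<times> nat) \<times> nat. ((int (fst (fst k)), int (snd (fst k))), snd k))"
  have inj: "inj_on h K" by (auto simp: inj_on_def h_def prod_eq_iff)
  define S where "S = (\<lambda>z. {x :: bool \<times> bool \<times> real. (fst x, if t < snd (snd x) then fst x else fst (snd x)) = z})"
  define Y where "Y = (\<lambda>j. S (z (the_inv_into K h j)))"
  have Yh: "Y (h k) = S (z k)" if "k \<in> K" for k using that inj by (simp add: Y_def the_inv_into_f_f)
  have bt: "bt t s k = z' \<longleftrightarrow> s (h k) \<in> S z'" for s k z'
    by (simp add: bt_def Let_def h_def S_def X_def X'_def U_def Xt_def)
  have SM: "S z' \<in> sets (coord_measure p)" for z' unfolding S_def by (rule coord_law(1)[OF p t])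
  have spC: "space (coord_measure p) = UNIV" by (simp add: coord_measure_def space_pair_measure)
  then have sp: "space (Omega p) = UNIV" by (simp add: Omega_def space_PiM)
  have eq: "{s. \<forall>k\<in>K. bt t s k = z k} = {s \<in> space (Omega p). \<forall>j\<in>h ` K. s j \<in> Y j}"
    by (auto simp: sp bt Yh)
  show "{s. \<forall>k\<in>K. bt t s k = z k} \<in> sets (Omega p)"
  proof -
    have "{s \<in> space (Omega p). s j \<in> Y j} \<in> sets (Omega p)" for j
      unfolding Omega_def by (rule sets_Collect_single') (auto simp: Y_def SM spC)
    then show ?thesis unfolding eq by (intro sets.sets_Collect_finite_All' sets.sets_Collect_finite_All) (use K in auto)
  qed
  have "emeasure (Omega p) {s. \<forall>k\<in>K. bt t s k = z k} = (\<Prod>j\<in>h ` K. emeasure (coord_measure p) (Y j))"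
    unfolding eq Omega_def by (rule P.emeasure_PiM_Collect) (use K in \<open>auto simp: Y_def SM\<close>)
  also have "\<dots> = (\<Prod>k\<in>K. ennreal (pmf (bitp p (exp (- t))) (z k)))"
    unfolding prod.reindex[OF inj] o_def by (rule prod.cong) (simp_all add: Yh, simp add: S_def coord_law(2)[OF p t])
  also have "\<dots> = ennreal (\<Prod>k\<in>K. pmf (bitp p (exp (- t))) (z k))" by (rule prod_ennreal) simp
  finally show "emeasure (Omega p) {s. \<forall>k\<in>K. bt t s k = z k} = ennreal (\<Prod>k\<in>K. pmf (bitp p (exp (- t))) (z k))" .
qed

text \<open>A function of finitely many bits is a finite combination of cylinder indicators, which
  yields integrability and the value of the integral together. Bits outside \<open>K\<close> are set
  to the default of \<open>Pi_pmf\<close>.\<close>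

lemma bits_law:
  fixes \<Phi> :: "_ \<Rightarrow> real"
  assumes p: "0 < p" "p < 1" and t: "0 < t" and K: "finite K"
  defines "V \<equiv> \<lambda>s k. if k \<in> K then bt t s k else (True, True)"
  shows "integrable (Omega p) (\<lambda>s. \<Phi> (V s))"
    and "(\<integral>s. \<Phi> (V s) \<partial>Omega p) = (\<integral>z. \<Phi> z \<partial>Pi_pmf K (True, True) (\<lambda>_. bitp p (exp (- t))))"
proof -
  define S where "S = PiE_dflt K (True, True) (\<lambda>_. UNIV :: (bool \<times> bool) set)"
  have fS: "finite S" unfolding S_def using K by (intro finite_PiE_dflt) auto
  have VS: "V s \<in> S" for s by (auto simp: V_def S_def PiE_dflt_def)
  have Veq: "{s. V s = z} = {s. \<forall>k\<in>K. bt t s k = z k}" if "z \<in> S" for z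
    using that by (auto simp: V_def S_def PiE_dflt_def fun_eq_iff)
  have m: "{s. V s = z} \<in> sets (Omega p)" if "z \<in> S" for z
    unfolding Veq[OF that] by (rule cylinder(1)[OF p t K])
  have em: "emeasure (Omega p) {s. V s = z} = ennreal (pmf (Pi_pmf K (True, True) (\<lambda>_. bitp p (exp (- t)))) z)" if "z \<in> S" for z
    unfolding Veq[OF that] cylinder(2)[OF p t K] using that K by (simp add: pmf_Pi S_def PiE_dflt_def)
  have sum: "\<Phi> (V s) = (\<Sum>z\<in>S. \<Phi> z * indicator {s. V s = z} s)" for s
  proof -
    have "(\<Sum>z\<in>S. \<Phi> z * indicator {s. V s = z} s) = (\<Sum>z\<in>S. if z = V s then \<Phi> z else 0)"
      by (rule sum.cong) (auto simp: indicator_def)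
    then show ?thesis using VS fS by (simp add: sum.delta)
  qed
  have int: "integrable (Omega p) (\<lambda>s. \<Phi> z * indicator {s. V s = z} s)" if "z \<in> S" for z
    using m[OF that] em[OF that] by (intro integrable_mult_right integrable_real_indicator) auto
  show "integrable (Omega p) (\<lambda>s. \<Phi> (V s))"
    unfolding sum by (rule Bochner_Integration.integrable_sum) (rule int)
  have "(\<integral>s. \<Phi> (V s) \<partial>Omega p) = (\<Sum>z\<in>S. \<integral>s. \<Phi> z * indicator {s. V s = z} s \<partial>Omega p)"
    unfolding sum by (rule Bochner_Integration.integral_sum) (rule int)
  also have "\<dots> = (\<Sum>z\<in>S. \<Phi> z * pmf (Pi_pmf K (True, True) (\<lambda>_. bitp p (exp (- t)))) z)"
  proof (rule sum.cong[OF refl])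
    fix z assume z: "z \<in> S"
    have "measure (Omega p) {s. V s = z} = pmf (Pi_pmf K (True, True) (\<lambda>_. bitp p (exp (- t)))) z"
      using em[OF z] by (simp add: measure_def)
    moreover have "{s. V s = z} \<subseteq> space (Omega p)" using m[OF z] by (rule sets.sets_into_space)
    ultimately show "(\<integral>s. \<Phi> z * indicator {s. V s = z} s \<partial>Omega p) = \<Phi> z * pmf (Pi_pmf K (True, True) (\<lambda>_. bitp p (exp (- t)))) z"
      by (simp add: Int_absorb1 Int_absorb2)
  qed
  also have "\<dots> = (\<integral>z. \<Phi> z \<partial>Pi_pmf K (True, True) (\<lambda>_. bitp p (exp (- t))))"
  proof (subst integral_measure_pmf[OF fS])
    fix z assume "z \<in> set_pmf (Pi_pmf K (True, True) (\<lambda>_. bitp p (exp (- t))))"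
    then have "z \<in> {f. \<forall>x. x \<notin> K \<longrightarrow> f x = (True, True)}" by (rule subsetD[OF set_Pi_pmf_subset[OF K]])
    then show "z \<in> S" unfolding S_def PiE_dflt_def by simp
  qed (simp add: mult.commute)
  finally show "(\<integral>s. \<Phi> (V s) \<partial>Omega p) = (\<integral>z. \<Phi> z \<partial>Pi_pmf K (True, True) (\<lambda>_. bitp p (exp (- t))))" .
qed

definition om :: "real \<Rightarrow> nat \<Rightarrow> ((site \<times> nat) \<Rightarrow> bool \<times> bool \<times> real) \<Rightarrow> (nat \<times> nat \<Rightarrow> nat) \<times> (nat \<times> nat \<Rightarrow> nat)" where
  "om t N s = (\<lambda>v. trunc N (X s (int (fst v), int (snd v))), \<lambda>v. trunc N (Xt t s (int (fst v), int (snd v))))"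

lemma Omega_plaw:
  fixes F :: "_ \<Rightarrow> real"
  assumes p: "0 < p" "p < 1" and t: "0 < t" and B: "finite B"
    and F: "\<And>x y x' y'. (\<And>v. v \<in> B \<Longrightarrow> x v = x' v \<and> y v = y' v) \<Longrightarrow> F (x, y) = F (x', y')"
  shows "integrable (Omega p) (\<lambda>s. F (om t N s))"
    and "(\<integral>s. F (om t N s) \<partial>Omega p) = (\<integral>z. F z \<partial>plaw p (exp (- t)) N B)"
proof -
  let ?K = "B \<times> {..<N}"
  define \<Phi> where "\<Phi> = (\<lambda>\<beta>. F (\<lambda>v. trunc N (\<lambda>i. fst (\<beta> (v, i))), \<lambda>v. trunc N (\<lambda>i. snd (\<beta> (v, i)))))"
  have K: "finite ?K" using B by simp
  have eq: "\<Phi> (\<lambda>k. if k \<in> ?K then bt t s k else (True, True)) = F (om t N s)" for s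
    unfolding \<Phi>_def om_def
  proof (rule F, intro conjI)
    fix v assume "v \<in> B"
    then show "trunc N (\<lambda>i. fst (if (v, i) \<in> ?K then bt t s (v, i) else (True, True))) = trunc N (X s (int (fst v), int (snd v)))"
      "trunc N (\<lambda>i. snd (if (v, i) \<in> ?K then bt t s (v, i) else (True, True))) = trunc N (Xt t s (int (fst v), int (snd v)))"
      by (auto intro!: trunc_cong simp: bt_def Let_def)
  qed
  show "integrable (Omega p) (\<lambda>s. F (om t N s))"
    using bits_law(1)[OF p t K, where \<Phi> = \<Phi>] unfolding eq .
  show "(\<integral>s. F (om t N s) \<partial>Omega p) = (\<integral>z. F z \<partial>plaw p (exp (- t)) N B)"
    using bits_law(2)[OF p t K, where \<Phi> = \<Phi>] unfolding eq unfolding plaw_bits[OF B] integral_map_pmf \<Phi>_def .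
qed

section \<open>Directed paths and the recursion\<close>

lemma lp_step:
  "w (Suc i, j) + lp w i j \<le> lp w (Suc i) j" "w (i, Suc j) + lp w i j \<le> lp w i (Suc j)"
  by (cases j; simp) (cases i; simp)

lemma directed_path_snoc:
  assumes "directed_path u v xs" "y - v \<in> {(1, 0), (0, 1)}"
  shows "directed_path u y (xs @ [y])"
proof -
  have "(xs @ [y]) ! Suc i - (xs @ [y]) ! i \<in> {(1, 0), (0, 1)}" if "Suc i < length (xs @ [y])" for i
  proof (cases "Suc i < length xs")
    case True
    then show ?thesis using assms(1) by (simp add: directed_path_def nth_append)
  next
    case False
    then have i: "i = length xs - 1" "Suc i = length xs" using that by auto
    have "xs ! (length xs - 1) = v" using assms(1) by (metis directed_path_def last_conv_nth)
    then show ?thesis using assms(2) i(2) unfolding i(1) by (simp add: nth_append)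
  qed
  then show ?thesis using assms(1) by (simp add: directed_path_def)
qed

text \<open>That the endpoint lies in the quadrant is not assumed but carried along in the
  induction, which removes the last site of the path.\<close>

lemma directed_path_le_lp:
  assumes "directed_path (0, 0) v xs"
  shows "\<exists>i j. v = (int i, int j) \<and> (\<Sum>x\<leftarrow>xs. w x) \<le> lp (\<lambda>(a, b). w (int a, int b)) i j"
  using assms
proof (induction xs arbitrary: v rule: rev_induct)
  case Nil
  then show ?case by (simp add: directed_path_def)
next
  case (snoc x xs)
  have v: "v = x" using snoc.prems by (simp add: directed_path_def)
  show ?case
  proof (cases "xs = []")
    case True
    then have "x = (0, 0)" using snoc.prems by (simp add: directed_path_def)
    then show ?thesis using True v by (intro exI[of _ 0]) simp
  next
    case False
    have idx: "(xs @ [x]) ! Suc i - (xs @ [x]) ! i \<in> {(1, 0), (0, 1)}" if "Suc i < length (xs @ [x])" for i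
      using snoc.prems that unfolding directed_path_def by blast
    have "xs ! Suc i - xs ! i \<in> {(1, 0), (0, 1)}" if "Suc i < length xs" for i
      using idx[of i] that by (simp add: nth_append)
    then have "directed_path (0, 0) (last xs) xs"
      using snoc.prems False by (simp add: directed_path_def)
    then obtain i j where ij: "last xs = (int i, int j)" "(\<Sum>x\<leftarrow>xs. w x) \<le> lp (\<lambda>(a, b). w (int a, int b)) i j"
      using snoc.IH by blast
    have "x - last xs \<in> {(1, 0), (0, 1)}"
      using idx[of "length xs - 1"] False by (simp add: nth_append last_conv_nth)
    then consider "x = (int (Suc i), int j)" | "x = (int i, int (Suc j))"
      unfolding ij(1) by (cases x) (auto simp: algebra_simps)
    then show ?thesis
    proof cases
      case 1
      then show ?thesis using ij(2) lp_step(1)[of "\<lambda>(a, b). w (int a, int b)" i j] v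
        by (intro exI[of _ "Suc i"] exI[of _ j]) simp
    next
      case 2
      then show ?thesis using ij(2) lp_step(2)[of "\<lambda>(a, b). w (int a, int b)" i j] v
        by (intro exI[of _ i] exI[of _ "Suc j"]) simp
    qed
  qed
qed

lemma directed_path_lp:
  "\<exists>xs. directed_path (0, 0) (int i, int j) xs \<and> (\<Sum>x\<leftarrow>xs. w x) = lp (\<lambda>(a, b). w (int a, int b)) i j"
proof (induction "\<lambda>(a, b). w (int a, int b)" i j rule: lp.induct)
  case 1
  then show ?case by (intro exI[of _ "[(0, 0)]"]) (simp add: directed_path_def)
next
  case (2 i)
  then obtain xs where "directed_path (0, 0) (int i, int 0) xs" "(\<Sum>x\<leftarrow>xs. w x) = lp (\<lambda>(a, b). w (int a, int b)) i 0" by blast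
  then show ?case by (intro exI[of _ "xs @ [(int (Suc i), int 0)]"] conjI directed_path_snoc) auto
next
  case (3 j)
  then obtain xs where "directed_path (0, 0) (int 0, int j) xs" "(\<Sum>x\<leftarrow>xs. w x) = lp (\<lambda>(a, b). w (int a, int b)) 0 j" by blast
  then show ?case by (intro exI[of _ "xs @ [(int 0, int (Suc j))]"] conjI directed_path_snoc) auto
next
  case (4 i j)
  let ?l = "lp (\<lambda>(a, b). w (int a, int b))"
  obtain xs ys where xs: "directed_path (0, 0) (int i, int (Suc j)) xs" "(\<Sum>x\<leftarrow>xs. w x) = ?l i (Suc j)"
    and ys: "directed_path (0, 0) (int (Suc i), int j) ys" "(\<Sum>x\<leftarrow>ys. w x) = ?l (Suc i) j"
    using 4 by blast
  show ?case
  proof (cases "?l i (Suc j) \<le> ?l (Suc i) j")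
    case True
    then show ?thesis using ys by (intro exI[of _ "ys @ [(int (Suc i), int (Suc j))]"] conjI directed_path_snoc) auto
  next
    case False
    then show ?thesis using xs by (intro exI[of _ "xs @ [(int (Suc i), int (Suc j))]"] conjI directed_path_snoc) auto
  qed
qed

lemma T_n_conv_lp: "T_n n w = real (lp (\<lambda>v. w (int (fst v), int (snd v))) n n)"
proof -
  let ?l = "lp (\<lambda>(a, b). w (int a, int b)) n n"
  let ?A = "{real (\<Sum>x\<leftarrow>xs. w x) |xs. directed_path (0, 0) (int n, int n) xs}"
  have le: "(\<Sum>x\<leftarrow>xs. w x) \<le> ?l" if "directed_path (0, 0) (int n, int n) xs" for xs
    using directed_path_le_lp[OF that, of w] by auto
  have "Max ?A = real ?l"
  proof (rule Max_eqI)
    have "?A \<subseteq> real ` {..?l}" using le by blast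
    then show "finite ?A" by (rule finite_subset) simp
    show "y \<le> real ?l" if "y \<in> ?A" for y using that le by auto
    show "real ?l \<in> ?A" using directed_path_lp[of n n w] by (auto simp: Bex_def) (metis of_nat_eq_iff)
  qed
  then show ?thesis by (simp add: T_n_def lpp_def case_prod_unfold)
qed

lemma prob_space_Omega: "prob_space (Omega p)"
  unfolding Omega_def by (rule prob_space_PiM) (rule prob_space_coord)

lemma pred_bits:
  assumes p: "0 < p" "p < 1" and t: "0 < t"
  shows "Measurable.pred (Omega p) (\<lambda>s. X s (int a, int b) i)" "Measurable.pred (Omega p) (\<lambda>s. Xt t s (int a, int b) i)"
proof -
  have m: "{s. bt t s ((a, b), i) = z} \<in> sets (Omega p)" for z
    using cylinder(1)[OF p t, of "{((a, b), i)}" "\<lambda>_. z"] by simp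
  have sp: "space (Omega p) = UNIV" by (simp add: Omega_def space_PiM coord_measure_def space_pair_measure)
  have "{s. X s (int a, int b) i} = {s. bt t s ((a, b), i) = (True, True)} \<union> {s. bt t s ((a, b), i) = (True, False)}"
    "{s. Xt t s (int a, int b) i} = {s. bt t s ((a, b), i) = (True, True)} \<union> {s. bt t s ((a, b), i) = (False, True)}"
    by (auto simp: bt_def Let_def)
  then show "Measurable.pred (Omega p) (\<lambda>s. X s (int a, int b) i)" "Measurable.pred (Omega p) (\<lambda>s. Xt t s (int a, int b) i)"
    using m by (simp_all add: pred_def sp)
qed

text \<open>On the event without a true bit the cut-off index equals \<open>N\<close>. A mean
  bounded uniformly in \<open>N\<close> therefore forces the probability of that event to be
  0.\<close>

lemma AE_exists_bit:
  fixes Y :: "((site \<times> nat) \<Rightarrow> bool \<times> bool \<times> real) \<Rightarrow> nat \<Rightarrow> bool"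
  assumes p: "0 < p" "p < 1"
    and int: "\<And>N. integrable (Omega p) (\<lambda>s. real (trunc N (Y s)))"
    and law: "\<And>N. (\<integral>s. real (trunc N (Y s)) \<partial>Omega p) \<le> K"
    and Y: "\<And>i. Measurable.pred (Omega p) (\<lambda>s. Y s i)"
  shows "AE s in Omega p. \<exists>i. Y s i"
proof -
  interpret prob_space "Omega p" by (rule prob_space_Omega)
  let ?A = "{s \<in> space (Omega p). \<forall>i. \<not> Y s i}"
  have A: "?A \<in> sets (Omega p)" using Y by measurable
  have "real N * prob ?A \<le> K" for N
  proof -
    have "real N * prob ?A = (\<integral>s. real N * indicator ?A s \<partial>Omega p)" using A by simp
    also have "\<dots> \<le> (\<integral>s. real (trunc N (Y s)) \<partial>Omega p)"
    proof (rule integral_mono)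
      show "integrable (Omega p) (\<lambda>s. real N * indicator ?A s)"
        using A by (intro integrable_mult_right integrable_real_indicator) (auto simp: emeasure_eq_measure)
      fix s
      have "trunc N (Y s) = N" if "\<forall>i. \<not> Y s i" using that unfolding trunc_def by (intro Least_equality) auto
      then show "real N * indicator ?A s \<le> real (trunc N (Y s))" by (auto simp: indicator_def)
    qed (rule int)
    finally show ?thesis using law[of N] by linarith
  qed
  then have "prob ?A = 0"
    by (metis (no_types, lifting) measure_nonneg less_eq_real_def mult.commute reals_Archimedean3 not_less)
  then show ?thesis by (intro AE_I[of _ _ ?A]) (use A in \<open>auto simp: emeasure_eq_measure\<close>)
qed

lemma AE_omega:
  assumes p: "0 < p" "p < 1" and t: "0 < t"
  shows "AE s in Omega p. \<forall>a b. (\<exists>i. X s (int a, int b) i) \<and> (\<exists>i. Xt t s (int a, int b) i)"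
proof -
  obtain K where K: "\<And>N. (\<integral>x. real x ^ 1 \<partial>tgeo p N) \<le> K" using tgeo_moment[OF p, of 1] by blast
  have \<rho>: "0 \<le> exp (- t)" "exp (- t) \<le> 1" using t by simp_all
  have one: "AE s in Omega p. (\<exists>i. X s (int a, int b) i) \<and> (\<exists>i. Xt t s (int a, int b) i)" for a b
  proof -
    let ?B = "{(a, b)}"
    have m: "(\<integral>w. real (w (a, b)) \<partial>mlaw p N ?B) \<le> K" for N
    proof -
      have "map_pmf (\<lambda>w. w (a, b)) (mlaw p N ?B) = tgeo p N" unfolding mlaw_def by (simp add: Pi_pmf_component)
      from arg_cong[where f = "\<lambda>M. \<integral>x. real x \<partial>measure_pmf M", OF this] K[of N] show ?thesis by simp
    qed
    have 1: "integrable (Omega p) (\<lambda>s. real (trunc N (X s (int a, int b))))"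
      "(\<integral>s. real (trunc N (X s (int a, int b))) \<partial>Omega p) \<le> K" for N
    proof -
      have "integrable (Omega p) (\<lambda>s. real (fst (om t N s) (a, b)))"
        by (rule Omega_plaw(1)[where F = "\<lambda>z. real (fst z (a, b))" and B = ?B, OF p t]) simp_all
      then show "integrable (Omega p) (\<lambda>s. real (trunc N (X s (int a, int b))))" by (simp add: om_def)
      have "(\<integral>s. real (fst (om t N s) (a, b)) \<partial>Omega p) = (\<integral>z. real (fst z (a, b)) \<partial>plaw p (exp (- t)) N ?B)"
        by (rule Omega_plaw(2)[where F = "\<lambda>z. real (fst z (a, b))" and B = ?B, OF p t]) simp_all
      then have "(\<integral>s. real (trunc N (X s (int a, int b))) \<partial>Omega p) = (\<integral>z. real (fst z (a, b)) \<partial>plaw p (exp (- t)) N ?B)"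
        by (simp add: om_def)
      also have "\<dots> = (\<integral>w. real (w (a, b)) \<partial>mlaw p N ?B)"
        by (rule integral_plaw_fst_snd(1)[where \<phi> = "\<lambda>w. real (w (a, b))"]) (use p \<rho> in auto)
      finally show "(\<integral>s. real (trunc N (X s (int a, int b))) \<partial>Omega p) \<le> K" using m[of N] by simp
    qed
    have 2: "integrable (Omega p) (\<lambda>s. real (trunc N (Xt t s (int a, int b))))"
      "(\<integral>s. real (trunc N (Xt t s (int a, int b))) \<partial>Omega p) \<le> K" for N
    proof -
      have "integrable (Omega p) (\<lambda>s. real (snd (om t N s) (a, b)))"
        by (rule Omega_plaw(1)[where F = "\<lambda>z. real (snd z (a, b))" and B = ?B, OF p t]) simp_all
      then show "integrable (Omega p) (\<lambda>s. real (trunc N (Xt t s (int a, int b))))" by (simp add: om_def)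
      have "(\<integral>s. real (snd (om t N s) (a, b)) \<partial>Omega p) = (\<integral>z. real (snd z (a, b)) \<partial>plaw p (exp (- t)) N ?B)"
        by (rule Omega_plaw(2)[where F = "\<lambda>z. real (snd z (a, b))" and B = ?B, OF p t]) simp_all
      then have "(\<integral>s. real (trunc N (Xt t s (int a, int b))) \<partial>Omega p) = (\<integral>z. real (snd z (a, b)) \<partial>plaw p (exp (- t)) N ?B)"
        by (simp add: om_def)
      also have "\<dots> = (\<integral>w. real (w (a, b)) \<partial>mlaw p N ?B)"
        by (rule integral_plaw_fst_snd(2)[where \<phi> = "\<lambda>w. real (w (a, b))"]) (use p \<rho> in auto)
      finally show "(\<integral>s. real (trunc N (Xt t s (int a, int b))) \<partial>Omega p) \<le> K" using m[of N] by simp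
    qed
    show ?thesis
      using AE_exists_bit[OF p 1 pred_bits(1)[OF p t]] AE_exists_bit[OF p 2 pred_bits(2)[OF p t]] by (rule AE_conjI)
  qed
  then show ?thesis by (simp add: AE_all_countable)
qed

lemma borel_measurable_lp:
  fixes w :: "'s \<Rightarrow> nat \<times> nat \<Rightarrow> nat"
  assumes "\<And>a b. (\<lambda>s. w s (a, b)) \<in> measurable M (count_space UNIV)"
  shows "(\<lambda>s. real (lp (w s) i j)) \<in> borel_measurable M"
proof -
  have r: "(\<lambda>s. real (w s (a, b))) \<in> borel_measurable M" for a b
    using measurable_compose[OF assms, of real borel] by simp
  \<comment> \<open>The dummy \<open>w0\<close> stands for the weight argument that
    \<open>lp.induct\<close> carries; the actual weights depend on \<open>s\<close>.\<close>
  have "(\<lambda>s. real (lp (w s) i j)) \<in> borel_measurable M" for w0 :: "nat \<times> nat \<Rightarrow> nat"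
    by (induction w0 i j rule: lp.induct) (auto simp: r of_nat_max intro!: borel_measurable_add borel_measurable_max)
  then show ?thesis by blast
qed

subsection \<open>Passage to untruncated weights\<close>

text \<open>Dominated convergence on one space: the truncated field is the coordinatewise minimum of
  the geometric field with \<open>N\<close>. Almost surely the latter vanishes off the box, so the
  two agree for large \<open>N\<close>.\<close>

lemma mlaw_limit:
  fixes \<phi> :: "(nat \<times> nat \<Rightarrow> nat) \<Rightarrow> real"
  assumes p: "0 < p" "p < 1" and \<phi>: "\<And>w. \<bar>\<phi> w\<bar> \<le> C * (1 + (\<Sum>x\<in>{..R} \<times> {..R}. real (w x)) ^ 4)"
  shows "(\<lambda>N. \<integral>w. \<phi> w \<partial>mlaw p N ({..R} \<times> {..R})) \<longlonglongrightarrow> (\<integral>w. \<phi> w \<partial>ilaw (1 - p) R R)"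
proof -
  let ?S = "\<lambda>w. (\<Sum>x\<in>{..R} \<times> {..R}. real (w x)) ^ 4"
  have "0 \<le> C" using \<phi>[of "\<lambda>_. 0"] by simp
  have eq: "mlaw p N ({..R} \<times> {..R}) = map_pmf (\<lambda>w. (\<lambda>x. min x N) \<circ> w) (ilaw (1 - p) R R)" for N
    unfolding mlaw_def tgeo_def ilaw_def geo_def by (subst Pi_pmf_map) auto
  have "(\<lambda>N. \<integral>w. \<phi> ((\<lambda>x. min x N) \<circ> w) \<partial>ilaw (1 - p) R R) \<longlonglongrightarrow> (\<integral>w. \<phi> w \<partial>ilaw (1 - p) R R)"
  proof (rule integral_dominated_convergence[where w = "\<lambda>w. C * (1 + ?S w)"])
    show "integrable (ilaw (1 - p) R R) (\<lambda>w. C * (1 + ?S w))"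
      by (rule integrable_ilaw[where C = C]) (use p \<open>0 \<le> C\<close> in \<open>auto simp: abs_mult\<close>)
    show "AE w in ilaw (1 - p) R R. (\<lambda>N. \<phi> ((\<lambda>x. min x N) \<circ> w)) \<longlonglongrightarrow> \<phi> w"
    proof (rule AE_pmfI)
      fix w assume "w \<in> set_pmf (ilaw (1 - p) R R)"
      then have "w \<in> {f. \<forall>x. x \<notin> {..R} \<times> {..R} \<longrightarrow> f x = 0}"
        unfolding ilaw_def by (rule subsetD[OF set_Pi_pmf_subset, rotated]) simp
      then have w: "w x = 0" if "x \<notin> {..R} \<times> {..R}" for x using that by blast
      have le: "w x \<le> (\<Sum>x\<in>{..R} \<times> {..R}. w x)" for x
        using w[of x] member_le_sum[of x "{..R} \<times> {..R}" w] by (cases "x \<in> {..R} \<times> {..R}") auto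
      have "\<forall>\<^sub>F N in sequentially. (\<Sum>x\<in>{..R} \<times> {..R}. w x) \<le> N" by (rule eventually_ge_at_top)
      then have "\<forall>\<^sub>F N in sequentially. \<phi> ((\<lambda>x. min x N) \<circ> w) = \<phi> w"
      proof eventually_elim
        case (elim N)
        then have "(\<lambda>x. min x N) \<circ> w = w" using le by (auto simp: fun_eq_iff min_def intro: order_trans antisym)
        then show ?case by simp
      qed
      then show "(\<lambda>N. \<phi> ((\<lambda>x. min x N) \<circ> w)) \<longlonglongrightarrow> \<phi> w" by (rule tendsto_eventually)
    qed
    show "AE w in ilaw (1 - p) R R. norm (\<phi> ((\<lambda>x. min x N) \<circ> w)) \<le> C * (1 + ?S w)" for N
    proof (rule AE_pmfI)
      fix w
      have "?S ((\<lambda>x. min x N) \<circ> w) \<le> ?S w" by (intro power_mono sum_mono sum_nonneg) auto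
      then have "C * (1 + ?S ((\<lambda>x. min x N) \<circ> w)) \<le> C * (1 + ?S w)" using \<open>0 \<le> C\<close> by (intro mult_left_mono) auto
      with \<phi>[of "(\<lambda>x. min x N) \<circ> w"] show "norm (\<phi> ((\<lambda>x. min x N) \<circ> w)) \<le> C * (1 + ?S w)" by simp
    qed
  qed simp_all
  then show ?thesis unfolding eq integral_map_pmf .
qed

lemma lp_moment_limit:
  assumes p: "0 < p" "p < 1" and e: "e \<le> 4" and R: "n \<le> R"
  shows "(\<lambda>N. \<integral>w. real (lp w n n) ^ e \<partial>mlaw p N ({..R} \<times> {..R})) \<longlonglongrightarrow> (\<integral>w. real (lp w n n) ^ e \<partial>ilaw (1 - p) n n)"
proof -
  have "(\<lambda>N. \<integral>w. real (lp w n n) ^ e \<partial>mlaw p N ({..R} \<times> {..R})) \<longlonglongrightarrow> (\<integral>w. real (lp w n n) ^ e \<partial>ilaw (1 - p) R R)"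
  proof (rule mlaw_limit[OF p, where C = 1])
    fix w
    have "real (lp w n n) ^ e \<le> (\<Sum>x\<in>{..R} \<times> {..R}. real (w x)) ^ e"
      using lp_sh_le_sum[of 0 n R 0 n R w] R by (intro power_mono) auto
    also have "\<dots> \<le> 1 + (\<Sum>x\<in>{..R} \<times> {..R}. real (w x)) ^ 4" by (rule power_le_one_plus_pow4) (auto intro: sum_nonneg e)
    finally show "\<bar>real (lp w n n) ^ e\<bar> \<le> 1 * (1 + (\<Sum>x\<in>{..R} \<times> {..R}. real (w x)) ^ 4)" by simp
  qed
  also have "(\<integral>w. real (lp w n n) ^ e \<partial>ilaw (1 - p) R R) = (\<integral>w. real (lp w n n) ^ e \<partial>ilaw (1 - p) n n)"
    using ilaw_translate[where a = 0 and b = 0 and f = "\<lambda>x. x ^ e" and q = "1 - p" and N = R and m = R and n = n] R by simp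
  finally show ?thesis .
qed

lemma trunc_mono: "N \<le> N' \<Longrightarrow> trunc N b \<le> trunc N' b"
proof -
  assume "N \<le> N'"
  have "b (trunc N' b) \<or> N' \<le> trunc N' b" unfolding trunc_def by (rule LeastI[of _ N']) simp
  with \<open>N \<le> N'\<close> show ?thesis unfolding trunc_def[of N] by (intro Least_le) auto
qed

lemma eventually_lp_trunc:
  assumes "\<And>v. \<exists>i. y v i"
  shows "\<forall>\<^sub>F N in sequentially. lp (\<lambda>v. trunc N (y v)) n n = lp (\<lambda>v. LEAST i. y v i) n n"
proof -
  have "\<forall>\<^sub>F N in sequentially. (\<Sum>v\<in>{..n} \<times> {..n}. LEAST i. y v i) \<le> N" by (rule eventually_ge_at_top)
  then show ?thesis
  proof eventually_elim
    case (elim N)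
    show ?case
    proof (rule lp_cong)
      fix a b assume "a \<le> n" "b \<le> n"
      then have "(LEAST i. y (a, b) i) \<le> (\<Sum>v\<in>{..n} \<times> {..n}. LEAST i. y v i)" by (intro member_le_sum) auto
      with elim have "(LEAST i. y (a, b) i) \<le> N" by linarith
      then show "trunc N (y (a, b)) = (LEAST i. y (a, b) i)" by (rule trunc_eq_Least[where b = "y (a, b)", OF LeastI_ex[OF assms]])
    qed
  qed
qed

text \<open>The truncated passage times increase with \<open>N\<close>, so monotone convergence
  gives integrability and the value together. A general bit array \<open>y\<close> lets the lemma
  serve the original and the resampled bits.\<close>

lemma moment_transfer:
  fixes y :: "'s \<Rightarrow> nat \<times> nat \<Rightarrow> nat \<Rightarrow> bool"
  assumes p: "0 < p" "p < 1" and e: "e \<le> 4"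
    and int: "\<And>N. integrable M (\<lambda>s. real (lp (\<lambda>v. trunc N (y s v)) n n) ^ e)"
    and law: "\<And>N. (\<integral>s. real (lp (\<lambda>v. trunc N (y s v)) n n) ^ e \<partial>M) = (\<integral>w. real (lp w n n) ^ e \<partial>mlaw p N ({..n} \<times> {..n}))"
    and pred: "\<And>a b i. Measurable.pred M (\<lambda>s. y s (a, b) i)"
    and ex: "AE s in M. \<forall>v. \<exists>i. y s v i"
  shows "integrable M (\<lambda>s. real (lp (\<lambda>v. LEAST i. y s v i) n n) ^ e)"
    and "(\<integral>s. real (lp (\<lambda>v. LEAST i. y s v i) n n) ^ e \<partial>M) = (\<integral>w. real (lp w n n) ^ e \<partial>ilaw (1 - p) n n)"
proof -
  have mono: "AE s in M. mono (\<lambda>N. real (lp (\<lambda>v. trunc N (y s v)) n n) ^ e)"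
    by (intro AE_I2 monoI power_mono of_nat_mono lp_mono_weights trunc_mono) auto
  have lim: "AE s in M. (\<lambda>N. real (lp (\<lambda>v. trunc N (y s v)) n n) ^ e) \<longlonglongrightarrow> real (lp (\<lambda>v. LEAST i. y s v i) n n) ^ e"
    using ex
  proof eventually_elim
    case (elim s)
    then have "\<forall>\<^sub>F N in sequentially. lp (\<lambda>v. trunc N (y s v)) n n = lp (\<lambda>v. LEAST i. y s v i) n n"
      by (intro eventually_lp_trunc) blast
    then show ?case by (intro tendsto_eventually) (auto elim: eventually_mono)
  qed
  have ilim: "(\<lambda>N. \<integral>s. real (lp (\<lambda>v. trunc N (y s v)) n n) ^ e \<partial>M) \<longlonglongrightarrow> (\<integral>w. real (lp w n n) ^ e \<partial>ilaw (1 - p) n n)"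
    unfolding law by (rule lp_moment_limit[OF p e order_refl])
  have m: "(\<lambda>s. real (lp (\<lambda>v. LEAST i. y s v i) n n) ^ e) \<in> borel_measurable M"
    by (intro borel_measurable_power borel_measurable_lp measurable_Least pred)
  note mc = integral_monotone_convergence_nonneg[OF int mono _ lim ilim m]
  show "integrable M (\<lambda>s. real (lp (\<lambda>v. LEAST i. y s v i) n n) ^ e)" by (rule mc) simp
  show "(\<integral>s. real (lp (\<lambda>v. LEAST i. y s v i) n n) ^ e \<partial>M) = (\<integral>w. real (lp w n n) ^ e \<partial>ilaw (1 - p) n n)"
    by (rule mc) simp
qed

lemma T_n_omega: "T_n n (omega s) = real (lp (\<lambda>v. LEAST i. X s (int (fst v), int (snd v)) i) n n)"
  and T_n_omega_t: "T_n n (omega_t t s) = real (lp (\<lambda>v. LEAST i. Xt t s (int (fst v), int (snd v)) i) n n)"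
  by (simp_all add: T_n_conv_lp omega_def omega_t_def)

lemma moments_omega:
  assumes p: "0 < p" "p < 1" and t: "0 < t" and e: "e \<le> 4"
  shows "integrable (Omega p) (\<lambda>s. T_n n (omega s) ^ e)" "(\<integral>s. T_n n (omega s) ^ e \<partial>Omega p) = (\<integral>w. real (lp w n n) ^ e \<partial>ilaw (1 - p) n n)"
    and "integrable (Omega p) (\<lambda>s. T_n n (omega_t t s) ^ e)" "(\<integral>s. T_n n (omega_t t s) ^ e \<partial>Omega p) = (\<integral>w. real (lp w n n) ^ e \<partial>ilaw (1 - p) n n)"
proof -
  let ?B = "{..n} \<times> {..n}"
  have \<rho>: "0 \<le> exp (- t)" "exp (- t) \<le> 1" using t by simp_all
  have B: "finite ?B" by simp
  have cong: "real (lp (fst (x, y)) n n) ^ e = real (lp (fst (x', y')) n n) ^ e" "real (lp (snd (x, y)) n n) ^ e = real (lp (snd (x', y')) n n) ^ e"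
    if h: "\<And>v. v \<in> ?B \<Longrightarrow> x v = x' v \<and> y v = y' v" for x y x' y'
  proof -
    have "lp x n n = lp x' n n" "lp y n n = lp y' n n" by (rule lp_cong; use h in simp)+
    then show "real (lp (fst (x, y)) n n) ^ e = real (lp (fst (x', y')) n n) ^ e" "real (lp (snd (x, y)) n n) ^ e = real (lp (snd (x', y')) n n) ^ e"
      by simp_all
  qed
  have int: "integrable (Omega p) (\<lambda>s. real (lp (fst (om t N s)) n n) ^ e)" for N
    by (rule Omega_plaw(1)[where F = "\<lambda>z. real (lp (fst z) n n) ^ e", OF p t B]) (rule cong, blast)
  have int': "integrable (Omega p) (\<lambda>s. real (lp (snd (om t N s)) n n) ^ e)" for N
    by (rule Omega_plaw(1)[where F = "\<lambda>z. real (lp (snd z) n n) ^ e", OF p t B]) (rule cong, blast)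
  have law: "(\<integral>s. real (lp (fst (om t N s)) n n) ^ e \<partial>Omega p) = (\<integral>w. real (lp w n n) ^ e \<partial>mlaw p N ?B)" for N
  proof -
    have "(\<integral>s. real (lp (fst (om t N s)) n n) ^ e \<partial>Omega p) = (\<integral>z. real (lp (fst z) n n) ^ e \<partial>plaw p (exp (- t)) N ?B)"
      by (rule Omega_plaw(2)[where F = "\<lambda>z. real (lp (fst z) n n) ^ e", OF p t B]) (rule cong, blast)
    also have "\<dots> = (\<integral>w. real (lp w n n) ^ e \<partial>mlaw p N ?B)"
      by (rule integral_plaw_fst_snd(1)[OF B p \<rho>, where \<phi> = "\<lambda>w. real (lp w n n) ^ e"])
    finally show ?thesis .
  qed
  have law': "(\<integral>s. real (lp (snd (om t N s)) n n) ^ e \<partial>Omega p) = (\<integral>w. real (lp w n n) ^ e \<partial>mlaw p N ?B)" for N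
  proof -
    have "(\<integral>s. real (lp (snd (om t N s)) n n) ^ e \<partial>Omega p) = (\<integral>z. real (lp (snd z) n n) ^ e \<partial>plaw p (exp (- t)) N ?B)"
      by (rule Omega_plaw(2)[where F = "\<lambda>z. real (lp (snd z) n n) ^ e", OF p t B]) (rule cong, blast)
    also have "\<dots> = (\<integral>w. real (lp w n n) ^ e \<partial>mlaw p N ?B)"
      by (rule integral_plaw_fst_snd(2)[OF B p \<rho>, where \<phi> = "\<lambda>w. real (lp w n n) ^ e"])
    finally show ?thesis .
  qed
  have ex: "AE s in Omega p. \<forall>v. \<exists>i. X s (int (fst v), int (snd v)) i" "AE s in Omega p. \<forall>v. \<exists>i. Xt t s (int (fst v), int (snd v)) i"
    using AE_omega[OF p t] by (eventually_elim, blast)+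
  have pred: "Measurable.pred (Omega p) (\<lambda>s. X s (int (fst (a, b)), int (snd (a, b))) i)" for a b i
    unfolding fst_conv snd_conv by (rule pred_bits[OF p t])
  have pred': "Measurable.pred (Omega p) (\<lambda>s. Xt t s (int (fst (a, b)), int (snd (a, b))) i)" for a b i
    unfolding fst_conv snd_conv by (rule pred_bits[OF p t])
  note M = moment_transfer[OF p e, of "Omega p" "\<lambda>s v. X s (int (fst v), int (snd v))" n]
  note M' = moment_transfer[OF p e, of "Omega p" "\<lambda>s v. Xt t s (int (fst v), int (snd v))" n]
  show "integrable (Omega p) (\<lambda>s. T_n n (omega s) ^ e)" "(\<integral>s. T_n n (omega s) ^ e \<partial>Omega p) = (\<integral>w. real (lp w n n) ^ e \<partial>ilaw (1 - p) n n)"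
    unfolding T_n_omega by (rule M[OF int[unfolded om_def fst_conv] law[unfolded om_def fst_conv] pred ex(1)])+
  show "integrable (Omega p) (\<lambda>s. T_n n (omega_t t s) ^ e)" "(\<integral>s. T_n n (omega_t t s) ^ e \<partial>Omega p) = (\<integral>w. real (lp w n n) ^ e \<partial>ilaw (1 - p) n n)"
    unfolding T_n_omega_t by (rule M'[OF int'[unfolded om_def snd_conv] law'[unfolded om_def snd_conv] pred' ex(2)])+
qed

text \<open>The product is dominated by the sum of the squares, whose integrability is known from
  the marginals; no joint moment has to be estimated.\<close>

lemma cross_moment:
  assumes p: "0 < p" "p < 1" and t: "0 < t" and R: "n \<le> R"
  shows "integrable (Omega p) (\<lambda>s. T_n n (omega s) * T_n n (omega_t t s))"
    and "(\<lambda>N. \<integral>z. real (lp (fst z) n n) * real (lp (snd z) n n) \<partial>plaw p (exp (- t)) N ({..R} \<times> {..R}))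
      \<longlonglongrightarrow> (\<integral>s. T_n n (omega s) * T_n n (omega_t t s) \<partial>Omega p)"
proof -
  let ?B = "{..R} \<times> {..R}"
  define F where "F = (\<lambda>N s. real (lp (fst (om t N s)) n n) * real (lp (snd (om t N s)) n n))"
  have B: "finite ?B" by simp
  have cong: "real (lp (fst (x, y)) n n) * real (lp (snd (x, y)) n n) = real (lp (fst (x', y')) n n) * real (lp (snd (x', y')) n n)"
    if h: "\<And>v. v \<in> ?B \<Longrightarrow> x v = x' v \<and> y v = y' v" for x y x' y'
  proof -
    have "lp x n n = lp x' n n" "lp y n n = lp y' n n" by (rule lp_cong; use h R in simp)+
    then show ?thesis by simp
  qed
  have int: "integrable (Omega p) (F N)" for N
    unfolding F_def by (rule Omega_plaw(1)[where F = "\<lambda>z. real (lp (fst z) n n) * real (lp (snd z) n n)" , OF p t B]) (rule cong, blast)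
  have law: "(\<integral>s. F N s \<partial>Omega p) = (\<integral>z. real (lp (fst z) n n) * real (lp (snd z) n n) \<partial>plaw p (exp (- t)) N ?B)" for N
    unfolding F_def by (rule Omega_plaw(2)[where F = "\<lambda>z. real (lp (fst z) n n) * real (lp (snd z) n n)" , OF p t B]) (rule cong, blast)
  note mom = moments_omega[OF p t, of 2 n, simplified]
  have m1: "integrable (Omega p) (\<lambda>s. T_n n (omega s))" "integrable (Omega p) (\<lambda>s. T_n n (omega_t t s))"
    using moments_omega(1,3)[OF p t, of 1 n] by simp_all
  let ?D = "\<lambda>s. (T_n n (omega s))\<^sup>2 + (T_n n (omega_t t s))\<^sup>2"
  have lim: "AE s in Omega p. (\<lambda>N. F N s) \<longlonglongrightarrow> T_n n (omega s) * T_n n (omega_t t s)"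
    using AE_omega[OF p t]
  proof eventually_elim
    case (elim s)
    have "\<forall>\<^sub>F N in sequentially. lp (fst (om t N s)) n n = lp (\<lambda>v. LEAST i. X s (int (fst v), int (snd v)) i) n n"
      unfolding om_def fst_conv by (rule eventually_lp_trunc) (use elim in blast)
    moreover have "\<forall>\<^sub>F N in sequentially. lp (snd (om t N s)) n n = lp (\<lambda>v. LEAST i. Xt t s (int (fst v), int (snd v)) i) n n"
      unfolding om_def snd_conv by (rule eventually_lp_trunc) (use elim in blast)
    ultimately have "\<forall>\<^sub>F N in sequentially. F N s = T_n n (omega s) * T_n n (omega_t t s)"
      by eventually_elim (simp add: F_def T_n_omega T_n_omega_t)
    then show ?case by (rule tendsto_eventually)
  qed
  have dom: "AE s in Omega p. norm (F N s) \<le> ?D s" for N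
    using AE_omega[OF p t]
  proof eventually_elim
    case (elim s)
    have "lp (fst (om t N s)) n n \<le> lp (\<lambda>v. LEAST i. X s (int (fst v), int (snd v)) i) n n"
      "lp (snd (om t N s)) n n \<le> lp (\<lambda>v. LEAST i. Xt t s (int (fst v), int (snd v)) i) n n"
      unfolding om_def fst_conv snd_conv by (intro lp_mono_weights trunc_le_Least, use elim in simp)+
    then have "F N s \<le> T_n n (omega s) * T_n n (omega_t t s)"
      unfolding F_def T_n_omega T_n_omega_t by (intro mult_mono) auto
    also have "\<dots> \<le> ?D s"
    proof -
      have "0 \<le> (T_n n (omega s) - T_n n (omega_t t s))\<^sup>2 + ?D s" by simp
      then show ?thesis by (simp add: power2_diff)
    qed
    finally show ?case by (simp add: F_def)
  qed
  have meas: "(\<lambda>s. T_n n (omega s) * T_n n (omega_t t s)) \<in> borel_measurable (Omega p)" using m1 by simp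
  have measF: "F N \<in> borel_measurable (Omega p)" for N using int by blast
  have D: "integrable (Omega p) ?D" using mom by simp
  show "integrable (Omega p) (\<lambda>s. T_n n (omega s) * T_n n (omega_t t s))"
    by (rule integrable_dominated_convergence[OF meas measF D lim dom])
  show "(\<lambda>N. \<integral>z. real (lp (fst z) n n) * real (lp (snd z) n n) \<partial>plaw p (exp (- t)) N ?B)
      \<longlonglongrightarrow> (\<integral>s. T_n n (omega s) * T_n n (omega_t t s) \<partial>Omega p)"
    unfolding law[symmetric] by (rule integral_dominated_convergence[OF meas measF D lim dom])
qed

section \<open>Correlation, covariance and averaging error\<close>

lemma lpvar_eq:
  assumes "0 < p" "p < 1"
  shows "lpvar (1 - p) n = (\<integral>w. (real (lp w n n))\<^sup>2 \<partial>ilaw (1 - p) n n) - (\<integral>w. real (lp w n n) \<partial>ilaw (1 - p) n n)\<^sup>2"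
proof -
  have "integrable (ilaw (1 - p) n n) (\<lambda>w. (real (lp w n n))\<^sup>2)" "integrable (ilaw (1 - p) n n) (\<lambda>w. real (lp w n n))"
    using integrable_lp[of "1 - p" 0 n n 0 n n] assms by simp_all
  then show ?thesis unfolding lpvar_def by (subst measure_pmf.variance_eq) simp_all
qed

text \<open>Both passage times have the variance \<open>lpvar (1 - p) n\<close>, so the square root
  in the denominator is that variance itself.\<close>

lemma correlation_eq:
  assumes p: "0 < p" "p < 1" and t: "0 < t"
  shows "correlation (Omega p) (\<lambda>s. T_n n (omega s)) (\<lambda>s. T_n n (omega_t t s)) =
    ((\<integral>s. T_n n (omega s) * T_n n (omega_t t s) \<partial>Omega p) - (\<integral>w. real (lp w n n) \<partial>ilaw (1 - p) n n)\<^sup>2) / lpvar (1 - p) n"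
proof -
  interpret prob_space "Omega p" by (rule prob_space_Omega)
  let ?F = "\<lambda>s. T_n n (omega s)" and ?G = "\<lambda>s. T_n n (omega_t t s)"
  define m where "m = (\<integral>w. real (lp w n n) \<partial>ilaw (1 - p) n n)"
  have 1: "integrable (Omega p) ?F" "expectation ?F = m" "integrable (Omega p) ?G" "expectation ?G = m"
    using moments_omega[OF p t, of 1 n] by (simp_all add: m_def)
  note 2 = moments_omega[OF p t, of 2 n, simplified]
  have "expectation (\<lambda>s. (?F s - m)\<^sup>2) = lpvar (1 - p) n" "expectation (\<lambda>s. (?G s - m)\<^sup>2) = lpvar (1 - p) n"
    using variance_eq[OF 1(1) 2(1)] variance_eq[OF 1(3) 2(3)] by (simp_all add: 1 2 lpvar_eq[OF p] m_def)
  moreover have "expectation (\<lambda>s. (?F s - m) * (?G s - m)) = expectation (\<lambda>s. ?F s * ?G s) - m\<^sup>2"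
  proof -
    have "expectation (\<lambda>s. (?F s - m) * (?G s - m)) = expectation (\<lambda>s. ?F s * ?G s - m * ?F s - m * ?G s + m\<^sup>2)"
      by (intro Bochner_Integration.integral_cong) (simp_all add: power2_eq_square algebra_simps)
    also have "\<dots> = expectation (\<lambda>s. ?F s * ?G s) - m\<^sup>2"
      using 1 cross_moment(1)[OF p t order_refl, of n] by (simp add: power2_eq_square prob_space)
    finally show ?thesis .
  qed
  moreover have "0 \<le> lpvar (1 - p) n" by (simp add: lpvar_def)
  ultimately show ?thesis unfolding correlation_def by (simp add: 1 Let_def m_def)
qed

lemma square_diff_le_pow4:
  fixes x y S :: real
  assumes "0 \<le> x" "0 \<le> y" "x \<le> S" "y \<le> S"
  shows "\<bar>(x - y)\<^sup>2\<bar> \<le> 1 * (1 + S ^ 4)"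
proof -
  have "\<bar>x - y\<bar> \<le> \<bar>S\<bar>" using assms by linarith
  then have "(x - y)\<^sup>2 \<le> S\<^sup>2" by (simp add: abs_le_square_iff)
  also have "\<dots> \<le> 1 + S ^ 4" by (rule power_le_one_plus_pow4) (use assms in auto)
  finally show ?thesis by simp
qed

lemma avT_bounds:
  assumes "n + L \<le> R"
  shows "0 \<le> avT n L w" "avT n L w \<le> (\<Sum>x\<in>{..R} \<times> {..R}. real (w x))"
proof -
  let ?S = "\<Sum>x\<in>{..R} \<times> {..R}. real (w x)"
  show "0 \<le> avT n L w" by (simp add: avT_def sum_nonneg)
  have "(\<Sum>z\<in>{..<L} \<times> {..<L}. real (lp (sh (fst z) (snd z) w) n n)) \<le> (\<Sum>z\<in>{..<L} \<times> {..<L}. ?S)"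
    by (rule sum_mono, rule lp_sh_le_sum) (use assms in auto)
  also have "\<dots> = (real L)\<^sup>2 * ?S" by (simp add: power2_eq_square)
  finally show "avT n L w \<le> ?S"
    unfolding avT_def by (cases "L = 0") (auto simp: divide_le_eq mult.commute sum_nonneg)
qed

text \<open>The limit of \<open>noise_covariance_bound\<close> as the number \<open>N\<close> of
  bits grows: the influence bound \<open>I\<close> is uniform in \<open>N\<close>, and every other
  quantity converges.\<close>

lemma covariance_bound:
  assumes p: "0 < p" "p < 1" and t: "0 < t" and R: "n + L \<le> R"
    and q: "1 < q" "q < 2" and H: "hyper q (bitp p (exp (- t) ^ (2 ^ Suc k)))"
    and I: "\<And>N. (\<Sum>v\<in>{..R} \<times> {..R}. 16 * (\<integral>w. \<bar>avT n L w - avT n L (w(v := 0))\<bar> powr q \<partial>mlaw p N ({..R} \<times> {..R})) powr (2 / q)) \<le> I"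
  defines "V \<equiv> lpvar (1 - p) n"
  defines "G \<equiv> \<integral>w. (real (lp w n n) - avT n L w)\<^sup>2 \<partial>ilaw (1 - p) R R"
  shows "((\<integral>s. T_n n (omega s) * T_n n (omega_t t s) \<partial>Omega p) - (\<integral>w. real (lp w n n) \<partial>ilaw (1 - p) n n)\<^sup>2) ^ (2 ^ Suc k) \<le>
    V ^ (2 ^ Suc k - 1) * (I + 2 * sqrt ((2 * V + 2 * G) * G) + G)"
proof -
  let ?B = "{..R} \<times> {..R}"
  have B: "finite ?B" by simp
  have nR: "n \<le> R" using R by simp
  have \<rho>: "0 \<le> exp (- t)" "exp (- t) \<le> 1" using t by simp_all
  define m where "m = (\<lambda>N. \<integral>w. real (lp w n n) \<partial>mlaw p N ?B)"
  define W where "W = (\<lambda>N. \<integral>w. (real (lp w n n) - m N)\<^sup>2 \<partial>mlaw p N ?B)"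
  define D where "D = (\<lambda>N. \<integral>w. (real (lp w n n) - avT n L w)\<^sup>2 \<partial>mlaw p N ?B)"
  define Q where "Q = (\<lambda>N. \<integral>z. real (lp (fst z) n n) * real (lp (snd z) n n) \<partial>plaw p (exp (- t)) N ?B)"
  define m' where "m' = (\<integral>w. real (lp w n n) \<partial>ilaw (1 - p) n n)"
  have fin: "(Q N - (m N)\<^sup>2) ^ (2 ^ Suc k) \<le> W N ^ (2 ^ Suc k - 1) * (I + 2 * sqrt ((2 * W N + 2 * D N) * D N) + D N)" for N
    unfolding Q_def m_def W_def D_def by (rule noise_covariance_bound[OF p \<rho> B q H I])
  have m: "m \<longlonglongrightarrow> m'"
    using lp_moment_limit[OF p _ nR, of 1] by (simp add: m_def m'_def)
  have W_eq: "W = (\<lambda>N. (\<integral>w. (real (lp w n n))\<^sup>2 \<partial>mlaw p N ?B) - (m N)\<^sup>2)"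
    unfolding W_def m_def by (rule ext, rule measure_pmf.variance_eq) (simp_all add: integrable_measure_pmf_finite)
  have "(\<lambda>N. \<integral>w. (real (lp w n n))\<^sup>2 \<partial>mlaw p N ?B) \<longlonglongrightarrow> (\<integral>w. (real (lp w n n))\<^sup>2 \<partial>ilaw (1 - p) n n)"
    using lp_moment_limit[OF p _ nR, of 2] by simp
  then have W: "W \<longlonglongrightarrow> V"
    unfolding V_def lpvar_eq[OF p] m'_def[symmetric] W_eq by (intro tendsto_diff tendsto_power m)
  have D: "D \<longlonglongrightarrow> G"
    unfolding D_def G_def
  proof (rule mlaw_limit[OF p, where C = 1], rule square_diff_le_pow4)
    show "real (lp w n n) \<le> (\<Sum>x\<in>?B. real (w x))" for w
      using lp_sh_le_sum[of 0 n R 0 n R w] nR by simp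
  qed (use avT_bounds[OF R] in simp_all)
  have Q: "Q \<longlonglongrightarrow> (\<integral>s. T_n n (omega s) * T_n n (omega_t t s) \<partial>Omega p)"
    unfolding Q_def by (rule cross_moment(2)[OF p t nR])
  show ?thesis unfolding m'_def[symmetric]
    by (rule LIMSEQ_le[where X = "\<lambda>N. (Q N - (m N)\<^sup>2) ^ (2 ^ Suc k)" and
        Y = "\<lambda>N. W N ^ (2 ^ Suc k - 1) * (I + 2 * sqrt ((2 * W N + 2 * D N) * D N) + D N)"];
        (intro tendsto_intros Q m W D)?) (use fin in blast)
qed

lemma mean_square_le:
  fixes x :: "'i \<Rightarrow> real"
  assumes "finite A" "A \<noteq> {}"
  shows "((\<Sum>i\<in>A. x i) / real (card A))\<^sup>2 \<le> (\<Sum>i\<in>A. (x i)\<^sup>2) / real (card A)"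
proof -
  have c: "0 < real (card A)" using assms by (simp add: card_gt_0_iff)
  have "(\<Sum>i\<in>A. x i)\<^sup>2 \<le> real (card A) * (\<Sum>i\<in>A. (x i)\<^sup>2)"
    using Cauchy_Schwarz_ineq_sum[of "\<lambda>_. 1" x A] by simp
  then show ?thesis using c by (simp add: power_divide power2_eq_square field_simps)
qed

context sandwich
begin

text \<open>By convexity of the square, averaging is no worse than the worst translate. Each
  translate is reached by a vertical and a horizontal shift, and the vertical one is a horizontal
  one for the reflected field.\<close>

lemma avT_close:
  "\<exists>B>0. \<forall>\<^sub>F n in sequentially. \<forall>L R. 1 \<le> L \<longrightarrow> real L \<le> sqrt (real n) + 1 \<longrightarrow> n + L \<le> R \<longrightarrow>
    (\<integral>w. (real (lp w n n) - avT n L w)\<^sup>2 \<partial>ilaw q R R) \<le> B * sqrt (real n)"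
proof -
  have q: "0 < q" "q < 1" using c by (auto simp: power_less_one_iff)
  obtain B where B: "0 < B" and up: "\<forall>\<^sub>F n in sequentially. \<forall>k. real k \<le> sqrt (real n) + 1 \<longrightarrow>
    integrable (ilaw q (n + k) n) (\<lambda>w. (real (lp (sh k 0 w) n n) - real (lp w n n))\<^sup>2) \<and>
    (\<integral>w. (real (lp (sh k 0 w) n n) - real (lp w n n))\<^sup>2 \<partial>ilaw q (n + k) n) \<le> B * sqrt (real n)"
    using translate_upper by blast
  have "\<forall>\<^sub>F n in sequentially. \<forall>L R. 1 \<le> L \<longrightarrow> real L \<le> sqrt (real n) + 1 \<longrightarrow> n + L \<le> R \<longrightarrow>
    (\<integral>w. (real (lp w n n) - avT n L w)\<^sup>2 \<partial>ilaw q R R) \<le> 4 * B * sqrt (real n)"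
    using up
  proof eventually_elim
    case (elim n)
    show ?case
    proof (intro allI impI)
      fix L R :: nat assume L: "1 \<le> L" "real L \<le> sqrt (real n) + 1" and R: "n + L \<le> R"
      let ?M = "ilaw q R R"
      define D where "D = (\<lambda>k w. (real (lp (sh k 0 w) n n) - real (lp w n n))\<^sup>2)"
      have I: "integrable ?M (\<lambda>w. (real (lp (sh a b w) n n) - real (lp (sh a' b' w) n n))\<^sup>2)"
        if "a < L" "b < L" "a' < L" "b' < L" for a b a' b'
        by (rule integrable_ilaw[OF q], rule square_diff_le_pow4) (use that R in \<open>auto intro!: lp_sh_le_sum\<close>)
      have red: "(\<integral>w. D k (w \<circ> h) \<partial>?M) \<le> B * sqrt (real n)"
        if "k < L" "inj_on h ({..n + k} \<times> {..n})" "h ` ({..n + k} \<times> {..n}) \<subseteq> {..R} \<times> {..R}" for k h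
      proof -
        have "(\<integral>w. D k (w \<circ> h) \<partial>?M) = (\<integral>w. D k w \<partial>ilaw q (n + k) n)"
        proof (rule integral_ilaw_reindex[where F = "D k"])
          fix w w' :: "nat \<times> nat \<Rightarrow> nat" assume h: "\<And>i j. i \<le> n + k \<Longrightarrow> j \<le> n \<Longrightarrow> w (i, j) = w' (i, j)"
          have "lp (sh k 0 w) n n = lp (sh k 0 w') n n" "lp w n n = lp w' n n"
            by (rule lp_cong; use h in \<open>simp add: sh_def\<close>)+
          then show "D k w = D k w'" by (simp add: D_def)
        qed (use that in auto)
        also have "\<dots> \<le> B * sqrt (real n)" using elim[rule_format, of k] that(1) L by (simp add: D_def)
        finally show ?thesis .
      qed
      have one: "(\<integral>w. (real (lp w n n) - real (lp (sh i j w) n n))\<^sup>2 \<partial>?M) \<le> 4 * B * sqrt (real n)" if ij: "i < L" "j < L" for i j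
      proof -
        have "(\<integral>w. (real (lp w n n) - real (lp (sh i j w) n n))\<^sup>2 \<partial>?M) \<le>
          (\<integral>w. 2 * (real (lp (sh i j w) n n) - real (lp (sh 0 j w) n n))\<^sup>2 + 2 * (real (lp (sh 0 j w) n n) - real (lp (sh 0 0 w) n n))\<^sup>2 \<partial>?M)"
        proof (rule integral_mono)
          show "integrable ?M (\<lambda>w. (real (lp w n n) - real (lp (sh i j w) n n))\<^sup>2)"
            using I[of 0 0 i j] L ij by simp
          show "integrable ?M (\<lambda>w. 2 * (real (lp (sh i j w) n n) - real (lp (sh 0 j w) n n))\<^sup>2 + 2 * (real (lp (sh 0 j w) n n) - real (lp (sh 0 0 w) n n))\<^sup>2)"
            by (intro Bochner_Integration.integrable_add integrable_mult_right I) (use L ij in auto)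
          fix w
          have "(x - z)\<^sup>2 \<le> 2 * (z - y)\<^sup>2 + 2 * (y - x)\<^sup>2" for x y z :: real
          proof -
            have "0 \<le> (x + z - 2 * y)\<^sup>2" by simp
            then show ?thesis by (simp add: power2_eq_square algebra_simps)
          qed
          then show "(real (lp w n n) - real (lp (sh i j w) n n))\<^sup>2 \<le>
            2 * (real (lp (sh i j w) n n) - real (lp (sh 0 j w) n n))\<^sup>2 + 2 * (real (lp (sh 0 j w) n n) - real (lp (sh 0 0 w) n n))\<^sup>2"
            by simp
        qed
        also have "\<dots> = 2 * (\<integral>w. (real (lp (sh i j w) n n) - real (lp (sh 0 j w) n n))\<^sup>2 \<partial>?M) +
          2 * (\<integral>w. (real (lp (sh 0 j w) n n) - real (lp (sh 0 0 w) n n))\<^sup>2 \<partial>?M)"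
          by (subst Bochner_Integration.integral_add) (use I[of i j 0 j] I[of 0 j 0 0] L ij in simp_all)
        also have "(\<integral>w. (real (lp (sh i j w) n n) - real (lp (sh 0 j w) n n))\<^sup>2 \<partial>?M) \<le> B * sqrt (real n)"
        proof -
          have "D i (w \<circ> (\<lambda>(a, b). (a + 0, b + j))) = (real (lp (sh i j w) n n) - real (lp (sh 0 j w) n n))\<^sup>2" for w
          proof -
            have "sh i 0 (sh 0 j w) = sh i j w" by (simp add: sh_def fun_eq_iff)
            then show ?thesis unfolding D_def sh_conv_comp[symmetric] by simp
          qed
          moreover have "inj_on (\<lambda>(a, b). (a + 0, b + j)) ({..n + i} \<times> {..n})" by (auto simp: inj_on_def)
          moreover have "(\<lambda>(a, b). (a + 0, b + j)) ` ({..n + i} \<times> {..n}) \<subseteq> {..R} \<times> {..R}" using ij R by auto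
          ultimately show ?thesis using red[of i "\<lambda>(a, b). (a + 0, b + j)"] ij(1) by simp
        qed
        also have "(\<integral>w. (real (lp (sh 0 j w) n n) - real (lp (sh 0 0 w) n n))\<^sup>2 \<partial>?M) \<le> B * sqrt (real n)"
        proof -
          have "D j (w \<circ> prod.swap) = (real (lp (sh 0 j w) n n) - real (lp (sh 0 0 w) n n))\<^sup>2" for w
          proof -
            have "sh j 0 (w \<circ> prod.swap) = sh 0 j w \<circ> prod.swap" by (simp add: sh_def fun_eq_iff)
            then show ?thesis unfolding D_def by (simp add: lp_swap)
          qed
          moreover have "inj_on prod.swap ({..n + j} \<times> {..n})" by (auto simp: inj_on_def)
          moreover have "prod.swap ` ({..n + j} \<times> {..n}) \<subseteq> {..R} \<times> {..R}" using ij R by auto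
          ultimately show ?thesis using red[of j prod.swap] ij(2) by simp
        qed
        finally show ?thesis by simp
      qed
      let ?Z = "{..<L} \<times> {..<L}"
      have cZ: "real (card ?Z) = (real L)\<^sup>2" by (simp add: power2_eq_square)
      have Z: "?Z \<noteq> {}" using L by (auto simp: lessThan_empty_iff)
      have "(\<integral>w. (real (lp w n n) - avT n L w)\<^sup>2 \<partial>?M) \<le>
        (\<integral>w. (\<Sum>z\<in>?Z. (real (lp w n n) - real (lp (sh (fst z) (snd z) w) n n))\<^sup>2) / real (card ?Z) \<partial>?M)"
      proof (rule integral_mono)
        show "integrable ?M (\<lambda>w. (real (lp w n n) - avT n L w)\<^sup>2)"
          by (rule integrable_ilaw[OF q], rule square_diff_le_pow4)
            (use lp_sh_le_sum[of 0 n R 0 n R] R avT_bounds[OF R] in simp_all)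
        show "integrable ?M (\<lambda>w. (\<Sum>z\<in>?Z. (real (lp w n n) - real (lp (sh (fst z) (snd z) w) n n))\<^sup>2) / real (card ?Z))"
          by (intro integrable_divide Bochner_Integration.integrable_sum) (use I[of 0 0] L in auto)
        fix w
        have "real (lp w n n) - avT n L w = (\<Sum>z\<in>?Z. real (lp w n n) - real (lp (sh (fst z) (snd z) w) n n)) / real (card ?Z)"
          unfolding avT_def cZ[symmetric] using Z L by (simp add: sum_subtractf diff_divide_distrib)
        then show "(real (lp w n n) - avT n L w)\<^sup>2 \<le> (\<Sum>z\<in>?Z. (real (lp w n n) - real (lp (sh (fst z) (snd z) w) n n))\<^sup>2) / real (card ?Z)"
          using mean_square_le[of ?Z] Z by simp
      qed
      also have "\<dots> = (\<Sum>z\<in>?Z. \<integral>w. (real (lp w n n) - real (lp (sh (fst z) (snd z) w) n n))\<^sup>2 \<partial>?M) / real (card ?Z)"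
        by (subst integral_divide_zero, subst Bochner_Integration.integral_sum) (use I[of 0 0] L in auto)
      also have "\<dots> \<le> (\<Sum>z\<in>?Z. 4 * B * sqrt (real n)) / real (card ?Z)"
        by (intro divide_right_mono sum_mono one) auto
      also have "\<dots> = 4 * B * sqrt (real n)" using Z cZ L by simp
      finally show "(\<integral>w. (real (lp w n n) - avT n L w)\<^sup>2 \<partial>?M) \<le> 4 * B * sqrt (real n)" .
    qed
  qed
  then show ?thesis using B by (intro exI[of _ "4 * B"]) simp
qed

end

theorem theorem1p1:
  fixes p t :: real
  assumes "0 < p" and "p < 1" and "0 < t"
  shows "(\<lambda>n. correlation (Omega p) (\<lambda>s. T_n n (omega s)) (\<lambda>s. T_n n (omega_t t s)))
           \<longlonglongrightarrow> 0"
proof -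
  note p = assms(1,2) and t = assms(3)
  \<comment> \<open>The bulk ratio of the boundary model is c^2, and a weight with success
    probability p has ratio 1 - p.\<close>
  define c where "c = sqrt (1 - p)"
  have c: "0 < c" "c < 1" "c\<^sup>2 = 1 - p" using p by (simp_all add: c_def)
  obtain d0 \<kappa> C' K' where S: "sandwich c d0 \<kappa> C' K'" using sandwich_exists[OF c(1,2)] by blast
  obtain B where B: "0 < B" and close: "\<forall>\<^sub>F n in sequentially. \<forall>L R. 1 \<le> L \<longrightarrow> real L \<le> sqrt (real n) + 1 \<longrightarrow> n + L \<le> R \<longrightarrow>
    (\<integral>w. (real (lp w n n) - avT n L w)\<^sup>2 \<partial>ilaw (1 - p) R R) \<le> B * sqrt (real n)"
    using sandwich.avT_close[OF S] unfolding c(3) by blast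
  obtain b where b: "0 < b" and low: "\<forall>\<^sub>F n in sequentially. b * real n powr 0.6 \<le> lpvar (1 - p) n"
    using sandwich.variance_lower[OF S] unfolding c(3) by blast
  obtain K where K: "0 < K" and infl: "\<forall>n L R N. 1 \<le> L \<longrightarrow> n + L \<le> R \<longrightarrow>
    (\<Sum>v\<in>{..R} \<times> {..R}. 16 * (\<integral>w. \<bar>avT n L w - avT n L (w(v := 0))\<bar> powr (100 / 99) \<partial>mlaw p N ({..R} \<times> {..R})) powr (2 / (100 / 99)))
    \<le> K * (2 * real n + 1) * (2 / real L) powr 0.881"
    by (rule exE[OF influence_sum[OF p]]) (erule conjE, rule that)
  obtain \<rho>0 where \<rho>0: "0 < \<rho>0" "\<And>\<rho>. 0 \<le> \<rho> \<Longrightarrow> \<rho> \<le> \<rho>0 \<Longrightarrow> hyper (100 / 99) (bitp p \<rho>)"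
    using hyper_bit[OF p, of "100 / 99"] by auto
  \<comment> \<open>Squaring produces the exponent 2^(k + 1), which is at least k, so the
    correlation of the bits falls below the threshold \<open>\<rho>0\<close> for
    hypercontractivity.\<close>
  obtain k where k: "exp (- t) ^ k < \<rho>0" using real_arch_pow_inv[OF \<rho>0(1), of "exp (- t)"] t by auto
  define e :: nat where "e = 2 ^ Suc k"
  have e: "even e" "k \<le> e" "0 < e" using less_exp[of "Suc k"] by (simp_all add: e_def)
  have "exp (- t) ^ e \<le> exp (- t) ^ k" using e(2) t by (intro power_decreasing) auto
  then have H: "hyper (100 / 99) (bitp p (exp (- t) ^ e))" using k by (intro \<rho>0) auto
  define corr where "corr = (\<lambda>n. correlation (Omega p) (\<lambda>s. T_n n (omega s)) (\<lambda>s. T_n n (omega_t t s)))"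
  \<comment> \<open>\<open>r\<close> bounds the averaging error relative to the variance: n^(1/2)
    against n^0.6.\<close>
  define r where "r = (\<lambda>n. B / b * real n powr (- 0.1))"
  \<comment> \<open>The exponents of the influence term add up to 1 - 0.4405 - 0.6 = -0.0405, as
    \<open>L\<close> is about sqrt n.\<close>
  define h where "h = (\<lambda>n. K / b * ((2 * real n + 1) * (2 / sqrt (real n)) powr 0.881 * real n powr (- 0.6)) + 2 * sqrt ((2 + 2 * r n) * r n) + r n)"
  have "\<forall>\<^sub>F n in sequentially. corr n ^ e \<le> h n"
    using close low eventually_gt_at_top[of 0]
  proof eventually_elim
    case (elim n)
    define L where "L = nat \<lceil>sqrt (real n)\<rceil>"
    define R where "R = n + L"
    define V where "V = lpvar (1 - p) n"
    define G where "G = (\<integral>w. (real (lp w n n) - avT n L w)\<^sup>2 \<partial>ilaw (1 - p) R R)"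
    define I where "I = K * (2 * real n + 1) * (2 / real L) powr 0.881"
    have s: "0 < sqrt (real n)" using elim(3) by simp
    then have "0 < nat \<lceil>sqrt (real n)\<rceil>" by simp
    then have L1: "1 \<le> L" unfolding L_def by linarith
    have rL: "real L = of_int \<lceil>sqrt (real n)\<rceil>" using s by (simp add: L_def)
    have L2: "sqrt (real n) \<le> real L" "real L \<le> sqrt (real n) + 1" unfolding rL by linarith+
    have G: "G \<le> B * sqrt (real n)" unfolding G_def using elim(1) L1 L2(2) by (simp add: R_def)
    have G0: "0 \<le> G" by (simp add: G_def)
    have V: "b * real n powr 0.6 \<le> V" unfolding V_def by (rule elim(2))
    have n6: "0 < b * real n powr 0.6" using b elim(3) by simp
    then have V0: "0 < V" using V by linarith
    have I0: "0 \<le> I" using K by (simp add: I_def)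
    define Cov where "Cov = (\<integral>s. T_n n (omega s) * T_n n (omega_t t s) \<partial>Omega p) - (\<integral>w. real (lp w n n) \<partial>ilaw (1 - p) n n)\<^sup>2"
    have "Cov ^ e \<le> V ^ (e - 1) * (I + 2 * sqrt ((2 * V + 2 * G) * G) + G)"
      unfolding Cov_def V_def G_def e_def
      by (rule covariance_bound[OF p t, where q = "100 / 99"]) (use infl[rule_format, OF L1] H in \<open>auto simp: R_def I_def e_def\<close>)
    \<comment> \<open>Division by V^e turns the left side into a power of the correlation; on the
      right a single factor V remains in the denominator.\<close>
    then have "Cov ^ e / V ^ e \<le> V ^ (e - 1) * (I + 2 * sqrt ((2 * V + 2 * G) * G) + G) / V ^ e"
      using V0 by (intro divide_right_mono) auto
    also have "V ^ e = V ^ (e - 1) * V" using e(3) by (metis Suc_diff_1 power_Suc2)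
    also have "V ^ (e - 1) * (I + 2 * sqrt ((2 * V + 2 * G) * G) + G) / (V ^ (e - 1) * V) = (I + 2 * sqrt ((2 * V + 2 * G) * G) + G) / V"
      using V0 by simp
    also have "\<dots> = I / V + 2 * sqrt ((2 + 2 * (G / V)) * (G / V)) + G / V"
    proof -
      have "(2 * V + 2 * G) * G = ((2 + 2 * (G / V)) * (G / V)) * V\<^sup>2" using V0 by (simp add: power2_eq_square field_simps)
      then have "sqrt ((2 * V + 2 * G) * G) = sqrt ((2 + 2 * (G / V)) * (G / V)) * V" using V0 by (simp only: real_sqrt_mult real_sqrt_abs abs_of_pos)
      then show ?thesis using V0 by (simp add: add_divide_distrib)
    qed
    also have "\<dots> \<le> h n"
    proof -
      have GV: "G / V \<le> r n"
      proof -
        have "G / V \<le> (B * sqrt (real n)) / (b * real n powr 0.6)" using G G0 V n6 by (intro frac_le) auto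
        also have "\<dots> = r n"
        proof -
          have "sqrt (real n) = real n powr (- 0.1) * real n powr 0.6"
            using elim(3) by (simp add: powr_half_sqrt[symmetric] flip: powr_add)
          then show ?thesis using elim(3) by (simp add: r_def)
        qed
        finally show ?thesis .
      qed
      have GV0: "0 \<le> G / V" using G0 V0 by simp
      have IV: "I / V \<le> K / b * ((2 * real n + 1) * (2 / sqrt (real n)) powr 0.881 * real n powr (- 0.6))"
      proof -
        have "2 / real L \<le> 2 / sqrt (real n)" using L2(1) s by (intro frac_le) auto
        then have "(2 / real L) powr 0.881 \<le> (2 / sqrt (real n)) powr 0.881" by (intro powr_mono2) auto
        then have "I \<le> K * (2 * real n + 1) * (2 / sqrt (real n)) powr 0.881"
          unfolding I_def using K by (intro mult_left_mono) auto
        then have "I / V \<le> (K * (2 * real n + 1) * (2 / sqrt (real n)) powr 0.881) / (b * real n powr 0.6)"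
          using V n6 I0 by (intro frac_le) auto
        also have "\<dots> = K / b * ((2 * real n + 1) * (2 / sqrt (real n)) powr 0.881 * real n powr (- 0.6))"
          by (simp only: powr_minus divide_inverse inverse_mult_distrib mult_ac)
        finally show ?thesis .
      qed
      have "(2 + 2 * (G / V)) * (G / V) \<le> (2 + 2 * r n) * r n"
        using GV GV0 by (intro mult_mono add_left_mono mult_left_mono) auto
      then have "sqrt ((2 + 2 * (G / V)) * (G / V)) \<le> sqrt ((2 + 2 * r n) * r n)" by (rule real_sqrt_le_mono)
      then show ?thesis using IV GV unfolding h_def by linarith
    qed
    finally show "corr n ^ e \<le> h n"
      unfolding corr_def correlation_eq[OF p t] Cov_def[symmetric] V_def[symmetric] power_divide
      by (simp only: \<open>V ^ e = V ^ (e - 1) * V\<close>)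
  qed
  moreover have "h \<longlonglongrightarrow> 0"
  proof -
    have "(\<lambda>n. real n powr (- 0.1)) \<longlonglongrightarrow> 0" by real_asymp
    then have "(\<lambda>n. B / b * real n powr (- 0.1)) \<longlonglongrightarrow> B / b * 0" by (rule tendsto_mult_left)
    then have r: "r \<longlonglongrightarrow> 0" by (simp add: r_def)
    have "(\<lambda>n. (2 * real n + 1) * (2 / sqrt (real n)) powr 0.881 * real n powr (- 0.6)) \<longlonglongrightarrow> 0" by real_asymp
    then have "h \<longlonglongrightarrow> K / b * 0 + 2 * sqrt ((2 + 2 * 0) * 0) + 0" unfolding h_def by (intro tendsto_intros r)
    then show ?thesis by simp
  qed
  \<comment> \<open>The lower bound 0 for the squeezing comes from \<open>e\<close> being
    even.\<close>
  ultimately have "(\<lambda>n. corr n ^ e) \<longlonglongrightarrow> 0"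
    using tendsto_sandwich[where f = "\<lambda>_. 0" and g = "\<lambda>n. corr n ^ e" and h = h and net = sequentially and c = 0] e(1)
    by (simp add: zero_le_even_power)
  then show ?thesis using e(3) by (simp add: corr_def power_tendsto_0_iff)
qed

end
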